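(* Let $n=2$. The initial value problem for the periodic Schrödinger–Debye equation is locally well-posed in $H^s(\mathbb{T}^2)\times H^s(\mathbb{T}^2)$ when $\alpha=2$ and $s>0$. Moreover it is locally well-posed in $H^s(\mathbb{T}^2)\times H^s(\mathbb{T}^2)$ whenever $2\le \alpha<\frac{2}{1-s}$.
   Context: The periodic Schrödinger–Debye equation (SDE) on $\mathbb{T}^n=\mathbb{R}^n/\mathbb{Z}^n$ is the system $$ i\partial_t u+\Delta u=uv,\qquad K\partial_t v+v=\varepsilon |u|^{\alpha},\qquad u(0,x)=u_0(x),\ v(0,x)=v_0(x),$$ for $t\ge 0$, $x\in\mathbb{T}^n$, where $u$ is complex-valued, $v$ is real-valued, $K>0$, $\varepsilon\in\{1,-1\}$, $\alpha=p-2>0$. Local well-posedness in $H^s\times H^s$ means: for every $(u_0,v_0)\in H^s\times H^s$ there is $T>0$ (depending on the size of the data) and a unique solution $(u,v)$ of the equivalent integral (Duhamel) formulation on $[0,T]$ with $u$ in the Bourgain space $X^{s,b}$ restricted to $[0,T]$ for some $b>1/2$ (hence $u\in C([0,T];H^s)$) and $v\in C([0,T];H^s)$, depending continuously on the data; $\|f\|_{X^{s,b}}=\|\langle\xi\rangle^s\langle\lambda-|\xi|^2\rangle^b\hat f(\xi,\lambda)\|_{L^2_{\xi,\lambda}}$. *)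

theory Defs
  imports "HOL-Analysis.Analysis"
begin

text \<open>The torus T^2 = R^2/Z^2 is represented by the fundamental domain
  [0,1] x [0,1]; functions on T^2 are functions on real x real, only their
  values on the unit square matter (up to null sets).  Frequencies are
  k in Z^2, with xi = 2 pi k, so |xi|^2 = 4 pi^2 |k|^2 is the symbol of -Laplacian.\<close>

definition unit_sq :: "(real \<times> real) set" where
  "unit_sq = {0..1} \<times> {0..1}"

definition fcoef :: "(real \<times> real \<Rightarrow> complex) \<Rightarrow> int \<times> int \<Rightarrow> complex" where
  "fcoef f k = (LINT x:unit_sq|lborel.
      f x * cis (- 2 * pi * (of_int (fst k) * fst x + of_int (snd k) * snd x)))"

definition freq2 :: "int \<times> int \<Rightarrow> real" where
  "freq2 k = 4 * pi\<^sup>2 * ((of_int (fst k))\<^sup>2 + (of_int (snd k))\<^sup>2)"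

definition Hs_energy :: "real \<Rightarrow> (real \<times> real \<Rightarrow> complex) \<Rightarrow> ennreal" where
  "Hs_energy s f = (\<integral>\<^sup>+ k. ennreal ((1 + freq2 k) powr s * (cmod (fcoef f k))\<^sup>2) \<partial>count_space UNIV)"

definition in_Hs :: "real \<Rightarrow> (real \<times> real \<Rightarrow> complex) \<Rightarrow> bool" where
  "in_Hs s f \<longleftrightarrow> f \<in> borel_measurable lborel
      \<and> set_integrable lborel unit_sq (\<lambda>x. (cmod (f x))\<^sup>2)
      \<and> Hs_energy s f < \<infinity>"

definition Hs_norm :: "real \<Rightarrow> (real \<times> real \<Rightarrow> complex) \<Rightarrow> real" where
  "Hs_norm s f = sqrt (enn2real (Hs_energy s f))"

definition cplx :: "(real \<times> real \<Rightarrow> real) \<Rightarrow> real \<times> real \<Rightarrow> complex" where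
  "cplx f = (\<lambda>x. complex_of_real (f x))"

text \<open>Space-time Fourier transform of w(t,x):
  hat w(k,lambda) = int_R int_T w(t,x) e^{-2 pi i k.x} e^{i lambda t} dx dt,
  so that the free Schroedinger evolution concentrates on lambda = |xi|^2.\<close>
definition stfour :: "(real \<Rightarrow> real \<times> real \<Rightarrow> complex) \<Rightarrow> int \<times> int \<Rightarrow> real \<Rightarrow> complex" where
  "stfour w k lam = (LINT t|lborel. fcoef (w t) k * cis (lam * t))"

definition Xsb_energy :: "real \<Rightarrow> real \<Rightarrow> (real \<Rightarrow> real \<times> real \<Rightarrow> complex) \<Rightarrow> ennreal" where
  "Xsb_energy s b w = (\<integral>\<^sup>+ k. (\<integral>\<^sup>+ lam. ennreal ((1 + freq2 k) powr s * (1 + (lam - freq2 k)\<^sup>2) powr b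
       * (cmod (stfour w k lam))\<^sup>2) \<partial>lborel) \<partial>count_space UNIV)"

text \<open>Restriction space X^{s,b}_T: u on [0,T] is the restriction of some w in X^{s,b}.
  Multiplying an arbitrary extension by a smooth cutoff in time (equal to 1 on [0,T],
  supported in [-1,T+1]) one may assume w is supported in [-1,T+1] and lies in L^2;
  this makes the time Fourier transform an absolutely convergent integral.\<close>
definition in_Xsb_T :: "real \<Rightarrow> real \<Rightarrow> real \<Rightarrow> (real \<Rightarrow> real \<times> real \<Rightarrow> complex) \<Rightarrow> bool" where
  "in_Xsb_T s b T u \<longleftrightarrow> (\<exists>w.
      (\<lambda>(t, x). w t x) \<in> borel_measurable lborel
    \<and> set_integrable lborel (UNIV \<times> unit_sq) (\<lambda>(t, x). (cmod (w t x))\<^sup>2)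
    \<and> (\<forall>t. t \<notin> {-1..T+1} \<longrightarrow> w t = (\<lambda>x. 0))
    \<and> (\<forall>t\<in>{0..T}. w t = u t)
    \<and> Xsb_energy s b w < \<infinity>)"

definition cont_Hs :: "real \<Rightarrow> real \<Rightarrow> (real \<Rightarrow> real \<times> real \<Rightarrow> complex) \<Rightarrow> bool" where
  "cont_Hs s T u \<longleftrightarrow> (\<forall>t\<in>{0..T}. in_Hs s (u t))
     \<and> (\<forall>t0\<in>{0..T}. ((\<lambda>t. Hs_norm s (\<lambda>x. u t x - u t0 x)) \<longlongrightarrow> 0) (at t0 within {0..T}))"

text \<open>Duhamel (integral) formulation, written frequency by frequency:
  u(t) = e^{it Delta} u0 - i int_0^t e^{i(t-t')Delta} (u v)(t') dt',
  v(t) = e^{-t/K} v0 + (eps/K) int_0^t e^{-(t-t')/K} |u(t')|^alpha dt'.\<close>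
definition SDE_duhamel :: "real \<Rightarrow> real \<Rightarrow> real \<Rightarrow> real \<Rightarrow> (real \<times> real \<Rightarrow> complex) \<Rightarrow> (real \<times> real \<Rightarrow> real)
     \<Rightarrow> (real \<Rightarrow> real \<times> real \<Rightarrow> complex) \<Rightarrow> (real \<Rightarrow> real \<times> real \<Rightarrow> real) \<Rightarrow> bool" where
  "SDE_duhamel \<alpha> K \<epsilon> T u0 v0 u v \<longleftrightarrow>
     (\<forall>t\<in>{0..T}.
        set_integrable lborel unit_sq (\<lambda>x. u t x * complex_of_real (v t x))
      \<and> set_integrable lborel unit_sq (\<lambda>x. cmod (u t x) powr \<alpha>))
   \<and> (\<forall>t\<in>{0..T}. \<forall>k.
        set_integrable lborel {0..t}
          (\<lambda>t'. cis (- freq2 k * (t - t')) * fcoef (\<lambda>x. u t' x * complex_of_real (v t' x)) k)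
      \<and> set_integrable lborel {0..t}
          (\<lambda>t'. complex_of_real (exp (- (t - t') / K)) * fcoef (\<lambda>x. complex_of_real (cmod (u t' x) powr \<alpha>)) k)
      \<and> fcoef (u t) k = cis (- freq2 k * t) * fcoef u0 k
          - \<i> * (LINT t':{0..t}|lborel.
                 cis (- freq2 k * (t - t')) * fcoef (\<lambda>x. u t' x * complex_of_real (v t' x)) k)
      \<and> fcoef (cplx (v t)) k = complex_of_real (exp (- t / K)) * fcoef (cplx v0) k
          + complex_of_real (\<epsilon> / K) * (LINT t':{0..t}|lborel.
                 complex_of_real (exp (- (t - t') / K)) * fcoef (\<lambda>x. complex_of_real (cmod (u t' x) powr \<alpha>)) k))"

definition SDE_sol :: "real \<Rightarrow> real \<Rightarrow> real \<Rightarrow> real \<Rightarrow> real \<Rightarrow> real \<Rightarrow> (real \<times> real \<Rightarrow> complex)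
     \<Rightarrow> (real \<times> real \<Rightarrow> real) \<Rightarrow> (real \<Rightarrow> real \<times> real \<Rightarrow> complex) \<Rightarrow> (real \<Rightarrow> real \<times> real \<Rightarrow> real) \<Rightarrow> bool" where
  "SDE_sol s b \<alpha> K \<epsilon> T u0 v0 u v \<longleftrightarrow>
     in_Xsb_T s b T u \<and> cont_Hs s T u \<and> cont_Hs s T (\<lambda>t. cplx (v t))
   \<and> SDE_duhamel \<alpha> K \<epsilon> T u0 v0 u v"

definition data_ball :: "real \<Rightarrow> real \<Rightarrow> (real \<times> real \<Rightarrow> complex) \<Rightarrow> (real \<times> real \<Rightarrow> real) \<Rightarrow> bool" where
  "data_ball s R u0 v0 \<longleftrightarrow> in_Hs s u0 \<and> in_Hs s (cplx v0)
     \<and> Hs_norm s u0 \<le> R \<and> Hs_norm s (cplx v0) \<le> R"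

definition SDE_LWP :: "real \<Rightarrow> real \<Rightarrow> real \<Rightarrow> real \<Rightarrow> bool" where
  "SDE_LWP s \<alpha> K \<epsilon> \<longleftrightarrow> (\<exists>b>1/2. \<forall>R>0. \<exists>T>0.
     (\<forall>u0 v0. data_ball s R u0 v0 \<longrightarrow> (\<exists>u v. SDE_sol s b \<alpha> K \<epsilon> T u0 v0 u v))
   \<and> (\<forall>u0 v0 u v u' v'. data_ball s R u0 v0 \<and> SDE_sol s b \<alpha> K \<epsilon> T u0 v0 u v
        \<and> SDE_sol s b \<alpha> K \<epsilon> T u0 v0 u' v' \<longrightarrow>
        (\<forall>t\<in>{0..T}. Hs_norm s (\<lambda>x. u t x - u' t x) = 0
                   \<and> Hs_norm s (\<lambda>x. cplx (v t) x - cplx (v' t) x) = 0))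
   \<and> (\<forall>u0 v0 u v. data_ball s R u0 v0 \<and> SDE_sol s b \<alpha> K \<epsilon> T u0 v0 u v \<longrightarrow>
        (\<forall>e>0. \<exists>d>0. \<forall>u0' v0' u' v'.
            data_ball s R u0' v0' \<and> SDE_sol s b \<alpha> K \<epsilon> T u0' v0' u' v'
          \<and> Hs_norm s (\<lambda>x. u0 x - u0' x) + Hs_norm s (\<lambda>x. cplx v0 x - cplx v0' x) < d \<longrightarrow>
            (\<forall>t\<in>{0..T}. Hs_norm s (\<lambda>x. u t x - u' t x)
                        + Hs_norm s (\<lambda>x. cplx (v t) x - cplx (v' t) x) < e))))"

end

theory Submission
  imports Defs "HOL-Computational_Algebra.Primes"
begin

text \<open>
  On the torus the substitute for dispersion is arithmetic: a circle of radius \<open>M\<^bsup>1/2\<^esup>\<close> in the lattice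
  carries at most \<open>C M\<^sup>\<epsilon>\<close> points. By orthogonality in time this gives the bilinear \<open>L\<^sup>2\<close> estimate
  \<open>\<parallel>P\<^sub>j u v\<parallel> \<le> C 2\<^bsup>j\<epsilon>\<^esup> \<parallel>u\<parallel> \<parallel>v\<parallel>\<close> for products of free waves, where \<open>v\<close> may also be constant in time, and by
  Jensen's inequality the same estimate for superpositions of free waves. Hence \<open>u v\<close> lies in \<open>L\<^sup>2H\<^sup>s\<close> in time,
  with a gain \<open>T\<^bsup>1/2\<^esup>\<close> after integration. For \<open>s < 1\<close> the power \<open>|u|\<^sup>\<alpha>\<close> is estimated in \<open>L\<^sup>1H\<^sup>s\<close> through its
  finite differences: the difference multipliers \<open>mu\<close> give an equivalent norm of \<open>H\<^sup>s\<close>, a pointwise inequality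
  reduces the differences of \<open>|u|\<^sup>\<alpha> - |u'|\<^sup>\<alpha>\<close> to products of a difference of one factor with powers of dyadic
  pieces of another, and these are again bilinear. The condition \<open>(\<alpha> - 2) (1 - s) < 2 s\<close> makes the dyadic
  sums converge.

  The system is solved for the Fourier coefficients, with \<open>v\<close> expressed through \<open>u\<close>; the Picard iteration runs on
  the forcing term in \<open>L\<^sup>1H\<^sup>s\<close>. A solution in the restricted space \<open>X\<^bsup>s,1\<^esup>\<close> is a superposition of free waves (a
  Fourier series in time on an interval of length \<open>2\<pi>\<close>), and a continuity argument in time bounds its mass by the
  data, so uniqueness and continuous dependence hold for all solutions.
\<close>

text \<open>For non-integer \<open>af\<close> the power has no expansion in frequency, so no
  multilinear estimate applies to it directly; only pointwise information survives. This is why its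
  differences are squared and reduced to products of two factors, the setting in which orthogonality
  in time still acts. The bilinear loss \<open>kap\<close> sits on the lower of the two frequencies
  because the weighted sum over a lattice circle is uniform in the centre of the weight and in the
  radius: a short arc holds at most two points, and a longer one bounds the radius. In the nonlinear
  estimate the loss can therefore be charged to a dyadic piece of known frequency. What results is a
  product of two quantities integrable in time, so only its square root is integrable, which
  dictates \<open>L^1 H^s\<close> for the forcing of \<open>v\<close>. The modulations in time leave
  the estimate by absolute values before orthogonality is used, so the cutoffs in Duhamel's formula
  cost nothing. With \<open>b = 1\<close>, membership in the restriction space means one time
  derivative in \<open>L^2\<close> after the flow is undone, and Duhamel's formula provides such an
  extension explicitly.\<close>

type_synonym lat = "int \<times> int"

abbreviation bmeas :: "('a::topological_space => 'b::topological_space) set" where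
 "bmeas == borel_measurable borel"

abbreviation SumU :: "('a => ennreal) => ennreal" (binder "SU " 10) where
 "SumU f == nn_integral (count_space UNIV) f"

abbreviation IntL :: "('a::euclidean_space => ennreal) => ennreal" (binder "IL " 10) where
 "IntL f == nn_integral lborel f"

abbreviation NN :: "'a measure => ('a => ennreal) => ennreal" where "NN == nn_integral"

abbreviation sqn :: "complex => ennreal" where "sqn z == ennreal ((cmod z)^2)"

abbreviation ind :: "'a set => 'a => 'b::zero_neq_one" where "ind == indicator"

abbreviation bmeas2 :: "('a::second_countable_topology * 'b::second_countable_topology => 'c::topological_space) set" where
 "bmeas2 == borel_measurable (borel \<Otimes>\<^sub>M borel)"

lemmas bintegral_cong = Bochner_Integration.integral_cong
lemmas bintegral_diff = Bochner_Integration.integral_diff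
lemmas bintegral_add = Bochner_Integration.integral_add
lemmas bintegrable_bound = Bochner_Integration.integrable_bound
lemmas bintegrable_diff = Bochner_Integration.integrable_diff
lemmas bintegrable_add = Bochner_Integration.integrable_add

section \<open>Lattice points on circles\<close>

lemma card_divisors_prime_power_mult:
 fixes p m :: nat
 assumes p: "prime p" and m: "m > 0"
 shows "card {d. d dvd p^a * m} <= (a + 1) * card {d. d dvd m}"
proof -
 have "{d. d dvd p^a * m} \<subseteq> (%(i,e). p^i * e) ` ({..a} \<times> {e. e dvd m})"
 proof
  fix d assume "d : {d. d dvd p^a * m}"
  hence "d dvd p^a * m" by simp
  then obtain b c where bc: "d = b * c" "b dvd p^a" "c dvd m"
   using division_decomp by blast
  obtain i where "i <= a" "b = p^i" using bc(2) divides_primepow_nat[OF p] by blast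
  thus "d : (%(i,e). p^i * e) ` ({..a} \<times> {e. e dvd m})" using bc by force
 qed
 hence "card {d. d dvd p^a * m} <= card ((%(i,e). p^i * e) ` ({..a} \<times> {e. e dvd m}))"
  using m by (intro card_mono) auto
 also have "... <= card ({..a} \<times> {e. e dvd m})" using m by (intro card_image_le) auto
 also have "... = (a + 1) * card {d. d dvd m}" by (simp add: card_cartesian_product)
 finally show ?thesis .
qed

text \<open>Linear growth loses to exponential growth, quantified by \<open>exp x >= 1 + x\<close>;
  \<open>C\<close> depends on \<open>e\<close> alone, so one constant serves all multiplicities
  \<open>a\<close> of a prime.\<close>

lemma Suc_le_const_powr:
 fixes e :: real
 assumes "e > 0"
 obtains C where "C >= 1" "!!a::nat. real (a + 1) <= C * 2 powr (e * real a)"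
proof -
 define f where "f = e * ln 2"
 have f: "f > 0" using assms by (simp add: f_def)
 define C where "C = max 1 (1 / f)"
 have "real (a + 1) <= C * 2 powr (e * real a)" for a :: nat
 proof -
  have "1 + f * real a <= exp (f * real a)" by (rule exp_ge_add_one_self)
  also have "exp (f * real a) = 2 powr (e * real a)" by (simp add: powr_def f_def mult_ac)
  finally have 1: "1 + f * real a <= 2 powr (e * real a)" .
  have "1 * 1 <= C * 1" "1 <= C * f" using f by (auto simp: C_def max_def field_simps)
  hence "1 + real a <= C * (1 + f * real a)"
   using mult_right_mono[of 1 "C * f" "real a"] by (simp add: algebra_simps)
  also have "... <= C * 2 powr (e * real a)" using 1 by (intro mult_left_mono) (auto simp: C_def)
  finally show ?thesis by simp
 qed
 thus ?thesis using that[of C] by (auto simp: C_def)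
qed

text \<open>Primes are split off one at a time, each trading a factor \<open>a + 1\<close> against
  \<open>p powr (e * a)\<close>. A prime with \<open>p powr e >= 2\<close> pays for itself since
  \<open>a + 1 <= 2^a\<close>; a smaller one costs a factor \<open>C\<close>, and the number of
  these is bounded in terms of \<open>e\<close> only, so the accumulated
  \<open>C ^ card (sm n)\<close> stays bounded.\<close>

lemma divisor_bound:
 fixes e :: real
 assumes e: "e > 0"
 obtains C where "C >= 1" "!!n::nat. n > 0 ==> real (card {d. d dvd n}) <= C * real n powr e"
proof -
 obtain C where C: "C >= 1" "!!a::nat. real (a + 1) <= C * 2 powr (e * real a)"
  using Suc_le_const_powr[OF e] by blast
 define B where "B = 2 powr (1/e)"
 define sm where "sm n = {p::nat. prime p & p dvd n & real p < B}" for n :: nat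
 have finB: "finite {p::nat. real p < B}"
 proof (rule finite_subset)
  show "{p::nat. real p < B} \<subseteq> {..nat \<lceil>B\<rceil>}" by (auto simp: le_nat_iff) linarith
 qed simp
 have finsm: "finite (sm n)" for n by (rule finite_subset[OF _ finB]) (auto simp: sm_def)
 have main: "real (card {d. d dvd n}) <= C ^ card (sm n) * real n powr e" if "n > 0" for n :: nat
  using that
 proof (induction n rule: less_induct)
  case (less n)
  show ?case
  proof (cases "n = 1")
   case True
   thus ?thesis using C(1) by (simp add: sm_def) 
  next
   case False
   then obtain p where p: "prime p" "p dvd n" using prime_factor_nat by blast
   define a where "a = multiplicity p n"
   have a: "a >= 1" using p less.prems unfolding a_def
    by (metis One_nat_def Suc_leI not_gr_zero multiplicity_eq_zero_iff not_prime_unit)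
   obtain m where m: "n = p^a * m" "\<not> p dvd m"
    using multiplicity_decompose'[of n p] p less.prems a_def not_prime_unit by (metis neq0_conv)
   have m0: "m > 0" using m less.prems by (cases m) auto
   have p2: "p >= 2" using p prime_ge_2_nat by blast
   have "m < n" using m m0 p2 a by (metis One_nat_def less_le_trans mult.commute n_less_m_mult_n one_less_power prime_gt_1_nat p(1) zero_less_one not_less_eq_eq leI not_less0)
   hence IH: "real (card {d. d dvd m}) <= C ^ card (sm m) * real m powr e"
    using less.IH m0 by blast
   have np: "real n powr e = real p powr (e * a) * real m powr e"
    using m p2 m0 by (simp add: powr_mult powr_powr powr_realpow[symmetric] mult.commute)
   have step: "real (card {d. d dvd n}) <= real (a + 1) * real (card {d. d dvd m})"
    using card_divisors_prime_power_mult[OF p(1) m0, of a] m(1)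
    by (metis of_nat_le_iff of_nat_mult)
   have pd: "p dvd n" by (rule p)
   show ?thesis
   proof (cases "real p < B")
    case True
    have sub: "insert p (sm m) \<subseteq> sm n" using True p m by (auto simp: sm_def)
    have "p \<notin> sm m" using m by (auto simp: sm_def)
    hence c: "card (sm m) + 1 <= card (sm n)" using card_mono[OF finsm sub] finsm[of m] by simp
    have "real (a+1) <= C * 2 powr (e * real a)" by (rule C(2))
    also have "... <= C * real p powr (e * a)" using C(1) p2 e by (intro mult_left_mono powr_mono2) auto
    finally have 1: "real (a+1) <= C * real p powr (e * a)" .
    have "real (card {d. d dvd n}) <= (C * real p powr (e * a)) * (C ^ card (sm m) * real m powr e)"
     using step by (rule order_trans) (intro mult_mono 1 IH, use C in auto)
    also have "... = C ^ (card (sm m) + 1) * real n powr e" by (simp add: np mult_ac)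
    also have "... <= C ^ card (sm n) * real n powr e"
     using c C(1) by (intro mult_right_mono power_increasing) auto
    finally show ?thesis .
   next
    case False
    have sub: "sm m \<subseteq> sm n" using m by (auto simp: sm_def)
    have c: "card (sm m) <= card (sm n)" using card_mono[OF finsm sub] .
    have "a + 1 <= 2 ^ a" by (metis Suc_eq_plus1 Suc_leI less_exp)
    hence "real (a+1) <= 2 ^ a" using of_nat_le_iff[where 'a=real, of "a+1" "2^a"] by simp
    also have "(2::real)^a = B powr (e * a)" using e by (simp add: B_def powr_powr powr_realpow)
    also have "... <= real p powr (e * a)" using False e by (intro powr_mono2) (auto simp: B_def)
    finally have 1: "real (a+1) <= real p powr (e * a)" .
    have "real (card {d. d dvd n}) <= real p powr (e * a) * (C ^ card (sm m) * real m powr e)"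
     using step by (rule order_trans) (intro mult_mono 1 IH, use C in auto)
    also have "... = C ^ card (sm m) * real n powr e" by (simp add: np mult_ac)
    also have "... <= C ^ card (sm n) * real n powr e"
     using c C(1) by (intro mult_right_mono power_increasing) auto
    finally show ?thesis .
   qed
  qed
 qed
 define D where "D = C ^ card {p::nat. real p < B}"
 have "real (card {d. d dvd n}) <= D * real n powr e" if n: "n > 0" for n :: nat
 proof -
  have "card (sm n) <= card {p::nat. real p < B}" by (rule card_mono[OF finB]) (auto simp: sm_def)
  hence "C ^ card (sm n) <= D" using C(1) unfolding D_def by (intro power_increasing) auto
  thus ?thesis using main[OF n] by (meson mult_right_mono order_trans powr_ge_zero)
 qed
 moreover have "D >= 1" using C(1) by (simp add: D_def)
 ultimately show ?thesis using that by blast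
qed

lemma finite_circle: "finite {(x::int, y::int). x^2 + y^2 = n}"
proof (rule finite_subset)
 have "\<bar>x\<bar> <= \<bar>n\<bar>" if "x^2 + y^2 = n" for x y :: int
 proof -
  have "\<bar>x\<bar> <= x^2" by (metis abs_le_square_iff abs_mult_self_eq mult.commute power2_eq_square self_le_power abs_ge_zero int_one_le_iff_zero_less le_less linorder_not_less mult_eq_0_iff mult_le_cancel_left1 zero_less_abs_iff)
  thus ?thesis using that zero_le_power2[of y] by linarith
 qed
 note * = this
 have "\<bar>y\<bar> <= \<bar>n\<bar>" if "x^2 + y^2 = n" for x y :: int using *[of y x] that by (simp add: add.commute)
 with * show "{(x::int, y::int). x^2 + y^2 = n} \<subseteq> {-\<bar>n\<bar>..\<bar>n\<bar>} \<times> {-\<bar>n\<bar>..\<bar>n\<bar>}"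
  by (fastforce simp: abs_le_iff)
qed simp

text \<open>Modulo \<open>n\<close> the slope of a primitive point is a square root of -1, and the
  gcd with \<open>n\<close> records at which divisors of \<open>n\<close> two slopes agree. With
  \<open>n = d * e\<close>, \<open>d\<close> divides both forms \<open>x * y0 - x0 * y\<close>, and
  \<open>e\<close> divides both forms with a plus sign; eliminating the reference point shows that
  \<open>d\<close> and \<open>e\<close> divide the determinant. They share at most a factor 2, which
  is the 2 in the conclusion.\<close>

lemma det_dvd_of_same_gcd:
 fixes x y x' y' x0 y0 n :: int
 assumes n: "n > 0" and z: "x^2 + y^2 = n" "coprime x y" and z': "x'^2 + y'^2 = n"
  and z0: "x0^2 + y0^2 = n" "coprime x0 y0"
  and g: "gcd (x * y0 - x0 * y) n = gcd (x' * y0 - x0 * y') n"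
 shows "n dvd 2 * (x * y' - x' * y)"
proof -
 define d where "d = gcd (x * y0 - x0 * y) n"
 have copn: "coprime a n" if "a^2 + b^2 = n" "coprime a b" for a b :: int
 proof -
  have "coprime a (b^2)" using that(2) by simp
  hence "coprime a (a * a + b^2)" by (metis coprime_iff_gcd_eq_1 gcd_add_mult add.commute)
  thus ?thesis using that(1) by (simp add: power2_eq_square)
 qed
 have cx: "coprime x n" using copn z by blast
 have cy0: "coprime y0 n" using copn[of y0 x0] z0 by (simp add: add.commute coprime_commute)
 obtain e where e: "n = d * e" unfolding d_def by (metis dvd_def gcd_dvd2)
 have d0: "d > 0" using n by (simp add: d_def)
 \<comment> \<open>The two forms multiply to a multiple of \<open>n\<close>; once \<open>d\<close>
   is cancelled, the cofactor \<open>A1\<close> is coprime to \<open>e\<close>, so \<open>e\<close>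
   has to divide the second form.\<close>
 have eB: "e dvd (a * y0 + x0 * b)" if "a^2 + b^2 = n" "gcd (a * y0 - x0 * b) n = d" for a b
 proof -
  note gd = that(2)
  obtain A1 where A1: "a * y0 - x0 * b = d * A1" using gd by (metis dvd_def gcd_dvd1)
  have "gcd (d * A1) (d * e) = d" using that(2) A1 e by simp
  hence "d * gcd A1 e = d * 1" using d0 gcd_mult_distrib_int[of d A1 e] by simp
  hence "gcd A1 e = 1" using d0 by (metis less_irrefl mult_left_cancel)
  hence c: "coprime A1 e" by (simp add: coprime_iff_gcd_eq_1)
  have "(a * y0 - x0 * b) * (a * y0 + x0 * b) = n * (y0^2 - b^2)"
  proof -
   have "(a * y0 - x0 * b) * (a * y0 + x0 * b) = (a^2 + b^2) * y0^2 - (x0^2 + y0^2) * b^2" by algebra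
   thus ?thesis using that(1) z0(1) by (simp add: right_diff_distrib)
  qed
  hence "d * (A1 * (a * y0 + x0 * b)) = d * (e * (y0^2 - b^2))" using A1 e by (simp add: mult_ac)
  hence "A1 * (a * y0 + x0 * b) = e * (y0^2 - b^2)" using d0 by simp
  thus ?thesis using c by (metis coprime_commute coprime_dvd_mult_right_iff dvd_triv_left)
 qed
 have eB1: "e dvd x * y0 + x0 * y" using eB z d_def by simp
 have eB2: "e dvd x' * y0 + x0 * y'" using eB z' d_def g by simp
 have dA1: "d dvd x * y0 - x0 * y" by (simp add: d_def)
 have dA2: "d dvd x' * y0 - x0 * y'" using g by (simp add: d_def)
 have cd: "coprime y0 d" "coprime y0 e" using cy0 e by auto
 have "d dvd y' * (x * y0 - x0 * y) - y * (x' * y0 - x0 * y')" using dA1 dA2 by simp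
 also have "... = y0 * (x * y' - x' * y)" by (simp add: algebra_simps)
 finally have dd: "d dvd (x * y' - x' * y)" using cd coprime_dvd_mult_right_iff[of d y0] by (simp add: coprime_commute)
 have "e dvd y' * (x * y0 + x0 * y) - y * (x' * y0 + x0 * y')" using eB1 eB2 by simp
 also have "... = y0 * (x * y' - x' * y)" by (simp add: algebra_simps)
 finally have ed: "e dvd (x * y' - x' * y)" using cd coprime_dvd_mult_right_iff[of e y0] by (simp add: coprime_commute)
 \<comment> \<open>The sum of the two forms is \<open>2 * x * y0\<close> with \<open>x\<close> and
   \<open>y0\<close> coprime to \<open>n\<close>, which leaves only 2 for a common factor.\<close>
 define h where "h = gcd d e"
 have "h dvd (x * y0 - x0 * y) + (x * y0 + x0 * y)"
 proof (rule dvd_add)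
  show "h dvd x * y0 - x0 * y" unfolding h_def using dA1 by (meson dvd_trans gcd_dvd1)
  show "h dvd x * y0 + x0 * y" unfolding h_def using eB1 by (meson dvd_trans gcd_dvd2)
 qed
 hence h2: "h dvd x * (y0 * 2)" by (simp add: algebra_simps)
 have "h dvd n" using e h_def by simp
 hence "coprime h x" "coprime h y0" using cx cy0
  by (meson coprime_commute coprime_divisors dvd_refl)+
 hence "h dvd 2" using h2 by (simp add: coprime_dvd_mult_right_iff)
 have "lcm d e dvd (x * y' - x' * y)" using dd ed by simp
 hence "lcm d e * h dvd (x * y' - x' * y) * 2" using \<open>h dvd 2\<close> mult_dvd_mono by blast
 moreover have "lcm d e * h = n * (if e > 0 then 1 else 1)"
  using e d0 n by (simp add: h_def lcm_mult_gcd zero_less_mult_iff abs_mult)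
 ultimately show ?thesis by (simp add: mult.commute)
qed

text \<open>Points are sorted by the gcd with \<open>n\<close> of their determinant against one
  fixed primitive point. Inside a class, the determinant against a member \<open>z\<close> is a
  multiple of \<open>n/2\<close> of size at most \<open>n\<close>, so it takes at most five values.
  Together with the sign of the dot product it determines the point, because the squares of
  determinant and dot product add up to \<open>n^2\<close>; hence 10.\<close>

lemma card_primitive_circle:
 fixes n :: nat
 assumes n: "n > 0"
 shows "card {(x::int, y::int). x^2 + y^2 = int n & coprime x y} <= 10 * card {d. d dvd n}"
proof -
 define S where "S = {(x::int, y::int). x^2 + y^2 = int n & coprime x y}"
 have fS: "finite S" by (rule finite_subset[OF _ finite_circle[of "int n"]]) (auto simp: S_def)
 show ?thesis
 proof (cases "S = {}")
  case True thus ?thesis unfolding S_def[symmetric] by simp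
 next
  case False
  then obtain x0 y0 where z0: "x0^2 + y0^2 = int n" "coprime x0 y0" by (auto simp: S_def)
  define F where "F d = {(x,y) : S. nat (gcd (x * y0 - x0 * y) (int n)) = d}" for d
  have "S \<subseteq> (\<Union>d\<in>{d. d dvd n}. F d)"
  proof clarify
   fix x y assume "(x,y) : S"
   moreover have "nat (gcd (x * y0 - x0 * y) (int n)) dvd n"
    by (metis gcd_dvd2 gcd_ge_0_int int_dvd_int_iff int_nat_eq)
   ultimately show "(x,y) : (\<Union>d\<in>{d. d dvd n}. F d)" by (auto simp: F_def)
  qed
  hence "card S <= card (\<Union>d\<in>{d. d dvd n}. F d)"
   using n fS by (intro card_mono) (auto simp: F_def intro!: finite_subset[OF _ fS])
  also have "... <= (\<Sum>d\<in>{d. d dvd n}. card (F d))" using n by (intro card_UN_le) auto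
  also have "... <= (\<Sum>d\<in>{d. d dvd n}. 10)"
  proof (rule sum_mono)
   fix d
   show "card (F d) <= 10"
   proof (cases "F d = {}")
    case False
    then obtain x y where z: "(x,y) : F d" by auto
    hence zz: "x^2 + y^2 = int n" "coprime x y" "nat (gcd (x * y0 - x0 * y) (int n)) = d"
     by (auto simp: F_def S_def)
    define g where "g = (%(x',y'). (2 * (x * y' - x' * y) div int n, x * x' + y * y' >= 0))"
    have dv: "int n dvd 2 * (x * y' - x' * y)" if "(x',y') : F d" for x' y'
    proof (rule det_dvd_of_same_gcd)
     have "nat (gcd (x * y0 - x0 * y) (int n)) = nat (gcd (x' * y0 - x0 * y') (int n))"
      using that zz by (auto simp: F_def)
     thus "gcd (x * y0 - x0 * y) (int n) = gcd (x' * y0 - x0 * y') (int n)" by (metis gcd_ge_0_int int_nat_eq)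
    qed (use that zz z0 n in \<open>auto simp: F_def S_def\<close>)
    have sq: "(x * y' - x' * y)^2 + (x * x' + y * y')^2 = (int n)^2" if "(x',y') : F d" for x' y'
    proof -
     have "x'^2 + y'^2 = int n" using that by (auto simp: F_def S_def)
     moreover have "(x * y' - x' * y)^2 + (x * x' + y * y')^2 = (x^2 + y^2) * (x'^2 + y'^2)"
      by algebra
     ultimately show ?thesis using zz(1) by (simp add: power2_eq_square)
    qed
    have "inj_on g (F d)"
    proof (rule inj_onI, clarify)
     fix a b a' b' assume 1: "(a,b) : F d" "(a',b') : F d" and "g (a,b) = g (a',b')"
     hence eq: "2 * (x * b - a * y) div int n = 2 * (x * b' - a' * y) div int n"
      and sg: "x * a + y * b >= 0 \<longleftrightarrow> x * a' + y * b' >= 0" by (auto simp: g_def)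
     have "2 * (x * b - a * y) = 2 * (x * b' - a' * y)"
      using eq dv[OF 1(1)] dv[OF 1(2)] by (metis dvd_mult_div_cancel)
     hence det: "x * b - a * y = x * b' - a' * y" by simp
     hence "(x * a + y * b)^2 = (x * a' + y * b')^2" using sq[OF 1(1)] sq[OF 1(2)] by simp
     hence dot: "x * a + y * b = x * a' + y * b'" using sg unfolding power2_eq_iff by linarith
     have "(x^2 + y^2) * a = (x^2+y^2) * a'" "(x^2 + y^2) * b = (x^2+y^2) * b'"
      using det dot by algebra+
     thus "a = a' & b = b'" using zz(1) n by simp
    qed
    moreover have "g ` F d \<subseteq> {-2..2} \<times> UNIV"
    proof (rule image_subsetI)
     fix z assume z1: "z : F d"
     obtain a b where ab: "z = (a,b)" by (cases z)
     have 1: "(a,b) : F d" using z1 ab by simp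
     have "(x * b - a * y)^2 <= (int n)^2" using sq[OF 1] zero_le_power2[of "x * a + y * b"] by linarith
     hence 2: "\<bar>x * b - a * y\<bar> <= int n" using abs_le_square_iff[of "x * b - a * y" "int n"] by simp
     obtain k where k: "2 * (x * b - a * y) = int n * k" using dv[OF 1] by blast
     hence u: "fst (g z) = k" using n ab by (simp add: g_def)
     have "\<bar>int n * k\<bar> <= 2 * int n" unfolding k[symmetric] abs_mult using 2 by simp
     hence "int n * \<bar>k\<bar> <= int n * 2" by (simp add: abs_mult)
     hence "\<bar>k\<bar> <= 2" using n by simp
     thus "g z : {-2..2} \<times> UNIV" using u by (cases "g z") auto
    qed
    ultimately have "card (F d) <= card ({-2..2::int} \<times> (UNIV::bool set))"
     by (rule card_inj_on_le) simp
    also have "... = 10" by (simp add: card_cartesian_product)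
    finally show ?thesis .
   qed simp
  qed
  also have "... = 10 * card {d. d dvd n}" by simp
  finally show ?thesis by (simp add: S_def)
 qed
qed

text \<open>Dividing by \<open>g = gcd x y\<close> makes a point primitive on the circle for
  \<open>n / g^2\<close>. Both the choice of \<open>g\<close> and the primitive points for that
  \<open>g\<close> are counted by divisors of \<open>n\<close>, hence the square.\<close>

lemma card_circle:
 fixes n :: nat
 assumes n: "n > 0"
 shows "card {(x::int, y::int). x^2 + y^2 = int n} <= 10 * (card {d. d dvd n})^2"
proof -
 define S where "S = {(x::int, y::int). x^2 + y^2 = int n}"
 have fS: "finite S" using finite_circle by (simp add: S_def)
 define F where "F g = {(x,y) : S. nat (gcd x y) = g}" for g
 have gd: "g > 0 & g^2 dvd n" if "(x,y) : F g" for x y g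
 proof -
  have eq: "x^2 + y^2 = int n" "g = nat (gcd x y)" using that by (auto simp: F_def S_def)
  hence "x ~= 0 \<or> y ~= 0" using n by auto
  hence "gcd x y > 0" by simp
  moreover have "(gcd x y)^2 dvd x^2 + y^2" by (intro dvd_add) (auto intro: dvd_power_same)
  ultimately show ?thesis using eq by (metis int_dvd_int_iff int_nat_eq less_imp_le of_nat_power zero_less_nat_eq)
 qed
 have "S \<subseteq> (\<Union>g\<in>{d. d dvd n}. F g)"
 proof clarify
  fix x y assume xy: "(x,y) : S"
  hence "(x,y) : F (nat (gcd x y))" by (auto simp: F_def)
  moreover from gd[OF this] have "nat (gcd x y) dvd n" by (meson dvd_trans dvd_triv_left power2_eq_square dvd_power zero_less_numeral)
  ultimately show "(x,y) : (\<Union>g\<in>{d. d dvd n}. F g)" by blast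
 qed
 hence "card S <= card (\<Union>d\<in>{d. d dvd n}. F d)"
  using n fS by (intro card_mono) (auto simp: F_def intro!: finite_subset[OF _ fS])
 also have "... <= (\<Sum>d\<in>{d. d dvd n}. card (F d))" using n by (intro card_UN_le) auto
 also have "... <= (\<Sum>d\<in>{d. d dvd n}. 10 * card {d. d dvd n})"
 proof (rule sum_mono)
  fix g
  show "card (F g) <= 10 * card {d. d dvd n}"
  proof (cases "F g = {}")
   case False
   then obtain x y where "(x,y) : F g" by auto
   from gd[OF this] obtain m where g: "g > 0" and m: "n = g^2 * m" by auto
   have m0: "m > 0" using m n by (cases m) auto
   define P where "P = {(x::int, y::int). x^2 + y^2 = int m & coprime x y}"
   have "F g \<subseteq> (%(x,y). (int g * x, int g * y)) ` P"
   proof clarify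
    fix a b assume "(a,b) : F g"
    hence ab: "a^2 + b^2 = int n" "int g = gcd a b" by (auto simp: F_def S_def)
    then obtain a' b' where a': "a = int g * a'" "b = int g * b'" "coprime a' b'"
     using gcd_coprime_exists[of a b] g by (metis mult.commute of_nat_0_less_iff less_irrefl)
    hence "(int g)^2 * (a'^2 + b'^2) = (int g)^2 * int m" by (metis ab(1) a'(1,2) m of_nat_mult of_nat_power power_mult_distrib distrib_left)
    hence "a'^2 + b'^2 = int m" using g by simp
    thus "(a,b) : (%(x,y). (int g * x, int g * y)) ` P" using a' by (auto simp: P_def)
   qed
   moreover have "finite P" by (rule finite_subset[OF _ finite_circle[of "int m"]]) (auto simp: P_def)
   ultimately have "card (F g) <= card P" by (meson card_image_le card_mono finite_imageI le_trans)
   also have "... <= 10 * card {d. d dvd m}" using card_primitive_circle[OF m0] by (simp add: P_def)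
   also have "card {d. d dvd m} <= card {d. d dvd n}" using n m by (intro card_mono) auto
   finally show ?thesis by simp
  qed simp
 qed
 also have "... = 10 * (card {d. d dvd n})^2" by (simp add: power2_eq_square)
 finally show ?thesis by (simp add: S_def)
qed

text \<open>The squared relation between circumradius, sides and area of the triangle with vertex
  \<open>p\<close> and sides \<open>u\<close>, \<open>v\<close>, \<open>u - v\<close>: the cross
  product is twice the area and \<open>M\<close> is the squared radius. Squaring keeps everything in
  the integers.\<close>

lemma circle_triangle:
 fixes p1 p2 u1 u2 v1 v2 M :: int
 assumes "p1^2 + p2^2 = M" "(p1+u1)^2 + (p2+u2)^2 = M" "(p1+v1)^2 + (p2+v2)^2 = M"
 shows "4 * (u1 * v2 - u2 * v1)^2 * M = (u1^2+u2^2) * (v1^2+v2^2) * ((u1-v1)^2 + (u2-v2)^2)"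
proof -
 have a: "2 * (p1 * u1+p2 * u2) = - (u1^2+u2^2)" "2 * (p1 * v1+p2 * v2) = - (v1^2+v2^2)"
  using assms by (auto simp: power2_eq_square algebra_simps)
 have "4 * (u1 * v2 - u2 * v1)^2 * M = ((2*(p1 * u1+p2 * u2)) * v1 - (2*(p1 * v1+p2 * v2)) * u1)^2 + ((2*(p1 * u1+p2 * u2)) * v2 - (2*(p1 * v1+p2 * v2)) * u2)^2"
  unfolding assms(1)[symmetric] by algebra
 also have "... = (u1^2+u2^2) * (v1^2+v2^2) * ((u1-v1)^2 + (u2-v2)^2)"
  unfolding a by algebra
 finally show ?thesis .
qed

text \<open>Three lattice points on a circle span a triangle of area at least 1/2, so by
  \<open>abc = 4 R * area\<close> a short arc of a large circle contains at most two of them.\<close>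

lemma close_points_on_circle:
 fixes S :: "lat set"
 assumes S: "\<forall>p\<in>S. (fst p)^2 + (snd p)^2 = M"
  and close: "\<forall>p\<in>S. \<forall>q\<in>S. (fst p - fst q)^2 + (snd p - snd q)^2 <= L"
  and c: "card S >= 3"
 shows "4 * M <= L^3"
proof -
 obtain T where T: "T \<subseteq> S" "card T = 3" using c by (meson obtain_subset_with_card_n)
 then obtain p q r where pqr: "T = {p,q,r}" "p ~= q" "p ~= r" "q ~= r" by (auto simp: card_3_iff)
 obtain p1 p2 q1 q2 r1 r2 where c: "p = (p1,p2)" "q = (q1,q2)" "r = (r1,r2)" by (metis surj_pair)
 have mem: "(p1,p2) : S" "(q1,q2) : S" "(r1,r2) : S" using T pqr c by auto
 define u1 u2 v1 v2 where d: "u1 = q1 - p1" "u2 = q2 - p2" "v1 = r1 - p1" "v2 = r2 - p2"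
 have eq: "4 * (u1 * v2 - u2 * v1)^2 * M = (u1^2+u2^2) * (v1^2+v2^2) * ((u1-v1)^2 + (u2-v2)^2)"
  using S mem by (intro circle_triangle[where ?p1.0=p1 and ?p2.0=p2]) (auto simp: d)
 have cl: "u1^2+u2^2 <= L" "v1^2+v2^2 <= L" "(u1-v1)^2 + (u2-v2)^2 <= L"
  using close[rule_format, OF mem(2) mem(1)] close[rule_format, OF mem(3) mem(1)]
   close[rule_format, OF mem(2) mem(3)] by (auto simp: d)
 have pos: "a^2 + b^2 > 0" if "(a,b) ~= (0,0)" for a b :: int
  using that by (auto simp: sum_power2_gt_zero_iff)
 have ps: "u1^2+u2^2 > 0" "v1^2+v2^2 > 0" "(u1-v1)^2 + (u2-v2)^2 > 0"
  using pqr c by (auto intro!: pos simp: d)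
 hence "(u1^2+u2^2) * (v1^2+v2^2) * ((u1-v1)^2 + (u2-v2)^2) > 0" by simp
 \<comment> \<open>Distinct points of a circle are not collinear; this is read off the identity,
   whose other side is positive.\<close>
 hence D: "(u1 * v2 - u2 * v1)^2 ~= 0" using eq by auto
 hence D1: "(u1 * v2 - u2 * v1)^2 >= 1" using zero_le_power2[of "u1 * v2 - u2 * v1"] by linarith
 have M0: "M >= 0" using S mem by fastforce
 have "4 * M <= 4 * (u1 * v2 - u2 * v1)^2 * M" using mult_right_mono[OF D1, of "4*M"] M0 by (simp add: mult_ac)
 also have "... <= L * L * L" unfolding eq using cl ps by (intro mult_mono) auto
 finally show ?thesis by (simp add: power3_eq_cube)
qed

section \<open>Frequency weights and dyadic blocks\<close>

abbreviation CZ :: "lat measure" where "CZ \<equiv> count_space UNIV"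

abbreviation SumZ :: "(lat => ennreal) => ennreal" (binder "SZ " 10) where "SumZ f == nn_integral CZ f"

definition nrm2 :: "lat => int" where "nrm2 k = (fst k)^2 + (snd k)^2"

text \<open>The weight of a squared modulus, that is the Japanese bracket to the power
  \<open>2 * s\<close>: exponents of \<open>wt\<close> agree with those of the Sobolev scale, and
  dyadic powers come out in base 4.\<close>

definition wt :: "real => lat => real" where "wt s k = (1 + freq2 k) powr s"

text \<open>Since \<open>1 + freq2 k >= 1\<close>, these annuli partition the whole lattice; block 0
  contains the origin, so low frequencies belong to the same decomposition.\<close>

definition blk :: "nat => (lat) set" where
 "blk j = {k. 4 ^ j <= 1 + freq2 k & 1 + freq2 k < 4 ^ (j + 1)}"

lemma freq2_nrm2: "freq2 k = 4 * pi^2 * of_int (nrm2 k)"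
 by (simp add: freq2_def nrm2_def)

lemma freq2_nonneg [simp]: "0 <= freq2 k" by (simp add: freq2_def)

lemma nrm2_nonneg [simp]: "0 <= nrm2 k" by (simp add: nrm2_def)

lemma freq2_uminus [simp]: "freq2 (- k) = freq2 k" by (simp add: freq2_def)

lemma freq2_diff_commute: "freq2 (k - l) = freq2 (l - k)"
 using freq2_uminus[of "l - k"] by simp

lemma nrm2_le_freq2: "36 * of_int (nrm2 k) <= freq2 k"
proof -
 have "3^2 <= pi^2" using pi_gt3 by (intro power_mono) auto
 hence "9 * real_of_int (nrm2 k) <= pi^2 * of_int (nrm2 k)" by (intro mult_right_mono) auto
 thus ?thesis by (simp add: freq2_nrm2 mult.commute)
qed

lemma one_plus_freq2_pos [simp]: "0 < 1 + freq2 k" by (rule add_pos_nonneg) auto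

lemma one_plus_freq2_nz [simp]: "1 + freq2 k ~= 0" using one_plus_freq2_pos[of k] by linarith

lemma wt_pos [simp]: "0 < wt s k" by (simp add: wt_def)

lemma wt_nonneg [simp]: "0 <= wt s k" by (simp add: wt_def)

lemma wt_zero [simp]: "wt 0 k = 1" using freq2_nonneg[of k] by (simp add: wt_def)

lemma wt_ge_1: "0 <= s ==> 1 <= wt s k" by (simp add: wt_def ge_one_powr_ge_zero)

lemma wt_mono: "s <= s' ==> wt s k <= wt s' k" by (simp add: wt_def powr_mono)

lemma wt_add: "wt (s + s') k = wt s k * wt s' k" by (simp add: wt_def powr_add)

lemma wt_minus: "wt (- s) k = 1 / wt s k" by (simp add: wt_def powr_minus_divide)

lemma wt_uminus [simp]: "wt s (- k) = wt s k" by (simp add: wt_def)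

lemma freq2_add_le: "freq2 (l + m) <= 2 * freq2 l + 2 * freq2 m"
proof -
 have *: "(real_of_int (a + b))^2 <= 2 * (of_int a)^2 + 2 * (of_int b)^2" for a b
  using zero_le_power2[of "real_of_int a - of_int b"] by (simp add: power2_eq_square algebra_simps)
 have "(real_of_int (fst (l+m)))^2 + (real_of_int (snd (l+m)))^2 <= 
  (2 * (of_int (fst l))^2 + 2 * (of_int (fst m))^2) + (2 * (of_int (snd l))^2 + 2 * (of_int (snd m))^2)"
  unfolding fst_add snd_add by (intro add_mono *)
 hence "4 * pi^2 * ((real_of_int (fst (l+m)))^2 + (real_of_int (snd (l+m)))^2) <= 4 * pi^2 * (
  (2 * (of_int (fst l))^2 + 2 * (of_int (fst m))^2) + (2 * (of_int (snd l))^2 + 2 * (of_int (snd m))^2))"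
  by (intro mult_left_mono) auto
 thus ?thesis by (simp add: freq2_def algebra_simps)
qed

lemma wt_add_le:
 assumes "0 <= s" shows "wt s (l + m) <= 4 powr s * max (wt s l) (wt s m)"
proof -
 have "1 + freq2 (l + m) <= 4 * max (1 + freq2 l) (1 + freq2 m)"
  using freq2_add_le[of l m] by (auto simp: max_def)
 hence "wt s (l + m) <= (4 * max (1 + freq2 l) (1 + freq2 m)) powr s"
  unfolding wt_def using assms by (intro powr_mono2) auto
 also have "... = 4 powr s * (max (1 + freq2 l) (1 + freq2 m)) powr s" by (simp add: powr_mult)
 also have "... <= 4 powr s * max (wt s l) (wt s m)" by (auto simp: wt_def max_def)
 finally show ?thesis .
qed

lemma blk_cover: "\<exists>j. k : blk j"
proof -
 obtain n where n: "1 + freq2 k < 4 ^ n" using real_arch_pow[of 4 "1 + freq2 k"] by auto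
 define m where "m = (LEAST n. 1 + freq2 k < 4 ^ n)"
 have m: "1 + freq2 k < 4 ^ m" unfolding m_def using n by (rule LeastI)
 have "m ~= 0" using m freq2_nonneg[of k] by (cases m) auto
 then obtain j where j: "m = Suc j" by (cases m) auto
 have "\<not> 1 + freq2 k < 4 ^ j" using not_less_Least[of j "%n. 1 + freq2 k < 4 ^ n"] j m_def by auto
 hence "k : blk j" using m j by (auto simp: blk_def)
 thus ?thesis ..
qed

lemma blk_unique: "k : blk i ==> k : blk j ==> i = j"
proof -
 have "i <= j" if "k : blk i" "k : blk j" for i j
 proof -
  have "(4::real) ^ i < 4 ^ (j + 1)" using that by (auto simp: blk_def)
  hence "i < j + 1" by (rule power_less_imp_less_exp[rotated]) simp
  thus ?thesis by simp
 qed
 thus "k : blk i ==> k : blk j ==> i = j" by (meson le_antisym)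
qed

lemma blk_sums_indicator: "(\<Sum>j. ind (blk j) k :: ennreal) = 1"
proof -
 obtain i where i: "k : blk i" using blk_cover by blast
 have "(\<Sum>j. ind (blk j) k :: ennreal) = (\<Sum>j\<in>{i}. ind (blk j) k)"
  by (rule suminf_finite) (auto simp: indicator_def dest: blk_unique[OF i])
 thus ?thesis using i by simp
qed

lemma nrm2_le_coord: "\<bar>fst k\<bar>^2 <= nrm2 k" "\<bar>snd k\<bar>^2 <= nrm2 k" by (auto simp: nrm2_def)

lemma blk_subset: "blk j \<subseteq> {- (2^j)..2^j} \<times> {- (2^j)..2^j}"
proof
 fix k assume k: "k : blk j"
 have "36 * real_of_int (nrm2 k) < 4 ^ (j+1)" using k nrm2_le_freq2[of k] by (auto simp: blk_def)
 hence "9 * real_of_int (nrm2 k) < 4 ^ j" by simp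
 moreover have "0 <= real_of_int (nrm2 k)" by simp
 ultimately have "real_of_int (nrm2 k) <= 4 ^ j" by linarith
 hence "nrm2 k <= 4 ^ j" by (metis of_int_le_iff of_int_numeral of_int_power)
 also have "(4::int) ^ j = (2^2)^j" by simp
 also have "... = (2^j)^2" by (simp only: power_mult[symmetric] mult.commute)
 finally have "nrm2 k <= (2^j)^2" .
 hence "\<bar>fst k\<bar> <= 2^j" "\<bar>snd k\<bar> <= 2^j" using nrm2_le_coord[of k] by (meson order_trans power2_le_imp_le zero_le_numeral zero_le_power)+
 thus "k : {- (2^j)..2^j} \<times> {- (2^j)..2^j}" by (cases k) (auto simp: abs_le_iff)
qed

lemma finite_blk [simp]: "finite (blk j)"
 by (rule finite_subset[OF blk_subset]) simp

lemma card_blk: "real (card (blk j)) <= 9 * 4 ^ j"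
proof -
 have "card (blk j) <= card ({- (2^j)..2^j::int} \<times> {- (2^j)..2^j::int})"
  by (rule card_mono[OF _ blk_subset]) simp
 also have "... = (2 * 2^j + 1)^2" by (simp add: card_cartesian_product power2_eq_square nat_add_distrib nat_mult_distrib nat_power_eq)
 also have "... <= (3 * 2^j)^2" by (intro power_mono) auto
 also have "... = 9 * 4^j" by (simp add: power_mult_distrib power_mult[symmetric] mult.commute[of j] power_mult)
 finally show ?thesis using of_nat_le_iff[where 'a=real, of "card (blk j)" "9 * 4^j"] by simp
qed

lemma powr_mult_nat: "0 < a ==> a powr (b * real n) = (a powr b) ^ n"
 by (simp add: powr_powr[symmetric] powr_realpow)

lemma wt_blk_ge: "k : blk j ==> 0 <= s ==> (4 powr s) ^ j <= wt s k"
 using powr_mono2[of s "4^j" "1 + freq2 k"]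
 by (auto simp: blk_def wt_def powr_realpow[symmetric] powr_powr mult.commute)

lemma suminf_ennreal_geometric:
 assumes "0 <= C" "0 <= q" "q < 1"
 shows "(\<Sum>j. ennreal (C * q ^ j)) = ennreal (C / (1 - q))"
 using sums_mult[OF geometric_sums[of q], of C] assms by (intro suminf_ennreal_eq) auto

section \<open>Weighted lattice sums over the level sets of the phase\<close>

lemma nn_integral_count_inj_le:
 assumes "inj_on T A"
 shows "(SU x. f (T x) * ind A x) <= (SU y. f y)"
proof -
 have "(SU x. f (T x) * ind A x) = (\<integral>\<^sup>+x. f (T x) \<partial>count_space A)"
  by (simp add: nn_integral_count_space_indicator)
 also have "... = (\<integral>\<^sup>+y. f y \<partial>count_space (T ` A))"
  using assms by (intro nn_integral_bij_count_space) (simp add: bij_betw_def)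
 also have "... <= (SU y. f y)"
  by (subst nn_integral_count_space_indicator, simp, intro nn_integral_mono) (auto simp: indicator_def)
 finally show ?thesis .
qed

text \<open>Uniform in the centre \<open>q\<close> and in the radius. At distance of order
  \<open>2^j\<close> from \<open>q\<close> there are either at most two points, or three points so
  close together that the radius is at most of order \<open>8^j\<close>; in the second case the
  count on the whole circle is a small power of \<open>4^j\<close> and no longer refers to
  \<open>M\<close>.\<close>

lemma circle_sum:
 assumes d: "d > 0"
 obtains S where "S > 0"
  "!!q M. (SZ p. ennreal (wt (-d) (p - q)) * ind {p. nrm2 p = M} p) <= ennreal S"
proof -
 \<comment> \<open>The divisor count enters squared, which gives \<open>M powr (d/6)\<close>, and
   \<open>M <= 64^(j+1)\<close> turns this into \<open>4 powr (d/2 * (j+1))\<close>. Half of the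
   decay \<open>4 powr (-d)\<close> of the weight is left; this is the ratio
   \<open>Q\<close>.\<close>
 obtain C where C: "C >= 1" "!!n::nat. n > 0 ==> real (card {d. d dvd n}) <= C * real n powr (d/12)"
  using divisor_bound[of "d/12"] d by auto
 define Q where "Q = 4 powr (- d / 2)"
 have Q: "0 < Q" "Q < 1" using d by (auto simp: Q_def powr_less_one)
 define S where "S = (10 * C^2 * 4 powr (d/2)) / (1 - Q)"
 have S0: "S > 0" using C Q by (auto simp: S_def)
 have "(SZ p. ennreal (wt (-d) (p - q)) * ind {p. nrm2 p = M} p) <= ennreal S" for q M
 proof -
  define B where "B j = {p. nrm2 p = M & p - q : blk j}" for j
  have finB: "finite (B j)" for j
  proof (rule finite_subset)
   show "B j \<subseteq> (%p. p + q) ` blk j" by (force simp: B_def)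
  qed simp
  have card_B: "real (card (B j)) <= 10 * C^2 * 4 powr (d/2) * (4 powr (d/2)) ^ j" for j
  proof (cases "card (B j) >= 3")
   case False
   hence "real (card (B j)) <= 10 * 1 * 1 * 1" by simp
   also have "... <= 10 * C^2 * 4 powr (d/2) * (4 powr (d/2)) ^ j"
    using C(1) d by (intro mult_mono one_le_power) (auto simp: ge_one_powr_ge_zero)
   finally show ?thesis .
  next
   case True
   have n2: "36 * real_of_int (nrm2 (p - q)) <= 4^(j+1)" if "p : B j" for p
    using that nrm2_le_freq2[of "p - q"] by (auto simp: B_def blk_def)
   have "4 * M <= (4^(j+1))^3"
   proof (rule close_points_on_circle[OF _ _ True])
    show "\<forall>p\<in>B j. (fst p)^2 + (snd p)^2 = M" by (auto simp: B_def nrm2_def)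
    show "\<forall>p\<in>B j. \<forall>p'\<in>B j. (fst p - fst p')^2 + (snd p - snd p')^2 <= 4^(j+1)"
    proof (intro ballI)
     fix p p' assume pp: "p : B j" "p' : B j"
     have *: "(a - b)^2 <= 2 * (a - c)^2 + 2 * (b - c)^2" for a b c :: int
      using zero_le_power2[of "a + b - 2 * c"] by (simp add: power2_eq_square algebra_simps)
     have "(fst p - fst p')^2 + (snd p - snd p')^2 <= 2 * nrm2 (p - q) + 2 * nrm2 (p' - q)"
      using *[of "fst p" "fst p'" "fst q"] *[of "snd p" "snd p'" "snd q"] by (simp add: nrm2_def)
     moreover have "real_of_int (2 * nrm2 (p - q) + 2 * nrm2 (p' - q)) <= 4^(j+1)"
      using n2[OF pp(1)] n2[OF pp(2)] of_int_nonneg[OF nrm2_nonneg, of "p - q", where 'a=real]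
       of_int_nonneg[OF nrm2_nonneg, of "p' - q", where 'a=real]
      unfolding of_int_add of_int_mult of_int_numeral power_add power_one_right by linarith
     hence "2 * nrm2 (p - q) + 2 * nrm2 (p' - q) <= 4^(j+1)"
      by (metis of_int_le_iff of_int_numeral of_int_power)
     ultimately show "(fst p - fst p')^2 + (snd p - snd p')^2 <= 4^(j+1)" by linarith
    qed
   qed
   also have "(4^(j+1))^3 = (4^3::int)^(j+1)" by (simp only: power_mult[symmetric] mult.commute)
   finally have "4 * M <= 64^(j+1)" by simp
   moreover have "(0::int) <= 64^(j+1)" by simp
   ultimately have M1: "M <= 64^(j+1)" by linarith
   have M0: "M > 0"
   proof (rule ccontr)
    assume "\<not> M > 0"
    hence "B j \<subseteq> {0}" by (auto simp: B_def nrm2_def prod_eq_iff sum_power2_gt_zero_iff)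
    hence "card (B j) <= 1" using card_mono[of "{0}" "B j"] by simp
    thus False using True by simp
   qed
   define n where "n = nat M"
   have n: "n > 0" "int n = M" using M0 by (auto simp: n_def)
   have "(real n powr (d/12)) <= (64^(j+1)) powr (d/12)"
   proof (rule powr_mono2)
    have "real_of_int (int n) <= real_of_int (64^(j+1))" using M1 n(2) by (simp only: of_int_le_iff)
    thus "real n <= 64^(j+1)" by simp
   qed (use d in auto)
   also have "((64::real)^(j+1)) powr (d/12) = 4 powr (d/4 * (j+1))"
   proof -
    have "(64::real)^(j+1) = (4 powr 3) powr (real (j+1))" by (subst powr_realpow) auto
    hence "((64::real)^(j+1)) powr (d/12) = 4 powr (3 * real (j+1) * (d/12))" by (simp only: powr_powr)
    also have "3 * real (j+1) * (d/12) = d/4 * real (j+1)" by simp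
    finally show ?thesis .
   qed
   finally have pw: "real n powr (d/12) <= 4 powr (d/4 * (j+1))" .
   have "B j \<subseteq> {(x, y). x^2 + y^2 = int n}" by (auto simp: B_def nrm2_def n)
   hence "card (B j) <= card {(x::int, y). x^2 + y^2 = int n}" by (intro card_mono finite_circle)
   also have "... <= 10 * (card {d. d dvd n})^2" by (rule card_circle[OF n(1)])
   finally have "real (card (B j)) <= real (10 * (card {d. d dvd n})^2)" by (simp only: of_nat_le_iff)
   also have "... = 10 * (real (card {d. d dvd n}))^2" by simp
   also have "... <= 10 * (C * real n powr (d/12))^2" using C(2)[OF n(1)] by (intro mult_left_mono power_mono) auto
   also have "... <= 10 * (C * 4 powr (d/4 * (j+1)))^2" using C(1) by (intro mult_left_mono power_mono pw) auto
   also have "(C * 4 powr (d/4 * (j+1)))^2 = C^2 * 4 powr (d/2 * (j+1))"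
   proof -
    have "4 powr (d/4 * (j+1)) * 4 powr (d/4 * (j+1)) = 4 powr (d/4 * (j+1) + d/4 * (j+1))"
     by (simp only: powr_add)
    also have "d/4 * (j+1) + d/4 * (j+1) = d/2 * (j+1)" by (simp add: algebra_simps)
    finally show ?thesis by (metis power2_eq_square power_mult_distrib)
   qed
   also have "10 * (C^2 * 4 powr (d/2 * (j+1))) = 10 * C^2 * 4 powr (d/2 * (j+1))" by simp
   also have "... = 10 * C^2 * 4 powr (d/2) * (4 powr (d/2)) ^ j" by (subst powr_mult_nat) (auto)
   finally show ?thesis .
  qed
  have "(SZ p. ennreal (wt (-d) (p - q)) * ind {p. nrm2 p = M} p)
    <= (SZ p. (\<Sum>j. ennreal ((4 powr (-d)) ^ j) * ind (B j) p))"
  proof (rule nn_integral_mono)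
   fix p
   obtain i where i: "p - q : blk i" using blk_cover by blast
   have "ennreal (wt (-d) (p - q)) * ind {p. nrm2 p = M} p <= ennreal ((4 powr (-d)) ^ i) * ind (B i) p"
   proof -
    have "wt (-d) (p - q) <= (4 powr (-d)) ^ i" unfolding wt_minus powr_minus_divide power_one_over
     using wt_blk_ge[OF i, of d] d by (simp add: power_divide field_simps)
    thus ?thesis using i by (auto simp: B_def indicator_def intro: ennreal_leI)
   qed
   also have "... <= (\<Sum>j. ennreal ((4 powr (-d)) ^ j) * ind (B j) p)"
   proof -
    define g where "g j = ennreal ((4 powr (-d)) ^ j) * ind (B j) p" for j
    have "sum g {i} <= suminf g" by (rule sum_le_suminf) auto
    hence "g i <= suminf g" by simp
    thus ?thesis unfolding g_def[abs_def] .
   qed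
   finally show "ennreal (wt (-d) (p - q)) * ind {p. nrm2 p = M} p <= (\<Sum>j. ennreal ((4 powr (-d)) ^ j) * ind (B j) p)" .
  qed
  also have "... = (\<Sum>j. (SZ p. ennreal ((4 powr (-d)) ^ j) * ind (B j) p))"
   by (rule nn_integral_suminf) simp
  also have "... = (\<Sum>j. ennreal ((4 powr (-d)) ^ j) * ennreal (real (card (B j))))"
   by (simp add: nn_integral_cmult emeasure_count_space_finite[OF _ finB] ennreal_of_nat_eq_real_of_nat)
  also have "... <= (\<Sum>j. ennreal ((10 * C^2 * 4 powr (d/2)) * Q ^ j))"
  proof (rule suminf_le)
   fix j
   have "(4 powr (-d)) ^ j * real (card (B j)) <= (4 powr (-d)) ^ j * (10 * C^2 * 4 powr (d/2) * (4 powr (d/2)) ^ j)"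
    by (intro mult_left_mono card_B) auto
   also have "... = (10 * C^2 * 4 powr (d/2)) * (4 powr (-d) * 4 powr (d/2)) ^ j" by (simp add: power_mult_distrib mult_ac)
   also have "4 powr (-d) * 4 powr (d/2) = Q" unfolding Q_def powr_add[symmetric] by (rule arg_cong[where f="%x. 4 powr x"]) simp
   finally show "ennreal ((4 powr (-d)) ^ j) * ennreal (real (card (B j))) <= ennreal ((10 * C^2 * 4 powr (d/2)) * Q ^ j)"
    by (simp add: ennreal_mult[symmetric] ennreal_leI)
  qed auto
  also have "... = ennreal S" unfolding S_def using Q by (intro suminf_ennreal_geometric) auto
  finally show ?thesis .
 qed
 thus ?thesis using that S0 by blast
qed

text \<open>The weight for the Cauchy-Schwarz inequality over all \<open>l\<close> with the same
  phase. The minimum places the loss on the lower of the two interacting frequencies.\<close>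

definition kap :: "real => lat => lat => real" where
 "kap d k l = min (wt d l) (wt d (k - l))"

lemma kap_pos [simp]: "0 < kap d k l" by (simp add: kap_def)

lemma inverse_kap_le: "1 / kap d k l <= wt (-d) l + wt (-d) (k - l)"
 by (auto simp: kap_def wt_minus min_def)

lemma nn_inverse_kap_le:
 "(SZ l. ennreal (1 / kap d k l) * ind A l) <=
 (SZ l. ennreal (wt (-d) l) * ind A l) + (SZ l. ennreal (wt (-d) (k - l)) * ind A l)"
proof -
 have "(SZ l. ennreal (1 / kap d k l) * ind A l) <= (SZ l. ennreal (wt (-d) l) * ind A l + ennreal (wt (-d) (k - l)) * ind A l)"
  using inverse_kap_le[of d k] by (intro nn_integral_mono)
   (auto simp: indicator_def ennreal_plus[symmetric] intro!: ennreal_leI simp del: ennreal_plus)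
 also have "... = (SZ l. ennreal (wt (-d) l) * ind A l) + (SZ l. ennreal (wt (-d) (k - l)) * ind A l)"
  by (rule nn_integral_add) auto
 finally show ?thesis .
qed

text \<open>For \<open>et = 0\<close> the level set is a circle about the origin; for
  \<open>et = 1\<close> the parallelogram law makes \<open>2 * l - k\<close> run through a circle.
  The two summands that bound \<open>1 / kap\<close> are weights centred at 0 and at
  \<open>k\<close>, which is why the circle sum has to allow arbitrary centres.\<close>

lemma kap_sum_circle:
 assumes d: "d > 0"
 obtains S where "S > 0"
  "!!(et::int) k M. et : {0,1} ==> (SZ l. ennreal (1 / kap d k l) * ind {l. nrm2 l + et * nrm2 (k - l) = M} l) <= ennreal S"
proof -
 obtain S where S: "S > 0"
  "!!q M. (SZ p. ennreal (wt (-d) (p - q)) * ind {p. nrm2 p = M} p) <= ennreal S"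
  using circle_sum[OF d] by blast
 have wts: "wt (-d) (k - l) = wt (-d) (l - k)" for k l by (simp add: wt_def freq2_diff_commute)
 define S' where "S' = 2 * (4 powr d * S) + 2 * S"
 have "(SZ l. ennreal (1 / kap d k l) * ind {l. nrm2 l + et * nrm2 (k - l) = M} l) <= ennreal S'" 
  if "et : {0,1}" for et :: int and k M
 proof -
  define A where "A = {l. nrm2 l + et * nrm2 (k - l) = M}"
  have bd: "(SZ l. ennreal (wt (-d) (l - q)) * ind A l) <= ennreal (4 powr d * S + S)" if "q = 0 \<or> q = k" for q
  proof (cases "et = 0")
   case True
   hence "(SZ l. ennreal (wt (-d) (l - q)) * ind A l) <= ennreal S" using S(2)[of q M] by (simp add: A_def)
   also have "... <= ennreal (4 powr d * S + S)" using S(1) by (intro ennreal_leI) simp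
   finally show ?thesis .
  next
   case False
   hence et: "et = 1" using \<open>et : {0,1}\<close> by simp
   \<comment> \<open>Doubling is injective and sends the centre \<open>q\<close> to
     \<open>q + q - k\<close>; distances double, so the weight loses only
     \<open>4 powr d\<close>.\<close>
   define M' where "M' = 2 * M - nrm2 k"
   define f where "f p = ennreal (4 powr d) * (ennreal (wt (-d) (p - (q + q - k))) * ind {p. nrm2 p = M'} p)" for p
   have "(SZ l. ennreal (wt (-d) (l - q)) * ind A l) <= (SZ l. f (l + l - k) * ind A l)"
   proof (rule nn_integral_mono)
    fix l
    have 1: "nrm2 (l + l - k) = M'" if "l : A"
     using that by (auto simp: A_def et M'_def nrm2_def power2_eq_square algebra_simps)
    have 2: "wt (-d) (l - q) <= 4 powr d * wt (-d) (l + l - k - (q + q - k))"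
    proof -
     have "freq2 (l + l - k - (q + q - k)) = 4 * freq2 (l - q)"
      by (simp add: freq2_def power2_eq_square algebra_simps)
     hence "wt d (l + l - k - (q + q - k)) <= (4 * (1 + freq2 (l - q))) powr d"
      unfolding wt_def using d freq2_nonneg[of "l - q"] by (intro powr_mono2) auto
     also have "... = 4 powr d * wt d (l - q)" unfolding wt_def by (subst powr_mult) auto
     finally show ?thesis by (simp add: wt_minus field_simps)
    qed
    show "ennreal (wt (-d) (l - q)) * ind A l <= f (l + l - k) * ind A l"
     using 1 2 by (auto simp: f_def indicator_def ennreal_mult[symmetric] intro!: ennreal_leI)
   qed
   also have "... <= (SZ p. f p)"
    by (rule nn_integral_count_inj_le) (auto simp: inj_on_def prod_eq_iff)
   also have "... <= ennreal (4 powr d) * ennreal S" unfolding f_def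
    by (subst nn_integral_cmult) (auto intro!: mult_left_mono S(2))
   also have "... <= ennreal (4 powr d * S + S)" using S(1) by (simp add: ennreal_mult[symmetric] ennreal_leI)
   finally show ?thesis .
  qed
  have "(SZ l. ennreal (1 / kap d k l) * ind A l) <= ennreal (4 powr d * S + S) + ennreal (4 powr d * S + S)"
   using nn_inverse_kap_le[of d k A] add_mono[OF bd[of 0] bd[of k]] by (simp add: wts)
  also have "... = ennreal S'" using S(1) by (subst ennreal_plus[symmetric]) (auto simp: S'_def)
  finally show ?thesis by (simp add: A_def)
 qed
 moreover have "S' > 0" using S(1) by (auto simp: S'_def intro: add_pos_pos)
 ultimately show ?thesis using that by blast
qed

lemma int_square_sum_finite:
 obtains S where "S > 0" "(\<integral>\<^sup>+n. ennreal (1 / (1 + (of_int n)^2)) \<partial>count_space (UNIV::int set)) <= ennreal S"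
proof -
 have sm: "summable (%n. 1 / (1 + (real n)^2))"
 proof (rule summable_comparison_test)
  show "summable (%n. 2 * (1 / (real n + 1)^2))"
  proof (rule summable_mult)
   have "summable (%n. inverse ((real n)^2))" by (rule inverse_power_summable) simp
   hence "summable (%n. inverse ((real (Suc n))^2))" by (subst summable_Suc_iff)
   thus "summable (%n. 1 / (real n + 1)^2)" by (simp add: inverse_eq_divide add.commute)
  qed
  have "1 / (1 + (real n)^2) <= 2 * (1 / (real n + 1)^2)" for n
   using zero_le_power2[of "real n - 1"] by (simp add: field_simps power2_eq_square add_pos_nonneg)
  thus "\<exists>N. \<forall>n\<ge>N. norm (1 / (1 + (real n)^2)) <= 2 * (1 / (real n + 1)^2)" by (auto simp: add_nonneg_nonneg)
 qed
 define S where "S = (\<Sum>n. 1 / (1 + (real n)^2))"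
 have 1: "(SU n. ennreal (1 / (1 + (real n)^2))) = ennreal S"
  unfolding S_def nn_integral_count_space_nat by (rule suminf_ennreal2[OF _ sm]) (auto simp: add_nonneg_nonneg)
 have "S > 0" unfolding S_def by (rule suminf_pos[OF sm]) (auto simp: add_pos_nonneg)
 define f where "f n = ennreal (1 / (1 + (of_int n)^2))" for n :: int
 have "(SU n. f n) <= (SU n. f n * ind {0..} n + f n * ind {..0} n)"
  by (intro nn_integral_mono) (auto simp: indicator_def)
 also have "... = (SU n. f n * ind {0..} n) + (SU n. f n * ind {..0} n)"
  by (rule nn_integral_add) auto
 also have "... <= ennreal S + ennreal S"
 proof (intro add_mono)
  have "(SU n. f n * ind {0..} n) = (SU n. ennreal (1 / (1 + (real (nat n))^2)) * ind {0..} n)"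
   by (intro nn_integral_cong) (auto simp: f_def indicator_def)
  also have "... <= ennreal S" unfolding 1[symmetric] by (rule nn_integral_count_inj_le) (auto simp: inj_on_def)
  finally show "(SU n. f n * ind {0..} n) <= ennreal S" .
  have "(SU n. f n * ind {..0} n) = (SU n. ennreal (1 / (1 + (real (nat (-n)))^2)) * ind {..0} n)"
   by (intro nn_integral_cong) (auto simp: f_def indicator_def)
  also have "... <= ennreal S" unfolding 1[symmetric] by (rule nn_integral_count_inj_le) (auto simp: inj_on_def)
  finally show "(SU n. f n * ind {..0} n) <= ennreal S" .
 qed
 also have "... = ennreal (2 * S)" using \<open>S > 0\<close> by (simp flip: ennreal_plus)
 finally show ?thesis using that[of "2 * S"] \<open>S > 0\<close> by (simp add: f_def)
qed

text \<open>For the conjugate flow the level set is a line orthogonal to \<open>k\<close>, which may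
  carry far more points than a circle; a small \<open>d\<close> does not suffice and
  \<open>d = 1\<close> is taken. For \<open>k = 0\<close> the phase vanishes identically. Otherwise
  one coordinate is injective on the line and the weight decays like its inverse square.\<close>

lemma kap_sum_line:
 obtains S where "S > 0"
  "!!k M. k ~= 0 ==> (SZ l. ennreal (1 / kap 1 k l) * ind {l. nrm2 l - nrm2 (k - l) = M} l) <= ennreal S"
proof -
 obtain S where S: "S > 0" "(\<integral>\<^sup>+n. ennreal (1 / (1 + (of_int n)^2)) \<partial>count_space (UNIV::int set)) <= ennreal S"
  using int_square_sum_finite by blast
 have w: "wt (-1) l <= 1 / (1 + (of_int (fst l))^2)" "wt (-1) l <= 1 / (1 + (of_int (snd l))^2)" for l
 proof -
  have "real_of_int (nrm2 l) <= 36 * of_int (nrm2 l)" by simp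
  hence "real_of_int (nrm2 l) <= freq2 l" using nrm2_le_freq2[of l] by linarith
  hence *: "(real_of_int (fst l))^2 <= freq2 l" "(real_of_int (snd l))^2 <= freq2 l"
   by (auto simp: nrm2_def) (smt (verit) zero_le_power2)+
  show "wt (-1) l <= 1 / (1 + (of_int (fst l))^2)" "wt (-1) l <= 1 / (1 + (of_int (snd l))^2)"
   using * by (auto simp: wt_def powr_minus_divide intro!: divide_left_mono mult_pos_pos add_pos_nonneg)
 qed
 have "(SZ l. ennreal (1 / kap 1 k l) * ind {l. nrm2 l - nrm2 (k - l) = M} l) <= ennreal (2 * S)" if k: "k ~= 0" for k M
 proof -
  define A where "A = {l. nrm2 l - nrm2 (k - l) = M}"
  have line: "2 * (fst k * fst l + snd k * snd l) = M + nrm2 k" if "l : A" for l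
   using that by (auto simp: A_def nrm2_def power2_eq_square algebra_simps)
  have inj: "inj_on snd A \<or> inj_on fst A"
  proof (cases "fst k = 0")
   case True
   hence "snd k ~= 0" using k by (simp add: prod_eq_iff)
   hence "inj_on fst A" using line True by (intro inj_onI) (metis add_left_cancel mult_cancel_left prod_eq_iff zero_neq_numeral)
   thus ?thesis ..
  next
   case False
   hence "inj_on snd A" using line by (intro inj_onI) (metis add_right_cancel mult_cancel_left prod_eq_iff zero_neq_numeral)
   thus ?thesis ..
  qed
  have bd: "(SZ l. ennreal (wt (-1) (g l)) * ind A l) <= ennreal S"
   if g: "!!l. fst (g l) = fst l \<or> True" and inj': "inj_on (snd \<circ> g) A \<or> inj_on (fst \<circ> g) A" for g
  proof -
   have "\<exists>h. inj_on h A & (\<forall>l. wt (-1) (g l) <= 1 / (1 + (of_int (h l))^2))"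
    using inj' w by (metis comp_apply)
   then obtain h where h: "inj_on h A" "!!l. wt (-1) (g l) <= 1 / (1 + (of_int (h l))^2)" by blast
   have "(SZ l. ennreal (wt (-1) (g l)) * ind A l) <= (SZ l. ennreal (1 / (1 + (of_int (h l))^2)) * ind A l)"
    by (intro nn_integral_mono mult_right_mono ennreal_leI h(2)) auto
   also have "... <= (\<integral>\<^sup>+n. ennreal (1 / (1 + (of_int n)^2)) \<partial>count_space (UNIV::int set))"
    by (rule nn_integral_count_inj_le[OF h(1), of "%n. ennreal (1 / (1 + (of_int n)^2))"])
   finally show ?thesis using S(2) by simp
  qed
  have "(SZ l. ennreal (1 / kap 1 k l) * ind A l) <= ennreal S + ennreal S"
   using nn_inverse_kap_le[of 1 k A] add_mono[OF bd[of "%l. l"] bd[of "%l. k - l"]] inj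
   by (auto simp: inj_on_def)
  also have "... = ennreal (2 * S)" using S(1) by (simp flip: ennreal_plus)
  finally show ?thesis by (simp add: A_def)
 qed
 thus ?thesis using that[of "2 * S"] S(1) by auto
qed

section \<open>Completeness of characters\<close>

text \<open>The family of characters is a parameter because completeness is used twice, for
  \<open>ek\<close> on the torus and for integer frequencies on an interval of time.\<close>

inductive_set trig_poly :: "('i => 'a => complex) => ('a => complex) set" for e where
 mono: "(%x. a * e k x) : trig_poly e"
| add: "f : trig_poly e ==> g : trig_poly e ==> (%x. f x + g x) : trig_poly e"

lemma trig_poly_mult:
 fixes e :: "'i::ab_group_add => 'a => complex"
 assumes hom: "!!k l x. e (k + l) x = e k x * e l x" and f: "f : trig_poly e" and g: "g : trig_poly e"
 shows "(%x. f x * g x) : trig_poly e"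
 using f
proof (induction rule: trig_poly.induct)
 case (mono a k)
 show ?case using g
 proof (induction rule: trig_poly.induct)
  case (mono b l)
  have "(%x. a * e k x * (b * e l x)) = (%x. (a * b) * e (k + l) x)" by (simp add: hom mult_ac)
  thus ?case using trig_poly.mono[of "a * b" e "k + l"] by simp
 next
  case (add f g) thus ?case using trig_poly.add by (fastforce simp: distrib_left)
 qed
next
 case (add f g) thus ?case using trig_poly.add by (fastforce simp: distrib_right)
qed

lemma trig_poly_sum:
 assumes "finite B" "!!b. b : B ==> f b : trig_poly e"
 shows "(%x. \<Sum>b\<in>B. f b x) : trig_poly e"
 using assms
proof (induction B rule: finite_induct)
 case empty thus ?case using trig_poly.mono[of 0 e undefined] by simp
next
 case (insert b B) thus ?case using trig_poly.add[of "f b" e "%x. \<Sum>b\<in>B. f b x"] by simp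
qed

text \<open>\<open>E\<close> is a map whose real coordinates are trigonometric polynomials, and
  \<open>hom\<close> keeps products of those in the class. Hence polynomial approximation on the
  image of \<open>E\<close> yields approximation by characters.\<close>

lemma polynomial_in_trig_poly:
 fixes e :: "'i::ab_group_add => 'a => complex" and E :: "'a => 'b::euclidean_space"
 assumes hom: "!!k l x. e (k + l) x = e k x * e l x" and one: "!!x. e 0 x = 1"
  and comps: "!!b. b : Basis ==> (%x. of_real (E x \<bullet> b)) : trig_poly e"
  and p: "real_polynomial_function p"
 shows "(%x. of_real (p (E x))) : trig_poly e"
proof -
 have cst: "(%x. c) : trig_poly e" for c using trig_poly.mono[of c e 0] by (simp add: one)
 show ?thesis using p
 proof (induction rule: real_polynomial_function.induct)
  case (linear f)
  have "f (E x) = (\<Sum>b\<in>Basis. (E x \<bullet> b) * f b)" for x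
  proof -
   have "f (\<Sum>b\<in>Basis. (E x \<bullet> b) *\<^sub>R b) = (\<Sum>b\<in>Basis. (E x \<bullet> b) *\<^sub>R f b)"
    by (simp add: linear_sum[OF bounded_linear.linear[OF linear]] linear_scale[OF bounded_linear.linear[OF linear]])
   thus ?thesis by (simp add: euclidean_representation)
  qed
  hence "(%x. complex_of_real (f (E x))) = (%x. \<Sum>b\<in>Basis. of_real (E x \<bullet> b) * of_real (f b))" by simp
  thus ?case by (simp only:) (intro trig_poly_sum trig_poly_mult[of e, OF hom] comps cst finite_Basis)
 next
  case (const c) thus ?case by (rule cst)
 next
  case (add f g) thus ?case using trig_poly.add by fastforce
 next
  case (mult f g)
  thus ?case using trig_poly_mult[of e "%x. of_real (f (E x))" "%x. of_real (g (E x))", OF hom] by simp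
 qed
qed

text \<open>Tested on the set where \<open>H\<close> is positive and on the set where it is
  negative.\<close>

lemma AE_zero_of_integrals:
 fixes H :: "'a => real"
 assumes H: "integrable M H" and z: "!!A. A : sets M ==> (LINT x|M. ind A x * H x) = 0"
 shows "AE x in M. H x = 0"
proof -
 have [measurable]: "H : borel_measurable M" using H by simp
 have P: "{x:space M. H x > 0} : sets M" and N: "{x:space M. H x < 0} : sets M" by simp_all
 have i: "integrable M (%x. ind {x:space M. H x > 0} x * H x)" "integrable M (%x. ind {x:space M. H x < 0} x * (- H x))"
  using integrable_mult_indicator[OF P H] integrable_mult_indicator[OF N integrable_minus[OF H]] by simp_all
 have "AE x in M. ind {x:space M. H x > 0} x * H x = 0"
  using integral_nonneg_eq_0_iff_AE[OF i(1)] z[OF P] by (auto simp: indicator_def)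
 moreover have "AE x in M. ind {x:space M. H x < 0} x * (- H x) = 0"
  using integral_nonneg_eq_0_iff_AE[OF i(2)] z[OF N] by (auto simp: indicator_def)
 moreover note AE_space[of M]
 ultimately show ?thesis
  by eventually_elim (auto simp: indicator_def split: if_splits)
qed

text \<open>Polynomials in \<open>E\<close> approximate the functions \<open>g \<circ> E\<close>, hence indicators of open sets
  \<open>O \<subseteq> U\<close>, because \<open>E\<close> separates points of \<open>U\<close> from \<open>S\<close>; a Dynkin argument does the rest.\<close>

lemma fourier_unique:
 fixes e :: "'i::ab_group_add => 'a::euclidean_space => complex" and E :: "'a => 'b::euclidean_space"
 assumes hom: "!!k l x. e (k + l) x = e k x * e l x" and one: "!!x. e 0 x = 1"
  and comps: "!!b. b : Basis ==> (%x. of_real (E x \<bullet> b)) : trig_poly e"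
  and e1: "!!k x. cmod (e k x) <= 1" and em [measurable]: "!!k. e k : bmeas"
  and S: "compact S" and E: "continuous_on S E"
  and U: "open U" "U \<subseteq> S" "S - U ~= {}" and inj: "!!x y. x : U ==> y : S ==> E x = E y ==> x = y"
  and f: "integrable lborel (%x. ind S x *\<^sub>R f x)"
  and zero: "!!k. (LINT x|lborel. (ind S x *\<^sub>R f x) * e k x) = 0"
 shows "AE x in lborel. x : U --> f x = (0::complex)"
proof -
 define F where "F x = ind S x *\<^sub>R f x" for x
 have F: "integrable lborel F" using f by (simp add: F_def[abs_def])
 have Fm [measurable]: "F : bmeas" using F by simp
 have Sm [measurable]: "S : sets borel" using S by (simp add: borel_compact)
 have bnd: "integrable lborel (%x. F x * h x)" if "h : bmeas" "!!x. x : S ==> cmod (h x) <= B" for h B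
 proof (rule bintegrable_bound)
  show "integrable lborel (%x. B *\<^sub>R F x)" using F by simp
  show "(%x. F x * h x) : borel_measurable lborel" using that by simp
  have "cmod (F x * h x) <= cmod (B *\<^sub>R F x)" for x
  proof (cases "x : S")
   case True
   hence "cmod (h x) <= \<bar>B\<bar>" using that(2)[of x] by linarith
   thus ?thesis by (simp add: norm_mult mult.commute[of "\<bar>B\<bar>"] mult_left_mono)
  qed (simp add: F_def)
  thus "AE x in lborel. norm (F x * h x) <= norm (B *\<^sub>R F x)" by simp
 qed
 have tp: "h : bmeas & (\<exists>B. \<forall>x. cmod (h x) <= B) & (LINT x|lborel. F x * h x) = 0" if "h : trig_poly e" for h
  using that
 proof (induction rule: trig_poly.induct)
  case (mono a k)
  have "(LINT x|lborel. F x * (a * e k x)) = a * (LINT x|lborel. F x * e k x)"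
   by (simp flip: integral_mult_right_zero add: mult_ac)
  moreover have "cmod (a * e k x) <= cmod a" for x using e1[of k x] by (simp add: norm_mult mult_left_le)
  ultimately show ?case using zero[of k] by (auto simp: F_def)
 next
  case (add f g)
  then obtain B B' where B: "\<forall>x. cmod (f x) <= B" "\<forall>x. cmod (g x) <= B'" by blast
  have "\<forall>x. cmod (f x + g x) <= B + B'" using B by (meson add_mono norm_triangle_le)
  moreover have "(LINT x|lborel. F x * (f x + g x)) = 0"
   using add B by (simp add: distrib_left bintegral_add[OF bnd[where B=B] bnd[where B=B']])
  ultimately show ?case using add by auto
 qed
 have cont: "(LINT x|lborel. F x * of_real (ind S x * g (E x))) = 0" if g: "continuous_on (E ` S) g" for g :: "'b => real"
 proof -
  have cE: "compact (E ` S)" using S E compact_continuous_image by blast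
  have cg: "continuous_on S (%x. g (E x))" using g E by (rule continuous_on_compose2) auto
  define hh where "hh x = ind S x * g (E x)" for x
  have hd: "(LINT x|lborel. F x * of_real (ind S x * g (E x))) = (LINT x|lborel. F x * of_real (hh x))" by (simp only: hh_def)
  have m [measurable]: "hh : bmeas"
   using borel_measurable_continuous_on_indicator[OF Sm cg] by (simp add: hh_def[abs_def])
  obtain B where B: "!!x. x : S ==> \<bar>g (E x)\<bar> <= B"
   using compact_imp_bounded[OF compact_continuous_image[OF cg S]] by (auto simp: bounded_iff)
  have ii: "integrable lborel (%x. F x * of_real (hh x))"
  proof (rule bnd[where B=B])
   fix x assume "x : S" thus "cmod (of_real (hh x)) <= B" using B[of x] by (simp add: hh_def)
  qed measurable
  define I where "I = (LINT x|lborel. norm (F x))"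
  have I0: "I >= 0" by (simp add: I_def)
  have "cmod (LINT x|lborel. F x * of_real (hh x)) <= d * I" if d: "d > 0" for d
  proof -
   obtain p where p: "real_polynomial_function p" "!!z. z : E ` S ==> \<bar>g z - p z\<bar> < d"
    using Stone_Weierstrass_real_polynomial_function[OF cE g d] by blast
   have P: "(%x. of_real (p (E x))) : trig_poly e" by (rule polynomial_in_trig_poly[OF hom one comps p(1)])
   then obtain B' where B': "\<forall>x. cmod (of_real (p (E x)) :: complex) <= B'" using tp by blast
   have pm: "(%x. of_real (p (E x)) :: complex) : bmeas" using tp[OF P] by blast
   have ip: "integrable lborel (%x. F x * of_real (p (E x)))" by (rule bnd[OF pm, where B=B']) (use B' in auto)
   have "(LINT x|lborel. F x * of_real (hh x)) = (LINT x|lborel. F x * of_real (hh x) - F x * of_real (p (E x)))"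
    using tp[OF P] by (simp add: bintegral_diff[OF ii ip])
   also have "cmod ... <= (LINT x|lborel. d * norm (F x))"
   proof (rule Bochner_Integration.integral_norm_bound_integral)
    show "integrable lborel (%x. F x * of_real (hh x) - F x * of_real (p (E x)))" using ii ip by simp
    show "integrable lborel (%x. d * norm (F x))" using F by simp
    fix x
    show "cmod (F x * of_real (hh x) - F x * of_real (p (E x))) <= d * cmod (F x)"
    proof (cases "x : S")
     case True
     hence "\<bar>g (E x) - p (E x)\<bar> <= d" using p(2)[of "E x"] by auto
     hence "cmod (F x) * \<bar>g (E x) - p (E x)\<bar> <= cmod (F x) * d" by (rule mult_left_mono) simp
     moreover have "F x * of_real (hh x) - F x * of_real (p (E x)) = F x * of_real (g (E x) - p (E x))"
      using True by (simp add: right_diff_distrib hh_def)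
     ultimately show ?thesis by (simp only: norm_mult norm_of_real) (simp add: mult.commute)
    qed (simp add: F_def)
   qed
   finally show ?thesis by (simp add: I_def)
  qed
  note small = this
  have "cmod (LINT x|lborel. F x * of_real (hh x)) <= 0 + d" if "d > 0" for d
  proof -
   have "cmod (LINT x|lborel. F x * of_real (hh x)) <= (d / (I + 1)) * I" by (rule small) (use that I0 in \<open>auto intro!: divide_pos_pos\<close>)
   also have "... <= d" using that I0 by (simp add: field_simps)
   finally show ?thesis by simp
  qed
  hence "cmod (LINT x|lborel. F x * of_real (hh x)) <= 0" by (rule field_le_epsilon)
  thus ?thesis unfolding hd by simp
 qed
 have opn: "(LINT x|lborel. ind W x *\<^sub>R F x) = 0" if W: "open W" "W \<subseteq> U" for W
 proof -
  define C where "C = E ` (S - W)"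
  have C: "compact C" "C ~= {}"
   using compact_continuous_image[OF continuous_on_subset[OF E Diff_subset] compact_diff[OF S W(1)]] U(3) W(2)
   by (auto simp: C_def)
  \<comment> \<open>Vanishes on the image of the complement of \<open>W\<close> in \<open>S\<close>
    and tends to 1 off that compact image, so that \<open>g n\<close> composed with \<open>E\<close>
    tends to the indicator of \<open>W\<close> on \<open>S\<close>.\<close>
  define g where "g n z = min 1 (real n * infdist z C)" for n z
  have gc: "continuous_on A (g n)" for n A unfolding g_def by (intro continuous_intros)
  define h where "h n x = ind S x * g n (E x)" for n x
  have hm [measurable]: "h n : bmeas" for n
  proof -
   have cg: "continuous_on S (%x. g n (E x))" using gc E by (rule continuous_on_compose2) auto
   show ?thesis using borel_measurable_continuous_on_indicator[OF Sm cg] by (simp add: h_def[abs_def])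
  qed
  have h1: "\<bar>h n x\<bar> <= 1" for n x
  proof -
   have "0 <= g n z" "g n z <= 1" for z by (simp_all add: g_def infdist_nonneg)
   thus ?thesis by (simp add: h_def indicator_def)
  qed
  have hlim: "(%n. h n x) \<longlonglongrightarrow> ind W x" for x
  proof (cases "x : W")
   case True
   have "E x \<notin> C" using True inj W U unfolding C_def by blast
   hence pos: "infdist (E x) C > 0" using C by (metis compact_imp_closed in_closed_iff_infdist_zero infdist_nonneg less_le)
   obtain N where N: "1 / infdist (E x) C < real N" using reals_Archimedean2 by blast
   have "h n x = ind W x" if "n >= N" for n
   proof -
    have "1 / infdist (E x) C < real n" using N that by linarith
    hence "g n (E x) = 1" using pos by (simp add: g_def field_simps min_def)
    thus ?thesis using True W U by (auto simp: h_def)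
   qed
   hence "eventually (%n. h n x = ind W x) sequentially"
    by (auto simp: eventually_sequentially)
   thus ?thesis by (rule tendsto_eventually)
  next
   case False
   hence "g n (E x) = 0" if "x : S" for n using that C by (auto simp: g_def C_def)
   hence "h n x = ind W x" for n using False by (cases "x : S") (auto simp: h_def)
   thus ?thesis by simp
  qed
  have Wm [measurable]: "W : sets borel" using W by simp
  have lim: "(%n. \<integral>x. F x * of_real (h n x) \<partial>lborel) \<longlonglongrightarrow> (LINT x|lborel. F x * of_real (ind W x))"
  proof (rule integral_dominated_convergence[where w="%x. norm (F x)"])
   show "(%x. F x * of_real (ind W x)) : borel_measurable lborel" "(%x. F x * of_real (h n x)) : borel_measurable lborel" for n
    by measurable
   show "integrable lborel (%x. norm (F x))" using F by simp
   show "AE x in lborel. norm (F x * of_real (h n x)) <= norm (F x)" for n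
    using h1[of n] by (simp add: norm_mult mult_left_le)
   show "AE x in lborel. (%n. F x * of_real (h n x)) \<longlonglongrightarrow> F x * of_real (ind W x)"
    by (intro AE_I2 tendsto_mult tendsto_const tendsto_of_real hlim)
  qed
  have "(LINT x|lborel. F x * of_real (h n x)) = 0" for n unfolding h_def by (rule cont[OF gc])
  with lim have "(%n::nat. 0) \<longlonglongrightarrow> (LINT x|lborel. F x * of_real (ind W x))" by simp
  hence "(LINT x|lborel. F x * of_real (ind W x)) = 0" by (simp add: LIMSEQ_const_iff)
  thus ?thesis by (simp add: scaleR_conv_of_real mult.commute)
 qed
 define G where "G x = ind U x *\<^sub>R F x" for x
 have Um [measurable]: "U : sets borel" using U by simp
 have G: "integrable lborel G" unfolding G_def by (rule integrable_mult_indicator[OF _ F]) simp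
 have all: "(LINT x:A|lborel. G x) = 0" if "A : sets borel" for A
 proof -
  have iA: "set_integrable lborel A G" if "A : sets borel" for A
   unfolding set_integrable_def by (rule integrable_mult_indicator[OF _ G]) (use that in simp)
  have op: "(LINT x:A|lborel. G x) = 0" if "open A" for A
   using opn[of "A \<inter> U"] open_Int[OF that U(1)] by (simp add: set_lebesgue_integral_def G_def indicator_inter_arith)
  have "A : sigma_sets UNIV {S. open S}" using that by (simp add: borel_def)
  note memb = this
  have IS: "Int_stable {S::'a set. open S}" by (auto simp: Int_stable_def)
  have sub: "{S::'a set. open S} \<subseteq> Pow UNIV" by simp
  show ?thesis using IS sub memb
  proof (induction rule: sigma_sets_induct_disjoint)
   case (basic A) thus ?case using op by simp
  next
   case empty show ?case by (simp add: set_lebesgue_integral_def)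
  next
   case (compl A)
   hence Am: "A : sets borel" by (simp add: borel_def)
   have "(LINT x:UNIV|lborel. G x) = (LINT x:A \<union> (UNIV - A)|lborel. G x)" by simp
   also have "... = (LINT x:A|lborel. G x) + (LINT x:UNIV - A|lborel. G x)"
    by (rule set_integral_Un) (use iA Am in auto)
   finally show ?case using compl op[of UNIV] by simp
  next
   case (union A)
   hence Am: "A i : sets borel" for i by (auto simp: borel_def)
   have "(LINT x:(\<Union>i. A i)|lborel. G x) = (\<Sum>i. (LINT x:(A i)|lborel. G x))"
    using union Am iA by (intro lebesgue_integral_countable_add) (auto simp: disjoint_family_on_def)
   thus ?case using union by simp
  qed
 qed
 have "AE x in lborel. Re (G x) = 0"
 proof (rule AE_zero_of_integrals)
  show "integrable lborel (%x. Re (G x))" using G by simp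
  fix A assume A: "A : sets (lborel::'a measure)"
  have "(LINT x|lborel. ind A x * Re (G x)) = (LINT x|lborel. Re (ind A x *\<^sub>R G x))" by simp
  also have "... = Re (LINT x|lborel. ind A x *\<^sub>R G x)" by (rule integral_Re, rule integrable_mult_indicator[OF A G])
  finally show "(LINT x|lborel. ind A x * Re (G x)) = 0" using all[of A] A by (simp add: set_lebesgue_integral_def)
 qed
 moreover have "AE x in lborel. Im (G x) = 0"
 proof (rule AE_zero_of_integrals)
  show "integrable lborel (%x. Im (G x))" using G by simp
  fix A assume A: "A : sets (lborel::'a measure)"
  have "(LINT x|lborel. ind A x * Im (G x)) = (LINT x|lborel. Im (ind A x *\<^sub>R G x))" by simp
  also have "... = Im (LINT x|lborel. ind A x *\<^sub>R G x)" by (rule integral_Im, rule integrable_mult_indicator[OF A G])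
  finally show "(LINT x|lborel. ind A x * Im (G x)) = 0" using all[of A] A by (simp add: set_lebesgue_integral_def)
 qed
 ultimately show ?thesis by eventually_elim (use U in \<open>auto simp: G_def F_def complex_eq_iff\<close>)
qed

lemma borel_measurable_cnj [measurable (raw)]:
 "f : borel_measurable M ==> (%x. cnj (f x)) : borel_measurable M"
 by (rule measurable_compose[OF _ borel_measurable_continuous_onI]) (auto intro: continuous_intros)

lemma borel_measurable_cis [measurable (raw)]:
 "f : borel_measurable M ==> (%x. cis (f x)) : borel_measurable M"
 by (rule measurable_compose[OF _ borel_measurable_continuous_onI]) (auto intro: continuous_intros)

section \<open>Bessel's inequality\<close>

lemma nn_integral_count_space_le:
 fixes f :: "'i::countable => ennreal"
 assumes "!!F. finite F ==> (\<Sum>i\<in>F. f i) <= B"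
 shows "(SU i. f i) <= B"
proof -
 define g where "g n = f (from_nat n) * ind (range (to_nat :: 'i => nat)) n" for n
 have "(SU i. f i) = (SU i. f (from_nat (to_nat (i::'i))) * ind UNIV i)" by simp
 also have "... = (SU i. g (to_nat (i::'i)) * ind UNIV i)" by (simp add: g_def)
 also have "... <= (SU n. g n)" by (rule nn_integral_count_inj_le) simp
 also have "... = (\<Sum>n. g n)" by (rule nn_integral_count_space_nat)
 also have "... = (SUP n. \<Sum>i<n. g i)" by (rule suminf_eq_SUP)
 also have "... <= B"
 proof (rule SUP_least)
  fix n
  define F where "F = {n'. n' < n & n' : range (to_nat :: 'i => nat)}"
  have "(\<Sum>i<n. g i) = (\<Sum>i\<in>F. f (from_nat i))"
   unfolding g_def F_def by (rule sum.mono_neutral_cong_right) (auto simp: indicator_def)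
  also have "... = (\<Sum>i\<in>from_nat ` F. f i)" 
   by (subst sum.reindex) (auto simp: inj_on_def F_def)
  also have "... <= B" by (rule assms) (simp add: F_def)
  finally show "(\<Sum>i<n. g i) <= B" .
 qed
 finally show ?thesis .
qed

lemma integrable_of_L2:
 fixes f :: "'a => complex"
 assumes "finite_measure M" and [measurable]: "f : borel_measurable M" and fin: "(NN M (%x. sqn (f x))) < \<infinity>"
 shows "integrable M f" "integrable M (%x. (cmod (f x))^2)"
proof -
 interpret finite_measure M by fact
 show i2: "integrable M (%x. (cmod (f x))^2)" by (rule integrableI_bounded) (use fin in auto)
 show "integrable M f"
 proof (rule bintegrable_bound)
  show "integrable M (%x. 1 + (cmod (f x))^2)" using i2 by simp
  have "cmod (f x) <= 1 + (cmod (f x))^2" for x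
   using zero_le_power2[of "cmod (f x) - 1"] unfolding power2_diff by (simp add: power2_eq_square) (smt (verit) norm_ge_zero zero_le_square)
  thus "AE x in M. norm (f x) <= norm (1 + (cmod (f x))^2)" by (simp add: abs_of_nonneg)
 qed simp
qed

text \<open>The common squared norm \<open>L\<close> of the family is left open, which covers the
  unit square (\<open>L = 1\<close>) as well as intervals of time. The inequality is the
  nonnegativity of the distance from \<open>f\<close> to its projection \<open>g\<close>.\<close>

lemma bessel_finite:
 fixes e :: "'i => 'a => complex"
 assumes M: "finite_measure M" and [measurable]: "f : borel_measurable M" "!!i. e i : borel_measurable M"
  and e1: "!!i x. cmod (e i x) <= 1" and L: "L > 0"
  and orth: "!!i j. (LINT x|M. e i x * cnj (e j x)) = (if i = j then of_real L else 0)"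
  and F: "finite F"
 shows "(\<Sum>i\<in>F. sqn (LINT x|M. f x * cnj (e i x))) <= ennreal L * (NN M (%x. sqn (f x)))"
proof (cases "(NN M (%x. sqn (f x))) < \<infinity>")
 case False
 hence "(NN M (%x. sqn (f x))) = \<infinity>" by (simp add: less_top[symmetric])
 thus ?thesis using L by (simp add: ennreal_mult_top)
next
 case True
 interpret finite_measure M by (rule M)
 note int = integrable_of_L2[OF M _ True]
 have intf: "integrable M f" and int2: "integrable M (%x. (cmod (f x))^2)" using int by auto
 have fe: "integrable M (%x. f x * cnj (e i x))" for i
  by (rule bintegrable_bound[OF intf]) (auto simp: norm_mult e1 mult_left_le)
 have ee: "integrable M (%x. e i x * cnj (e j x))" for i j
  by (rule integrable_const_bound[where B=1]) (auto simp: norm_mult e1 mult_le_one)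
 define c where "c i = (LINT x|M. f x * cnj (e i x))" for i
 define g where "g x = (\<Sum>i\<in>F. (c i / L) * e i x)" for x
 have fg: "f x * cnj (g x) = (\<Sum>i\<in>F. cnj (c i / L) * (f x * cnj (e i x)))" for x
  by (simp add: g_def sum_distrib_left mult_ac)
 have gg: "g x * cnj (g x) = (\<Sum>i\<in>F. \<Sum>j\<in>F. (c i / L) * cnj (c j / L) * (e i x * cnj (e j x)))" for x
  by (simp add: g_def sum_product mult_ac)
 have ifg: "integrable M (%x. f x * cnj (g x))" unfolding fg by (auto intro!: Bochner_Integration.integrable_sum integrable_mult_right fe)
 have igg: "integrable M (%x. g x * cnj (g x))" unfolding gg by (auto intro!: Bochner_Integration.integrable_sum integrable_mult_right ee)
 define T where "T = (\<Sum>i\<in>F. (cmod (c i))^2)"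
 have Ifg: "(LINT x|M. f x * cnj (g x)) = of_real (T / L)"
 proof -
  have "(LINT x|M. f x * cnj (g x)) = (\<Sum>i\<in>F. cnj (c i / L) * c i)"
   unfolding fg c_def by (subst Bochner_Integration.integral_sum) (use fe in auto)
  also have "... = (\<Sum>i\<in>F. of_real ((cmod (c i))^2 / L))"
   by (rule sum.cong) (auto simp: complex_norm_square mult.commute simp del: of_real_power)
  finally show ?thesis by (simp add: T_def sum_divide_distrib)
 qed
 have Igg: "(LINT x|M. g x * cnj (g x)) = of_real (T / L)"
 proof -
  have "(LINT x|M. g x * cnj (g x)) = (\<Sum>i\<in>F. \<Sum>j\<in>F. (c i / L) * cnj (c j / L) * (if i = j then of_real L else 0))"
   unfolding gg by (subst Bochner_Integration.integral_sum) (use ee in \<open>auto intro!: sum.cong simp: Bochner_Integration.integral_sum orth\<close>)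
  also have "... = (\<Sum>i\<in>F. of_real ((cmod (c i))^2 / L))"
   using F L by (intro sum.cong refl) (simp add: if_distrib complex_norm_square field_simps cong: if_cong del: of_real_power)
  finally show ?thesis by (simp add: T_def sum_divide_distrib)
 qed
 have "0 <= (LINT x|M. (cmod (f x - g x))^2)" by simp
 also have "(%x. (cmod (f x - g x))^2) = (%x. (cmod (f x))^2 - 2 * Re (f x * cnj (g x)) + Re (g x * cnj (g x)))"
  unfolding cmod_power2 by (rule ext) (simp add: power2_eq_square algebra_simps)
 also have "(LINT x|M. (cmod (f x))^2 - 2 * Re (f x * cnj (g x)) + Re (g x * cnj (g x))) = (LINT x|M. (cmod (f x))^2) - 2 * (T / L) + T / L"
 proof -
  have iB: "integrable M (%x. 2 * Re (f x * cnj (g x)))" "integrable M (%x. Re (g x * cnj (g x)))"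
   using ifg igg by (auto simp del: times_complex.sel)
  have "(LINT x|M. (cmod (f x))^2 - 2 * Re (f x * cnj (g x)) + Re (g x * cnj (g x))) =
   (LINT x|M. (cmod (f x))^2) - (LINT x|M. 2 * Re (f x * cnj (g x))) + (LINT x|M. Re (g x * cnj (g x)))"
   by (simp only: bintegral_add[OF bintegrable_diff[OF int2 iB(1)] iB(2)] bintegral_diff[OF int2 iB(1)])
  also have "(LINT x|M. 2 * Re (f x * cnj (g x))) = 2 * (T / L)"
   by (simp only: integral_mult_right_zero integral_Re[OF ifg] Ifg Re_complex_of_real)
  also have "(LINT x|M. Re (g x * cnj (g x))) = T / L"
   by (simp only: integral_Re[OF igg] Igg Re_complex_of_real)
  finally show ?thesis .
 qed
 finally have "T <= L * (LINT x|M. (cmod (f x))^2)" using L by (simp add: field_simps)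
 hence "ennreal T <= ennreal L * ennreal (LINT x|M. (cmod (f x))^2)" using L by (simp add: ennreal_mult[symmetric] ennreal_leI)
 also have "ennreal (LINT x|M. (cmod (f x))^2) = (NN M (%x. sqn (f x)))" by (rule nn_integral_eq_integral[OF int2, symmetric]) simp
 finally show ?thesis by (simp add: T_def c_def sum_ennreal)
qed

lemma bessel:
 fixes e :: "'i::countable => 'a => complex"
 assumes "finite_measure M" "f : borel_measurable M" "!!i. e i : borel_measurable M"
  "!!i x. cmod (e i x) <= 1" "L > 0"
  "!!i j. (LINT x|M. e i x * cnj (e j x)) = (if i = j then of_real L else 0)"
 shows "(SU i. sqn (LINT x|M. f x * cnj (e i x))) <= ennreal L * (NN M (%x. sqn (f x)))"
 by (intro nn_integral_count_space_le bessel_finite assms)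

lemma integral_cis_linear:
 assumes "a <= b" "c ~= 0"
 shows "(LINT x|lborel. ind {a..b} x *\<^sub>R cis (c * x)) = (cis (c * b) - cis (c * a)) / (\<i> * of_real c)"
proof -
 have "(LINT x|lborel. ind {a..b} x *\<^sub>R cis (c * x)) = cis (c * b) / (\<i> * of_real c) - cis (c * a) / (\<i> * of_real c)"
 proof (rule integral_FTC_Icc[OF assms(1)])
  fix x
  have "((%x. cis (c * x) / (\<i> * of_real c)) has_vector_derivative (c *\<^sub>R (\<i> * cis (c * x))) / (\<i> * of_real c)) (at x)"
   unfolding cis_conv_exp
   by (auto intro!: derivative_eq_intros has_vector_derivative_real_field simp: assms scaleR_conv_of_real field_simps)
  thus "((%x. cis (c * x) / (\<i> * of_real c)) has_vector_derivative cis (c * x)) (at x within {a..b})"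
   using assms(2) by (simp add: scaleR_conv_of_real has_vector_derivative_at_within)
 qed (intro continuous_intros)
 thus ?thesis by (simp add: diff_divide_distrib)
qed

section \<open>Fourier synthesis on the torus\<close>

definition ek :: "lat => real \<times> real => complex" where
 "ek k x = cis (2 * pi * (of_int (fst k) * fst x + of_int (snd k) * snd x))"

text \<open>A density on the whole plane rather than a restricted space: measurability stays that of
  \<open>borel\<close>, and integrands may be evaluated at shifted points outside the
  square.\<close>

definition sqM :: "(real \<times> real) measure" where
 "sqM = density lborel (%x. ennreal (ind unit_sq x))"

abbreviation IntQ :: "(real \<times> real => ennreal) => ennreal" (binder "IQ " 10) where "IntQ f == nn_integral sqM f"

lemma sets_sqM [simp, measurable_cong]: "sets sqM = sets borel" by (simp add: sqM_def)

lemma measurable_sqM [simp]: "measurable sqM N = measurable borel N"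
 by (rule measurable_cong_sets) auto

lemma space_sqM [simp]: "space sqM = UNIV" by (simp add: sqM_def)

text \<open>The squared Sobolev norm of a coefficient sequence, with extended values so that
  summability may be a consequence of an estimate instead of its hypothesis.\<close>

definition En :: "real => (lat => complex) => ennreal" where
 "En s a = (SZ k. ennreal (wt s k * (cmod (a k))^2))"

lemma Hs_energy_En: "Hs_energy s f = En s (fcoef f)"
 by (simp add: Hs_energy_def En_def wt_def)

lemma ek_add: "ek (k + l) x = ek k x * ek l x"
 by (simp add: ek_def cis_mult algebra_simps)

lemma ek_zero [simp]: "ek 0 x = 1" by (simp add: ek_def)

lemma cmod_ek [simp]: "cmod (ek k x) = 1" by (simp add: ek_def)

lemma cnj_ek: "cnj (ek k x) = ek (- k) x"
 by (simp add: ek_def cis_cnj algebra_simps)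

lemma ek_shift: "ek k (x + h) = ek k x * ek k h"
 by (simp add: ek_def cis_mult algebra_simps)

lemma ek_measurable [measurable]: "ek k : bmeas"
 unfolding ek_def by (intro borel_measurable_continuous_onI continuous_intros)

lemma ek_measurable' [measurable (raw)]: "f : borel_measurable M ==> (%x. ek k (f x)) : borel_measurable M"
 by (rule measurable_compose[OF _ ek_measurable])

lemma unit_sq_cbox: "unit_sq = cbox (0,0) (1,1)" by (auto simp: unit_sq_def cbox_Pair_eq)

lemma unit_sq_borel [measurable, simp]: "unit_sq : sets borel" by (simp add: unit_sq_cbox)

lemma emeasure_unit_sq: "emeasure lborel unit_sq = 1"
 unfolding unit_sq_cbox by (subst emeasure_lborel_cbox) (auto simp: Basis_prod_def)

lemma emeasure_sqM: "emeasure sqM UNIV = 1"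
 by (simp add: sqM_def emeasure_density emeasure_unit_sq ennreal_indicator)

lemma finite_sqM: "finite_measure sqM"
 by (rule finite_measureI) (simp add: emeasure_sqM)

lemma integral_sqM: "f : bmeas ==> integral\<^sup>L sqM f = (LINT x:unit_sq|lborel. f x)" for f :: "_ => complex"
 unfolding sqM_def set_lebesgue_integral_def by (rule integral_density) auto

lemma nn_integral_sqM: "f : bmeas ==> integral\<^sup>N sqM f = (IL x. f x * ind unit_sq x)"
 unfolding sqM_def by (subst nn_integral_density) (auto intro!: nn_integral_cong simp: indicator_def)

lemma integrable_sqM: "f : bmeas ==> integrable sqM f \<longleftrightarrow> set_integrable lborel unit_sq f" for f :: "_ => 'b::{banach,second_countable_topology}"
 unfolding sqM_def set_integrable_def by (rule integrable_density) auto

lemma AE_sqM: "(AE x in sqM. P x) \<longleftrightarrow> (AE x in lborel. x : unit_sq --> P x)"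
 unfolding sqM_def by (subst AE_density) (auto simp: indicator_def)

lemma fcoef_sqM: "f : bmeas ==> fcoef f k = (LINT x|sqM. f x * ek (- k) x)"
proof -
 assume [measurable]: "f : bmeas"
 have "(%x. f x * ek (- k) x) : bmeas" by measurable
 from integral_sqM[OF this] show ?thesis by (simp add: fcoef_def ek_def algebra_simps)
qed

lemma integral_ek: "(LINT x|sqM. ek k x) = (if k = 0 then 1 else 0)"
proof -
 have one: "(LINT x|lborel. ind {0..1} x *\<^sub>R cis (2 * pi * of_int n * x)) = (if n = 0 then 1 else 0)" for n :: int
 proof (cases "n = 0")
  case False
  have "cis (2 * pi * of_int n) = 1" by simp
  thus ?thesis using False by (subst integral_cis_linear) auto
 qed simp
 have i: "integrable lborel (%x. ind unit_sq x *\<^sub>R ek k x)"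
 proof -
  interpret finite_measure sqM by (rule finite_sqM)
  have "integrable sqM (ek k)" by (rule integrable_const_bound[where B=1]) auto
  thus ?thesis by (simp add: integrable_sqM set_integrable_def)
 qed
 define f where "f x = ind unit_sq x *\<^sub>R ek k x" for x
 have f: "f (x, y) = (ind {0..1} x *\<^sub>R cis (2 * pi * of_int (fst k) * x)) * (ind {0..1} y *\<^sub>R cis (2 * pi * of_int (snd k) * y))" for x y
  by (simp add: f_def unit_sq_def ek_def indicator_def cis_mult algebra_simps)
 have "(LINT x|sqM. ek k x) = integral\<^sup>L lborel f" by (simp add: integral_sqM set_lebesgue_integral_def f_def[abs_def])
 also have "... = (LINT x|lborel. (LINT y|lborel. f (x, y)))"
  using i by (subst lborel_pair.integral_fst') (auto simp: lborel_prod f_def[abs_def])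
 also have "... = (if fst k = 0 then 1 else 0) * (if snd k = 0 then 1 else 0)"
  unfolding f by (simp only: integral_mult_right_zero integral_mult_left_zero one)
 finally show ?thesis by (simp add: prod_eq_iff)
qed

lemma ek_orthonormal: "(LINT x|sqM. ek k x * cnj (ek l x)) = (if k = l then of_real 1 else 0)"
proof -
 have "ek k x * cnj (ek l x) = ek (k - l) x" for x by (simp add: cnj_ek ek_add[symmetric])
 thus ?thesis by (simp add: integral_ek)
qed

lemma bessel_sq:
 assumes "f : bmeas"
 shows "(SZ k. sqn (fcoef f k)) <= (IQ x. sqn (f x))"
proof -
 have "(SZ k. sqn (LINT x|sqM. f x * cnj (ek k x))) <= ennreal 1 * (IQ x. sqn (f x))"
  by (rule bessel[OF finite_sqM]) (use assms ek_orthonormal in auto)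
 thus ?thesis using assms by (simp add: fcoef_sqM cnj_ek)
qed

lemma fcoef_bound:
 assumes "f : bmeas"
 shows "sqn (fcoef f k) <= (IQ x. sqn (f x))"
proof -
 have "(\<Sum>k\<in>{k}. sqn (LINT x|sqM. f x * cnj (ek k x))) <= ennreal 1 * (IQ x. sqn (f x))"
  by (rule bessel_finite[OF finite_sqM]) (use assms ek_orthonormal in auto)
 thus ?thesis using assms by (simp add: fcoef_sqM cnj_ek)
qed

lemma parseval_finite:
 fixes e :: "'i => 'a => complex"
 assumes M: "finite_measure M" and [measurable]: "!!i. e i : borel_measurable M"
  and e1: "!!i x. cmod (e i x) <= 1"
  and orth: "!!i j. (LINT x|M. e i x * cnj (e j x)) = (if i = j then of_real L else 0)"
  and F: "finite F"
 shows "(NN M (%x. sqn (\<Sum>k\<in>F. a k * e k x))) = ennreal (L * (\<Sum>k\<in>F. (cmod (a k))^2))"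
proof -
 interpret finite_measure M by (rule M)
 define g where "g x = (\<Sum>k\<in>F. a k * e k x)" for x
 have gm [measurable]: "g : borel_measurable M" unfolding g_def by measurable
 have gb: "cmod (g x) <= (\<Sum>k\<in>F. cmod (a k))" for x
  unfolding g_def by (rule order_trans[OF norm_sum]) (auto simp: norm_mult e1 mult_left_le intro!: sum_mono)
 have i2: "integrable M (%x. (cmod (g x))^2)"
  by (rule integrable_const_bound[where B="(\<Sum>k\<in>F. cmod (a k))^2"]) (auto intro!: power_mono gb)
 have ee: "integrable M (%x. e i x * cnj (e j x))" for i j
  by (rule integrable_const_bound[where B=1]) (auto simp: norm_mult e1 mult_le_one)
 have gg: "g x * cnj (g x) = (\<Sum>i\<in>F. \<Sum>j\<in>F. a i * cnj (a j) * (e i x * cnj (e j x)))" for x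
  by (simp add: g_def sum_product mult_ac)
 have "of_real (LINT x|M. (cmod (g x))^2) = (LINT x|M. g x * cnj (g x))"
  unfolding complex_norm_square[symmetric] by (rule integral_complex_of_real[symmetric])
 also have "... = (\<Sum>i\<in>F. \<Sum>j\<in>F. a i * cnj (a j) * (if i = j then of_real L else 0))"
  unfolding gg by (subst Bochner_Integration.integral_sum) (use ee in \<open>auto intro!: sum.cong simp: Bochner_Integration.integral_sum orth\<close>)
 also have "... = (\<Sum>i\<in>F. of_real ((cmod (a i))^2 * L))"
  using F by (intro sum.cong refl) (simp add: if_distrib complex_norm_square cong: if_cong del: of_real_power)
 also have "... = of_real (L * (\<Sum>i\<in>F. (cmod (a i))^2))" by (simp add: sum_distrib_left mult.commute)
 finally have "(LINT x|M. (cmod (g x))^2) = L * (\<Sum>i\<in>F. (cmod (a i))^2)" by (simp only: of_real_eq_iff)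
 thus ?thesis using nn_integral_eq_integral[OF i2] by (simp add: g_def)
qed

lemma parseval_fin:
 assumes F: "finite F"
 shows "(IQ x. sqn (\<Sum>k\<in>F. a k * ek k x)) = ennreal (\<Sum>k\<in>F. (cmod (a k))^2)"
 using parseval_finite[OF finite_sqM _ _ ek_orthonormal F] by simp

lemma fcoef_diff:
 assumes "integrable sqM f" "integrable sqM g"
 shows "fcoef (%x. f x - g x) k = fcoef f k - fcoef g k"
proof -
 have "integrable sqM (%x. h x * ek (- k) x)" if "integrable sqM h" for h
  by (rule bintegrable_bound[OF that]) (use that in \<open>auto simp: norm_mult\<close>)
 moreover have "f : bmeas" "g : bmeas" using borel_measurable_integrable[OF assms(1)] borel_measurable_integrable[OF assms(2)] by auto
 ultimately show ?thesis using assms by (simp add: fcoef_sqM left_diff_distrib bintegral_diff)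
qed

lemma fcoef_cong_AE:
 assumes "AE x in sqM. f x = g x" "f : bmeas" "g : bmeas"
 shows "fcoef f k = fcoef g k"
 unfolding fcoef_sqM[OF assms(2)] fcoef_sqM[OF assms(3)] by (rule integral_cong_AE) (use assms in \<open>auto elim: eventually_mono\<close>)

lemma fcoef_trig:
 assumes "finite F" shows "fcoef (%x. \<Sum>k\<in>F. a k * ek k x) l = (if l : F then a l else 0)"
proof -
 interpret finite_measure sqM by (rule finite_sqM)
 have i: "integrable sqM (ek k)" for k by (rule integrable_const_bound[where B=1]) auto
 have "fcoef (%x. \<Sum>k\<in>F. a k * ek k x) l = (LINT x|sqM. (\<Sum>k\<in>F. a k * ek (k - l) x))"
  by (simp add: fcoef_sqM sum_distrib_right mult.assoc ek_add[symmetric])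
 also have "... = (\<Sum>k\<in>F. a k * (if k = l then 1 else 0))"
  by (subst Bochner_Integration.integral_sum) (use i in \<open>auto simp: integral_ek\<close>)
 also have "... = (if l : F then a l else 0)" using assms by (simp add: if_distrib cong: if_cong)
 finally show ?thesis .
qed

section \<open>Dyadic pieces and functions synthesised from coefficients\<close>

definition Pj :: "(lat => complex) => nat => real \<times> real => complex" where
 "Pj a j x = (\<Sum>k\<in>blk j. a k * ek k x)"

text \<open>A pointwise representative of the function with coefficients \<open>a\<close>. Summation
  by blocks makes it periodic, and jointly measurable in coefficients and point, by construction;
  for \<open>s > 0\<close> and finite energy the series converges absolutely almost
  everywhere.\<close>

definition syn :: "(lat => complex) => real \<times> real => complex" where
 "syn a x = (\<Sum>j. Pj a j x)"

definition BJ :: "nat => (lat) set" where "BJ J = (\<Union>j<J. blk j)"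

lemma Pj_measurable [measurable (raw)]:
 assumes [measurable]: "!!k. (%y. c y k) : borel_measurable M" "g : borel_measurable M"
 shows "(%y. Pj (c y) j (g y)) : borel_measurable M"
 unfolding Pj_def by measurable

lemma syn_measurable [measurable (raw)]:
 assumes [measurable]: "!!k. (%y. c y k) : borel_measurable M" "g : borel_measurable M"
 shows "(%y. syn (c y) (g y)) : borel_measurable M"
 unfolding syn_def by measurable

lemma finite_BJ [simp]: "finite (BJ J)" by (simp add: BJ_def)

lemma sum_Pj: "(\<Sum>j<J. Pj a j x) = (\<Sum>k\<in>BJ J. a k * ek k x)"
 unfolding Pj_def BJ_def by (subst sum.UNION_disjoint) (auto dest: blk_unique)

lemma mem_BJ_eventually: "eventually (%J. k : BJ J) sequentially"
proof -
 obtain j where "k : blk j" using blk_cover by blast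
 thus ?thesis unfolding eventually_sequentially BJ_def by (intro exI[of _ "Suc j"]) (auto simp: Suc_le_eq)
qed

lemma Pj_shift: "Pj a j (x + h) = Pj (%k. ek k h * a k) j x"
 by (simp add: Pj_def ek_shift mult_ac)

lemma syn_shift: "syn a (x + h) = syn (%k. ek k h * a k) x"
 by (simp add: syn_def Pj_shift)

lemma En_blk_sum: "En s a = (\<Sum>j. \<integral>\<^sup>+k. ennreal (wt s k * (cmod (a k))^2) * ind (blk j) k \<partial>CZ)"
proof -
 have "En s a = (SZ k. (\<Sum>j. ennreal (wt s k * (cmod (a k))^2) * ind (blk j) k))"
  unfolding En_def by (intro nn_integral_cong) (simp add: ennreal_suminf_cmult blk_sums_indicator)
 also have "... = (\<Sum>j. \<integral>\<^sup>+k. ennreal (wt s k * (cmod (a k))^2) * ind (blk j) k \<partial>CZ)"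
  by (rule nn_integral_suminf) simp
 finally show ?thesis .
qed

lemma nn_integral_blk: "(SZ k. ennreal (f k) * ind (blk j) k) = ennreal (\<Sum>k\<in>blk j. f k)" if "!!k. f k >= 0"
 by (subst nn_integral_count_space'[of "blk j"]) (use that in \<open>auto simp: indicator_def sum_ennreal\<close>)

lemma dominated_tail:
 fixes p :: "nat => complex"
 assumes r: "0 < r" "r < 1" and b: "!!j. cmod (p j) <= b * r ^ j"
 shows "summable (%j. cmod (p j))" "cmod (suminf p - (\<Sum>j<J. p j)) <= b * r ^ J / (1 - r)"
proof -
 have sg: "summable (%j. b * r ^ j)" using r by (intro summable_mult summable_geometric) auto
 show sn: "summable (%j. cmod (p j))" by (rule summable_comparison_test'[OF sg, of 0]) (use b in simp)
 have sp: "summable p" by (rule summable_norm_cancel[OF sn])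
 have sh: "summable (%i. cmod (p (i + J)))" using sn summable_iff_shift[of "%j. cmod (p j)" J] by simp
 have sgJ: "summable (%i. b * r ^ (i + J))" using sg summable_iff_shift[of "%j. b * r ^ j" J] by simp
 have "suminf p - (\<Sum>j<J. p j) = (\<Sum>i. p (i + J))" using suminf_minus_initial_segment[OF sp] by simp
 also have "cmod ... <= (\<Sum>i. cmod (p (i + J)))" by (rule summable_norm[OF sh])
 also have "... <= (\<Sum>i. b * r ^ (i + J))" by (rule suminf_le[OF _ sh sgJ]) (use b in simp)
 also have "... = (\<Sum>i. (b * r ^ J) * r ^ i)" by (simp add: power_add mult_ac)
 also have "... = b * r ^ J / (1 - r)" using r by (subst suminf_mult) (auto simp: suminf_geometric summable_geometric)
 finally show "cmod (suminf p - (\<Sum>j<J. p j)) <= b * r ^ J / (1 - r)" .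
qed

text \<open>The weighted square function \<open>B\<close> has integral at most
  \<open>En s a\<close>. Where it is finite, the blocks are dominated by a geometric series of ratio
  \<open>r = 4 powr (-s/2)\<close>; this yields convergence and a rate for the tail in
  \<open>L^2\<close> at once, and is where \<open>s > 0\<close> enters.\<close>

lemma syn_AE_L2:
 assumes s: "s > 0" and fin: "En s a < \<infinity>"
 shows "AE x in sqM. summable (%j. cmod (Pj a j x))"
  and "(IQ x. sqn (syn a x - (\<Sum>j<J. Pj a j x))) <= ennreal (((4 powr (-s/2))^J / (1 - 4 powr (-s/2)))^2) * En s a"
proof -
 define r where "r = 4 powr (-s/2)"
 have r: "0 < r" "r < 1" using s by (auto simp: r_def powr_less_one)
 have rq: "r^2 * 4 powr s = 1" 
 proof -
  have "r^2 = 4 powr (- s)" by (simp add: r_def power2_eq_square powr_add[symmetric])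
  thus ?thesis by (simp add: powr_add[symmetric])
 qed
 define B where "B x = (\<Sum>j. ennreal ((4 powr s) ^ j * (cmod (Pj a j x))^2))" for x
 have Bm [measurable]: "B : bmeas" unfolding B_def by measurable
 have "(IQ x. B x) = (\<Sum>j. \<integral>\<^sup>+x. ennreal ((4 powr s) ^ j * (cmod (Pj a j x))^2) \<partial>sqM)"
  unfolding B_def by (rule nn_integral_suminf) measurable
 also have "... <= (\<Sum>j. \<integral>\<^sup>+k. ennreal (wt s k * (cmod (a k))^2) * ind (blk j) k \<partial>CZ)"
 proof (rule suminf_le)
  fix j
  have "(IQ x. ennreal ((4 powr s) ^ j * (cmod (Pj a j x))^2)) = ennreal ((4 powr s) ^ j) * ennreal (\<Sum>k\<in>blk j. (cmod (a k))^2)"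
   by (subst parseval_fin[OF finite_blk, symmetric]) (simp add: Pj_def ennreal_mult nn_integral_cmult)
  also have "... = ennreal (\<Sum>k\<in>blk j. (4 powr s) ^ j * (cmod (a k))^2)"
   by (simp add: ennreal_mult[symmetric] sum_nonneg sum_distrib_left)
  also have "... <= ennreal (\<Sum>k\<in>blk j. wt s k * (cmod (a k))^2)"
   using s by (intro ennreal_leI sum_mono mult_right_mono wt_blk_ge) auto
  finally show "(IQ x. ennreal ((4 powr s) ^ j * (cmod (Pj a j x))^2)) <= (SZ k. ennreal (wt s k * (cmod (a k))^2) * ind (blk j) k)"
   by (subst nn_integral_blk) auto
 qed auto
 also have "... = En s a" by (rule En_blk_sum[symmetric])
 finally have IB: "(IQ x. B x) <= En s a" .
 hence "(IQ x. B x) ~= \<infinity>" using fin by auto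
 hence AEB: "AE x in sqM. B x ~= \<infinity>" by (intro nn_integral_PInf_AE) auto
 have pt: "summable (%j. cmod (Pj a j x)) & sqn (syn a x - (\<Sum>j<J. Pj a j x)) <= ennreal ((r^J / (1 - r))^2) * B x"
  if Bx: "B x ~= \<infinity>" for x J
 proof -
  obtain b where b: "B x = ennreal b" "b >= 0" using Bx by (cases "B x") auto
  have bd: "cmod (Pj a j x) <= sqrt b * r ^ j" for j
  proof -
   have "sum (%j. ennreal ((4 powr s) ^ j * (cmod (Pj a j x))^2)) {j} <= B x" unfolding B_def by (rule sum_le_suminf) auto
   hence "(4 powr s) ^ j * (cmod (Pj a j x))^2 <= b" using b by simp
   hence "(r^2)^j * ((4 powr s) ^ j * (cmod (Pj a j x))^2) <= (r^2)^j * b" by (rule mult_left_mono) simp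
   hence "(r^2 * 4 powr s)^j * (cmod (Pj a j x))^2 <= (r^j)^2 * b"
    by (simp add: power_mult_distrib power_mult[symmetric] mult.commute mult.left_commute)
   hence "(cmod (Pj a j x))^2 <= (sqrt b * r ^ j)^2" using rq b by (simp add: power_mult_distrib mult.commute)
   thus ?thesis by (rule power2_le_imp_le) (use b r in simp)
  qed
  note dt = dominated_tail[OF r bd]
  have "(cmod (syn a x - (\<Sum>j<J. Pj a j x)))^2 <= (sqrt b * r ^ J / (1 - r))^2"
   using dt(2)[of J] by (intro power_mono) (auto simp: syn_def)
  also have "... = (r^J / (1 - r))^2 * b" using b by (simp add: power_mult_distrib power_divide mult.commute)
  finally show ?thesis using dt(1) b by (simp add: ennreal_mult[symmetric] ennreal_leI)
 qed
 show "AE x in sqM. summable (%j. cmod (Pj a j x))" using AEB pt by (auto elim: eventually_mono)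
 have "(IQ x. sqn (syn a x - (\<Sum>j<J. Pj a j x))) <= (IQ x. ennreal ((r^J / (1 - r))^2) * B x)"
  by (intro nn_integral_mono_AE) (use AEB pt in \<open>auto elim: eventually_mono\<close>)
 also have "... = ennreal ((r^J / (1 - r))^2) * (IQ x. B x)" by (rule nn_integral_cmult) simp
 also have "... <= ennreal ((r^J / (1 - r))^2) * En s a" by (intro mult_left_mono IB) simp
 finally show "(IQ x. sqn (syn a x - (\<Sum>j<J. Pj a j x))) <= ennreal (((4 powr (-s/2))^J / (1 - 4 powr (-s/2)))^2) * En s a"
  unfolding r_def .
qed

definition L2 :: "(real \<times> real => complex) => bool" where
 "L2 f \<longleftrightarrow> f : bmeas & (IQ x. sqn (f x)) < \<infinity>"

lemma L2_integrable:
 assumes "L2 f" shows "integrable sqM f" "integrable sqM (%x. (cmod (f x))^2)"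
proof -
 have f: "f : borel_measurable sqM" "(IQ x. sqn (f x)) < \<infinity>" using assms by (simp_all add: L2_def)
 show "integrable sqM f" "integrable sqM (%x. (cmod (f x))^2)" by (rule integrable_of_L2[OF finite_sqM f])+
qed

lemma L2_syn: assumes "s > 0" "En s a < \<infinity>" shows "L2 (syn a)"
proof -
 have "(IQ x. sqn (syn a x)) <= ennreal ((1 / (1 - 4 powr (-s/2)))^2) * En s a"
  using syn_AE_L2(2)[OF assms, of 0] by simp
 also have "... < \<infinity>" using assms by (simp add: ennreal_mult_less_top)
 finally show ?thesis by (simp add: L2_def)
qed

lemma L2_diff: assumes "L2 f" "L2 g" shows "L2 (%x. f x - g x)"
proof -
 have [measurable]: "f : bmeas" "g : bmeas" using assms by (auto simp: L2_def)
 have *: "(cmod (f x - g x))^2 <= 2 * (cmod (f x))^2 + 2 * (cmod (g x))^2" for x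
 proof -
  have "(cmod (f x - g x))^2 <= (cmod (f x) + cmod (g x))^2" by (intro power_mono norm_triangle_ineq4) auto
  also have "... <= 2 * (cmod (f x))^2 + 2 * (cmod (g x))^2"
   using zero_le_power2[of "cmod (f x) - cmod (g x)"] unfolding power2_sum power2_diff by linarith
  finally show ?thesis .
 qed
 have "(IQ x. sqn (f x - g x)) <= (IQ x. 2 * sqn (f x) + 2 * sqn (g x))"
  using * by (intro nn_integral_mono) (simp add: ennreal_mult[symmetric] ennreal_plus[symmetric] ennreal_leI flip: ennreal_numeral del: ennreal_plus)
 also have "... = 2 * (IQ x. sqn (f x)) + 2 * (IQ x. sqn (g x))"
  by (simp add: nn_integral_add nn_integral_cmult)
 also have "... < \<infinity>" using assms by (simp add: L2_def ennreal_mult_less_top)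
 finally show ?thesis by (simp add: L2_def)
qed

lemma in_Hs_iff: "in_Hs s f \<longleftrightarrow> L2 f & En s (fcoef f) < \<infinity>"
proof -
 have "set_integrable lborel unit_sq (%x. (cmod (f x))^2) \<longleftrightarrow> (IQ x. sqn (f x)) < \<infinity>"
  if "f : bmeas"
  using that by (subst integrable_sqM[symmetric]) (auto simp: integrable_iff_bounded)
 thus ?thesis by (auto simp: in_Hs_def L2_def Hs_energy_En)
qed

text \<open>Exact on partial sums that contain \<open>k\<close>; a single coefficient of the
  remainder is bounded by the \<open>L^2\<close> norm of the tail.\<close>

lemma fcoef_syn:
 assumes "s > 0" "En s a < \<infinity>" shows "fcoef (syn a) k = a k"
proof -
 have L: "L2 (syn a)" by (rule L2_syn[OF assms])
 define r where "r = 4 powr (-s/2)"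
 have r: "0 < r" "r < 1" using assms by (auto simp: r_def powr_less_one)
 obtain E where E: "En s a = ennreal E" "E >= 0" using assms(2) by (cases "En s a") auto
 have "eventually (%J. (cmod (fcoef (syn a) k - a k))^2 <= (r^J / (1 - r))^2 * E) sequentially"
  using mem_BJ_eventually[of k]
 proof eventually_elim
  case (elim J)
  interpret finite_measure sqM by (rule finite_sqM)
  have iP: "integrable sqM (%x. \<Sum>k\<in>BJ J. a k * ek k x)"
   by (rule integrable_const_bound[where B="\<Sum>k\<in>BJ J. cmod (a k)"]) (auto intro!: order_trans[OF norm_sum] simp: norm_mult)
  have "fcoef (%x. syn a x - (\<Sum>k\<in>BJ J. a k * ek k x)) k = fcoef (syn a) k - a k"
   using elim by (simp add: fcoef_diff[OF L2_integrable(1)[OF L] iP] fcoef_trig)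
  hence "sqn (fcoef (syn a) k - a k) <= (IQ x. sqn (syn a x - (\<Sum>k\<in>BJ J. a k * ek k x)))"
   using fcoef_bound[of "%x. syn a x - (\<Sum>k\<in>BJ J. a k * ek k x)" k] by simp
  also have "... <= ennreal ((r^J / (1 - r))^2) * ennreal E"
   using syn_AE_L2(2)[OF assms, of J] by (simp add: sum_Pj r_def E)
  finally show ?case using E by (simp add: ennreal_mult[symmetric])
 qed
 moreover have "(%J. (r^J / (1 - r))^2 * E) \<longlonglongrightarrow> (0 / (1 - r))^2 * E"
  using r by (intro tendsto_intros LIMSEQ_power_zero) auto
 ultimately have "(cmod (fcoef (syn a) k - a k))^2 <= (0 / (1 - r))^2 * E"
  by (intro tendsto_le[OF _ _ tendsto_const]) auto
 thus ?thesis by simp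
qed

text \<open>\<open>E\<close> maps the square onto a product of two circles and identifies opposite
  sides. It therefore separates only points of the open square \<open>U\<close> from the rest, and
  the boundary is a null set.\<close>

lemma fcoef_unique:
 assumes f: "L2 f" and z: "!!k. fcoef f k = 0"
 shows "AE x in sqM. f x = 0"
proof -
 define E where "E x = (cis (2 * pi * fst x), cis (2 * pi * snd x))" for x :: "real \<times> real"
 have [measurable]: "f : bmeas" using f by (simp add: L2_def)
 have comp: "(%x. complex_of_real (E x \<bullet> b)) : trig_poly ek" if "b : Basis" for b
 proof -
  have k: "(%x. a * ek k x + b * ek l x) : trig_poly ek" for a b k l
   by (rule trig_poly.add; rule trig_poly.mono)
  have c: "complex_of_real (cos t) = (1/2) * cis t + (1/2) * cis (-t)" "complex_of_real (sin t) = (-\<i>/2) * cis t + (\<i>/2) * cis (-t)" for t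
   by (auto simp: complex_eq_iff)
  have e: "ek (1,0) x = cis (2 * pi * fst x)" "ek (-1,0) x = cis (- (2 * pi * fst x))"
   "ek (0,1) x = cis (2 * pi * snd x)" "ek (0,-1) x = cis (- (2 * pi * snd x))" for x by (simp_all add: ek_def)
  have "b = (1,0) \<or> b = (\<i>,0) \<or> b = (0,1) \<or> b = (0,\<i>)" using that by (auto simp: Basis_prod_def Basis_complex_def)
  thus ?thesis
  proof (elim disjE)
   assume "b = (1,0)"
   hence "(%x. complex_of_real (E x \<bullet> b)) = (%x. (1/2) * ek (1,0) x + (1/2) * ek (-1,0) x)"
    by (simp add: E_def inner_complex_def c(1) e)
   thus ?thesis using k by (simp only:)
  next
   assume "b = (\<i>,0)"
   hence "(%x. complex_of_real (E x \<bullet> b)) = (%x. (-\<i>/2) * ek (1,0) x + (\<i>/2) * ek (-1,0) x)"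
    by (simp add: E_def inner_complex_def c(2) e)
   thus ?thesis using k by (simp only:)
  next
   assume "b = (0,1)"
   hence "(%x. complex_of_real (E x \<bullet> b)) = (%x. (1/2) * ek (0,1) x + (1/2) * ek (0,-1) x)"
    by (simp add: E_def inner_complex_def c(1) e)
   thus ?thesis using k by (simp only:)
  next
   assume "b = (0,\<i>)"
   hence "(%x. complex_of_real (E x \<bullet> b)) = (%x. (-\<i>/2) * ek (0,1) x + (\<i>/2) * ek (0,-1) x)"
    by (simp add: E_def inner_complex_def c(2) e)
   thus ?thesis using k by (simp only:)
  qed
 qed
 have cis_inj: "x = y" if "cis (2 * pi * x) = cis (2 * pi * y)" "0 < x" "x < 1" "0 <= y" "y <= 1" for x y :: real
 proof -
  have "cis (2 * pi * (x - y)) = 1" using that(1) by (simp add: right_diff_distrib cis_divide[symmetric])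
  hence "cos (2 * pi * (x - y)) = 1" by (simp add: complex_eq_iff)
  then obtain n :: int where "2 * pi * (x - y) = of_int n * 2 * pi" using cos_one_2pi_int by blast
  hence "2 * pi * (x - y) = 2 * pi * of_int n" by (simp add: mult_ac)
  hence n: "x - y = of_int n" by (simp only: mult_cancel_left) simp
  hence "-1 < real_of_int n" "real_of_int n < 1" using that by linarith+
  hence "n = 0" by linarith
  thus ?thesis using n by simp
 qed
 define U where "U = box (0::real,0::real) (1,1)"
 have Ueq: "U = {0<..<1} \<times> {0<..<1}"
  by (rule set_eqI) (auto simp: U_def mem_box Basis_prod_def inner_prod_def)
 have "AE x in lborel. x : U --> f x = 0"
 proof (rule fourier_unique[where e=ek and E=E and S=unit_sq])
  show "compact unit_sq" by (simp add: unit_sq_cbox)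
  show "continuous_on unit_sq E" unfolding E_def by (intro continuous_intros)
  show "open U" by (simp add: U_def open_box)
  show "U \<subseteq> unit_sq" by (simp add: U_def unit_sq_cbox box_subset_cbox)
  show "unit_sq - U ~= {}"
  proof -
   have "(0,0) : unit_sq - U" by (auto simp: unit_sq_def U_def box_def Basis_prod_def)
   thus ?thesis by blast
  qed
  show "x = y" if "x : U" "y : unit_sq" "E x = E y" for x y
   using that cis_inj[of "fst x" "fst y"] cis_inj[of "snd x" "snd y"]
   unfolding Ueq by (auto simp: E_def unit_sq_def prod_eq_iff)
  show "integrable lborel (%x. ind unit_sq x *\<^sub>R f x)"
   using L2_integrable(1)[OF f] integrable_sqM[of f] by (simp add: set_integrable_def)
  show "(LINT x|lborel. ind unit_sq x *\<^sub>R f x * ek k x) = 0" for k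
  proof -
   have "fcoef f (- k) = (LINT x|lborel. ind unit_sq x *\<^sub>R f x * ek k x)"
    by (simp add: fcoef_sqM integral_sqM set_lebesgue_integral_def)
   thus ?thesis using z by simp
  qed
 qed (auto simp: ek_add comp)
 moreover have "AE x in lborel. x \<notin> unit_sq - U"
 proof (rule AE_not_in)
  have "emeasure lborel U = 1" unfolding U_def by (subst emeasure_lborel_box) (auto simp: Basis_prod_def)
  hence "emeasure lborel (unit_sq - U) = 0"
   using emeasure_unit_sq by (subst emeasure_Diff) (auto simp: U_def unit_sq_cbox box_subset_cbox)
  thus "unit_sq - U : null_sets lborel" by (auto simp: null_sets_def U_def unit_sq_cbox)
 qed
 ultimately have "AE x in lborel. x : unit_sq --> f x = 0" by eventually_elim auto
 thus ?thesis by (simp add: AE_sqM)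
qed

text \<open>Any \<open>H^s\<close> function with \<open>s > 0\<close> may be replaced by its
  synthesis, which turns statements about functions into statements about coefficients.\<close>

lemma syn_fcoef:
 assumes "s > 0" "L2 f" "En s (fcoef f) < \<infinity>"
 shows "AE x in sqM. f x = syn (fcoef f) x"
proof -
 have L: "L2 (syn (fcoef f))" using L2_syn assms by blast
 have "AE x in sqM. f x - syn (fcoef f) x = 0"
 proof (rule fcoef_unique)
  show "L2 (%x. f x - syn (fcoef f) x)" by (rule L2_diff[OF assms(2) L])
  show "fcoef (%x. f x - syn (fcoef f) x) k = 0" for k
   using assms L by (simp add: fcoef_diff L2_integrable fcoef_syn[where s=s])
 qed
 thus ?thesis by simp
qed

text \<open>A Bochner integral over counting measure, hence 0 wherever the sum fails to converge
  absolutely; for square summable sequences it always converges.\<close>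

definition conv :: "(lat => complex) => (lat => complex) => lat => complex" where
 "conv a b k = (LINT l|CZ. a l * b (k - l))"

lemma nn_integral_CZ_reflect: "(SZ l. f (k - l)) = (SZ l. f l)"
proof -
 have "bij_betw (%l. k - l) UNIV (UNIV :: (lat) set)"
  by (rule bij_betw_byWitness[where f'="%l. k - l"]) auto
 thus ?thesis by (rule nn_integral_bij_count_space)
qed

lemma conv_integrable:
 assumes "(SZ l. sqn (a l)) < \<infinity>" "(SZ l. sqn (b l)) < \<infinity>"
 shows "integrable CZ (%l. a l * b (k - l))"
proof (rule integrableI_bounded)
 have "(SZ l. ennreal (norm (a l * b (k - l)))) <= (SZ l. sqn (a l) + sqn (b (k - l)))"
 proof (rule nn_integral_mono)
  fix l
  have "cmod (a l) * cmod (b (k - l)) <= (cmod (a l))^2 + (cmod (b (k - l)))^2"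
   using sum_squares_bound[of "cmod (a l)" "cmod (b (k - l))"] mult_nonneg_nonneg[OF norm_ge_zero norm_ge_zero, of "a l" "b (k - l)"] unfolding mult.assoc by linarith
  thus "ennreal (norm (a l * b (k - l))) <= sqn (a l) + sqn (b (k - l))"
   by (simp add: norm_mult ennreal_plus[symmetric] ennreal_leI del: ennreal_plus)
 qed
 also have "... = (SZ l. sqn (a l)) + (SZ l. sqn (b l))"
  by (subst nn_integral_add) (auto simp: nn_integral_CZ_reflect[of "%l. sqn (b l)"])
 also have "... < \<infinity>" using assms by simp
 finally show "(SZ l. ennreal (norm (a l * b (k - l)))) < \<infinity>" .
qed simp

lemma En_mono: "s <= s' ==> En s a <= En s' a"
 unfolding En_def by (intro nn_integral_mono ennreal_leI mult_right_mono wt_mono) auto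

lemma En_0: "En 0 a = (SZ l. sqn (a l))" by (simp add: En_def)

text \<open>With \<open>u\<close> only in \<open>L^2\<close> the product is merely integrable.
  Against partial sums of \<open>syn b\<close> the formula is a finite sum; the error in the product
  is controlled by Cauchy-Schwarz and the \<open>L^2\<close> tail, the error in the convolution by
  dominated convergence.\<close>

lemma fcoef_mult_syn:
 assumes s: "s > 0" and u: "L2 u" and b: "En s b < \<infinity>"
 shows "integrable sqM (%x. u x * syn b x)" "fcoef (%x. u x * syn b x) k = conv b (fcoef u) k"
proof -
 interpret finite_measure sqM by (rule finite_sqM)
 have [measurable]: "u : bmeas" using u by (simp add: L2_def)
 have prod: "integrable sqM (%x. u x * v x)" if v: "L2 v" for v
 proof (rule bintegrable_bound)
  have [measurable]: "v : bmeas" using v by (simp add: L2_def)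
  show "integrable sqM (%x. (cmod (u x))^2 + (cmod (v x))^2)" using L2_integrable(2)[OF u] L2_integrable(2)[OF v] by simp
  show "(%x. u x * v x) : borel_measurable sqM" by measurable
  have "cmod (u x) * cmod (v x) <= (cmod (u x))^2 + (cmod (v x))^2" for x
   using sum_squares_bound[of "cmod (u x)" "cmod (v x)"] mult_nonneg_nonneg[OF norm_ge_zero norm_ge_zero, of "u x" "v x"] unfolding mult.assoc by linarith
  thus "AE x in sqM. norm (u x * v x) <= norm ((cmod (u x))^2 + (cmod (v x))^2)"
   by (simp add: norm_mult)
 qed
 have Ls: "L2 (syn b)" by (rule L2_syn[OF s b])
 show iuv: "integrable sqM (%x. u x * syn b x)" by (rule prod[OF Ls])
 define S where "S J x = (\<Sum>l\<in>BJ J. b l * ek l x)" for J x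
 have Sm [measurable]: "S J : bmeas" for J unfolding S_def by measurable
 have LS: "L2 (S J)" for J unfolding L2_def S_def using parseval_fin[of "BJ J" b] by simp
 have e1: "fcoef (%x. u x * S J x) k = (\<Sum>l\<in>BJ J. b l * fcoef u (k - l))" for J
 proof -
  have i: "integrable sqM (%x. u x * ek m x)" for m
   by (rule bintegrable_bound[OF L2_integrable(1)[OF u]]) (auto simp: norm_mult)
  have "u x * S J x * ek (- k) x = (\<Sum>l\<in>BJ J. b l * (u x * ek (- (k - l)) x))" for x
  proof -
   have "ek (- (k - l)) x = ek l x * ek (- k) x" for l by (simp add: ek_add[symmetric])
   thus ?thesis by (simp add: S_def sum_distrib_left sum_distrib_right mult_ac)
  qed
  note eq = this
  have "fcoef (%x. u x * S J x) k = (LINT x|sqM. u x * S J x * ek (- k) x)" by (rule fcoef_sqM) measurable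
  also have "... = (LINT x|sqM. (\<Sum>l\<in>BJ J. b l * (u x * ek (- (k - l)) x)))" by (simp only: eq)
  also have "... = (\<Sum>l\<in>BJ J. b l * fcoef u (k - l))"
   by (subst Bochner_Integration.integral_sum) (use i in \<open>auto simp: fcoef_sqM\<close>)
  finally show ?thesis .
 qed
 have b2: "(SZ l. sqn (b l)) < \<infinity>" using En_mono[of 0 s b] s b by (simp add: En_0)
 have u2: "(SZ l. sqn (fcoef u l)) < \<infinity>" using bessel_sq[of u] u by (auto simp: L2_def)
 have ci: "integrable CZ (%l. b l * fcoef u (k - l))" by (rule conv_integrable[OF b2 u2])
 have lim1: "(%J. \<Sum>l\<in>BJ J. b l * fcoef u (k - l)) \<longlonglongrightarrow> conv b (fcoef u) k"
 proof -
  have "(%J. \<integral>l. ind (BJ J) l *\<^sub>R (b l * fcoef u (k - l)) \<partial>CZ) \<longlonglongrightarrow> conv b (fcoef u) k"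
   unfolding conv_def
  proof (rule integral_dominated_convergence[where w="%l. norm (b l * fcoef u (k - l))"])
   show "integrable CZ (%l. norm (b l * fcoef u (k - l)))" using ci by simp
   have "(%J. ind (BJ J) l *\<^sub>R (b l * fcoef u (k - l))) \<longlonglongrightarrow> b l * fcoef u (k - l)" for l
    by (rule tendsto_eventually, rule eventually_mono[OF mem_BJ_eventually[of l]]) auto
   thus "AE l in CZ. (%J. ind (BJ J) l *\<^sub>R (b l * fcoef u (k - l))) \<longlonglongrightarrow> b l * fcoef u (k - l)" by simp
  qed (auto simp: indicator_def)
  moreover have "(LINT l|CZ. ind (BJ J) l *\<^sub>R (b l * fcoef u (k - l))) = (\<Sum>l\<in>BJ J. b l * fcoef u (k - l))" for J
   by (subst integral_restrict_space[symmetric]) (auto simp: restrict_count_space lebesgue_integral_count_space_finite)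
  ultimately show ?thesis by simp
 qed
 obtain E where E: "En s b = ennreal E" "E >= 0" using b by (cases "En s b") auto
 obtain G where G: "(IQ x. sqn (u x)) = ennreal G" "G >= 0" using u by (cases "\<integral>\<^sup>+x. sqn (u x) \<partial>sqM") (auto simp: L2_def)
 define r where "r = 4 powr (-s/2)"
 have r: "0 < r" "r < 1" using s by (auto simp: r_def powr_less_one)
 have bd: "(cmod (fcoef (%x. u x * syn b x) k - fcoef (%x. u x * S J x) k))^2 <= G * ((r^J / (1 - r))^2 * E)" for J
 proof -
  have "fcoef (%x. u x * syn b x) k - fcoef (%x. u x * S J x) k = fcoef (%x. u x * syn b x - u x * S J x) k"
   by (rule fcoef_diff[symmetric]) (auto intro: prod Ls LS)
  also have "cmod ... <= (LINT x|sqM. cmod (u x * syn b x - u x * S J x))"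
   by (subst fcoef_sqM, measurable, rule order_trans[OF integral_norm_bound]) (simp add: norm_mult)
  finally have "ennreal (cmod (fcoef (%x. u x * syn b x) k - fcoef (%x. u x * S J x) k)) <= ennreal (LINT x|sqM. cmod (u x * syn b x - u x * S J x))"
   by (rule ennreal_leI)
  also have "... = (IQ x. ennreal (cmod (u x * syn b x - u x * S J x)))"
   by (rule nn_integral_eq_integral[symmetric]) (auto intro!: prod Ls LS)
  also have "... = (IQ x. ennreal (cmod (u x)) * ennreal (cmod (syn b x - S J x)))"
   by (intro nn_integral_cong) (simp add: ennreal_mult[symmetric] norm_mult[symmetric] right_diff_distrib)
  finally have "(ennreal (cmod (fcoef (%x. u x * syn b x) k - fcoef (%x. u x * S J x) k)))^2 <= (IQ x. ennreal (cmod (u x)) * ennreal (cmod (syn b x - S J x)))^2"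
   by (rule power_mono) simp
  also have "... <= (IQ x. ennreal (cmod (u x))^2) * (IQ x. ennreal (cmod (syn b x - S J x))^2)"
   by (rule Cauchy_Schwarz_nn_integral) measurable
  also have "... <= ennreal G * (ennreal ((r^J / (1 - r))^2) * ennreal E)"
   using syn_AE_L2(2)[OF s b, of J] G by (intro mult_mono) (auto simp: ennreal_power r_def E S_def sum_Pj)
  finally show ?thesis using G E by (simp add: ennreal_power ennreal_mult[symmetric])
 qed
 have "(%J. G * ((r^J / (1 - r))^2 * E)) \<longlonglongrightarrow> G * ((0 / (1 - r))^2 * E)"
  using r by (intro tendsto_intros LIMSEQ_power_zero) auto
 hence z: "(%J. G * ((r^J / (1 - r))^2 * E)) \<longlonglongrightarrow> 0" by simp
 define D where "D J = fcoef (%x. u x * syn b x) k - fcoef (%x. u x * S J x) k" for J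
 have "(%J. (cmod (D J))^2) \<longlonglongrightarrow> 0"
  by (rule Lim_null_comparison[OF _ z]) (use bd in \<open>simp add: D_def\<close>)
 hence "(%J. sqrt ((cmod (D J))^2)) \<longlonglongrightarrow> sqrt 0" by (rule tendsto_real_sqrt)
 hence 1: "D \<longlonglongrightarrow> 0" by (simp add: tendsto_norm_zero_iff)
 have 2: "D \<longlonglongrightarrow> fcoef (%x. u x * syn b x) k - conv b (fcoef u) k"
  unfolding D_def e1 by (intro tendsto_diff tendsto_const lim1)
 show "fcoef (%x. u x * syn b x) k = conv b (fcoef u) k" using LIMSEQ_unique[OF 2 1] by simp
qed

section \<open>Measure-theoretic tools\<close>

lemma nn_integral_lborel_shift:
 fixes f :: "'a::euclidean_space => ennreal"
 assumes [measurable]: "f : bmeas"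
 shows "(IL x. f (h + x)) = (IL x. f x)"
proof -
 have "(IL x. f x) = (\<integral>\<^sup>+x. f x \<partial>distr lborel borel ((+) h))" by (simp add: lborel_distr_plus)
 also have "... = (IL x. f (h + x))" by (rule nn_integral_distr) auto
 finally show ?thesis by simp
qed

lemma AE_lborel_hyperplane:
 fixes b :: "'a::euclidean_space"
 assumes "b : Basis" shows "AE x in lborel. x \<bullet> b ~= c"
proof -
 have cl: "closed {x. x \<bullet> b = c}" by (intro closed_Collect_eq continuous_intros)
 have "negligible {x. x \<bullet> b = c}" using assms by (rule negligible_standard_hyperplane)
 hence "{x. x \<bullet> b = c} : null_sets (completion lborel)" by (simp add: negligible_iff_null_sets)
 hence "{x. x \<bullet> b = c} : null_sets lborel" using cl by (simp add: null_sets_completion_iff)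
 from AE_not_in[OF this] show ?thesis by simp
qed

text \<open>Translation modulo 1 along one axis, written as an exchange of the two rectangles
  \<open>S1\<close> and \<open>S2\<close>, moved by \<open>a\<close> and by \<open>a - 1\<close>.
  Their images cover the square exactly except on two lines, which are null.\<close>

lemma sq_rotation:
 fixes v :: "real \<times> real"
 assumes v: "v = (1,0) \<or> v = (0,1)" and a: "0 <= a" "a <= 1"
 defines "R \<equiv> %x. if x \<bullet> v <= 1 - a then a *\<^sub>R v + x else (a - 1) *\<^sub>R v + x"
 shows "distr sqM borel R = distr sqM borel (%x. x)"
proof (rule measure_eqI)
 have vb: "v : Basis" "v \<bullet> v = 1" using v by (auto simp: Basis_prod_def)
 have Rm [measurable]: "R : bmeas" unfolding R_def by measurable
 show "sets (distr sqM borel R) = sets (distr sqM borel (%x. x))" by simp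
 fix A assume "A : sets (distr sqM borel R)"
 hence [measurable]: "A : sets borel" by simp
 define S1 where "S1 = {x : unit_sq. x \<bullet> v <= 1 - a}"
 define S2 where "S2 = {x : unit_sq. x \<bullet> v > 1 - a}"
 have [measurable]: "S1 : sets borel" "S2 : sets borel" unfolding S1_def S2_def by measurable
 have "emeasure (distr sqM borel R) A = (IQ x. ind A (R x))"
 proof -
  have "(IQ x. ind A (R x)) = (IQ x. ind (R -` A) x)" by (intro nn_integral_cong) (simp add: indicator_def)
  also have "... = emeasure sqM (R -` A)" by (rule nn_integral_indicator) (use measurable_sets[OF Rm, of A] in simp)
  finally show ?thesis by (subst emeasure_distr) auto
 qed
 also have "... = (IL x. ind A (R x) * ind unit_sq x)" by (rule nn_integral_sqM) measurable
 also have "... = (IL x. ind A (a *\<^sub>R v + x) * ind S1 x + ind A ((a - 1) *\<^sub>R v + x) * ind S2 x)"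
  by (intro nn_integral_cong) (auto simp: S1_def S2_def R_def split: split_indicator)
 also have "... = (IL x. ind A (a *\<^sub>R v + x) * ind S1 x) + (IL x. ind A ((a - 1) *\<^sub>R v + x) * ind S2 x)"
  by (rule nn_integral_add) measurable
 also have "(IL x. ind A (a *\<^sub>R v + x) * ind S1 x) = (IL x. ind A (a *\<^sub>R v + x) * ind S1 ((a *\<^sub>R v + x) - a *\<^sub>R v))" by simp
 also have "... = (IL x. ind A x * ind S1 (x - a *\<^sub>R v))"
  by (rule nn_integral_lborel_shift[where f="%x. ind A x * ind S1 (x - a *\<^sub>R v)"]) measurable
 also have "(IL x. ind A ((a - 1) *\<^sub>R v + x) * ind S2 x) = (IL x. ind A ((a - 1) *\<^sub>R v + x) * ind S2 (((a - 1) *\<^sub>R v + x) - (a - 1) *\<^sub>R v))" by simp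
 also have "... = (IL x. ind A x * ind S2 (x - (a - 1) *\<^sub>R v))"
  by (rule nn_integral_lborel_shift[where f="%x. ind A x * ind S2 (x - (a - 1) *\<^sub>R v)"]) measurable
 also have "(IL x. ind A x * ind S1 (x - a *\<^sub>R v)) + (IL x. ind A x * ind S2 (x - (a - 1) *\<^sub>R v))
  = (IL x. ind A x * ind S1 (x - a *\<^sub>R v) + ind A x * ind S2 (x - (a - 1) *\<^sub>R v))"
  by (rule nn_integral_add[symmetric]) measurable
 also have "... = (IL x. ind A x * ind unit_sq x)"
 proof (rule nn_integral_cong_AE)
  show "AE x in lborel. (ind A x * ind S1 (x - a *\<^sub>R v) + ind A x * ind S2 (x - (a - 1) *\<^sub>R v) :: ennreal) = ind A x * ind unit_sq x"
   using AE_lborel_hyperplane[OF vb(1), of a] AE_lborel_hyperplane[OF vb(1), of 0]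
  proof eventually_elim
   case (elim x)
   have "(ind S1 (x - a *\<^sub>R v) + ind S2 (x - (a - 1) *\<^sub>R v) :: ennreal) = ind unit_sq x"
    using elim v a by (cases x) (auto simp: S1_def S2_def unit_sq_def split: split_indicator)
   thus ?case by (metis distrib_left)
  qed
 qed
 also have "... = (IQ x. ind A x)" by (rule nn_integral_sqM[symmetric]) measurable
 also have "... = emeasure (distr sqM borel (%x. x)) A" by (subst emeasure_distr) auto
 finally show "emeasure (distr sqM borel R) A = emeasure (distr sqM borel (%x. x)) A" .
qed

lemma sq_shift:
 fixes v :: "real \<times> real" and f :: "_ => ennreal" and g :: "_ => complex"
 assumes v: "v = (1,0) \<or> v = (0,1)" and a: "0 <= a" "a <= 1"
 shows "(!!x. f (x + v) = f x) ==> f : bmeas ==> (IQ x. f (x + a *\<^sub>R v)) = (IQ x. f x)"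
  and "(!!x. g (x + v) = g x) ==> g : bmeas ==> (LINT x|sqM. g (x + a *\<^sub>R v)) = (LINT x|sqM. g x)"
proof -
 define R where "R x = (if x \<bullet> v <= 1 - a then a *\<^sub>R v + x else (a - 1) *\<^sub>R v + x)" for x
 have Rm [measurable]: "R : bmeas" unfolding R_def by measurable
 have D: "distr sqM borel R = distr sqM borel (%x. x)" unfolding R_def by (rule sq_rotation[OF v a])
 have Rx: "R x = x + a *\<^sub>R v \<or> R x + v = x + a *\<^sub>R v" for x
  by (auto simp: R_def algebra_simps)
 show "(IQ x. f (x + a *\<^sub>R v)) = (IQ x. f x)" if per: "!!x. f (x + v) = f x" and [measurable]: "f : bmeas"
 proof -
  have "(IQ x. f (x + a *\<^sub>R v)) = (IQ x. f (R x))" by (intro nn_integral_cong) (metis per Rx)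
  also have "... = (\<integral>\<^sup>+x. f x \<partial>distr sqM borel R)" by (rule nn_integral_distr[symmetric]) measurable
  also have "... = (IQ x. f x)" unfolding D by (rule nn_integral_distr) measurable
  finally show ?thesis .
 qed
 show "(LINT x|sqM. g (x + a *\<^sub>R v)) = (LINT x|sqM. g x)" if p: "!!x. g (x + v) = g x" and [measurable]: "g : bmeas"
 proof -
  have "(LINT x|sqM. g (x + a *\<^sub>R v)) = (LINT x|sqM. g (R x))" by (intro bintegral_cong refl) (metis p Rx)
  also have "... = (\<integral>x. g x \<partial>distr sqM borel R)" by (rule integral_distr[symmetric]) measurable
  also have "... = (LINT x|sqM. g x)" unfolding D by (rule integral_distr) measurable
  finally show ?thesis .
 qed
qed

text \<open>Sums over a countable type become series along \<open>from_nat\<close>, with zero terms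
  off the range of \<open>to_nat\<close>; measurability and the exchange of sum and integral are
  then those of series.\<close>

lemma nn_integral_count_space_suminf:
 fixes f :: "'i::countable => ennreal"
 shows "(SU i. f i) = (\<Sum>n. f (from_nat n) * ind (range (to_nat :: 'i => nat)) n)"
proof -
 have "(SU i. f i) = (\<integral>\<^sup>+i. f (from_nat (to_nat i)) \<partial>count_space (UNIV :: 'i set))" by simp
 also have "... = (\<integral>\<^sup>+n. f (from_nat n) \<partial>count_space (range (to_nat :: 'i => nat)))"
  by (rule nn_integral_bij_count_space[where f="%n. f (from_nat n)"]) (simp add: bij_betw_def)
 also have "... = (SU n. f (from_nat n) * ind (range (to_nat :: 'i => nat)) n)"
  by (simp add: nn_integral_count_space_indicator)
 also have "... = (\<Sum>n. f (from_nat n) * ind (range (to_nat :: 'i => nat)) n)" by (rule nn_integral_count_space_nat)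
 finally show ?thesis .
qed

lemma nn_integral_count_swap:
 fixes f :: "'i::countable => 'a => ennreal"
 assumes [measurable]: "!!k. f k : borel_measurable M"
 shows "(SU k. (NN M (%x. f k x))) = (NN M (%x. (SU k. f k x)))"
 unfolding nn_integral_count_space_suminf
 by (subst nn_integral_suminf) (auto simp: nn_integral_multc)

lemma borel_measurable_nn_integral_count [measurable (raw)]:
 fixes f :: "'a => 'i::countable => ennreal"
 assumes [measurable]: "!!k. (%x. f x k) : borel_measurable M"
 shows "(%x. \<integral>\<^sup>+k. f x k \<partial>count_space UNIV) : borel_measurable M"
 unfolding nn_integral_count_space_suminf by measurable

lemma borel_measurable_integral_count [measurable (raw)]:
 fixes f :: "'a => 'i::countable => complex"
 assumes m: "!!k. (%x. f x k) : borel_measurable M"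
 shows "(%x. \<integral>k. f x k \<partial>count_space UNIV) : borel_measurable M"
proof -
 interpret sigma_finite_measure "count_space (UNIV :: 'i set)" by (rule sigma_finite_measure_count_space_countable) simp
 have "(%p. f (snd p) (fst p)) : borel_measurable (count_space UNIV \<Otimes>\<^sub>M M)"
  by (rule measurable_pair_measure_countable1) (use m in auto)
 hence "(%p. f (fst p) (snd p)) : borel_measurable (M \<Otimes>\<^sub>M count_space UNIV)"
  using measurable_compose[of "%p. (snd p, fst p)" "M \<Otimes>\<^sub>M count_space UNIV" "count_space UNIV \<Otimes>\<^sub>M M" "%p. f (snd p) (fst p)" borel] by simp
 thus ?thesis by (intro borel_measurable_lebesgue_integral) (simp add: case_prod_beta)
qed

lemma fatou_bound:
 fixes u :: "nat => 'a => ennreal"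
 assumes "!!n. u n : borel_measurable M" "AE x in M. (%n. u n x) \<longlonglongrightarrow> v x" "!!n. (NN M (%x. u n x)) <= B"
 shows "(NN M (%x. v x)) <= B"
proof -
 have "(NN M (%x. v x)) = (NN M (%x. liminf (%n. u n x)))"
  by (rule nn_integral_cong_AE) (use assms(2) in \<open>auto elim!: eventually_mono simp: lim_imp_Liminf\<close>)
 also have "... <= liminf (%n. \<integral>\<^sup>+x. u n x \<partial>M)" by (rule nn_integral_liminf) (use assms in auto)
 also have "... <= B" by (rule Liminf_le) (use assms in auto)
 finally show ?thesis .
qed

lemma nn_jensen:
 assumes [measurable]: "f : borel_measurable M"
 shows "(NN M (%x. f x))^2 <= emeasure M (space M) * (NN M (%x. (f x)^2))"
 using Cauchy_Schwarz_nn_integral[of "%x. 1" M f] by simp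

section \<open>Orthogonality in time\<close>

definition ivl :: "real => real => real measure" where
 "ivl a b = density lborel (%t. ennreal (ind {a..b} t))"

lemma sets_ivl [simp, measurable_cong]: "sets (ivl a b) = sets borel" by (simp add: ivl_def)

lemma space_ivl [simp]: "space (ivl a b) = UNIV" by (simp add: ivl_def)

lemma emeasure_ivl: "emeasure (ivl a b) UNIV = ennreal (b - a)" if "a <= b"
 using that by (simp add: ivl_def emeasure_density ennreal_indicator)

lemma finite_ivl: "a <= b ==> finite_measure (ivl a b)"
 by (rule finite_measureI) (simp add: emeasure_ivl)

lemma nn_integral_ivl: "f : bmeas ==> integral\<^sup>N (ivl a b) f = (IL x. f x * ind {a..b} x)"
 unfolding ivl_def by (subst nn_integral_density) (auto intro!: nn_integral_cong simp: indicator_def)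

lemma integral_ivl: "f : bmeas ==> integral\<^sup>L (ivl a b) f = (LINT x|lborel. ind {a..b} x *\<^sub>R f x)"
 for f :: "_ => complex"
 unfolding ivl_def by (rule integral_density) auto

lemma integrable_ivl: "f : bmeas ==> integrable (ivl a b) f \<longleftrightarrow> set_integrable lborel {a..b} f"
 for f :: "_ => complex"
 unfolding ivl_def set_integrable_def by (rule integrable_density) auto

lemma AE_ivl: "(AE x in ivl a b. P x) \<longleftrightarrow> (AE x in lborel. x : {a..b} --> P x)"
 unfolding ivl_def by (subst AE_density) (auto simp: indicator_def)

lemma cis_ivl_orthogonal:
 assumes "a <= b" and c: "!!m::int. cis (w * of_int m * (b - a)) = 1" "w ~= 0"
 shows "(\<integral>t. cis (w * of_int i * t) * cnj (cis (w * of_int j * t)) \<partial>ivl a b) = (if i = j then of_real (b - a) else 0)"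
proof -
 define m where "m = i - j"
 have "cis (w * of_int i * t) * cnj (cis (w * of_int j * t)) = cis (w * of_int m * t)" for t
  by (simp add: cis_cnj cis_mult m_def algebra_simps)
 hence "(\<integral>t. cis (w * of_int i * t) * cnj (cis (w * of_int j * t)) \<partial>ivl a b) = (LINT t|lborel. ind {a..b} t *\<^sub>R cis (w * of_int m * t))"
  by (simp add: integral_ivl)
 also have "... = (if m = 0 then of_real (b - a) else 0)"
 proof (cases "m = 0")
  case True thus ?thesis using assms(1) by (simp add: scaleR_conv_of_real)
 next
  case False
  have "cis (w * of_int m * b) = cis (w * of_int m * a) * cis (w * of_int m * (b - a))" by (simp add: cis_mult algebra_simps)
  hence "cis (w * of_int m * b) = cis (w * of_int m * a)" using c(1) by simp
  thus ?thesis using integral_cis_linear[of a b "w * of_int m"] assms False by simp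
 qed
 finally show ?thesis by (simp add: m_def)
qed

text \<open>The length \<open>2 * pi / (4 * pi^2)\<close> is a period of every phase
  \<open>4 * pi^2 * M * t\<close> with integer \<open>M\<close>, so over it distinct phases are
  exactly orthogonal.\<close>

definition T0 :: real where "T0 = 1 / (2 * pi)"

abbreviation IntT :: "(real => ennreal) => ennreal" (binder "IT " 10) where "IntT f == nn_integral (ivl 0 T0) f"

lemma T0_pos: "0 < T0" by (simp add: T0_def)

text \<open>Terms are collected by the value \<open>M\<close> of the integer phase. Different
  \<open>M\<close> are orthogonal over the period; within one \<open>M\<close>, Cauchy-Schwarz with
  weight \<open>ka\<close> costs the sum of \<open>1 / ka\<close> over that level set. Partial sums
  and Fatou's lemma cover infinite sequences.\<close>

lemma time_orthogonality:
 fixes P :: "lat => int"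
 assumes al: "(SZ l. ennreal (cmod (af l))) < \<infinity>" and S: "S >= 0" and ka: "!!l. ka l > 0"
  and sum: "!!M. (SZ l. ennreal (1 / ka l) * ind {l. P l = M} l) <= ennreal S"
 shows "(IT t. sqn (LINT l|CZ. af l * cis (- (4 * pi^2 * of_int (P l) * t))))
  <= ennreal (T0 * S) * (SZ l. ennreal (ka l * (cmod (af l))^2))"
proof (rule fatou_bound)
 define e where "e M t = cis (- (4 * pi^2) * of_int M * t)" for M :: int and t :: real
 define g where "g J t = (\<Sum>l\<in>BJ J. af l * e (P l) t)" for J t
 have em [measurable]: "e M : bmeas" for M unfolding e_def by measurable
 show "(%t. sqn (g J t)) : borel_measurable (ivl 0 T0)" for J unfolding g_def by measurable
 have ia: "integrable CZ (%l. af l * cis (- (4 * pi^2 * of_int (P l) * t)))" for t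
  by (rule integrableI_bounded) (use al in \<open>auto simp: norm_mult\<close>)
 have lim: "(%J. g J t) \<longlonglongrightarrow> (LINT l|CZ. af l * cis (- (4 * pi^2 * of_int (P l) * t)))" for t
 proof -
  have "(%J. \<integral>l. ind (BJ J) l *\<^sub>R (af l * cis (- (4 * pi^2 * of_int (P l) * t))) \<partial>CZ) \<longlonglongrightarrow> (LINT l|CZ. af l * cis (- (4 * pi^2 * of_int (P l) * t)))"
  proof (rule integral_dominated_convergence[where w="%l. norm (af l * cis (- (4 * pi^2 * of_int (P l) * t)))"])
   show "integrable CZ (%l. norm (af l * cis (- (4 * pi^2 * of_int (P l) * t))))" by (rule integrable_norm[OF ia])
   have "(%J. ind (BJ J) l *\<^sub>R (af l * cis (- (4 * pi^2 * of_int (P l) * t)))) \<longlonglongrightarrow> af l * cis (- (4 * pi^2 * of_int (P l) * t))" for l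
    by (rule tendsto_eventually, rule eventually_mono[OF mem_BJ_eventually[of l]]) auto
   thus "AE l in CZ. (%J. ind (BJ J) l *\<^sub>R (af l * cis (- (4 * pi^2 * of_int (P l) * t)))) \<longlonglongrightarrow> af l * cis (- (4 * pi^2 * of_int (P l) * t))" by simp
  qed (auto simp: indicator_def)
  moreover have "(LINT l|CZ. ind (BJ J) l *\<^sub>R (af l * cis (- (4 * pi^2 * of_int (P l) * t)))) = g J t" for J
   by (subst integral_restrict_space[symmetric]) (auto simp: restrict_count_space lebesgue_integral_count_space_finite g_def e_def mult_ac)
  ultimately show ?thesis by simp
 qed
 show "AE t in ivl 0 T0. (%J. sqn (g J t)) \<longlonglongrightarrow> sqn (LINT l|CZ. af l * cis (- (4 * pi^2 * of_int (P l) * t)))"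
  by (intro AE_I2 tendsto_ennrealI tendsto_power tendsto_norm lim)
 fix J
 define F where "F = BJ J"
 have F: "finite F" by (simp add: F_def)
 define be where "be M = (\<Sum>l\<in>{l:F. P l = M}. af l)" for M
 have gb: "g J t = (\<Sum>M\<in>P ` F. be M * e M t)" for t
 proof -
  have "g J t = (\<Sum>M\<in>P ` F. \<Sum>l\<in>{l:F. P l = M}. af l * e (P l) t)"
   unfolding g_def F_def[symmetric] by (rule sum.image_gen[OF F])
  also have "... = (\<Sum>M\<in>P ` F. be M * e M t)"
   unfolding be_def sum_distrib_right by (intro sum.cong refl) auto
  finally show ?thesis .
 qed
 have orth: "(\<integral>t. e i t * cnj (e j t) \<partial>ivl 0 T0) = (if i = j then of_real T0 else 0)" for i j
 proof -
  have "cis (- (4 * pi^2) * of_int m * (T0 - 0)) = 1" for m :: int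
  proof -
   have "- (4 * pi^2) * of_int m * (T0 - 0) = 2 * pi * of_int (- m)" by (simp add: T0_def power2_eq_square)
   thus ?thesis by (simp only: cis_multiple_2pi Ints_of_int)
  qed
  hence "(\<integral>t. cis (- (4 * pi^2) * of_int i * t) * cnj (cis (- (4 * pi^2) * of_int j * t)) \<partial>ivl 0 T0) = (if i = j then of_real (T0 - 0) else 0)"
   using T0_pos by (intro cis_ivl_orthogonal) auto
  thus ?thesis by (simp add: e_def)
 qed
 have "(IT t. sqn (g J t)) = ennreal (T0 * (\<Sum>M\<in>P ` F. (cmod (be M))^2))"
  unfolding gb by (rule parseval_finite[OF finite_ivl _ _ orth]) (use T0_pos F in \<open>auto simp: e_def\<close>)
 also have "... <= ennreal (T0 * (\<Sum>M\<in>P ` F. S * (\<Sum>l\<in>{l:F. P l = M}. ka l * (cmod (af l))^2)))"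
 proof (intro ennreal_leI mult_left_mono sum_mono)
  fix M
  define FM where "FM = {l:F. P l = M}"
  have fM: "finite FM" using F by (simp add: FM_def)
  have "(cmod (be M))^2 <= (\<Sum>l\<in>FM. cmod (af l))^2" unfolding be_def FM_def by (intro power_mono norm_sum) auto
  also have "... = (\<Sum>l\<in>FM. (1 / sqrt (ka l)) * (sqrt (ka l) * cmod (af l)))^2"
   using ka by (intro arg_cong[where f="%x. x^2"] sum.cong refl) (simp add: less_imp_neq[symmetric])
  also have "... <= (\<Sum>l\<in>FM. (1 / sqrt (ka l))^2) * (\<Sum>l\<in>FM. (sqrt (ka l) * cmod (af l))^2)" by (rule Cauchy_Schwarz_ineq_sum)
  also have "... = (\<Sum>l\<in>FM. 1 / ka l) * (\<Sum>l\<in>FM. ka l * (cmod (af l))^2)"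
   using ka by (simp add: power_divide power_mult_distrib less_imp_le)
  also have "... <= S * (\<Sum>l\<in>FM. ka l * (cmod (af l))^2)"
  proof (rule mult_right_mono)
   have "ennreal (\<Sum>l\<in>FM. 1 / ka l) = (\<Sum>l\<in>FM. ennreal (1 / ka l) * ind {l. P l = M} l)"
    using ka by (subst sum_ennreal[symmetric]) (auto simp: FM_def less_imp_le intro!: sum.cong)
   also have "... = (SZ l. ennreal (1 / ka l) * ind {l. P l = M} l * ind FM l)"
    using fM by (subst nn_integral_count_space'[of FM]) (auto simp: indicator_def)
   also have "... <= (SZ l. ennreal (1 / ka l) * ind {l. P l = M} l)"
    by (intro nn_integral_mono) (auto simp: indicator_def)
   also have "... <= ennreal S" by (rule sum)
   finally show "(\<Sum>l\<in>FM. 1 / ka l) <= S" using S by simp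
   show "0 <= (\<Sum>l\<in>FM. ka l * (cmod (af l))^2)" using ka by (intro sum_nonneg mult_nonneg_nonneg) (auto intro: less_imp_le)
  qed
  finally show "(cmod (be M))^2 <= S * (\<Sum>l\<in>{l:F. P l = M}. ka l * (cmod (af l))^2)" by (simp add: FM_def)
 qed (use T0_pos in auto)
 also have "(\<Sum>M\<in>P ` F. S * (\<Sum>l\<in>{l:F. P l = M}. ka l * (cmod (af l))^2)) = S * (\<Sum>l\<in>F. ka l * (cmod (af l))^2)"
  unfolding sum_distrib_left[symmetric] using sum.image_gen[OF F, of "%l. ka l * (cmod (af l))^2" P] by simp
 also have "ennreal (T0 * (S * (\<Sum>l\<in>F. ka l * (cmod (af l))^2))) = ennreal (T0 * S) * ennreal (\<Sum>l\<in>F. ka l * (cmod (af l))^2)"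
  using T0_pos S ka by (subst ennreal_mult[symmetric]) (auto intro!: sum_nonneg mult_nonneg_nonneg simp: mult.assoc less_imp_le[OF ka])
 also have "ennreal (\<Sum>l\<in>F. ka l * (cmod (af l))^2) = (SZ l. ennreal (ka l * (cmod (af l))^2) * ind F l)"
  using F ka by (subst nn_integral_count_space'[of F]) (auto simp: indicator_def sum_ennreal less_imp_le)
 also have "... <= (SZ l. ennreal (ka l * (cmod (af l))^2))" by (intro nn_integral_mono) (auto simp: indicator_def)
 finally show "(IT t. sqn (g J t)) <= ennreal (T0 * S) * (SZ l. ennreal (ka l * (cmod (af l))^2))"
  by (simp add: mult_left_mono)
qed

section \<open>Superpositions of modulated free solutions\<close>

lemma nn_norm_integral_le: "ennreal (norm (integral\<^sup>L M f)) <= (NN M (%x. ennreal (norm (f x))))"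
 by (cases "integrable M f") (auto intro: integral_norm_bound_ennreal simp: not_integrable_integral_eq)

lemma En_point: "ennreal (wt s k * (cmod (a k))^2) <= En s a"
 unfolding En_def by (rule nn_integral_ge_point) simp

lemma En_le_cmod:
 assumes "0 <= s" "0 <= q" "En s a <= ennreal (q^2)" shows "cmod (a k) <= q"
proof -
 have "sqn (a k) <= ennreal (wt s k * (cmod (a k))^2)"
  using mult_right_mono[OF wt_ge_1[OF assms(1), of k], of "(cmod (a k))^2"] by (intro ennreal_leI) simp
 also have "... <= ennreal (q^2)" using En_point assms(3) by (rule order_trans)
 finally have "(cmod (a k))^2 <= q^2" by simp
 thus ?thesis using assms(2) by (rule power2_le_imp_le)
qed

text \<open>\<open>c\<close> is a superposition of total mass at most \<open>r\<close> of free evolutions of unit vectors of \<open>H\<^sup>s\<close>,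
  each multiplied by a bounded function of time. It replaces the norm of \<open>X\<^bsup>s,b\<^esup>\<close>, \<open>b > 1/2\<close>; the parameter
  \<open>et = 1, -1, 0\<close> selects the Schroedinger flow, its conjugate, and the trivial flow (for \<open>v\<close>).\<close>

definition rep :: "real => real => real => (real => lat => complex) => bool" where
 "rep et s r c \<longleftrightarrow> (\<exists>(ms::real measure) ze ph. sets ms = sets borel & emeasure ms UNIV <= ennreal r
  & (%p. ze (fst p) (snd p)) : bmeas2 & (\<forall>t ta. cmod (ze t ta) <= 1)
  & (\<forall>k. (%ta. ph ta k) : bmeas) & (\<forall>ta. En s (ph ta) <= 1)
  & (\<forall>t k. c t k = cis (- et * freq2 k * t) * (LINT ta|ms. ze t ta * ph ta k)))"

lemma repD:
 assumes "rep et s r c" and s: "0 <= s"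
 shows "\<exists>(ms::real measure) ze ph. sets ms = sets borel & finite_measure ms & space ms = UNIV & emeasure ms UNIV <= ennreal r
  & (%p. ze (fst p) (snd p)) : bmeas2 & (\<forall>t ta. cmod (ze t ta) <= 1)
  & (\<forall>k. (%ta. ph ta k) : bmeas) & (\<forall>ta. En s (ph ta) <= 1) & (\<forall>ta k. cmod (ph ta k) <= 1)
  & (\<forall>t k. c t k = cis (- et * freq2 k * t) * (LINT ta|ms. ze t ta * ph ta k))"
proof -
 from assms(1) obtain ms :: "real measure" and ze ph where *: "sets ms = sets borel" "emeasure ms UNIV <= ennreal r"
  "(%p. ze (fst p) (snd p)) : bmeas2" "!!t ta. cmod (ze t ta) <= 1"
  "!!k. (%ta. ph ta k) : bmeas" "!!ta. En s (ph ta) <= 1"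
  "!!t k. c t k = cis (- et * freq2 k * t) * (LINT ta|ms. ze t ta * ph ta k)"
  unfolding rep_def by blast
 have sp: "space ms = UNIV" using sets_eq_imp_space_eq[OF *(1)] by simp
 have "emeasure ms (space ms) ~= \<infinity>" using *(2) sp by (auto simp: top_unique)
 hence fin: "finite_measure ms" by (rule finite_measureI)
 have "cmod (ph ta k) <= 1" for ta k using En_le_cmod[OF s, of 1 "ph ta" k] *(6) by simp
 thus ?thesis using * fin sp by blast
qed

lemma rep_measurable:
 assumes "rep et s r c" "0 <= s" shows "(%t. c t k) : bmeas"
proof -
 obtain ms :: "real measure" and ze ph where *: "sets ms = sets borel" "finite_measure ms" "space ms = UNIV" "emeasure ms UNIV <= ennreal r"
  "(%p. ze (fst p) (snd p)) : bmeas2" "!!t ta. cmod (ze t ta) <= 1"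
  "!!k. (%ta. ph ta k) : bmeas" "!!ta. En s (ph ta) <= 1" "!!ta k. cmod (ph ta k) <= 1"
  "!!t k. c t k = cis (- et * freq2 k * t) * (LINT ta|ms. ze t ta * ph ta k)"
  using repD[OF assms] by blast
 interpret finite_measure ms by fact
 note [measurable_cong] = *(1) and [measurable] = *(5,7)
 have "(%p. ze (fst p) (snd p) * ph (snd p) k) : borel_measurable (borel \<Otimes>\<^sub>M ms)" by measurable
 hence "(%t. \<integral>ta. ze t ta * ph ta k \<partial>ms) : bmeas"
  by (intro borel_measurable_lebesgue_integral) (simp add: case_prod_beta)
 thus ?thesis unfolding *(10) by measurable
qed

text \<open>The majorant is independent of \<open>t\<close> because the modulations
  \<open>ze\<close> are bounded by 1. This is stronger than a bound on \<open>En\<close> at each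
  time and later gives continuity in time by dominated convergence. Jensen's inequality on the
  finite measure turns the mass \<open>r\<close> into \<open>r^2\<close>.\<close>

lemma rep_dominated:
 assumes "rep et s r c" "0 <= s" "0 <= r"
 obtains D where "!!t k. cmod (c t k) <= D k" "!!k. 0 <= D k" "(SZ k. ennreal (wt s k * (D k)^2)) <= ennreal (r^2)"
proof -
 obtain ms :: "real measure" and ze ph where *: "sets ms = sets borel" "finite_measure ms" "space ms = UNIV" "emeasure ms UNIV <= ennreal r"
  "(%p. ze (fst p) (snd p)) : bmeas2" "!!t ta. cmod (ze t ta) <= 1"
  "!!k. (%ta. ph ta k) : bmeas" "!!ta. En s (ph ta) <= 1" "!!ta k. cmod (ph ta k) <= 1"
  "!!t k. c t k = cis (- et * freq2 k * t) * (LINT ta|ms. ze t ta * ph ta k)"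
  using repD[OF assms(1,2)] by blast
 interpret finite_measure ms by fact
 note [measurable_cong] = *(1) and [measurable] = *(5,7)
 define D where "D k = enn2real (NN ms (%ta. ennreal (cmod (ph ta k))))" for k
 have b1: "(NN ms (%ta. ennreal (cmod (ph ta k)))) <= (NN ms (%ta. 1))" for k using *(9) by (intro nn_integral_mono) simp
 have fin: "(NN ms (%ta. ennreal (cmod (ph ta k)))) < \<infinity>" for k proof -
  have "(NN ms (%ta. ennreal (cmod (ph ta k)))) <= ennreal r" using b1[of k] *(3,4) by simp
  also have "... < \<infinity>" by simp
  finally show ?thesis .
 qed
 have D: "ennreal (D k) = (NN ms (%ta. ennreal (cmod (ph ta k))))" for k unfolding D_def using fin[of k] by simp
 have 1: "cmod (c t k) <= D k" for t k
 proof -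
  have "ennreal (cmod (c t k)) = ennreal (cmod (LINT ta|ms. ze t ta * ph ta k))" by (simp add: *(10) norm_mult)
  also have "... <= (NN ms (%ta. ennreal (cmod (ze t ta * ph ta k))))" by (rule nn_norm_integral_le)
  also have "... <= (NN ms (%ta. ennreal (cmod (ph ta k))))"
   using *(6) by (intro nn_integral_mono ennreal_leI) (simp add: norm_mult mult_left_le_one_le)
  finally show ?thesis unfolding D[symmetric] by (subst (asm) ennreal_le_iff) (simp_all add: D_def)
 qed
 have "(SZ k. ennreal (wt s k * (D k)^2)) <= (SZ k. emeasure ms UNIV * (NN ms (%ta. ennreal (wt s k * (cmod (ph ta k))^2))))"
 proof (rule nn_integral_mono)
  fix k
  have "ennreal (wt s k * (D k)^2) = ennreal (wt s k) * (NN ms (%ta. ennreal (cmod (ph ta k))))^2"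
   unfolding D[symmetric] by (subst ennreal_power) (simp_all add: ennreal_mult D_def)
  also have "... <= ennreal (wt s k) * (emeasure ms UNIV * (NN ms (%ta. (ennreal (cmod (ph ta k)))^2)))"
   using nn_jensen[of "%ta. ennreal (cmod (ph ta k))" ms] *(3) by (intro mult_left_mono) auto
  also have "... = emeasure ms UNIV * (NN ms (%ta. ennreal (wt s k) * (ennreal (cmod (ph ta k)))^2))"
   by (subst nn_integral_cmult) (auto simp: mult_ac)
  also have "... = emeasure ms UNIV * (NN ms (%ta. ennreal (wt s k * (cmod (ph ta k))^2)))"
   by (simp add: ennreal_mult ennreal_power)
  finally show "ennreal (wt s k * (D k)^2) <= emeasure ms UNIV * (NN ms (%ta. ennreal (wt s k * (cmod (ph ta k))^2)))" .
 qed
 also have "... = emeasure ms UNIV * (SZ k. (NN ms (%ta. ennreal (wt s k * (cmod (ph ta k))^2))))" by (rule nn_integral_cmult) simp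
 also have "... = emeasure ms UNIV * (NN ms (%ta. En s (ph ta)))"
  unfolding En_def by (subst nn_integral_count_swap) auto
 also have "... <= emeasure ms UNIV * (NN ms (%ta. 1))" using *(8) by (intro mult_left_mono nn_integral_mono) auto
 also have "... <= ennreal r * ennreal r" using *(3,4) by (auto intro!: mult_mono)
 also have "... = ennreal (r^2)" using assms(3) by (simp add: ennreal_mult[symmetric] power2_eq_square)
 finally show ?thesis using that[of D] 1 by (auto simp: D_def)
qed

lemma rep_En:
 assumes "rep et s r c" "0 <= s" "0 <= r" shows "En s (c t) <= ennreal (r^2)"
proof -
 obtain D where D: "!!t k. cmod (c t k) <= D k" "!!k. 0 <= D k" "(SZ k. ennreal (wt s k * (D k)^2)) <= ennreal (r^2)"
  using rep_dominated[OF assms] by blast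
 have "En s (c t) <= (SZ k. ennreal (wt s k * (D k)^2))"
  unfolding En_def by (intro nn_integral_mono ennreal_leI mult_left_mono power_mono D) auto
 thus ?thesis using D(3) by simp
qed

lemma rep_mono: "rep et s r c ==> r <= r' ==> rep et s r' c"
 unfolding rep_def by (meson ennreal_leI order_trans)

lemma En_cmult: "En s (%k. z * a k) = sqn z * En s a"
 unfolding En_def by (subst nn_integral_cmult[symmetric]) (auto intro!: nn_integral_cong simp: norm_mult power_mult_distrib ennreal_mult[symmetric] mult_ac)

lemma En_multiplier_le:
 assumes "!!k. cmod (b k) <= cmod (a k)" shows "En s b <= En s a"
 unfolding En_def by (intro nn_integral_mono ennreal_leI mult_left_mono power_mono assms) auto

lemma rep_intro:
 fixes N :: "real measure"
 assumes s: "0 <= s" and N: "sets N = sets borel" and ro: "!!ta. 0 <= ro ta" and rom [measurable]: "ro : bmeas"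
  and mass: "(NN N (%ta. ennreal (ro ta))) <= ennreal r"
  and zem [measurable]: "(%p. ze (fst p) (snd p)) : bmeas2" and ze1: "!!t ta. cmod (ze t ta) <= 1"
  and phm [measurable]: "!!k. (%ta. ph ta k) : bmeas" and ph: "!!ta. En s (ph ta) <= ennreal ((ro ta)^2)"
  and c: "!!t k. c t k = cis (- et * freq2 k * t) * (LINT ta|N. ze t ta * ph ta k)"
 shows "rep et s r c"
proof -
 note [measurable_cong] = N
 define ms where "ms = density N (%ta. ennreal (ro ta))"
 define ph' where "ph' ta k = ph ta k / ro ta" for ta k
 have z: "ph ta k = ro ta *\<^sub>R ph' ta k" for ta k
  using En_le_cmod[OF s ro ph, of ta k] ro[of ta] by (cases "ro ta = 0") (auto simp: ph'_def scaleR_conv_of_real)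
 show ?thesis unfolding rep_def
 proof (intro exI[of _ ms] exI[of _ ze] exI[of _ ph'] conjI allI)
  show "sets ms = sets borel" by (simp add: ms_def N)
  show "emeasure ms UNIV <= ennreal r" using mass sets_eq_imp_space_eq[OF N]
   by (simp add: ms_def emeasure_density)
  show "(%ta. ph' ta k) : bmeas" for k unfolding ph'_def by measurable
  fix ta
  show "En s (ph' ta) <= 1"
  proof (cases "ro ta = 0")
   case True thus ?thesis by (simp add: ph'_def[abs_def] En_def)
  next
   case False
   have "ph' ta = (%k. (1 / of_real (ro ta)) * ph ta k)" by (simp add: ph'_def[abs_def])
   hence "En s (ph' ta) = sqn (1 / of_real (ro ta)) * En s (ph ta)" by (simp only: En_cmult)
   also have "... <= ennreal ((1 / ro ta)^2) * ennreal ((ro ta)^2)" using ro[of ta] ph[of ta] by (intro mult_mono) (auto simp: norm_divide)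
   also have "... = 1" using False by (simp add: ennreal_mult[symmetric] power_divide)
   finally show ?thesis .
  qed
 next
  fix t k
  have "(LINT ta|ms. ze t ta * ph' ta k) = (LINT ta|N. ro ta *\<^sub>R (ze t ta * ph' ta k))"
   unfolding ms_def
  proof (rule integral_density)
   have [measurable]: "(%ta. ze t ta) : bmeas"
    using measurable_compose[of "%ta. (t, ta)" borel "borel \<Otimes>\<^sub>M borel" "%p. ze (fst p) (snd p)" borel] by simp
   show "(%ta. ze t ta * ph' ta k) : borel_measurable N" unfolding ph'_def by measurable
  qed (use ro in auto)
  also have "... = (LINT ta|N. ze t ta * ph ta k)" by (intro bintegral_cong refl) (simp add: z)
  finally show "c t k = cis (- et * freq2 k * t) * (LINT ta|ms. ze t ta * ph' ta k)" by (simp add: c)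
 qed (use ze1 in auto)
qed

text \<open>The modulus of \<open>z\<close> scales the measure, and \<open>sgn z\<close> joins the
  modulation, where only a bound by 1 is required.\<close>

lemma rep_cmult:
 assumes "rep et s r c" "0 <= r" shows "rep et s (cmod z * r) (%t k. z * c t k)"
proof -
 from assms(1) obtain ms :: "real measure" and ze ph where *: "sets ms = sets borel" "emeasure ms UNIV <= ennreal r"
  "(%p. ze (fst p) (snd p)) : bmeas2" "!!t ta. cmod (ze t ta) <= 1"
  "!!k. (%ta. ph ta k) : bmeas" "!!ta. En s (ph ta) <= 1"
  "!!t k. c t k = cis (- et * freq2 k * t) * (LINT ta|ms. ze t ta * ph ta k)"
  unfolding rep_def by blast
 note [measurable] = *(3,5) and [measurable_cong] = *(1)
 define nv where "nv = density ms (%_. ennreal (cmod z))"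
 have m: "(%ta. ze t ta) : bmeas" for t
  using measurable_compose[of "%ta. (t, ta)" borel "borel \<Otimes>\<^sub>M borel" "%p. ze (fst p) (snd p)" borel] *(3) by simp
 have i: "(LINT ta|nv. sgn z * ze t ta * ph ta k) = z * (LINT ta|ms. ze t ta * ph ta k)" for t k
 proof -
  have "(LINT ta|nv. sgn z * ze t ta * ph ta k) = (LINT ta|ms. cmod z *\<^sub>R (sgn z * ze t ta * ph ta k))"
   unfolding nv_def by (rule integral_density) (use m in measurable)
  also have "... = (LINT ta|ms. z * (ze t ta * ph ta k))"
  proof -
   have "of_real (cmod z) * sgn z = z" by (cases "z = 0") (auto simp: sgn_div_norm scaleR_conv_of_real)
   thus ?thesis by (simp add: scaleR_conv_of_real mult.assoc[symmetric])
  qed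
  finally show ?thesis by simp
 qed
 show ?thesis unfolding rep_def
 proof (intro exI[of _ nv] exI[of _ "%t ta. sgn z * ze t ta"] exI[of _ ph] conjI allI)
  show "sets nv = sets borel" by (simp add: nv_def *(1))
  have "emeasure nv UNIV = ennreal (cmod z) * emeasure ms UNIV"
   using sets_eq_imp_space_eq[OF *(1)] by (simp add: nv_def emeasure_density nn_integral_cmult)
  also have "... <= ennreal (cmod z) * ennreal r" using *(2) by (rule mult_left_mono) simp
  finally show "emeasure nv UNIV <= ennreal (cmod z * r)" using assms(2) by (simp add: ennreal_mult)
  show "z * c t k = cis (- et * freq2 k * t) * (LINT ta|nv. sgn z * ze t ta * ph ta k)" for t k
   unfolding i *(7) by (simp add: mult_ac)
  show "cmod (sgn z * ze t ta) <= 1" for t ta using *(4)[of t ta] by (simp add: norm_mult norm_sgn)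
 qed (use * in auto)
qed

lemma En_cnj_reflect: "En s (%k. cnj (a (- k))) = En s a"
proof -
 have "bij_betw uminus UNIV (UNIV :: (lat) set)" by (rule bij_betw_byWitness[where f'=uminus]) auto
 from nn_integral_bij_count_space[OF this, of "%k. ennreal (wt s k * (cmod (a k))^2)"]
 show ?thesis by (simp add: En_def)
qed

text \<open>Conjugating a function conjugates and reflects its coefficients and reverses the
  flow.\<close>

lemma rep_cnj:
 assumes "rep et s r c" shows "rep (- et) s r (%t k. cnj (c t (- k)))"
proof -
 from assms(1) obtain ms :: "real measure" and ze ph where *: "sets ms = sets borel" "emeasure ms UNIV <= ennreal r"
  "(%p. ze (fst p) (snd p)) : bmeas2" "!!t ta. cmod (ze t ta) <= 1"
  "!!k. (%ta. ph ta k) : bmeas" "!!ta. En s (ph ta) <= 1"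
  "!!t k. c t k = cis (- et * freq2 k * t) * (LINT ta|ms. ze t ta * ph ta k)"
  unfolding rep_def by blast
 note [measurable] = *(3,5)
 have "cnj (c t (- k)) = cis (- (- et) * freq2 k * t) * (LINT ta|ms. cnj (ze t ta) * cnj (ph ta (- k)))" for t k
 proof -
  have "(LINT ta|ms. cnj (ze t ta) * cnj (ph ta (- k))) = cnj (LINT ta|ms. ze t ta * ph ta (- k))"
   unfolding complex_cnj_mult[symmetric]
   by (rule integral_bounded_linear'[OF bounded_linear_cnj bounded_linear_cnj]) simp
  thus ?thesis unfolding *(7) by (simp add: cis_cnj)
 qed
 thus ?thesis unfolding rep_def
  by (intro exI[of _ ms] exI[of _ "%t ta. cnj (ze t ta)"] exI[of _ "%ta k. cnj (ph ta (- k))"] conjI allI)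
   (use * in \<open>auto simp: En_cnj_reflect\<close>)
qed

section \<open>The bilinear estimate\<close>

lemma nn_integral_CZ_translate: "(SZ k. f (k - l)) = (SZ k. f k)"
proof -
 have "bij_betw (%k. k - l) UNIV (UNIV :: (lat) set)"
  by (rule bij_betw_byWitness[where f'="%k. k + l"]) auto
 thus ?thesis by (rule nn_integral_bij_count_space)
qed

text \<open>For fixed profiles of both factors the product is a sum over \<open>l\<close> with
  integer phase \<open>nrm2 l + et * nrm2 (k - l)\<close>, to which orthogonality in time applies;
  superpositions follow by Jensen's inequality over the product of the parameter measures. The index
  \<open>n\<close> carries a whole family of multipliers, whose squares are summed before they are
  bounded, as a square function demands. The bound on level sets is asked for only at those
  \<open>k\<close> where some multiplier is nonzero, so that \<open>k = 0\<close> can be left out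
  when the level sets are lines.\<close>

lemma bilinear_estimate:
 fixes A :: "'n::countable => lat => lat => complex" and et :: int
 assumes s: "0 <= s" and S: "0 <= S" and CA: "0 <= CA" and rq: "0 <= r" "0 <= q"
  and sum: "!!k M. (\<exists>n l. A n k l ~= 0) ==>
    (SZ l. ennreal (1 / kap d k l) * ind {l. nrm2 l + et * nrm2 (k - l) = M} l) <= ennreal S"
  and A: "!!k l. (SU n. sqn (A n k l)) * ennreal (kap d k l) <= ennreal (CA * wt s l * wt s (k - l))"
  and Abd: "!!n k. \<exists>B. \<forall>l. cmod (A n k l) <= B"
  and c: "rep 1 s r c" and d: "rep (of_int et) s q d'"
 shows "(IT t. (SU n. (SZ k. sqn (LINT l|CZ. A n k l * (c t l * d' t (k - l))))))
  <= ennreal (T0 * S * CA * (r * q)^2)"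
proof -
 obtain ms :: "real measure" and ze ph where m: "sets ms = sets borel" "finite_measure ms" "space ms = UNIV" "emeasure ms UNIV <= ennreal r"
  "(%p. ze (fst p) (snd p)) : bmeas2" "!!t ta. cmod (ze t ta) <= 1"
  "!!k. (%ta. ph ta k) : bmeas" "!!ta. En s (ph ta) <= 1" "!!ta k. cmod (ph ta k) <= 1"
  "!!t k. c t k = cis (- 1 * freq2 k * t) * (LINT ta|ms. ze t ta * ph ta k)"
  using repD[OF c s] by blast
 obtain nv :: "real measure" and ze' py where n: "sets nv = sets borel" "finite_measure nv" "space nv = UNIV" "emeasure nv UNIV <= ennreal q"
  "(%p. ze' (fst p) (snd p)) : bmeas2" "!!t ta. cmod (ze' t ta) <= 1"
  "!!k. (%ta. py ta k) : bmeas" "!!ta. En s (py ta) <= 1" "!!ta k. cmod (py ta k) <= 1"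
  "!!t k. d' t k = cis (- of_int et * freq2 k * t) * (LINT ta|nv. ze' t ta * py ta k)"
  using repD[OF d s] by blast
 interpret M: finite_measure ms by fact
 interpret N: finite_measure nv by fact
 interpret MN: pair_sigma_finite ms nv by unfold_locales
 note [measurable_cong] = m(1) n(1) and [measurable] = m(5,7) n(5,7)
 have mt [measurable]: "(%ta. ze t ta) : bmeas" "(%ta. ze' t ta) : bmeas" for t
  using measurable_compose[of "%ta. (t, ta)" borel "borel \<Otimes>\<^sub>M borel" "%p. ze (fst p) (snd p)" borel] m(5)
   measurable_compose[of "%ta. (t, ta)" borel "borel \<Otimes>\<^sub>M borel" "%p. ze' (fst p) (snd p)" borel] n(5) by simp_all
 define pj where "pj = ms \<Otimes>\<^sub>M nv"
 have spj [measurable_cong]: "sets pj = sets (borel \<Otimes>\<^sub>M borel)" unfolding pj_def by (rule sets_pair_measure_cong[OF m(1) n(1)])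
 have sppj: "space pj = UNIV" by (simp add: pj_def space_pair_measure m(3) n(3))
 have "emeasure pj UNIV = emeasure ms UNIV * emeasure nv UNIV"
 proof -
  have "emeasure pj (UNIV \<times> UNIV) = emeasure ms UNIV * emeasure nv UNIV" unfolding pj_def
   by (rule N.emeasure_pair_measure_Times) (use sets.top[of ms] sets.top[of nv] m(3) n(3) in auto)
  thus ?thesis by simp
 qed
 also have "... <= ennreal r * ennreal q" by (intro mult_mono m n) auto
 finally have pjU: "emeasure pj UNIV <= ennreal (r * q)" using rq by (simp add: ennreal_mult)
 interpret P: finite_measure pj
  by (rule finite_measureI) (use pjU sppj in \<open>auto simp: top_unique\<close>)
 interpret CP: pair_sigma_finite CZ pj
  by (intro pair_sigma_finite.intro sigma_finite_measure_count_space_countable P.sigma_finite_measure_axioms) simp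
 define Ph where "Ph k l = nrm2 l + et * nrm2 (k - l)" for k l
 define w where "w k t l = cis (- (4 * pi^2 * of_int (Ph k l) * t))" for k t l
 have w1: "cmod (w k t l) = 1" for k t l by (simp add: w_def)
 have wm [measurable]: "(%t. w k t l) : bmeas" for k l unfolding w_def by measurable
 define Fy where "Fy k x l = ph (fst x) l * py (snd x) (k - l)" for k l and x :: "real \<times> real"
 have Fym [measurable]: "(%x. Fy k x l) : bmeas2" for k l unfolding Fy_def by measurable
 define X where "X t x = ze t (fst x) * ze' t (snd x)" for t and x :: "real \<times> real"
 have Xm [measurable]: "X t : bmeas2" for t unfolding X_def by measurable
 have X1: "cmod (X t x) <= 1" for t x unfolding X_def norm_mult using m(6) n(6) by (simp add: mult_le_one)
 \<comment> \<open>The product for one pair of parameters, stripped of its modulations: only the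
   phases \<open>w\<close> depend on \<open>t\<close>.\<close>
 define G where "G n k t x = (LINT l|CZ. A n k l * (w k t l * Fy k x l))" for n k t x
 have Gm [measurable]: "(%p. G n k (fst p) (snd p)) : borel_measurable (borel \<Otimes>\<^sub>M (borel \<Otimes>\<^sub>M borel))" for n k
  unfolding G_def by measurable
 have prod: "c t l * d' t (k - l) = w k t l * (LINT x|pj. X t x * Fy k x l)" for t k l
 proof -
  have i: "integrable pj (%x. (ze t (fst x) * ph (fst x) l) * (ze' t (snd x) * py (snd x) (k - l)))"
   by (rule P.integrable_const_bound[where B=1])
    (measurable, intro AE_I2, auto simp: norm_mult intro!: mult_le_one m(6,9) n(6,9))
  have "(LINT x|pj. X t x * Fy k x l) = (LINT x|pj. (ze t (fst x) * ph (fst x) l) * (ze' t (snd x) * py (snd x) (k - l)))"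
   by (simp add: X_def Fy_def mult_ac)
  also have "... = (LINT ta|ms. (LINT si|nv. (ze t ta * ph ta l) * (ze' t si * py si (k - l))))"
   using MN.integral_fst'[OF i[unfolded pj_def]] by (simp add: pj_def)
  also have "... = (LINT ta|ms. ze t ta * ph ta l) * (LINT si|nv. ze' t si * py si (k - l))" by simp
  finally have "(LINT x|pj. X t x * Fy k x l) = (LINT ta|ms. ze t ta * ph ta l) * (LINT si|nv. ze' t si * py si (k - l))" .
  moreover have "w k t l = cis (- 1 * freq2 l * t) * cis (- of_int et * freq2 (k - l) * t)"
   by (simp add: w_def Ph_def freq2_nrm2 cis_mult algebra_simps)
  ultimately show ?thesis unfolding m(10) n(10) by (simp add: mult_ac)
 qed
 have nnFy: "(SZ l. ennreal (cmod (Fy k x l))) <= 2" for k x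
 proof -
  have "(SZ l. ennreal (cmod (Fy k x l))) <= (SZ l. sqn (ph (fst x) l) + sqn (py (snd x) (k - l)))"
  proof (rule nn_integral_mono)
   fix l
   define a b where "a = cmod (ph (fst x) l)" and "b = cmod (py (snd x) (k - l))"
   have "0 <= a * b" "2 * (a * b) <= a^2 + b^2" using sum_squares_bound[of a b] by (simp_all add: a_def b_def mult.assoc)
   hence "a * b <= a^2 + b^2" by linarith
   thus "ennreal (cmod (Fy k x l)) <= sqn (ph (fst x) l) + sqn (py (snd x) (k - l))"
    by (simp add: Fy_def norm_mult a_def b_def ennreal_plus[symmetric] ennreal_leI del: ennreal_plus)
  qed
  also have "... = En 0 (ph (fst x)) + En 0 (py (snd x))"
   by (subst nn_integral_add) (auto simp: En_0 nn_integral_CZ_reflect[of "%l. sqn (py (snd x) l)"])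
  also have "... <= 1 + 1" by (rule add_mono[OF order_trans[OF En_mono[OF s] m(8)] order_trans[OF En_mono[OF s] n(8)]])
  finally show ?thesis by simp
 qed
 have claim: "(LINT l|CZ. A n k l * (c t l * d' t (k - l))) = (LINT x|pj. X t x * G n k t x)" for n k t
 proof -
  define f where "f l x = A n k l * (w k t l * (X t x * Fy k x l))" for l x
  obtain B where B: "!!l. cmod (A n k l) <= B" using Abd by blast
  have B0: "B >= 0" using B[of 0] norm_ge_zero order_trans by blast
  have fm: "(%p. f (fst p) (snd p)) : borel_measurable (CZ \<Otimes>\<^sub>M pj)"
   by (rule measurable_pair_measure_countable1) (auto simp: f_def)
  have "(\<integral>\<^sup>+p. ennreal (norm (f (fst p) (snd p))) \<partial>(CZ \<Otimes>\<^sub>M pj)) = (SZ l. (NN pj (%x. ennreal (norm (f l x)))))"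
   using P.nn_integral_fst[of "%p. ennreal (norm (f (fst p) (snd p)))" CZ] fm by simp
  also have "... = (NN pj (%x. (SZ l. ennreal (norm (f l x)))))"
   by (rule nn_integral_count_swap) (auto simp: f_def)
  also have "... <= (NN pj (%x. ennreal B * 2))"
  proof (rule nn_integral_mono)
   fix x
   have "(SZ l. ennreal (norm (f l x))) <= (SZ l. ennreal B * ennreal (cmod (Fy k x l)))"
   proof (rule nn_integral_mono)
    fix l
    have "cmod (A n k l) * (cmod (X t x) * cmod (Fy k x l)) <= B * (1 * cmod (Fy k x l))"
     using B X1 B0 by (intro mult_mono) auto
    thus "ennreal (norm (f l x)) <= ennreal B * ennreal (cmod (Fy k x l))"
     using B0 by (simp add: f_def norm_mult w1 ennreal_mult[symmetric] ennreal_leI)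
   qed
   also have "... <= ennreal B * 2" by (subst nn_integral_cmult) (auto intro!: mult_left_mono nnFy)
   finally show "(SZ l. ennreal (norm (f l x))) <= ennreal B * 2" .
  qed
  also have "... < \<infinity>" using pjU sppj by (simp add: ennreal_mult_less_top le_less_trans)
  finally have fi: "integrable (CZ \<Otimes>\<^sub>M pj) (%p. f (fst p) (snd p))" using fm by (intro integrableI_bounded) auto
  have "(LINT l|CZ. A n k l * (c t l * d' t (k - l))) = (LINT l|CZ. (LINT x|pj. f l x))"
   unfolding prod f_def by simp
  also have "... = (LINT x|pj. (LINT l|CZ. f l x))"
  proof -
   have "integrable (CZ \<Otimes>\<^sub>M pj) (case_prod f)" using fi by (simp add: case_prod_beta')
   from CP.Fubini_integral[OF this] show ?thesis by simp
  qed
  also have "... = (LINT x|pj. X t x * G n k t x)"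
   unfolding G_def f_def by (simp flip: integral_mult_right_zero add: mult_ac)
  finally show ?thesis .
 qed
 define H where "H n k t x = sqn (G n k t x)" for n k t x
 have Hm [measurable]: "(%p. H n k (fst p) (snd p)) : borel_measurable (borel \<Otimes>\<^sub>M (borel \<Otimes>\<^sub>M borel))" for n k
  unfolding H_def by measurable
 have Gt [measurable]: "(%x. G n k t x) : bmeas2" "(%t. G n k t x) : bmeas" for n k t x
  unfolding G_def by measurable
 \<comment> \<open>The modulations disappear by absolute values before the time integral is taken;
   Jensen's inequality then moves the square inside the parameter integral at the cost of one factor
   \<open>r * q\<close>.\<close>
 have bound1: "sqn (LINT l|CZ. A n k l * (c t l * d' t (k - l))) <= ennreal (r * q) * (NN pj (%x. H n k t x))" for n k t
 proof -
  have "ennreal (cmod (LINT l|CZ. A n k l * (c t l * d' t (k - l)))) <= (NN pj (%x. ennreal (cmod (X t x * G n k t x))))"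
   unfolding claim by (rule nn_norm_integral_le)
  also have "... <= (NN pj (%x. ennreal (cmod (G n k t x))))"
   using X1 by (intro nn_integral_mono ennreal_leI) (simp add: norm_mult mult_left_le_one_le)
  finally have "(ennreal (cmod (LINT l|CZ. A n k l * (c t l * d' t (k - l)))))^2 <= (NN pj (%x. ennreal (cmod (G n k t x))))^2"
   by (rule power_mono) simp
  also have "... <= emeasure pj (space pj) * (NN pj (%x. (ennreal (cmod (G n k t x)))^2))" by (rule nn_jensen) measurable
  also have "... <= ennreal (r * q) * (NN pj (%x. H n k t x))"
   using pjU sppj by (intro mult_mono) (auto simp: H_def ennreal_power)
  finally show ?thesis by (simp add: ennreal_power)
 qed
 define Y where "Y n k x l = ennreal (kap d k l * (cmod (A n k l * Fy k x l))^2)" for n k x l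
 have Ym [measurable]: "(%x. Y n k x l) : bmeas2" for n k l unfolding Y_def by measurable
 have bound2: "(IT t. H n k t x) <= ennreal (T0 * S) * (SZ l. Y n k x l)" for n k x
 proof (cases "\<exists>n l. A n k l ~= 0")
  case False
  hence "A n k l = 0" for l by blast
  thus ?thesis by (simp add: H_def G_def)
 next
  case True
  obtain B where B: "!!l. cmod (A n k l) <= B" using Abd by blast
  have B0: "B >= 0" using B[of 0] norm_ge_zero order_trans by blast
  have "(SZ l. ennreal (cmod (A n k l * Fy k x l))) <= (SZ l. ennreal B * ennreal (cmod (Fy k x l)))"
   using B B0 by (intro nn_integral_mono) (simp add: norm_mult ennreal_mult[symmetric] ennreal_leI mult_right_mono)
  also have "... <= ennreal B * 2" by (subst nn_integral_cmult) (auto intro!: mult_left_mono nnFy)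
  also have "... < \<infinity>" by (simp add: ennreal_mult_less_top)
  finally have fin: "(SZ l. ennreal (cmod (A n k l * Fy k x l))) < \<infinity>" .
  have "G n k t x = (LINT l|CZ. (A n k l * Fy k x l) * cis (- (4 * pi^2 * of_int (Ph k l) * t)))" for t
   by (simp add: G_def w_def mult_ac)
  thus ?thesis unfolding H_def Y_def
   using time_orthogonality[where ka="kap d k" and P="Ph k", OF fin S kap_pos] sum[OF True] by (simp add: Ph_def)
 qed
 \<comment> \<open>The hypothesis on the multipliers compensates \<open>kap\<close> and leaves the
   product of the energies of two unit profiles.\<close>
 have bound3: "(SZ k. (SZ l. (SU n. Y n k x l))) <= ennreal CA" for x
 proof -
  have "(SZ k. (SZ l. (SU n. Y n k x l))) <=
   (SZ k. (SZ l. ennreal CA * (ennreal (wt s l * (cmod (ph (fst x) l))^2) * ennreal (wt s (k - l) * (cmod (py (snd x) (k - l)))^2))))"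
  proof (intro nn_integral_mono)
   fix k l
   have "(SU n. Y n k x l) = (SU n. sqn (A n k l) * (ennreal (kap d k l) * sqn (Fy k x l)))"
    unfolding Y_def by (intro nn_integral_cong) (simp add: norm_mult power_mult_distrib ennreal_mult[symmetric] less_imp_le mult_ac)
   also have "... = (SU n. sqn (A n k l)) * ennreal (kap d k l) * sqn (Fy k x l)"
    by (subst nn_integral_multc) (auto simp: mult_ac)
   also have "... <= ennreal (CA * wt s l * wt s (k - l)) * sqn (Fy k x l)" by (rule mult_right_mono[OF A]) simp
   also have "... = ennreal CA * (ennreal (wt s l * (cmod (ph (fst x) l))^2) * ennreal (wt s (k - l) * (cmod (py (snd x) (k - l)))^2))"
    using CA by (simp add: Fy_def norm_mult power_mult_distrib ennreal_mult[symmetric] mult_ac)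
   finally show "(SU n. Y n k x l) <= ennreal CA * (ennreal (wt s l * (cmod (ph (fst x) l))^2) * ennreal (wt s (k - l) * (cmod (py (snd x) (k - l)))^2))" .
  qed
  also have "... = (SZ l. (SZ k. ennreal CA * (ennreal (wt s l * (cmod (ph (fst x) l))^2) * ennreal (wt s (k - l) * (cmod (py (snd x) (k - l)))^2))))"
   by (rule nn_integral_count_swap) simp
  also have "... = (SZ l. ennreal CA * (ennreal (wt s l * (cmod (ph (fst x) l))^2) * En s (py (snd x))))"
   by (simp add: nn_integral_cmult nn_integral_CZ_translate[of "%k. ennreal (wt s k * (cmod (py (snd x) k))^2)"] En_def)
  also have "... = ennreal CA * (En s (ph (fst x)) * En s (py (snd x)))"
   by (simp add: nn_integral_cmult nn_integral_multc En_def)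
  also have "... <= ennreal CA * (1 * 1)" by (intro mult_left_mono mult_mono m n) auto
  finally show ?thesis by simp
 qed
 have "(IT t. (SU n. (SZ k. sqn (LINT l|CZ. A n k l * (c t l * d' t (k - l))))))
  <= (IT t. (SU n. (SZ k. ennreal (r * q) * (NN pj (%x. H n k t x)))))"
  by (intro nn_integral_mono bound1)
 also have "... = (SU n. (SZ k. (IT t. ennreal (r * q) * (NN pj (%x. H n k t x)))))"
 proof -
  have [measurable]: "(%t. \<integral>\<^sup>+x. H n k t x \<partial>pj) : bmeas" for n k
  proof -
   have "(%p. H n k (fst p) (snd p)) : borel_measurable (borel \<Otimes>\<^sub>M pj)" by measurable
   thus ?thesis by (intro P.borel_measurable_nn_integral) (simp add: case_prod_beta)
  qed
  show ?thesis
   by (subst nn_integral_count_swap[symmetric], measurable, intro nn_integral_cong, subst nn_integral_count_swap[symmetric], measurable)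
 qed
 also have "... = (SU n. (SZ k. ennreal (r * q) * (NN pj (%x. (IT t. H n k t x)))))"
 proof (intro nn_integral_cong)
  fix n k
  interpret I: finite_measure "ivl 0 T0" using T0_pos by (intro finite_ivl) simp
  interpret IP: pair_sigma_finite "ivl 0 T0" pj by unfold_locales
  have [measurable]: "(%t. \<integral>\<^sup>+x. H n k t x \<partial>pj) : bmeas"
  proof -
   have "(%p. H n k (fst p) (snd p)) : borel_measurable (borel \<Otimes>\<^sub>M pj)" by measurable
   thus ?thesis by (intro P.borel_measurable_nn_integral) (simp add: case_prod_beta)
  qed
  have "(%(t, x). H n k t x) : borel_measurable (ivl 0 T0 \<Otimes>\<^sub>M pj)" using Hm[of n k] by (simp add: case_prod_beta) measurable
  from IP.Fubini'[OF this] show "(IT t. ennreal (r * q) * (NN pj (%x. H n k t x))) = ennreal (r * q) * (NN pj (%x. (IT t. H n k t x)))"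
   by (subst nn_integral_cmult) auto
 qed
 also have "... <= (SU n. (SZ k. ennreal (r * q) * (NN pj (%x. ennreal (T0 * S) * (SZ l. Y n k x l)))))"
  by (intro nn_integral_mono mult_left_mono bound2) auto
 also have "... = ennreal (r * q) * (ennreal (T0 * S) * (SU n. (SZ k. (NN pj (%x. (SZ l. Y n k x l))))))"
  by (simp add: nn_integral_cmult)
 also have "(SU n. (SZ k. (NN pj (%x. (SZ l. Y n k x l))))) = (NN pj (%x. (SZ k. (SZ l. (SU n. Y n k x l)))))"
 proof -
  have "(SU n. (SZ k. (NN pj (%x. (SZ l. Y n k x l))))) = (SU n. (NN pj (%x. (SZ k. (SZ l. Y n k x l)))))"
   by (intro nn_integral_cong nn_integral_count_swap) measurable
  also have "... = (NN pj (%x. (SU n. (SZ k. (SZ l. Y n k x l)))))"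
   by (rule nn_integral_count_swap) measurable
  also have "... = (NN pj (%x. (SZ k. (SU n. (SZ l. Y n k x l)))))"
   by (intro nn_integral_cong nn_integral_count_swap) measurable
  also have "... = (NN pj (%x. (SZ k. (SZ l. (SU n. Y n k x l)))))"
   by (intro nn_integral_cong nn_integral_count_swap) measurable
  finally show ?thesis .
 qed
 also have "(NN pj (%x. (SZ k. (SZ l. (SU n. Y n k x l))))) <= (NN pj (%x. ennreal CA))"
  by (intro nn_integral_mono bound3)
 also have "(NN pj (%x. ennreal CA)) <= ennreal CA * ennreal (r * q)" using pjU sppj by (simp add: mult_left_mono)
 also have "ennreal (r * q) * (ennreal (T0 * S) * (ennreal CA * ennreal (r * q))) = ennreal (T0 * S * CA * (r * q)^2)"
  using rq S CA T0_pos by (simp add: ennreal_mult[symmetric] power2_eq_square mult_ac)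
 finally show ?thesis by (simp add: mult_left_mono)
qed

section \<open>Pointwise inequalities for the power nonlinearity\<close>

text \<open>For \<open>be < 1\<close> the derivative of the power is singular at 0. The factor
  \<open>y\<close> compensates, since \<open>z powr (be - 1) * y <= z powr be\<close> at the
  intermediate point.\<close>

lemma powr_diff_mult_le:
 fixes x y be :: real
 assumes "0 <= y" "y <= x" "0 <= be"
 shows "(x powr be - y powr be) * y <= be * x powr be * (x - y)"
proof (cases "y = 0 \<or> y = x")
 case True thus ?thesis using assms by auto
next
 case False
 hence y: "0 < y" "y < x" using assms by auto
 have "\<exists>z. y < z & z < x & x powr be - y powr be = (x - y) * (be * z powr (be - 1))"
  using y by (intro MVT2) (auto intro!: derivative_eq_intros)
 then obtain z where z: "y < z" "z < x" "x powr be - y powr be = (x - y) * (be * z powr (be - 1))" by blast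
 have "z powr (be - 1) * y <= z powr (be - 1) * z" using z y by (intro mult_left_mono) auto
 also have "... = z powr be" using z y by (simp add: powr_diff)
 also have "... <= x powr be" using z y assms by (intro powr_mono2) auto
 finally have "(x - y) * be * (z powr (be - 1) * y) <= (x - y) * be * x powr be" using y assms by (intro mult_left_mono) auto
 thus ?thesis by (simp add: z(3) mult_ac)
qed

text \<open>Up to a constant this is the gradient of the modulus to the power \<open>be + 2\<close>.
  Its Lipschitz bound holds for every \<open>be >= 0\<close> if the change of modulus is multiplied
  by the smaller of the two numbers.\<close>

lemma cmod_powr_mult_lipschitz:
 fixes be :: real
 assumes be: "0 <= be" and M: "cmod z <= M" "cmod z' <= M"
 shows "cmod (of_real (cmod z powr be) * z - of_real (cmod z' powr be) * z') <= (1 + be) * M powr be * cmod (z - z')"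
proof -
 have *: "cmod (of_real (cmod z powr be) * z - of_real (cmod z' powr be) * z') <= (1 + be) * M powr be * cmod (z - z')"
  if le: "cmod z' <= cmod z" and zM: "cmod z <= M" for z z'
 proof -
  have "of_real (cmod z powr be) * z - of_real (cmod z' powr be) * z' = of_real (cmod z powr be) * (z - z') + of_real (cmod z powr be - cmod z' powr be) * z'"
   by (simp add: algebra_simps)
  also have "cmod ... <= cmod z powr be * cmod (z - z') + \<bar>cmod z powr be - cmod z' powr be\<bar> * cmod z'"
   by (rule order_trans[OF norm_triangle_ineq]) (simp add: norm_mult del: of_real_diff)
  also have "\<bar>cmod z powr be - cmod z' powr be\<bar> = cmod z powr be - cmod z' powr be"
   using powr_mono2[OF be norm_ge_zero le] by simp
  also have "(cmod z powr be - cmod z' powr be) * cmod z' <= be * cmod z powr be * (cmod z - cmod z')"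
   by (rule powr_diff_mult_le) (use le be in auto)
  also have "... <= be * cmod z powr be * cmod (z - z')"
   using be norm_triangle_ineq2[of z z'] by (intro mult_left_mono) auto
  also have "cmod z powr be * cmod (z - z') + be * cmod z powr be * cmod (z - z') = (1 + be) * cmod z powr be * cmod (z - z')"
   by (simp add: algebra_simps)
  also have "... <= (1 + be) * M powr be * cmod (z - z')"
   using be powr_mono2[OF be norm_ge_zero zM] by (intro mult_right_mono mult_left_mono) auto
  finally show ?thesis by simp
 qed
 show ?thesis
 proof (cases "cmod z' <= cmod z")
  case True thus ?thesis using * M by blast
 next
  case False thus ?thesis using *[of z z'] M by (simp add: norm_minus_commute)
 qed
qed

text \<open>Away from zeros this is a power of a positive quadratic polynomial. At a zero the
  difference quotient is of order \<open>h powr (af - 1)\<close>, so the derivative exists and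
  vanishes, in agreement with the formula.\<close>

lemma deriv_cmod_powr:
 fixes af :: real and z e :: complex
 assumes af: "2 <= af"
 shows "((%te. cmod (z + of_real te * e) powr af) has_real_derivative
  af * cmod (z + of_real te * e) powr (af - 2) * Re (cnj (z + of_real te * e) * e)) (at te)"
proof (cases "z + of_real te * e = 0")
 case False
 define N where "N t = (cmod (z + of_real t * e))^2" for t
 have N: "N t = (Re z + t * Re e)^2 + (Im z + t * Im e)^2" for t by (simp add: N_def cmod_power2)
 have N0: "N te > 0" using False by (simp add: N_def)
 define R where "R = Re (cnj (z + of_real te * e) * e)"
 have D: "(N has_real_derivative 2 * R) (at te)"
  unfolding N R_def by (auto intro!: derivative_eq_intros simp: algebra_simps)
 have eq: "cmod (z + of_real t * e) powr af = N t powr (af/2)" for t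
  by (simp add: N_def powr_powr flip: powr_numeral)
 have "((%t. N t powr (af/2)) has_real_derivative (af/2) * N te powr (af/2 - 1) * (2 * R)) (at te)"
  using D N0 by (auto intro!: derivative_eq_intros)
 moreover have "N te powr (af/2 - 1) = cmod (z + of_real te * e) powr (af - 2)"
  by (simp add: N_def powr_powr diff_divide_distrib flip: powr_numeral)
 ultimately show ?thesis unfolding eq R_def[symmetric] by (simp add: mult_ac)
next
 case True
 have eq: "z + of_real (te + h) * e = of_real h * e" for h using True by (simp add: algebra_simps)
 have "((%h. (cmod (z + of_real (te + h) * e) powr af - cmod (z + of_real te * e) powr af) / h) \<longlongrightarrow> 0) (at 0)"
 proof (rule Lim_null_comparison)
  have "((%h::real. \<bar>h\<bar> * cmod e powr af) \<longlongrightarrow> \<bar>0\<bar> * cmod e powr af) (at 0)" by (intro tendsto_intros)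
  thus "((%h::real. \<bar>h\<bar> * cmod e powr af) \<longlongrightarrow> 0) (at 0)" by simp
  have "norm ((cmod (z + of_real (te + h) * e) powr af - cmod (z + of_real te * e) powr af) / h) <= \<bar>h\<bar> * cmod e powr af"
   if h: "h ~= 0" "\<bar>h\<bar> < 1" for h
  proof -
   have "\<bar>h\<bar> powr af <= \<bar>h\<bar> powr 2" using h af by (intro powr_mono') auto
   also have "... = \<bar>h\<bar> * \<bar>h\<bar>" using h by (simp add: power2_eq_square)
   finally have "\<bar>h\<bar> powr af / \<bar>h\<bar> <= \<bar>h\<bar>" using h by (simp add: divide_le_eq)
   hence "\<bar>h\<bar> powr af / \<bar>h\<bar> * cmod e powr af <= \<bar>h\<bar> * cmod e powr af" by (rule mult_right_mono) simp
   thus ?thesis unfolding eq True by (simp add: norm_mult powr_mult)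
  qed
  thus "eventually (%h. norm ((cmod (z + of_real (te + h) * e) powr af - cmod (z + of_real te * e) powr af) / h) <= \<bar>h\<bar> * cmod e powr af) (at 0)"
   unfolding eventually_at by (intro exI[of _ 1]) auto
 qed
 thus ?thesis using True by (simp add: DERIV_def)
qed

text \<open>Here \<open>a\<close>, \<open>b\<close> are values of one function at two points, and
  \<open>ea\<close>, \<open>eb\<close> those of a perturbation. The mixed difference has to gain
  both the size \<open>q\<close> and one difference in space without two derivatives of the power.
  The mean value theorem along the perturbation yields \<open>q\<close>; the gradient then changes
  between the two points according to its Lipschitz bound.\<close>

lemma four_point:
 fixes af q :: real
 assumes af: "2 <= af" and q: "0 <= q" and a': "a' = a + of_real q * ea" and b': "b' = b + of_real q * eb"
  and M: "cmod a <= M" "cmod a' <= M" "cmod b <= M" "cmod b' <= M" "cmod eb <= M"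
 shows "\<bar>(cmod b' powr af - cmod b powr af) - (cmod a' powr af - cmod a powr af)\<bar>
  <= q * af^2 * M powr (af - 1) * (cmod (b - a) + cmod (b' - a') + cmod (eb - ea))"
proof -
 define za where "za te = a + of_real te * (of_real q * ea)" for te
 define zb where "zb te = b + of_real te * (of_real q * eb)" for te
 define F where "F te = cmod (zb te) powr af - cmod (za te) powr af" for te
 define F' where "F' te = af * cmod (zb te) powr (af - 2) * Re (cnj (zb te) * (of_real q * eb)) - af * cmod (za te) powr (af - 2) * Re (cnj (za te) * (of_real q * ea))" for te
 have "\<exists>xe. 0 < xe & xe < 1 & F 1 - F 0 = (1 - 0) * F' xe"
 proof (rule MVT2)
  fix x show "(F has_real_derivative F' x) (at x)"
   unfolding F_def F'_def za_def zb_def by (intro DERIV_diff deriv_cmod_powr af)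
 qed simp
 then obtain xe where xe: "0 < xe" "xe < 1" "F 1 - F 0 = F' xe" by auto
 have M0: "0 <= M" using M(1) norm_ge_zero order_trans by blast
 have conva: "za xe = (1 - xe) *\<^sub>R a + xe *\<^sub>R a'" and convb: "zb xe = (1 - xe) *\<^sub>R b + xe *\<^sub>R b'"
  by (simp_all add: za_def zb_def a' b' scaleR_conv_of_real algebra_simps)
 have cm: "cmod ((1 - xe) *\<^sub>R x + xe *\<^sub>R y) <= M" if "cmod x <= M" "cmod y <= M" for x y
 proof -
  have "cmod ((1 - xe) *\<^sub>R x + xe *\<^sub>R y) <= (1 - xe) * cmod x + xe * cmod y" using xe by (intro order_trans[OF norm_triangle_ineq]) simp
  also have "... <= (1 - xe) * M + xe * M" using xe that by (intro add_mono mult_left_mono) auto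
  finally show ?thesis by (simp add: algebra_simps)
 qed
 have zM: "cmod (za xe) <= M" "cmod (zb xe) <= M" unfolding conva convb using cm M by auto
 define g where "g z = of_real (cmod z powr (af - 2)) * z" for z
 have g1: "cmod (g z) <= M powr (af - 1)" if "cmod z <= M" for z
 proof -
  have "cmod (g z) = cmod z powr (af - 2) * cmod z powr 1" by (simp add: g_def norm_mult)
  also have "... = cmod z powr (af - 1)" by (simp only: powr_add[symmetric]) simp
  also have "... <= M powr (af - 1)" using that af by (intro powr_mono2) auto
  finally show ?thesis .
 qed
 have dz: "cmod (zb xe - za xe) <= cmod (b - a) + cmod (b' - a')"
 proof -
  have "zb xe - za xe = (1 - xe) *\<^sub>R (b - a) + xe *\<^sub>R (b' - a')" unfolding conva convb by (simp add: algebra_simps)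
  also have "cmod ... <= (1 - xe) * cmod (b - a) + xe * cmod (b' - a')" using xe by (intro order_trans[OF norm_triangle_ineq]) simp
  also have "... <= 1 * cmod (b - a) + 1 * cmod (b' - a')" using xe by (intro add_mono mult_right_mono) auto
  finally show ?thesis by simp
 qed
 define Rr where "Rr = Re (cnj (g (zb xe) - g (za xe)) * eb + cnj (g (za xe)) * (eb - ea))"
 have "F' xe = q * af * Rr"
  by (simp add: F'_def g_def Rr_def algebra_simps)
 hence F'1: "\<bar>F' xe\<bar> = q * af * \<bar>Rr\<bar>" using q af by (simp add: abs_mult)
 have "\<bar>Rr\<bar> <= cmod (cnj (g (zb xe) - g (za xe)) * eb + cnj (g (za xe)) * (eb - ea))"
  unfolding Rr_def by (rule abs_Re_le_cmod)
 also have "... <= cmod (g (zb xe) - g (za xe)) * cmod eb + cmod (g (za xe)) * cmod (eb - ea)"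
  by (rule order_trans[OF norm_triangle_ineq]) (simp add: norm_mult del: complex_cnj_diff)
 also have "... <= ((1 + (af - 2)) * M powr (af - 2) * cmod (zb xe - za xe)) * M + M powr (af - 1) * cmod (eb - ea)"
  using cmod_powr_mult_lipschitz[of "af - 2" "zb xe" M "za xe"] zM af M(5) g1 M0 by (intro add_mono mult_mono) (auto simp: g_def)
 also have "((1 + (af - 2)) * M powr (af - 2) * cmod (zb xe - za xe)) * M = (af - 1) * (M powr (af - 2) * M powr 1) * cmod (zb xe - za xe)"
  using M0 by simp
 also have "M powr (af - 2) * M powr 1 = M powr (af - 1)" by (simp only: powr_add[symmetric]) simp
 also have "(af - 1) * M powr (af - 1) * cmod (zb xe - za xe) <= af * M powr (af - 1) * (cmod (b - a) + cmod (b' - a'))"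
  using af dz by (intro mult_mono) auto
 also have "M powr (af - 1) * cmod (eb - ea) <= af * M powr (af - 1) * cmod (eb - ea)"
  using af by (intro mult_right_mono) (auto simp: mult_le_cancel_right1)
 also have "af * M powr (af - 1) * (cmod (b - a) + cmod (b' - a')) + af * M powr (af - 1) * cmod (eb - ea) = af * M powr (af - 1) * (cmod (b - a) + cmod (b' - a') + cmod (eb - ea))"
  by (simp add: algebra_simps)
 finally have "\<bar>F' xe\<bar> <= q * af * (af * M powr (af - 1) * (cmod (b - a) + cmod (b' - a') + cmod (eb - ea)))"
  unfolding F'1 using q af by (intro mult_left_mono) auto
 moreover have "F 1 - F 0 = (cmod b' powr af - cmod b powr af) - (cmod a' powr af - cmod a powr af)"
  by (simp add: F_def za_def zb_def a' b')
 ultimately show ?thesis using xe(3) by (simp add: power2_eq_square mult_ac)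
qed

lemma powr_sum6_le:
 fixes p :: real
 assumes "0 <= p" "!!x. x : set [a,b,c,d,e,f] ==> 0 <= (x::real)"
 shows "(a + b + c + d + e + f) powr p <= 6 powr p * (a powr p + b powr p + c powr p + d powr p + e powr p + f powr p)"
proof -
 define m where "m = Max (set [a,b,c,d,e,f])"
 have mm: "m : set [a,b,c,d,e,f]" unfolding m_def by (rule Max_in) auto
 have le: "x <= m" if "x : set [a,b,c,d,e,f]" for x unfolding m_def using that by (intro Max_ge) auto
 have m0: "0 <= m" using assms(2) mm by blast
 have "a + b + c + d + e + f <= 6 * m" using le[of a] le[of b] le[of c] le[of d] le[of e] le[of f] by simp
 hence "(a + b + c + d + e + f) powr p <= (6 * m) powr p" using assms by (intro powr_mono2) auto
 also have "... = 6 powr p * m powr p" using m0 by (simp add: powr_mult)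
 also have "m powr p <= a powr p + b powr p + c powr p + d powr p + e powr p + f powr p"
  using mm by (auto simp: add_nonneg_nonneg add_increasing add_increasing2)
 finally show ?thesis by simp
qed

text \<open>The value \<open>th = 0\<close> stands for the undifferenced term of the square function
  and follows from the case \<open>a = ea = 0\<close>. Taking the sum of all six moduli for
  \<open>M\<close> separates the right side into squared differences of single functions times
  powers of single values.\<close>

lemma four_point_square:
 fixes af q :: real
 assumes af: "2 <= af" and q: "0 <= q" and a': "a' = a + of_real q * ea" and b': "b' = b + of_real q * eb" and th: "th : {0, 1}"
 shows "(cmod (of_real (cmod b' powr af - cmod b powr af) - of_real th * of_real (cmod a' powr af - cmod a powr af)))^2
  <= (3 * af^4 * 6 powr (2 * af - 2)) * q^2 * ((cmod (b - of_real th * a))^2 + (cmod (b' - of_real th * a'))^2 + (cmod (eb - of_real th * ea))^2)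
   * (cmod a powr (2*af-2) + cmod a' powr (2*af-2) + cmod ea powr (2*af-2) + cmod b powr (2*af-2) + cmod b' powr (2*af-2) + cmod eb powr (2*af-2))"
proof -
 define M where "M = cmod a + cmod a' + cmod ea + cmod b + cmod b' + cmod eb"
 define D where "D = cmod (b - of_real th * a) + cmod (b' - of_real th * a') + cmod (eb - of_real th * ea)"
 have M0: "0 <= M" by (simp add: M_def)
 define L where "L = \<bar>(cmod b' powr af - cmod b powr af) - th * (cmod a' powr af - cmod a powr af)\<bar>"
 have "L <= q * af^2 * M powr (af - 1) * D"
 proof (cases "th = 0")
  case True
  have "\<bar>(cmod b' powr af - cmod b powr af) - (cmod 0 powr af - cmod 0 powr af)\<bar> <= q * af^2 * M powr (af - 1) * (cmod (b - 0) + cmod (b' - 0) + cmod (eb - 0))"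
   by (rule four_point[OF af q _ b']) (auto simp: M_def)
  thus ?thesis using True by (simp add: L_def D_def)
 next
  case False
  hence th1: "th = 1" using th by simp
  have "\<bar>(cmod b' powr af - cmod b powr af) - (cmod a' powr af - cmod a powr af)\<bar> <= q * af^2 * M powr (af - 1) * (cmod (b - a) + cmod (b' - a') + cmod (eb - ea))"
   by (rule four_point[OF af q a' b']) (auto simp: M_def)
  thus ?thesis using th1 by (simp add: L_def D_def)
 qed
 hence "L^2 <= (q * af^2 * M powr (af - 1) * D)^2" by (intro power_mono) (auto simp: L_def)
 also have "... = af^4 * q^2 * D^2 * (M powr (af - 1))^2" by (simp add: power_mult_distrib mult_ac flip: power_mult)
 also have "(M powr (af - 1))^2 = M powr (2 * af - 2)" by (simp add: power2_eq_square flip: powr_add)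
 finally have L2: "L^2 <= af^4 * q^2 * D^2 * M powr (2 * af - 2)" .
 define X where "X = cmod a powr (2*af-2) + cmod a' powr (2*af-2) + cmod ea powr (2*af-2) + cmod b powr (2*af-2) + cmod b' powr (2*af-2) + cmod eb powr (2*af-2)"
 define Y where "Y = (cmod (b - of_real th * a))^2 + (cmod (b' - of_real th * a'))^2 + (cmod (eb - of_real th * ea))^2"
 have MX: "M powr (2 * af - 2) <= 6 powr (2 * af - 2) * X"
  unfolding M_def X_def using af by (intro powr_sum6_le) auto
 have DY: "D^2 <= 3 * Y"
 proof -
  have "(x + y + z)^2 <= 3 * (x^2 + y^2 + z^2)" for x y z :: real
   using zero_le_power2[of "x - y"] zero_le_power2[of "y - z"] zero_le_power2[of "x - z"] by (simp add: power2_eq_square algebra_simps)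
  thus ?thesis by (simp add: D_def Y_def)
 qed
 have "af^4 * q^2 * D^2 * M powr (2 * af - 2) <= af^4 * q^2 * (3 * Y) * (6 powr (2 * af - 2) * X)"
  by (intro mult_mono mult_left_mono DY MX) (auto simp: Y_def)
 hence "L^2 <= af^4 * q^2 * (3 * Y) * (6 powr (2 * af - 2) * X)" using L2 by linarith
 moreover have "cmod (of_real (cmod b' powr af - cmod b powr af) - of_real th * of_real (cmod a' powr af - cmod a powr af)) = L"
  unfolding L_def by (simp only: of_real_mult[symmetric] of_real_diff[symmetric] norm_of_real)
 ultimately show ?thesis unfolding X_def[symmetric] Y_def[symmetric] by (simp add: mult_ac)
qed

section \<open>Difference multipliers\<close>

text \<open>The index consists of a scale \<open>i\<close> and an axis, with shift
  \<open>2^-i\<close> along that axis for \<open>i > 0\<close>. At \<open>i = 0\<close> there is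
  neither shift nor subtraction: the multiplier is 1 and retains the zero frequency, which
  differences annihilate.\<close>

definition hv :: "nat \<times> bool => real \<times> real" where
 "hv n = (if fst n = 0 then 0 else (1/2)^fst n *\<^sub>R (if snd n then (1,0) else (0,1)))"

definition th :: "nat \<times> bool => real" where "th n = (if fst n = 0 then 0 else 1)"

definition mu :: "nat \<times> bool => lat => complex" where "mu n k = ek k (hv n) - of_real (th n)"

lemma cmod_cis_minus_one: "(cmod (cis t - 1))^2 = 2 - 2 * cos t"
proof -
 have "(cos t - 1)^2 + (sin t)^2 = 2 - 2 * cos t" using sin_cos_squared_add[of t] by (simp add: power2_eq_square algebra_simps)
 thus ?thesis unfolding cmod_power2 by simp
qed

lemma cis_minus_one_sq_le: "(cmod (cis t - 1))^2 <= t^2"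
proof -
 have "2 - 2 * cos t = 4 * (sin (t/2))^2" using cos_double_sin[of "t/2"] by simp
 also have "(sin (t/2))^2 <= (t/2)^2" using abs_sin_x_le_abs_x[of "t/2"] by (simp only: abs_le_square_iff)
 finally show ?thesis unfolding cmod_cis_minus_one by (simp add: power_divide)
qed

text \<open>For nonzero \<open>k\<close> the scale is such that the larger coordinate times
  \<open>2^-i\<close> lies between 1/4 and 1/2 in modulus; there the cosine is nonpositive and the
  multiplier has modulus at least 1. Then \<open>1 + freq2 k\<close> is at most
  \<open>1 + 8 * pi^2\<close> times \<open>4^i\<close>, by bounding both coordinates by the
  larger.\<close>

lemma mu_lower:
 assumes s: "0 <= s"
  and that: "k = 0 & n = (0, True) \<or> (\<exists>i>0. n = (i, True) & \<bar>snd k\<bar> <= \<bar>fst k\<bar> & 2^i <= 4 * \<bar>fst k\<bar> & 4 * \<bar>fst k\<bar> < 2 * 2^i)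
  \<or> (\<exists>i>0. n = (i, False) & \<bar>fst k\<bar> <= \<bar>snd k\<bar> & 2^i <= 4 * \<bar>snd k\<bar> & 4 * \<bar>snd k\<bar> < 2 * 2^i)"
 shows "wt s k <= (1 + 8 * pi^2) powr s * (4 powr s) ^ fst n * (cmod (mu n k))^2"
proof -
 have one: "1 <= (1 + 8 * pi^2) powr s" using s by (intro ge_one_powr_ge_zero) auto
 have main: "wt s k <= (1 + 8 * pi^2) powr s * (4 powr s) ^ i * (cmod (cis (2 * pi * of_int m * (1/2)^i) - 1))^2"
  if m: "2^i <= 4 * \<bar>m\<bar>" "4 * \<bar>m\<bar> < 2 * 2^i" and k: "\<bar>fst k\<bar> <= \<bar>m\<bar>" "\<bar>snd k\<bar> <= \<bar>m\<bar>" and i: "i > 0" for i and m :: int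
 proof -
  have m1: "1 <= \<bar>m\<bar>" using m(1) by (metis abs_ge_zero abs_of_nonneg le_less mult_zero_right not_less zero_less_numeral zero_less_power int_one_le_iff_zero_less)
  have rm: "real_of_int (2^i) <= of_int (4 * \<bar>m\<bar>)" "real_of_int (4 * \<bar>m\<bar>) < of_int (2 * 2^i)" using m by (simp_all only: of_int_le_iff of_int_less_iff)
  define x where "x = \<bar>real_of_int m\<bar> * (1/2)^i"
  have x: "1/4 <= x" "x < 1/2" using rm by (simp_all add: x_def field_simps power_one_over)
  have "cos (2 * pi * x) <= 0"
  proof -
   have "cos (2 * pi * x) = - cos (pi - 2 * pi * x)" by simp
   moreover have "cos (pi - 2 * pi * x) >= 0"
   proof (rule cos_ge_zero)
    show "- (pi/2) <= pi - 2 * pi * x" using mult_left_mono[OF less_imp_le[OF x(2)], of "2 * pi"] pi_gt_zero by linarith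
    show "pi - 2 * pi * x <= pi/2" using mult_left_mono[OF x(1), of "2 * pi"] by simp
   qed
   ultimately show ?thesis by linarith
  qed
  moreover have "cos (2 * pi * of_int m * (1/2)^i) = cos (2 * pi * x)"
   unfolding x_def by (cases "m >= 0") (auto simp: mult_ac)
  ultimately have c: "1 <= (cmod (cis (2 * pi * of_int m * (1/2)^i) - 1))^2" unfolding cmod_cis_minus_one by simp
  have sq: "real_of_int (x^2) <= of_int (m^2)" if "\<bar>x\<bar> <= \<bar>m\<bar>" for x
   unfolding of_int_le_iff using that by (simp only: abs_le_square_iff)
  have "real_of_int ((fst k)^2) <= of_int (m^2)" "real_of_int ((snd k)^2) <= of_int (m^2)" "real_of_int (1^2) <= of_int (m^2)"
   using sq[OF k(1)] sq[OF k(2)] sq[of 1] m1 by simp_all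
  hence k2: "(of_int (fst k))^2 + (of_int (snd k))^2 <= 2 * (real_of_int m)^2" "1 <= (real_of_int m)^2" by simp_all
  have m4: "(real_of_int m)^2 <= 4 ^ i"
  proof -
   have "real_of_int \<bar>m\<bar> <= 2^i" using rm(2) by simp
   hence "(real_of_int \<bar>m\<bar>)^2 <= (2^i)^2" by (intro power_mono) auto
   thus ?thesis by (simp add: power2_eq_square flip: power_mult_distrib)
  qed
  have "1 + freq2 k <= (real_of_int m)^2 + 4 * pi^2 * (2 * (real_of_int m)^2)"
   unfolding freq2_def using k2 by (intro add_mono mult_left_mono) auto
  also have "... = (1 + 8 * pi^2) * (real_of_int m)^2" by (simp add: algebra_simps)
  also have "... <= (1 + 8 * pi^2) * 4 ^ i" by (intro mult_left_mono m4) auto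
  finally have "1 + freq2 k <= (1 + 8 * pi^2) * 4 ^ i" .
  hence "wt s k <= ((1 + 8 * pi^2) * 4 ^ i) powr s" unfolding wt_def using s by (intro powr_mono2) auto
  also have "... = (1 + 8 * pi^2) powr s * (4 powr s)^i"
  proof -
   have "((4::real)^i) powr s = (4 powr s)^i" by (subst (1 2) powr_realpow[symmetric]) (auto simp: powr_powr mult.commute)
   thus ?thesis by (simp add: powr_mult)
  qed
  also have "... <= (1 + 8 * pi^2) powr s * (4 powr s)^i * (cmod (cis (2 * pi * of_int m * (1/2)^i) - 1))^2"
   using mult_left_mono[OF c, of "(1 + 8 * pi^2) powr s * (4 powr s)^i"] by simp
  finally show ?thesis .
 qed
 from that show ?thesis
 proof (elim disjE exE conjE)
  assume "k = 0" "n = (0, True)"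
  thus ?thesis using one by (simp add: mu_def hv_def th_def wt_def freq2_def)
 next
  fix i assume *: "i > 0" "n = (i, True)" "\<bar>snd k\<bar> <= \<bar>fst k\<bar>" "2^i <= 4 * \<bar>fst k\<bar>" "4 * \<bar>fst k\<bar> < 2 * 2^i"
  thus ?thesis using main[of i "fst k"] by (simp add: mu_def hv_def th_def ek_def mult_ac)
 next
  fix i assume *: "i > 0" "n = (i, False)" "\<bar>fst k\<bar> <= \<bar>snd k\<bar>" "2^i <= 4 * \<bar>snd k\<bar>" "4 * \<bar>snd k\<bar> < 2 * 2^i"
  thus ?thesis using main[of i "snd k"] by (simp add: mu_def hv_def th_def ek_def mult_ac)
 qed
qed

lemma wt_le_mu_sum:
 assumes s: "0 <= s"
 shows "ennreal (wt s k) <= ennreal ((1 + 8 * pi^2) powr s) * (SU n. ennreal ((4 powr s) ^ fst n * (cmod (mu n k))^2))"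
proof -
 have ex: "\<exists>i>0. 2^i <= 4 * m & 4 * m < 2 * 2^i" if "m >= 1" for m :: int
 proof -
  have n: "4 * m < 2 ^ nat (4 * m)" using of_nat_less_two_power[of "nat (4 * m)", where 'a=int] that by simp
  define j where "j = (LEAST n. 4 * m < 2^n)"
  have j: "4 * m < 2^j" unfolding j_def using n by (rule LeastI)
  have "j ~= 0" proof assume "j = 0" thus False using j that by simp qed
  moreover have "j ~= 1" proof assume "j = 1" thus False using j that by simp qed
  ultimately have j01: "j ~= 0" "j ~= 1" by blast+
  then obtain i where i: "j = Suc i" "i > 0" using j01 by (cases j) auto
  have "\<not> 4 * m < 2^i" using not_less_Least[of i "%n. 4 * m < 2^n"] i j_def by auto
  thus ?thesis using j i by auto
 qed
 have "\<exists>n. wt s k <= (1 + 8 * pi^2) powr s * (4 powr s) ^ fst n * (cmod (mu n k))^2"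
 proof (cases "k = 0")
  case True thus ?thesis using mu_lower[OF s, of k "(0, True)"] by (intro exI[of _ "(0, True)"]) simp
 next
  case False
  show ?thesis
  proof (cases "\<bar>snd k\<bar> <= \<bar>fst k\<bar>")
   case True
   hence "\<bar>fst k\<bar> >= 1" using False by (auto simp: prod_eq_iff)
   from ex[OF this] obtain i where "i > 0" "2^i <= 4 * \<bar>fst k\<bar>" "4 * \<bar>fst k\<bar> < 2 * 2^i" by blast
   thus ?thesis using mu_lower[OF s, of k "(i, True)"] True by (intro exI[of _ "(i, True)"]) simp
  next
   case F: False
   hence "\<bar>snd k\<bar> >= 1" by linarith
   from ex[OF this] obtain i where "i > 0" "2^i <= 4 * \<bar>snd k\<bar>" "4 * \<bar>snd k\<bar> < 2 * 2^i" by blast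
   thus ?thesis using mu_lower[OF s, of k "(i, False)"] F by (intro exI[of _ "(i, False)"]) simp
  qed
 qed
 then obtain n where n: "wt s k <= (1 + 8 * pi^2) powr s * (4 powr s) ^ fst n * (cmod (mu n k))^2" by blast
 have "ennreal (wt s k) <= ennreal ((1 + 8 * pi^2) powr s) * ennreal ((4 powr s) ^ fst n * (cmod (mu n k))^2)"
  using n by (simp add: ennreal_mult[symmetric] ennreal_leI mult.assoc)
 also have "... <= ennreal ((1 + 8 * pi^2) powr s) * (SU n. ennreal ((4 powr s) ^ fst n * (cmod (mu n k))^2))"
  by (intro mult_left_mono nn_integral_ge_point[of n UNIV "%n. ennreal ((4 powr s) ^ fst n * (cmod (mu n k))^2)"]) auto
 finally show ?thesis .
qed

text \<open>With \<open>k\<close> in block \<open>N\<close>, the scales \<open>i <= N\<close> are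
  bounded trivially by 4 and sum because \<open>s > 0\<close>; the finer ones use
  \<open>freq2 k / 4^i\<close> and sum because \<open>s < 1\<close>. This bound is what confines the
  method of first differences to \<open>s < 1\<close>.\<close>

lemma mu_sum_le_wt:
 assumes s: "0 < s" "s < 1"
 obtains C where "0 <= C" "!!k. (SU n. ennreal ((4 powr s) ^ fst n * (cmod (mu n k))^2)) <= ennreal (C * wt s k)"
proof -
 define a where "a = 4 powr (- s)"
 define b where "b = 4 powr (s - 1)"
 have ab: "0 < a" "a < 1" "0 < b" "b < 1" using s by (auto simp: a_def b_def powr_less_one)
 define C where "C = 2 * (4 / (1 - a) + 4 / (1 - b))"
 have C0: "0 <= C" using ab by (simp add: C_def)
 have "(SU n. ennreal ((4 powr s) ^ fst n * (cmod (mu n k))^2)) <= ennreal (C * wt s k)" for k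
 proof -
  obtain N where N: "k : blk N" using blk_cover by blast
  have mu4: "(cmod (mu n k))^2 <= 4" for n
  proof -
   have "cmod (mu n k) <= 1 + 1" unfolding mu_def by (rule order_trans[OF norm_triangle_ineq4]) (simp add: th_def)
   hence "(cmod (mu n k))^2 <= 2^2" by (intro power_mono) auto
   thus ?thesis by simp
  qed
  have mufreq: "(cmod (mu n k))^2 <= freq2 k / 4 ^ fst n" if "fst n ~= 0" for n
  proof -
   have "((1/2::real)^i)^2 = ((1/2)^2)^i" for i by (simp only: power_mult[symmetric] mult.commute)
   hence half: "((1/2::real)^i)^2 = 1 / 4^i" for i by (simp add: power2_eq_square power_one_over)
   define m where "m = (if snd n then fst k else snd k)"
   have "mu n k = cis (2 * pi * of_int m * (1/2)^fst n) - 1" using that by (simp add: mu_def hv_def th_def ek_def m_def mult_ac)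
   hence "(cmod (mu n k))^2 <= (2 * pi * of_int m * (1/2)^fst n)^2"
    using cis_minus_one_sq_le by simp
   also have "... = 4 * pi^2 * (of_int m)^2 / 4 ^ fst n" by (simp add: power_mult_distrib half)
   also have "... <= freq2 k / 4 ^ fst n" unfolding freq2_def by (intro divide_right_mono mult_left_mono) (auto simp: m_def)
   finally show ?thesis .
  qed
  define Tm where "Tm i = ennreal (4 * (4 powr s)^N * a^(N - i)) * ind {..N} i + ennreal (4 * (4 powr s)^N * b^(i - N)) * ind {N..} i" for i
  have tm: "ennreal ((4 powr s) ^ fst n * (cmod (mu n k))^2) <= Tm (fst n)" for n
  proof (cases "fst n <= N")
   case True
   have e: "(4 powr s) ^ fst n = (4 powr s)^N * a^(N - fst n)"
   proof -
    have "(4 powr s)^N = (4 powr s)^fst n * (4 powr s)^(N - fst n)" using True by (simp flip: power_add)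
    moreover have "(4 powr s)^(N - fst n) * a^(N - fst n) = 1" by (simp add: a_def flip: power_mult_distrib powr_add)
    ultimately show ?thesis by (simp add: mult.assoc)
   qed
   have "(4 powr s) ^ fst n * (cmod (mu n k))^2 <= (4 powr s) ^ fst n * 4" by (intro mult_left_mono mu4) auto
   hence "ennreal ((4 powr s) ^ fst n * (cmod (mu n k))^2) <= ennreal (4 * (4 powr s)^N * a^(N - fst n))" unfolding e by (intro ennreal_leI) (simp add: mult_ac)
   also have "... <= Tm (fst n)" using True by (simp add: Tm_def)
   finally show ?thesis .
  next
   case False
   hence "(4 powr s) ^ fst n * (cmod (mu n k))^2 <= (4 powr s) ^ fst n * (freq2 k / 4 ^ fst n)" by (intro mult_left_mono mufreq) auto
   also have "... <= (4 powr s) ^ fst n * (4^(N+1) / 4 ^ fst n)" using N by (intro mult_left_mono divide_right_mono) (auto simp: blk_def)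
   also have "... = 4 * (4 powr s)^N * b^(fst n - N)"
   proof -
    have e: "fst n = N + (fst n - N)" using False by simp
    have b4: "4 powr s = 4 * b" by (simp add: b_def powr_diff)
    have "(4 powr s) ^ fst n = (4 powr s)^N * (4 * b)^(fst n - N)" by (subst e) (simp only: power_add b4)
    moreover have "(4::real) ^ fst n = 4^N * 4^(fst n - N)" by (subst e) (simp only: power_add)
    ultimately show ?thesis by (simp add: power_mult_distrib)
   qed
   finally have "ennreal ((4 powr s) ^ fst n * (cmod (mu n k))^2) <= ennreal (4 * (4 powr s)^N * b^(fst n - N))" by (rule ennreal_leI)
   also have "... <= Tm (fst n)" using False by (simp add: Tm_def)
   finally show ?thesis .
  qed
  have sumT: "(SU i. Tm i) <= ennreal ((4 / (1 - a) + 4 / (1 - b)) * (4 powr s)^N)"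
  proof -
   have "(SU i. Tm i) = (SU i. ennreal (4 * (4 powr s)^N * a^(N - i)) * ind {..N} i) + (SU i. ennreal (4 * (4 powr s)^N * b^(i - N)) * ind {N..} i)"
    unfolding Tm_def by (rule nn_integral_add) auto
   also have "... <= (SU i. ennreal (4 * (4 powr s)^N * a^i)) + (SU i. ennreal (4 * (4 powr s)^N * b^i))"
    by (intro add_mono nn_integral_count_inj_le[where f="%i. ennreal (4 * (4 powr s)^N * a^i)"] nn_integral_count_inj_le[where f="%i. ennreal (4 * (4 powr s)^N * b^i)"])
     (auto simp: inj_on_def)
   also have "... = ennreal (4 * (4 powr s)^N / (1 - a)) + ennreal (4 * (4 powr s)^N / (1 - b))"
    unfolding nn_integral_count_space_nat using ab by (subst (1 2) suminf_ennreal_geometric) auto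
   also have "... = ennreal ((4 / (1 - a) + 4 / (1 - b)) * (4 powr s)^N)" using ab by (subst ennreal_plus[symmetric]) (auto simp: algebra_simps)
   finally show ?thesis .
  qed
  have "(SU n. ennreal ((4 powr s) ^ fst n * (cmod (mu n k))^2)) <= (SU n. Tm (fst n) * ind {n. snd n} n + Tm (fst n) * ind {n. \<not> snd n} n)"
   using tm by (intro nn_integral_mono) (simp add: indicator_def)
  also have "... = (SU n. Tm (fst n) * ind {n. snd n} n) + (SU n. Tm (fst n) * ind {n. \<not> snd n} n)"
   by (rule nn_integral_add) auto
  also have "... <= (SU i. Tm i) + (SU i. Tm i)"
   by (intro add_mono nn_integral_count_inj_le[where f=Tm]) (auto simp: inj_on_def)
  also have "... <= ennreal ((4 / (1 - a) + 4 / (1 - b)) * (4 powr s)^N) + ennreal ((4 / (1 - a) + 4 / (1 - b)) * (4 powr s)^N)"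
   by (intro add_mono sumT)
  also have "... = ennreal (C * (4 powr s)^N)" using ab by (subst ennreal_plus[symmetric]) (auto simp: C_def algebra_simps)
  also have "... <= ennreal (C * wt s k)" using wt_blk_ge[OF N, of s] s C0 by (intro ennreal_leI mult_left_mono) auto
  finally show ?thesis .
 qed
 thus ?thesis using that C0 by blast
qed

section \<open>Dyadic decomposition of powers\<close>

text \<open>An arbitrarily small loss \<open>te\<close> takes the place of Hoelder's inequality: if
  the series on the right has the finite value \<open>b\<close>, each block is at most
  \<open>b powr (1/p)\<close> times a geometric factor, and the blocks can be added. This treats all
  \<open>p > 0\<close> alike.\<close>

lemma syn_powr_le_blocks:
 assumes p: "0 < p" and te: "0 < te"
 shows "ennreal (cmod (syn a x) powr p) <= ennreal ((1 / (1 - 4 powr (-te/p))) powr p) * (\<Sum>j. ennreal ((4 powr te)^j * cmod (Pj a j x) powr p))"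
proof -
 define B where "B = (\<Sum>j. ennreal ((4 powr te)^j * cmod (Pj a j x) powr p))"
 define r where "r = 4 powr (-te/p)"
 have r: "0 < r" "r < 1" using p te by (auto simp: r_def powr_less_one)
 have "ennreal (cmod (syn a x) powr p) <= ennreal ((1 / (1 - r)) powr p) * B"
 proof (cases "B = \<infinity>")
  case True
  have "0 < (1 / (1 - r)) powr p" using r by simp
  thus ?thesis using True by (simp add: ennreal_mult_top)
 next
  case False
  then obtain b where b: "B = ennreal b" "b >= 0" by (cases B) auto
  have bd: "cmod (Pj a j x) <= b powr (1/p) * r^j" for j
  proof -
   define g where "g j = ennreal ((4 powr te)^j * cmod (Pj a j x) powr p)" for j
   have "sum g {j} <= suminf g" by (rule sum_le_suminf) auto
   hence "g j <= B" by (simp add: B_def g_def[abs_def])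
   hence "(4 powr te)^j * cmod (Pj a j x) powr p <= b" using b by (simp add: g_def)
   hence "cmod (Pj a j x) powr p <= b * (4 powr (-te))^j" by (simp add: powr_minus field_simps power_divide)
   hence "(cmod (Pj a j x) powr p) powr (1/p) <= (b * (4 powr (-te))^j) powr (1/p)" using p by (intro powr_mono2) auto
   also have "(cmod (Pj a j x) powr p) powr (1/p) = cmod (Pj a j x)" using p by (simp add: powr_powr)
   also have "(b * (4 powr (-te))^j) powr (1/p) = b powr (1/p) * r^j"
   proof -
    have "((4 powr (-te))^j) powr (1/p) = (4 powr (-te * real j)) powr (1/p)" by (simp only: powr_mult_nat zero_less_numeral)
    also have "... = 4 powr (-te * real j * (1/p))" by (simp only: powr_powr)
    also have "-te * real j * (1/p) = (-te/p) * real j" by simp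
    also have "4 powr ((-te/p) * real j) = r^j" by (simp only: powr_mult_nat zero_less_numeral r_def)
    finally show ?thesis using b by (simp add: powr_mult)
   qed
   finally show ?thesis .
  qed
  have "cmod (syn a x) <= b powr (1/p) / (1 - r)"
   using dominated_tail(2)[OF r bd, of 0] by (simp add: syn_def)
  hence "cmod (syn a x) powr p <= (b powr (1/p) * (1 / (1 - r))) powr p" using p by (intro powr_mono2) auto
  also have "... = (1 / (1 - r)) powr p * b" using b p r by (simp add: powr_mult powr_powr powr_divide)
  finally show ?thesis using b by (simp add: ennreal_mult[symmetric] ennreal_leI)
 qed
 thus ?thesis unfolding B_def r_def .
qed

lemma Pj_L2:
 assumes s: "0 <= s" and E: "En s a <= ennreal (q^2)" and q: "0 <= q"
 shows "(\<Sum>k\<in>blk j. (cmod (a k))^2) <= q^2 * (4 powr (-s))^j"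
proof -
 have "ennreal ((4 powr s)^j * (\<Sum>k\<in>blk j. (cmod (a k))^2)) <= ennreal (\<Sum>k\<in>blk j. wt s k * (cmod (a k))^2)"
  unfolding sum_distrib_left using s by (intro ennreal_leI sum_mono mult_right_mono wt_blk_ge) auto
 also have "... = (SZ k. ennreal (wt s k * (cmod (a k))^2) * ind (blk j) k)" by (subst nn_integral_blk) auto
 also have "... <= En s a" unfolding En_def by (intro nn_integral_mono) (auto simp: indicator_def)
 also have "... <= ennreal (q^2)" by (rule E)
 finally have "(4 powr s)^j * (\<Sum>k\<in>blk j. (cmod (a k))^2) <= q^2" by simp
 thus ?thesis by (simp add: powr_minus field_simps power_divide)
qed

text \<open>Bernstein's inequality: Cauchy-Schwarz over the at most \<open>9 * 4^j\<close>
  frequencies of the block.\<close>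

lemma Pj_sup:
 assumes s: "0 <= s" and E: "En s a <= ennreal (q^2)" and q: "0 <= q"
 shows "cmod (Pj a j x) <= 3 * q * (4 powr ((1 - s)/2))^j"
proof -
 have 1: "cmod (Pj a j x) <= (\<Sum>k\<in>blk j. cmod (a k) * 1)"
  unfolding Pj_def by (rule order_trans[OF norm_sum]) (simp add: norm_mult)
 have "(\<Sum>k\<in>blk j. cmod (a k) * 1)^2 <= (\<Sum>k\<in>blk j. (cmod (a k))^2) * (\<Sum>k\<in>blk j. 1^2)" by (rule Cauchy_Schwarz_ineq_sum)
 also have "... <= (q^2 * (4 powr (-s))^j) * (9 * 4^j)"
  using Pj_L2[OF assms, of j] card_blk[of j] by (intro mult_mono) (auto intro!: sum_nonneg)
 also have "... = (3 * q * (4 powr ((1 - s)/2))^j)^2"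
 proof -
  have "4 powr (-s) * 4 powr 1 = 4 powr ((1-s)/2) * 4 powr ((1-s)/2)"
   unfolding powr_add[symmetric] by (rule arg_cong[where f="%x. 4 powr x"]) (simp add: field_simps)
  moreover have "(4::real) powr 1 = 4" by simp
  ultimately have "4 powr (-s) * 4 = 4 powr ((1-s)/2) * 4 powr ((1-s)/2)" by (simp only:)
  hence "(4 powr (-s))^j * 4^j = (4 powr ((1-s)/2))^j * (4 powr ((1-s)/2))^j" by (simp only: flip: power_mult_distrib)
  thus ?thesis by (simp add: power2_eq_square mult_ac)
 qed
 finally have "(\<Sum>k\<in>blk j. cmod (a k) * 1) <= 3 * q * (4 powr ((1 - s)/2))^j" by (rule power2_le_imp_le) (use q in simp)
 thus ?thesis using 1 by simp
qed

lemma powr_minus_two_mult: "0 <= x ==> x powr af = x powr (af - 2) * x^2" for x af :: real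
proof (cases "x = 0")
 case False
 assume "0 <= x"
 hence "x^2 = x powr 2" using False by simp
 thus ?thesis by (simp only: powr_add[symmetric]) simp
qed simp

text \<open>In each block \<open>af - 2\<close> factors are taken in the supremum and two in
  \<open>L^2\<close>, which gives the exponent \<open>(af - 2) * (1 - s) / 2 - s\<close> in base 4;
  the hypothesis says that it is negative. Half of the gap is \<open>te\<close>, spent on adding the
  blocks, and the other half remains in \<open>Q\<close>.\<close>

lemma embedding:
 assumes s: "0 < s" and af: "2 <= af" "(af - 2) * (1 - s) < 2 * s"
 obtains C where "0 <= C" "!!a q. 0 <= q ==> En s a <= ennreal (q^2) ==> (IQ x. ennreal (cmod (syn a x) powr af)) <= ennreal (C * q powr af)"
proof -
 define te where "te = (2 * s - (af - 2) * (1 - s)) / 4"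
 have te: "0 < te" using af by (simp add: te_def)
 define Q where "Q = 4 powr (- te)"
 have Q: "0 < Q" "Q < 1" using te by (auto simp: Q_def powr_less_one)
 define K where "K = (1 / (1 - 4 powr (-te/af))) powr af"
 define C where "C = K * (3 powr (af - 2) / (1 - Q))"
 have C0: "0 <= C" using Q by (simp add: C_def K_def)
 have "(IQ x. ennreal (cmod (syn a x) powr af)) <= ennreal (C * q powr af)" if q: "0 <= q" and E: "En s a <= ennreal (q^2)" for a q
 proof -
  define y where "y = 4 powr ((1 - s)/2)"
  have Pb: "(IQ x. ennreal (cmod (Pj a j x) powr af)) <= ennreal ((3 * q * y^j) powr (af - 2) * (q^2 * (4 powr (-s))^j))" for j
  proof -
   have "(IQ x. ennreal (cmod (Pj a j x) powr af)) <= (IQ x. ennreal ((3 * q * y^j) powr (af - 2)) * sqn (Pj a j x))"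
   proof (rule nn_integral_mono)
    fix x
    have "cmod (Pj a j x) powr af = cmod (Pj a j x) powr (af - 2) * (cmod (Pj a j x))^2" by (rule powr_minus_two_mult) simp
    also have "... <= (3 * q * y^j) powr (af - 2) * (cmod (Pj a j x))^2"
     using Pj_sup[OF less_imp_le[OF s] E q, of j x] af by (intro mult_right_mono powr_mono2) (auto simp: y_def)
    finally show "ennreal (cmod (Pj a j x) powr af) <= ennreal ((3 * q * y^j) powr (af - 2)) * sqn (Pj a j x)"
     by (simp add: ennreal_mult[symmetric] ennreal_leI)
   qed
   also have "... = ennreal ((3 * q * y^j) powr (af - 2)) * ennreal (\<Sum>k\<in>blk j. (cmod (a k))^2)"
    by (subst nn_integral_cmult) (auto simp: Pj_def parseval_fin)
   also have "... <= ennreal ((3 * q * y^j) powr (af - 2)) * ennreal (q^2 * (4 powr (-s))^j)"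
    using Pj_L2[OF less_imp_le[OF s] E q, of j] by (intro mult_left_mono ennreal_leI) auto
   finally show ?thesis by (simp add: ennreal_mult)
  qed
  have eq: "(4 powr te)^j * ((3 * q * y^j) powr (af - 2) * (q^2 * (4 powr (-s))^j)) = (3 powr (af - 2) * q powr af) * Q^j" for j
  proof -
   have qq: "q powr (af - 2) * q^2 = q powr af"
   proof (cases "q = 0")
    case False
    hence "q^2 = q powr 2" using q by (simp add: powr_numeral)
    thus ?thesis by (simp flip: powr_add)
   qed (use af in simp)
   have "4 powr te * 4 powr ((af - 2) * (1 - s)/2) * 4 powr (-s) = Q"
    unfolding Q_def powr_add[symmetric] by (rule arg_cong[where f="%x. 4 powr x"]) (simp add: te_def field_simps)
   hence Qj: "(4 powr te)^j * (4 powr ((af - 2) * (1 - s)/2))^j * (4 powr (-s))^j = Q^j" by (simp only: flip: power_mult_distrib)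
   have "(y^j) powr (af - 2) = (4 powr ((af - 2) * (1 - s)/2))^j"
   proof -
    have "(y^j) powr (af - 2) = (4 powr ((1 - s)/2 * real j)) powr (af - 2)" unfolding y_def by (simp only: powr_mult_nat zero_less_numeral)
    also have "... = 4 powr ((1 - s)/2 * real j * (af - 2))" by (simp only: powr_powr)
    also have "(1 - s)/2 * real j * (af - 2) = (af - 2) * (1 - s)/2 * real j" by simp
    finally show ?thesis by (simp only: powr_mult_nat zero_less_numeral)
   qed
   moreover have "0 <= y" by (simp add: y_def)
   ultimately have e1: "(3 * q * y^j) powr (af - 2) = 3 powr (af - 2) * q powr (af - 2) * (4 powr ((af - 2) * (1 - s)/2))^j"
    using q by (simp add: powr_mult)
   have "(4 powr te)^j * ((3 * q * y^j) powr (af - 2) * (q^2 * (4 powr (-s))^j))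
    = 3 powr (af - 2) * (q powr (af - 2) * q^2) * ((4 powr te)^j * (4 powr ((af - 2) * (1 - s)/2))^j * (4 powr (-s))^j)"
    unfolding e1 by (simp only: mult_ac)
   thus ?thesis by (simp only: qq Qj)
  qed
  have "(IQ x. ennreal (cmod (syn a x) powr af)) <= (IQ x. ennreal K * (\<Sum>j. ennreal ((4 powr te)^j * cmod (Pj a j x) powr af)))"
   unfolding K_def using af te by (intro nn_integral_mono syn_powr_le_blocks) auto
  also have "... = ennreal K * (\<Sum>j. (IQ x. ennreal ((4 powr te)^j) * ennreal (cmod (Pj a j x) powr af)))"
   by (simp add: nn_integral_cmult nn_integral_suminf ennreal_mult)
  also have "... <= ennreal K * (\<Sum>j. ennreal ((3 powr (af - 2) * q powr af) * Q^j))"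
  proof (intro mult_left_mono suminf_le)
   fix j
   have "(IQ x. ennreal ((4 powr te)^j) * ennreal (cmod (Pj a j x) powr af)) <= ennreal ((4 powr te)^j) * ennreal ((3 * q * y^j) powr (af - 2) * (q^2 * (4 powr (-s))^j))"
    by (subst nn_integral_cmult) (auto intro!: mult_left_mono Pb)
   also have "... = ennreal ((3 powr (af - 2) * q powr af) * Q^j)" unfolding eq[symmetric] by (rule ennreal_mult[symmetric]) (use q in auto)
   finally show "(IQ x. ennreal ((4 powr te)^j) * ennreal (cmod (Pj a j x) powr af)) <= ennreal ((3 powr (af - 2) * q powr af) * Q^j)" .
  qed auto
  also have "... = ennreal K * ennreal ((3 powr (af - 2) * q powr af) / (1 - Q))" using Q by (subst suminf_ennreal_geometric) auto
  also have "... = ennreal (C * q powr af)" using Q by (simp add: ennreal_mult[symmetric] C_def K_def)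
  finally show ?thesis .
 qed
 thus ?thesis using that C0 by blast
qed

section \<open>Product estimates\<close>

lemma bilinear_estimate_single:
 fixes A :: "lat => lat => complex" and et :: int
 assumes "0 <= s" "0 <= S" "0 <= CA" "0 <= r" "0 <= q"
  "!!k M. (\<exists>l. A k l ~= 0) ==> (SZ l. ennreal (1 / kap d k l) * ind {l. nrm2 l + et * nrm2 (k - l) = M} l) <= ennreal S"
  and A: "!!k l. (cmod (A k l))^2 * kap d k l <= CA * wt s l * wt s (k - l)"
  and "!!k. \<exists>B. \<forall>l. cmod (A k l) <= B" "rep 1 s r c" "rep (of_int et) s q d'"
 shows "(IT t. (SZ k. sqn (LINT l|CZ. A k l * (c t l * d' t (k - l))))) <= ennreal (T0 * S * CA * (r * q)^2)"
proof -
 have u: "(\<integral>\<^sup>+n. f n \<partial>count_space (UNIV::unit set)) = f ()" for f :: "unit => ennreal"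
  by (simp add: nn_integral_count_space_finite UNIV_unit)
 have "(IT t. (\<integral>\<^sup>+n. (SZ k. sqn (LINT l|CZ. A k l * (c t l * d' t (k - l)))) \<partial>count_space (UNIV::unit set))) <= ennreal (T0 * S * CA * (r * q)^2)"
 proof (rule bilinear_estimate[where A="%n k l. A k l" and d=d and et=et])
  show "(\<integral>\<^sup>+n. sqn (A k l) \<partial>count_space (UNIV::unit set)) * ennreal (kap d k l) <= ennreal (CA * wt s l * wt s (k - l))" for k l
   unfolding u using A[of k l] by (simp add: ennreal_mult[symmetric] less_imp_le ennreal_leI)
 qed (use assms in auto)
 thus ?thesis unfolding u .
qed

text \<open>The weight of the output is carried by the larger frequency and \<open>kap\<close> by
  the smaller; maximum times minimum is the product.\<close>

lemma wt_kap_le: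
 assumes "0 <= d" "d <= s" shows "wt s k * kap d k l <= 4 powr s * (wt s l * wt s (k - l))"
proof -
 have "wt s k * kap d k l <= (4 powr s * max (wt s l) (wt s (k - l))) * min (wt s l) (wt s (k - l))"
 proof (rule mult_mono)
  show "wt s k <= 4 powr s * max (wt s l) (wt s (k - l))" using wt_add_le[of s l "k - l"] assms by simp
  show "kap d k l <= min (wt s l) (wt s (k - l))" unfolding kap_def by (intro min.mono wt_mono assms)
 qed (auto simp: less_imp_le max_def)
 also have "... = 4 powr s * (wt s l * wt s (k - l))" by (simp add: max_def min_def)
 finally show ?thesis .
qed

lemma nn_wt_conv: "sqn (LINT l|CZ. of_real (sqrt (wt s k)) * (a l * b (k - l))) = ennreal (wt s k * (cmod (conv a b k))^2)"
 by (simp add: conv_def norm_mult power_mult_distrib)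

text \<open>The case \<open>et = 0\<close>: the factor \<open>v\<close> has no dispersion, and the
  circles come from \<open>u\<close> alone.\<close>

lemma product_estimate:
 assumes s: "0 < s"
 obtains C where "0 <= C" "!!r q c d. 0 <= r ==> 0 <= q ==> rep 1 s r c ==> rep 0 s q d ==>
  (IT t. En s (conv (c t) (d t))) <= ennreal (C * (r * q)^2)"
proof -
 obtain S where S: "S > 0"
  "!!(et::int) k M. et : {0,1} ==> (SZ l. ennreal (1 / kap s k l) * ind {l. nrm2 l + et * nrm2 (k - l) = M} l) <= ennreal S"
  using kap_sum_circle[OF s] by blast
 have "(IT t. En s (conv (c t) (d t))) <= ennreal (T0 * S * 4 powr s * (r * q)^2)"
  if "0 <= r" "0 <= q" "rep 1 s r c" "rep 0 s q d" for r q c d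
 proof -
  have "(IT t. (SZ k. sqn (LINT l|CZ. of_real (sqrt (wt s k)) * (c t l * d t (k - l))))) <= ennreal (T0 * S * 4 powr s * (r * q)^2)"
  proof (rule bilinear_estimate_single[where A="%k l. of_real (sqrt (wt s k))" and d=s and et=0])
   show "(cmod (complex_of_real (sqrt (wt s k))))^2 * kap s k l <= 4 powr s * wt s l * wt s (k - l)" for k l
    using wt_kap_le[of s s k l] s by (simp add: mult.assoc)
   show "(SZ l. ennreal (1 / kap s k l) * ind {l. nrm2 l + 0 * nrm2 (k - l) = M} l) <= ennreal S" for k M
    by (rule S(2)) simp
  qed (use that s S in auto)
  thus ?thesis by (simp only: nn_wt_conv En_def)
 qed
 thus ?thesis using that[of "T0 * S * 4 powr s"] S(1) T0_pos by simp
qed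

text \<open>The phases of a product with a conjugate resonate along lines, and the weight
  \<open>kap 1\<close> is affordable because \<open>1 <= s\<close>. At \<open>k = 0\<close> all
  phases coincide; that mode is bounded by Cauchy-Schwarz at each time.\<close>

lemma product_estimate_cnj:
 assumes s: "1 <= s"
 obtains C where "0 <= C" "!!r q c d. 0 <= r ==> 0 <= q ==> rep 1 s r c ==> rep (-1) s q d ==>
  (IT t. En s (conv (c t) (d t))) <= ennreal (C * (r * q)^2)"
proof -
 obtain S where S: "S > 0"
  "!!k M. k ~= 0 ==> (SZ l. ennreal (1 / kap 1 k l) * ind {l. nrm2 l - nrm2 (k - l) = M} l) <= ennreal S"
  using kap_sum_line by blast
 have s0: "0 <= s" using s by simp
 have "(IT t. En s (conv (c t) (d t))) <= ennreal ((T0 * S * 4 powr s + T0) * (r * q)^2)"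
  if rq: "0 <= r" "0 <= q" and c: "rep 1 s r c" and d: "rep (-1) s q d" for r q c d
 proof -
  define A where "A k (l::lat) = (if k = 0 then 0 else complex_of_real (sqrt (wt s k)))" for k :: "lat" and l
  have Aconv: "(cmod (LINT l|CZ. A k l * (c t l * d t (k - l))))^2 = (if k = 0 then 0 else wt s k * (cmod (conv (c t) (d t) k))^2)" for k t
   by (simp add: A_def conv_def norm_mult power_mult_distrib)
  have 1: "(IT t. (SZ k. sqn (LINT l|CZ. A k l * (c t l * d t (k - l))))) <= ennreal (T0 * S * 4 powr s * (r * q)^2)"
  proof (rule bilinear_estimate_single[where A=A and d=1 and et="-1"])
   show "(cmod (A k l))^2 * kap 1 k l <= 4 powr s * wt s l * wt s (k - l)" for k l
    using wt_kap_le[of 1 s k l] s by (auto simp: A_def mult.assoc)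
   show "(SZ l. ennreal (1 / kap 1 k l) * ind {l. nrm2 l + -1 * nrm2 (k - l) = M} l) <= ennreal S" if "\<exists>l. A k l ~= 0" for k M
    using S(2)[of k M] that by (cases "k = 0") (simp_all add: A_def)
   show "\<exists>B. \<forall>l. cmod (A k l) <= B" for k by (auto simp: A_def)
  qed (use rq c d s S in auto)
  have 2: "sqn (conv (c t) (d t) 0) <= ennreal ((r * q)^2)" for t
  proof -
   have "ennreal (cmod (conv (c t) (d t) 0)) <= (SZ l. ennreal (cmod (c t l)) * ennreal (cmod (d t (0 - l))))"
    unfolding conv_def by (rule order_trans[OF nn_norm_integral_le]) (simp add: norm_mult ennreal_mult)
   hence "(ennreal (cmod (conv (c t) (d t) 0)))^2 <= (SZ l. ennreal (cmod (c t l)) * ennreal (cmod (d t (0 - l))))^2"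
    by (rule power_mono) simp
   also have "... <= (SZ l. (ennreal (cmod (c t l)))^2) * (SZ l. (ennreal (cmod (d t (0 - l))))^2)"
    by (rule Cauchy_Schwarz_nn_integral) auto
   also have "... = En 0 (c t) * En 0 (d t)"
    using nn_integral_CZ_reflect[of "%l. sqn (d t l)" 0] by (simp add: En_0 ennreal_power)
   also have "... <= ennreal (r^2) * ennreal (q^2)"
    using order_trans[OF En_mono[OF s0] rep_En[OF c s0 rq(1)]] order_trans[OF En_mono[OF s0] rep_En[OF d s0 rq(2)]] by (intro mult_mono) auto
   finally show ?thesis by (simp add: ennreal_power ennreal_mult[symmetric] power_mult_distrib)
  qed
  have cm [measurable]: "(%t. c t k) : bmeas" "(%t. d t k) : bmeas" for k
   using rep_measurable[OF c s0] rep_measurable[OF d s0] by auto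
  have "(IT t. En s (conv (c t) (d t))) <= (IT t. (SZ k. sqn (LINT l|CZ. A k l * (c t l * d t (k - l)))) + ennreal ((r * q)^2))"
  proof (rule nn_integral_mono)
   fix t
   have "En s (conv (c t) (d t)) <= (SZ k. sqn (LINT l|CZ. A k l * (c t l * d t (k - l))) + sqn (conv (c t) (d t) 0) * ind {0} k)"
    unfolding En_def Aconv by (intro nn_integral_mono) (auto simp: indicator_def wt_def freq2_def)
   also have "... = (SZ k. sqn (LINT l|CZ. A k l * (c t l * d t (k - l)))) + sqn (conv (c t) (d t) 0)"
    by (subst nn_integral_add) (auto simp: nn_integral_cmult)
   finally show "En s (conv (c t) (d t)) <= (SZ k. sqn (LINT l|CZ. A k l * (c t l * d t (k - l)))) + ennreal ((r * q)^2)"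
    using 2[of t] by (meson add_left_mono order_trans)
  qed
  also have "... = (IT t. (SZ k. sqn (LINT l|CZ. A k l * (c t l * d t (k - l))))) + ennreal ((r * q)^2) * ennreal T0"
   using T0_pos by (subst nn_integral_add) (auto simp: emeasure_ivl)
  also have "... <= ennreal (T0 * S * 4 powr s * (r * q)^2) + ennreal ((r * q)^2) * ennreal T0" by (rule add_right_mono[OF 1])
  also have "... = ennreal ((T0 * S * 4 powr s + T0) * (r * q)^2)"
   using T0_pos S(1) by (simp add: ennreal_mult[symmetric] ennreal_plus[symmetric] algebra_simps del: ennreal_plus)
  finally show ?thesis .
 qed
 thus ?thesis using that[of "T0 * S * 4 powr s + T0"] S(1) T0_pos by simp
qed

section \<open>The square function estimate\<close>

lemma integral_CZ_finite:
 assumes "finite F" "!!l. l \<notin> F ==> f l = 0"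
 shows "(LINT l|CZ. f l) = (\<Sum>l\<in>F. f l :: complex)"
proof -
 have "{a. f a ~= 0} \<subseteq> F" using assms(2) by blast
 moreover from finite_subset[OF this assms(1)] have "(LINT l|CZ. f l) = (\<Sum>l\<in>{a. f a ~= 0}. f l)"
  by (subst lebesgue_integral_count_space_finite_support) auto
 ultimately show ?thesis using assms by (auto intro: sum.mono_neutral_left)
qed

abbreviation restr :: "lat set => (lat => complex) => lat => complex" where
 "restr F a l \<equiv> (if l : F then a l else 0)"

lemma trig_product:
 assumes F: "finite F" and G: "finite G"
 defines "K \<equiv> (%p. fst p + snd p) ` (F \<times> G)"
 shows "(\<Sum>l\<in>F. a l * ek l x) * (\<Sum>l\<in>G. b l * ek l x) = (\<Sum>k\<in>K. conv (restr F a) (restr G b) k * ek k x)"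
proof -
 have K: "finite K" using F G by (simp add: K_def)
 have inner: "(\<Sum>m\<in>G. b m * ek m x) * ek l x = (\<Sum>k\<in>K. restr G b (k - l) * ek k x)" if l: "l : F" for l
 proof -
  have "(\<Sum>m\<in>G. b m * ek m x) * ek l x = (\<Sum>m\<in>G. b m * ek (l + m) x)" by (simp only: sum_distrib_right ek_add mult.assoc mult.commute[of "ek l x"])
  also have "... = (\<Sum>k\<in>(%m. l + m) ` G. b (k - l) * ek k x)" by (subst sum.reindex) (auto simp: inj_on_def)
  also have "... = (\<Sum>k\<in>K. restr G b (k - l) * ek k x)"
  proof (rule sum.mono_neutral_cong_left[OF K])
   show "(%m. l + m) ` G \<subseteq> K" using l by (force simp: K_def)
   show "\<forall>k\<in>K - (%m. l + m) ` G. restr G b (k - l) * ek k x = 0"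
   proof
    fix k assume k: "k : K - (%m. l + m) ` G"
    have "k - l \<notin> G"
    proof
     assume "k - l : G"
     hence "l + (k - l) : (%m. l + m) ` G" by (rule imageI)
     thus False using k by simp
    qed
    thus "restr G b (k - l) * ek k x = 0" by simp
   qed
  qed auto
  finally show ?thesis .
 qed
 have cv: "conv (restr F a) (restr G b) k = (\<Sum>l\<in>F. a l * restr G b (k - l))" for k
  unfolding conv_def by (subst integral_CZ_finite[OF F]) auto
 have "(\<Sum>l\<in>F. a l * ek l x) * (\<Sum>l\<in>G. b l * ek l x) = (\<Sum>l\<in>F. a l * ((\<Sum>m\<in>G. b m * ek m x) * ek l x))"
  by (simp add: sum_distrib_right mult_ac)
 also have "... = (\<Sum>l\<in>F. a l * (\<Sum>k\<in>K. restr G b (k - l) * ek k x))" by (intro sum.cong refl) (simp only: inner)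
 also have "... = (\<Sum>k\<in>K. \<Sum>l\<in>F. a l * (restr G b (k - l) * ek k x))" unfolding sum_distrib_left by (rule sum.swap)
 also have "... = (\<Sum>k\<in>K. conv (restr F a) (restr G b) k * ek k x)" unfolding cv sum_distrib_right by (simp only: mult.assoc)
 finally show ?thesis .
qed

lemma sum_le_nn_integral_count:
 assumes "finite K" "!!k. 0 <= f k"
 shows "ennreal (\<Sum>k\<in>K. f k) <= (SZ k. ennreal (f k))"
proof -
 have "ennreal (\<Sum>k\<in>K. f k) = (SZ k. ennreal (f k) * ind K k)"
  using assms by (subst nn_integral_count_space'[of K]) (auto simp: indicator_def sum_ennreal)
 also have "... <= (SZ k. ennreal (f k))" by (intro nn_integral_mono) (auto simp: indicator_def)
 finally show ?thesis .
qed

lemma trig_product_L2: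
 assumes F: "finite F" and G: "finite G"
 shows "(IQ x. sqn (\<Sum>l\<in>F. a l * ek l x) * sqn (\<Sum>l\<in>G. b l * ek l x))
  <= (SZ k. sqn (conv (restr F a) (restr G b) k))"
proof -
 define K where "K = (%p. fst p + snd p) ` (F \<times> G)"
 have K: "finite K" using F G by (simp add: K_def)
 have "(IQ x. sqn (\<Sum>l\<in>F. a l * ek l x) * sqn (\<Sum>l\<in>G. b l * ek l x))
  = (IQ x. sqn (\<Sum>k\<in>K. conv (restr F a) (restr G b) k * ek k x))"
  unfolding K_def trig_product[OF F G, symmetric] by (simp add: ennreal_mult[symmetric] norm_mult power_mult_distrib)
 also have "... = ennreal (\<Sum>k\<in>K. (cmod (conv (restr F a) (restr G b) k))^2)" by (rule parseval_fin[OF K])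
 also have "... <= (SZ k. sqn (conv (restr F a) (restr G b) k))" by (rule sum_le_nn_integral_count[OF K]) simp
 finally show ?thesis .
qed

definition Dn :: "nat \<times> bool => (lat => complex) => real \<times> real => complex" where
 "Dn n a x = syn a (x + hv n) - of_real (th n) * syn a x"

lemma Dn_measurable [measurable (raw)]:
 assumes [measurable]: "!!k. (%y. c y k) : borel_measurable M" "g : borel_measurable M"
 shows "(%y. Dn n (c y) (g y)) : borel_measurable M"
 unfolding Dn_def by measurable

text \<open>Both evaluations of the block are kept, since the pointwise inequality for a difference
  involves the values at \<open>x\<close> and at \<open>x + hv n\<close>.\<close>

definition Xsq :: "real => (real => lat => complex) => (real => lat => complex) => nat => real => ennreal" where
 "Xsq s f m j t = (SU n. (IQ x. ennreal ((4 powr s)^fst n) * sqn (Dn n (f t) x)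
   * (sqn (Pj (m t) j x) + sqn (Pj (m t) j (x + hv n)))))"

lemma fatou_liminf:
 fixes u :: "nat => 'a => ennreal"
 assumes "!!n. u n : borel_measurable M" "AE x in M. (%n. u n x) \<longlonglongrightarrow> v x"
 shows "(NN M (%x. v x)) <= liminf (%n. \<integral>\<^sup>+x. u n x \<partial>M)"
proof -
 have "(NN M (%x. v x)) = (NN M (%x. liminf (%n. u n x)))"
  by (rule nn_integral_cong_AE) (use assms(2) in \<open>auto elim!: eventually_mono simp: lim_imp_Liminf\<close>)
 also have "... <= liminf (%n. \<integral>\<^sup>+x. u n x \<partial>M)" by (rule nn_integral_liminf) (use assms in auto)
 finally show ?thesis .
qed

lemma partial_sums_tendsto_syn:
 assumes "s > 0" "En s a < \<infinity>" shows "AE x in sqM. (%J. \<Sum>k\<in>BJ J. a k * ek k x) \<longlonglongrightarrow> syn a x"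
 using syn_AE_L2(1)[OF assms]
proof eventually_elim
 case (elim x)
 from summable_LIMSEQ[OF summable_norm_cancel[OF elim]] show ?case by (simp add: sum_Pj syn_def)
qed

lemma partial_sums_tendsto_Dn:
 assumes "s > 0" "En s a < \<infinity>" shows "AE x in sqM. (%J. \<Sum>k\<in>BJ J. (mu n k * a k) * ek k x) \<longlonglongrightarrow> Dn n a x"
proof -
 have "En s (%k. ek k (hv n) * a k) <= En s a" by (rule En_multiplier_le) (simp add: norm_mult)
 hence "En s (%k. ek k (hv n) * a k) < \<infinity>" using assms(2) by (rule le_less_trans)
 from partial_sums_tendsto_syn[OF assms(1) this] partial_sums_tendsto_syn[OF assms] show ?thesis
 proof eventually_elim
  case (elim x)
  have "(%J. (\<Sum>k\<in>BJ J. (ek k (hv n) * a k) * ek k x) - of_real (th n) * (\<Sum>k\<in>BJ J. a k * ek k x)) \<longlonglongrightarrow> Dn n a x"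
   unfolding Dn_def syn_shift by (intro tendsto_intros elim)
  moreover have "(\<Sum>k\<in>BJ J. (ek k (hv n) * a k) * ek k x) - of_real (th n) * (\<Sum>k\<in>BJ J. a k * ek k x) = (\<Sum>k\<in>BJ J. (mu n k * a k) * ek k x)" for J
   by (simp add: mu_def sum_distrib_left left_diff_distrib sum_subtractf mult.assoc)
  ultimately show ?case by simp
 qed
qed

text \<open>The bilinear estimate with the difference multipliers on \<open>f\<close> and the block
  cutoff on \<open>m\<close>. The loss is charged to \<open>m\<close>, whose frequency is known, so
  \<open>f\<close> keeps its \<open>s\<close> derivatives through the sum over \<open>n\<close> and
  the block contributes \<open>4 powr (de - s)\<close>.\<close>

lemma Xsq_estimate:
 assumes s: "0 < s" "s < 1" and de: "0 < de" "de < s"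
 obtains C where "0 <= C" "!!f m j. rep 1 s 1 f ==> rep 1 s 1 m ==> (IT t. Xsq s f m j t) <= ennreal (C * (4 powr (de - s))^j)"
proof -
 obtain S where S: "S > 0"
  "!!(et::int) k M. et : {0,1} ==> (SZ l. ennreal (1 / kap de k l) * ind {l. nrm2 l + et * nrm2 (k - l) = M} l) <= ennreal S"
  using kap_sum_circle[OF de(1)] by blast
 obtain Cm where Cm: "0 <= Cm" "!!k. (SU n. ennreal ((4 powr s) ^ fst n * (cmod (mu n k))^2)) <= ennreal (Cm * wt s k)"
  using mu_sum_le_wt[OF s] by blast
 define C where "C = 2 * (T0 * S * Cm)"
 have C0: "0 <= C" using S(1) Cm(1) T0_pos by (simp add: C_def)
 have "(IT t. Xsq s f m j t) <= ennreal (C * (4 powr (de - s))^j)" if f: "rep 1 s 1 f" and m: "rep 1 s 1 m" for f m j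
 proof -
  have s0: "0 <= s" using s by simp
  have [measurable]: "(%t. f t k) : bmeas" "(%t. m t k) : bmeas" for k
   using rep_measurable[OF f s0] rep_measurable[OF m s0] by auto
  have Ef: "En s (f t) < \<infinity>" for t using rep_En[OF f s0, of t] by (simp add: le_less_trans)
  \<comment> \<open>The unimodular factor \<open>si\<close> covers both evaluations of the block:
    translating \<open>Pj\<close> by \<open>hv n\<close> multiplies its coefficients by
    \<open>ek l (hv n)\<close>.\<close>
  define V where "V si n t x = ennreal ((4 powr s)^fst n) * sqn (Dn n (f t) x) * sqn (\<Sum>l\<in>blk j. (si n l * m t l) * ek l x)"
   for si :: "nat \<times> bool => lat => complex" and n t x
  have part: "(IT t. (SU n. (IQ x. V si n t x))) <= ennreal (T0 * S * (Cm * (4 powr (de - s))^j))"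
   if si: "!!n l. cmod (si n l) = 1" for si
  proof -
   \<comment> \<open>Cutting \<open>f\<close> off at \<open>BJ J\<close> makes the product a
     trigonometric polynomial; the bounds are uniform in \<open>J\<close>, and Fatou's lemma removes
     the cutoff.\<close>
   define A where "A J n k l = of_real (sqrt ((4 powr s)^fst n)) * (restr (BJ J) (mu n) l * restr (blk j) (si n) (k - l))" for J n k l
   define KJ where "KJ J n t = (SZ k. sqn (LINT l|CZ. A J n k l * (f t l * m t (k - l))))" for J n t
   have KJm [measurable]: "KJ J n : bmeas" for J n unfolding KJ_def by measurable
   have 1: "(IQ x. V si n t x) <= liminf (%J. KJ J n t)" for n t
   proof -
    define u where "u J x = ennreal ((4 powr s)^fst n) * sqn (\<Sum>l\<in>BJ J. (mu n l * f t l) * ek l x) * sqn (\<Sum>l\<in>blk j. (si n l * m t l) * ek l x)" for J x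
    have "(IQ x. V si n t x) <= liminf (%J. \<integral>\<^sup>+x. u J x \<partial>sqM)"
    proof (rule fatou_liminf)
     show "u J : borel_measurable sqM" for J unfolding u_def by measurable
     show "AE x in sqM. (%J. u J x) \<longlonglongrightarrow> V si n t x"
      using partial_sums_tendsto_Dn[OF s(1) Ef[of t], of n]
     proof eventually_elim
      case (elim x)
      have "(%J. ennreal ((4 powr s)^fst n * (cmod (\<Sum>l\<in>BJ J. (mu n l * f t l) * ek l x))^2 * (cmod (\<Sum>l\<in>blk j. (si n l * m t l) * ek l x))^2))
       \<longlonglongrightarrow> ennreal ((4 powr s)^fst n * (cmod (Dn n (f t) x))^2 * (cmod (\<Sum>l\<in>blk j. (si n l * m t l) * ek l x))^2)"
       by (intro tendsto_ennrealI tendsto_intros elim)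
      thus ?case by (simp add: u_def V_def ennreal_mult)
     qed
    qed
    also have "... <= liminf (%J. KJ J n t)"
    proof (intro Liminf_mono always_eventually allI)
     fix J
     have "(IQ x. u J x) = ennreal ((4 powr s)^fst n) * (IQ x. sqn (\<Sum>l\<in>BJ J. (mu n l * f t l) * ek l x) * sqn (\<Sum>l\<in>blk j. (si n l * m t l) * ek l x))"
      unfolding u_def by (subst nn_integral_cmult[symmetric]) (auto simp: mult.assoc)
     also have "... <= ennreal ((4 powr s)^fst n) * (SZ k. sqn (conv (restr (BJ J) (%l. mu n l * f t l)) (restr (blk j) (%l. si n l * m t l)) k))"
      by (intro mult_left_mono trig_product_L2) auto
     also have "... = KJ J n t"
     proof -
      have "(cmod (LINT l|CZ. A J n k l * (f t l * m t (k - l))))^2 = (4 powr s)^fst n * (cmod (conv (restr (BJ J) (%l. mu n l * f t l)) (restr (blk j) (%l. si n l * m t l)) k))^2" for k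
      proof -
       have "A J n k l * (f t l * m t (k - l)) = of_real (sqrt ((4 powr s)^fst n)) * (restr (BJ J) (%l. mu n l * f t l) l * restr (blk j) (%l. si n l * m t l) (k - l))" for l
        by (simp add: A_def mult_ac)
       thus ?thesis by (simp add: conv_def norm_mult power_mult_distrib)
      qed
      thus ?thesis unfolding KJ_def by (simp add: ennreal_mult nn_integral_cmult)
     qed
     finally show "(IQ x. u J x) <= KJ J n t" .
    qed
    finally show ?thesis .
   qed
   have 2: "(IT t. (SU n. KJ J n t)) <= ennreal (T0 * S * (Cm * (4 powr (de - s))^j) * (1 * 1)^2)" for J
    unfolding KJ_def
   proof (rule bilinear_estimate[where A="A J" and d=de and et=1])
    show "rep (of_int 1) s 1 m" using m by simp
    show "0 <= Cm * (4 powr (de - s))^j" using Cm by simp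
    show "(SZ l. ennreal (1 / kap de k l) * ind {l. nrm2 l + 1 * nrm2 (k - l) = M} l) <= ennreal S" for k M by (rule S(2)) simp
    show "\<exists>B. \<forall>l. cmod (A J n k l) <= B" for n k
    proof -
     have "cmod (mu n l) <= 2" for l unfolding mu_def by (rule order_trans[OF norm_triangle_ineq4]) (simp add: th_def)
     hence "cmod (A J n k l) <= sqrt ((4 powr s)^fst n) * (2 * 1)" for l
      unfolding A_def norm_mult using si by (intro mult_mono) auto
     thus ?thesis by blast
    qed
    show "(SU n. sqn (A J n k l)) * ennreal (kap de k l) <= ennreal (Cm * (4 powr (de - s))^j * wt s l * wt s (k - l))" for k l
    proof (cases "k - l : blk j")
     case False
     hence "(cmod (A J n k l))^2 = 0" for n by (simp add: A_def)
     thus ?thesis by simp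
    next
     case True
     have "(SU n. sqn (A J n k l)) <= (SU n. ennreal ((4 powr s) ^ fst n * (cmod (mu n l))^2))"
      using True by (intro nn_integral_mono ennreal_leI) (simp add: A_def norm_mult power_mult_distrib si)
     also have "... <= ennreal (Cm * wt s l)" by (rule Cm(2))
     finally have "(SU n. sqn (A J n k l)) * ennreal (kap de k l) <= ennreal (Cm * wt s l) * ennreal (wt s (k - l) * (4 powr (de - s))^j)"
     proof (rule mult_mono)
      have "kap de k l <= wt de (k - l)" by (simp add: kap_def)
      also have "wt de (k - l) = wt s (k - l) * wt (- (s - de)) (k - l)" using wt_add[of s "- (s - de)" "k - l"] by simp
      also have "... <= wt s (k - l) * (4 powr (de - s))^j"
      proof (rule mult_left_mono)
       have "(4 powr (s - de))^j <= wt (s - de) (k - l)" by (rule wt_blk_ge[OF True]) (use de in simp)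
       moreover have "(4 powr (de - s))^j = 1 / (4 powr (s - de))^j" using powr_minus_divide[of 4 "s - de"] by (simp add: power_divide)
       ultimately show "wt (- (s - de)) (k - l) <= (4 powr (de - s))^j" unfolding wt_minus by (simp add: frac_le)
      qed simp
      finally show "ennreal (kap de k l) <= ennreal (wt s (k - l) * (4 powr (de - s))^j)" by (rule ennreal_leI)
     qed auto
     also have "... = ennreal (Cm * (4 powr (de - s))^j * wt s l * wt s (k - l))" using Cm by (simp add: ennreal_mult[symmetric] mult_ac)
     finally show ?thesis .
    qed
   qed (use s S f in auto)
   have "(IT t. (SU n. (IQ x. V si n t x))) <= (IT t. (SU n. liminf (%J. KJ J n t)))"
    by (intro nn_integral_mono 1)
   also have "... <= (IT t. liminf (%J. \<integral>\<^sup>+n. KJ J n t \<partial>count_space UNIV))"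
    by (intro nn_integral_mono nn_integral_liminf) auto
   also have "... <= liminf (%J. (IT t. (SU n. KJ J n t)))" by (rule nn_integral_liminf) measurable
   also have "... <= ennreal (T0 * S * (Cm * (4 powr (de - s))^j) * (1 * 1)^2)" by (rule Liminf_le) (use 2 in auto)
   finally show ?thesis by simp
  qed
  define si0 si1 where "si0 = (%(n::nat \<times> bool) (l::lat). 1::complex)" and "si1 = (%n l. ek l (hv n))"
  have Xeq: "Xsq s f m j t = (SU n. (IQ x. V si0 n t x)) + (SU n. (IQ x. V si1 n t x))" for t
  proof -
   have "Pj (m t) j x = (\<Sum>l\<in>blk j. (si0 n l * m t l) * ek l x)" "Pj (m t) j (x + hv n) = (\<Sum>l\<in>blk j. (si1 n l * m t l) * ek l x)" for n x
    by (simp_all add: Pj_shift) (simp_all add: Pj_def si0_def si1_def)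
   hence "Xsq s f m j t = (SU n. (IQ x. V si0 n t x + V si1 n t x))"
    unfolding Xsq_def V_def by (simp only: distrib_left)
   also have "... = (SU n. (IQ x. V si0 n t x) + (IQ x. V si1 n t x))"
    by (intro nn_integral_cong nn_integral_add) (simp_all add: V_def)
   finally show ?thesis by (simp add: nn_integral_add)
  qed
  have Vm [measurable]: "(%t. \<integral>\<^sup>+n. (IQ x. V si n t x) \<partial>count_space UNIV) : bmeas" for si
  proof -
   interpret finite_measure sqM by (rule finite_sqM)
   have "(%p. V si n (fst p) (snd p)) : borel_measurable (borel \<Otimes>\<^sub>M sqM)" for n unfolding V_def by measurable
   hence "(%t. \<integral>\<^sup>+x. V si n t x \<partial>sqM) : bmeas" for n
    by (intro borel_measurable_nn_integral) (simp add: case_prod_beta)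
   thus ?thesis by measurable
  qed
  have "(IT t. Xsq s f m j t) = (IT t. (SU n. (IQ x. V si0 n t x))) + (IT t. (SU n. (IQ x. V si1 n t x)))"
   unfolding Xeq by (rule nn_integral_add) measurable
  also have "... <= ennreal (T0 * S * (Cm * (4 powr (de - s))^j)) + ennreal (T0 * S * (Cm * (4 powr (de - s))^j))"
   by (intro add_mono part) (simp_all add: si0_def si1_def)
  also have "... = ennreal (C * (4 powr (de - s))^j)"
   using S(1) Cm(1) T0_pos by (subst ennreal_plus[symmetric]) (auto simp: C_def)
  finally show ?thesis .
 qed
 thus ?thesis using that C0 by blast
qed

text \<open>The squared \<open>l^2\<close> norm of the coefficients of the square of the block, that
  is the fourth power of its \<open>L^4\<close> norm in space.\<close>

definition Ysq :: "(real => lat => complex) => nat => real => ennreal" where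
 "Ysq m j t = (SZ k. sqn (conv (restr (blk j) (m t)) (restr (blk j) (m t)) k))"

text \<open>Bernstein's inequality for the square of the block, whose frequencies lie in a box of at
  most \<open>25 * 4^j\<close> points. It is to be integrated in time, where it controls the fourth
  power of the supremum better than the bound at each time.\<close>

lemma Ysq_sup: "ennreal ((cmod (Pj (m t) j x))^4) <= ennreal (25 * 4^j) * Ysq m j t"
proof -
 define K where "K = (%p. fst p + snd p) ` (blk j \<times> blk j)"
 have K: "finite K" by (simp add: K_def)
 define ka where "ka = conv (restr (blk j) (m t)) (restr (blk j) (m t))"
 have "K \<subseteq> {- 2 * 2^j..2 * 2^j} \<times> {- 2 * 2^j..2 * 2^j}"
 proof
  fix k assume "k : K"
  then obtain a b where "k = a + b" "a : blk j" "b : blk j" by (auto simp: K_def)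
  moreover have "a : {- (2^j)..2^j} \<times> {- (2^j)..2^j}" "b : {- (2^j)..2^j} \<times> {- (2^j)..2^j}"
   using calculation blk_subset[of j] by blast+
  ultimately show "k : {- 2 * 2^j..2 * 2^j} \<times> {- 2 * 2^j..2 * 2^j}" by (cases a; cases b) auto
 qed
 hence "card K <= card ({- 2 * 2^j..2 * 2^j::int} \<times> {- 2 * 2^j..2 * 2^j::int})" by (intro card_mono) auto
 also have "... = (4 * 2^j + 1)^2" by (simp add: card_cartesian_product power2_eq_square nat_add_distrib nat_mult_distrib nat_power_eq)
 also have "... <= (5 * 2^j)^2" by (intro power_mono) auto
 also have "... = 25 * 4^j" by (simp add: power_mult_distrib power_mult[symmetric] mult.commute[of j] power_mult)
 finally have cK: "real (card K) <= 25 * 4^j" using of_nat_le_iff[where 'a=real, of "card K" "25 * 4^j"] by simp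
 have "(Pj (m t) j x)^2 = (\<Sum>k\<in>K. ka k * ek k x)"
  unfolding K_def ka_def by (subst trig_product[symmetric]) (auto simp: Pj_def power2_eq_square)
 hence "cmod ((Pj (m t) j x)^2) <= (\<Sum>k\<in>K. cmod (ka k) * 1)" by (simp add: order_trans[OF norm_sum] norm_mult sum_mono)
 hence "(cmod ((Pj (m t) j x)^2))^2 <= (\<Sum>k\<in>K. cmod (ka k) * 1)^2" by (rule power_mono) simp
 also have "... <= (\<Sum>k\<in>K. (cmod (ka k))^2) * (\<Sum>k\<in>K. 1^2)" by (rule Cauchy_Schwarz_ineq_sum)
 also have "... <= (\<Sum>k\<in>K. (cmod (ka k))^2) * (25 * 4^j)" using cK by (intro mult_left_mono) (auto intro: sum_nonneg)
 also have "(cmod ((Pj (m t) j x)^2))^2 = (cmod (Pj (m t) j x))^4" by (simp add: norm_power flip: power_mult)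
 finally have "ennreal ((cmod (Pj (m t) j x))^4) <= ennreal (25 * 4^j) * ennreal (\<Sum>k\<in>K. (cmod (ka k))^2)"
  by (simp add: ennreal_mult[symmetric] sum_nonneg ennreal_leI mult.commute)
 also have "... <= ennreal (25 * 4^j) * Ysq m j t"
  unfolding Ysq_def ka_def by (intro mult_left_mono sum_le_nn_integral_count[OF K]) auto
 finally show ?thesis .
qed

text \<open>Both factors lie in the same block, so a loss of only \<open>de\<close> is set against
  two full weights of exponent \<open>s\<close>.\<close>

lemma Ysq_estimate:
 assumes s: "0 < s" and de: "0 < de" "de < s"
 obtains C where "0 <= C" "!!m j. rep 1 s 1 m ==> (IT t. Ysq m j t) <= ennreal (C * (4 powr (de - 2 * s))^j)"
proof -
 obtain S where S: "S > 0"
  "!!(et::int) k M. et : {0,1} ==> (SZ l. ennreal (1 / kap de k l) * ind {l. nrm2 l + et * nrm2 (k - l) = M} l) <= ennreal S"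
  using kap_sum_circle[OF de(1)] by blast
 have "(IT t. Ysq m j t) <= ennreal ((T0 * S) * (4 powr (de - 2 * s))^j)" if m: "rep 1 s 1 m" for m j
 proof -
  define A where "A k l = restr (blk j) (%_. 1) l * restr (blk j) (%_. 1) (k - l)" for k l
  have "(IT t. (SZ k. sqn (LINT l|CZ. A k l * (m t l * m t (k - l))))) <= ennreal (T0 * S * (4 powr (de - 2 * s))^j * (1 * 1)^2)"
  proof (rule bilinear_estimate_single[where A=A and d=de and et=1])
   show "rep (of_int 1) s 1 m" using m by simp
   show "(SZ l. ennreal (1 / kap de k l) * ind {l. nrm2 l + 1 * nrm2 (k - l) = M} l) <= ennreal S" for k M by (rule S(2)) simp
   show "\<exists>B. \<forall>l. cmod (A k l) <= B" for k by (intro exI[of _ 1]) (simp add: A_def)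
   show "(cmod (A k l))^2 * kap de k l <= (4 powr (de - 2 * s))^j * wt s l * wt s (k - l)" for k l
   proof (cases "l : blk j & k - l : blk j")
    case False thus ?thesis by (auto simp: A_def)
   next
    case True
    have a: "(4 powr s')^j <= wt s' p" if "p : blk j" "0 <= s'" for p s' using wt_blk_ge that by blast
    have "kap de k l <= wt de l" by (simp add: kap_def)
    also have "... = wt de l * ((4 powr (de - 2 * s))^j * ((4 powr (s - de))^j * (4 powr s)^j))"
     by (simp flip: power_mult_distrib powr_add)
    also have "... <= wt de l * ((4 powr (de - 2 * s))^j * (wt (s - de) l * wt s (k - l)))"
     using True de s by (intro mult_left_mono mult_mono a) auto
    also have "... = (4 powr (de - 2 * s))^j * (wt de l * wt (s - de) l) * wt s (k - l)" by (simp only: mult_ac)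
    also have "wt de l * wt (s - de) l = wt s l" by (simp flip: wt_add)
    finally show ?thesis using True by (simp add: A_def)
   qed
  qed (use s S m in auto)
  moreover have "(LINT l|CZ. A k l * (m t l * m t (k - l))) = conv (restr (blk j) (m t)) (restr (blk j) (m t)) k" for k t
   unfolding conv_def A_def by (intro bintegral_cong) auto
  ultimately show ?thesis by (simp add: Ysq_def)
 qed
 thus ?thesis using that[of "T0 * S"] S(1) T0_pos by simp
qed

section \<open>The nonlinear estimate\<close>

text \<open>Fourth powers are what is controlled on average in time. Below the threshold
  \<open>y\<close> the power is bounded trivially; above it \<open>w^4\<close> is split off, and the
  remaining power, whose exponent may have either sign, is estimated by its value at
  \<open>y\<close> or at the supremum bound \<open>D\<close>.\<close>

lemma powr_interpolate:
 fixes w :: real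
 assumes "0 <= w" "w <= D" "0 < y" and that: "0 <= be"
 shows "w powr (2*be) <= y powr (2*be) + w^4 * (y powr (2*be - 4) + D powr (2*be - 4))"
proof (cases "w <= y")
 case True
 hence "w powr (2*be) <= y powr (2*be)" using assms that by (intro powr_mono2) auto
 thus ?thesis by (simp add: add_increasing2)
next
 case False
 hence w: "0 < w" "y < w" using assms by auto
 have "w powr (2*be) = w powr 4 * w powr (2*be - 4)" by (simp flip: powr_add)
 also have "w powr 4 = w^4" using w by simp
 also have "w powr (2*be - 4) <= y powr (2*be - 4) + D powr (2*be - 4)"
 proof (cases "2*be - 4 >= 0")
  case True
  hence "w powr (2*be - 4) <= D powr (2*be - 4)" using assms w by (intro powr_mono2) auto
  thus ?thesis by (simp add: add_increasing)
 next
  case False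
  hence "w powr (2*be - 4) <= y powr (2*be - 4)" using assms w by (intro powr_mono2') auto
  thus ?thesis by (simp add: add_increasing2)
 qed
 finally have "w powr (2*be) <= w^4 * (y powr (2*be - 4) + D powr (2*be - 4))" by (simp add: mult_left_mono)
 thus ?thesis by (simp add: add_increasing)
qed

text \<open>A substitute for Cauchy-Schwarz in time: the root of a sum of products is dominated by a
  function that is integrable once the integrals of \<open>a j\<close> and \<open>b j\<close> are
  summable.\<close>

lemma ennreal_prod_sum_le_square:
 fixes a b :: "nat => ennreal"
 shows "(\<Sum>j. a j * b j) <= (\<Sum>j. a j + b j)^2"
proof -
 have "(\<Sum>j. a j * b j) <= (\<Sum>j. (a j + b j) * (\<Sum>j. a j + b j))"
 proof (rule suminf_le)
  fix j
  have "sum (%j. a j + b j) {j} <= (\<Sum>j. a j + b j)" by (rule sum_le_suminf) auto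
  hence "a j + b j <= (\<Sum>j. a j + b j)" by simp
  hence "(a j + b j) * (a j + b j) <= (a j + b j) * (\<Sum>j. a j + b j)" by (rule mult_left_mono) simp
  moreover have "a j * b j <= (a j + b j) * (a j + b j)" by (intro mult_mono) (auto simp: add_increasing add_increasing2)
  ultimately show "a j * b j <= (a j + b j) * (\<Sum>j. a j + b j)" by (rule order_trans[rotated])
 qed auto
 also have "... = (\<Sum>j. a j + b j)^2" by (simp add: power2_eq_square)
 finally show ?thesis .
qed

lemma Xsq_measurable:
 assumes [measurable]: "!!k. (%t. f t k) : bmeas" "!!k. (%t. m t k) : bmeas"
 shows "Xsq s f m j : bmeas"
proof -
 interpret finite_measure sqM by (rule finite_sqM)
 define g where "g n t x = ennreal ((4 powr s)^fst n) * sqn (Dn n (f t) x)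
   * (sqn (Pj (m t) j x) + sqn (Pj (m t) j (x + hv n)))" for n t x
 have "(%p. g n (fst p) (snd p)) : borel_measurable (borel \<Otimes>\<^sub>M sqM)" for n unfolding g_def by measurable
 hence [measurable]: "(%t. \<integral>\<^sup>+x. g n t x \<partial>sqM) : bmeas" for n
  by (intro borel_measurable_nn_integral) (simp add: case_prod_beta)
 show ?thesis unfolding Xsq_def g_def[symmetric] by measurable
qed

lemma Ysq_measurable:
 assumes [measurable]: "!!k. (%t. m t k) : bmeas"
 shows "Ysq m j : bmeas"
 unfolding Ysq_def conv_def by measurable

definition Zsq :: "real => real => (real => lat => complex) => (real => lat => complex) => real => ennreal" where
 "Zsq s p f m t = (SU n. (IQ x. ennreal ((4 powr s)^fst n) * sqn (Dn n (f t) x)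
   * (ennreal (cmod (syn (m t) x) powr p) + ennreal (cmod (syn (m t) (x + hv n)) powr p))))"

text \<open>The power \<open>2 * af - 2\<close> of the synthesis is split into blocks. Two factors
  of a block go into \<open>Xsq\<close>; the other \<open>2 * be\<close> are bounded uniformly in
  \<open>x\<close> by \<open>A j\<close>. Integrated in time, \<open>Xsq\<close> is of order
  \<open>4 powr ((de - s) * j)\<close> and \<open>A j\<close> at most of order
  \<open>4 powr ((s - 3 * de) * j)\<close>; the condition on \<open>af\<close> is what gives the
  latter.\<close>

lemma Zsq_estimate:
 assumes s: "0 < s" "s < 1" and af: "2 <= af" "(af - 2) * (1 - s) < 2 * s"
 obtains C where "0 <= C" "!!f m. rep 1 s 1 f ==> rep 1 s 1 m ==>
  \<exists>ro \<in> bmeas. (\<forall>t. Zsq s (2*af - 2) f m t <= (ro t)^2) & (IT t. ro t) <= ennreal C"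
proof -
 define be where "be = af - 2"
 \<comment> \<open>\<open>e0\<close> is the room that the hypothesis leaves. The sixth of it in
   \<open>de\<close> is dictated by the trivial part \<open>a0\<close>, of exponent
   \<open>s - e0/2\<close>.\<close>
 define e0 where "e0 = 2 * s - be * (1 - s)"
 define de where "de = min (s/4) (e0/6)"
 have be: "0 <= be" using af by (simp add: be_def)
 have e0: "0 < e0" using af by (simp add: e0_def be_def)
 have de: "0 < de" "de < s" "4 * de <= s" "6 * de <= e0" using s e0 by (auto simp: de_def)
 define te where "te = de/2"
 define p where "p = 2*af - 2"
 have p: "0 < p" "p = 2 + 2*be" using af by (auto simp: p_def be_def)
 obtain CX where CX: "0 <= CX" "!!f m j. rep 1 s 1 f ==> rep 1 s 1 m ==> (IT t. Xsq s f m j t) <= ennreal (CX * (4 powr (de - s))^j)"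
  using Xsq_estimate[OF s de(1,2)] by blast
 obtain CY where CY: "0 <= CY" "!!m j. rep 1 s 1 m ==> (IT t. Ysq m j t) <= ennreal (CY * (4 powr (de - 2 * s))^j)"
  using Ysq_estimate[OF s(1) de(1,2)] by blast
 define K where "K = (1 / (1 - 4 powr (-te/p))) powr p"
 have K0: "0 <= K" by (simp add: K_def)
 \<comment> \<open>The threshold of the interpolation is, up to a constant, the square root of the
   Bernstein bound \<open>D\<close>.\<close>
 define y where "y j = (4 powr ((1 - s)/4))^j" for j :: nat
 define D where "D j = 3 * (4 powr ((1 - s)/2))^j" for j :: nat
 define a0 where "a0 j = y j powr (2*be)" for j
 define a1 where "a1 j = 25 * 4^j * (y j powr (2*be - 4) + D j powr (2*be - 4))" for j
 define CA where "CA = T0 + 25 * CY * (1 + 3 powr (2*be - 4))"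
 have CA0: "0 <= CA" using CY T0_pos by (simp add: CA_def)
 have pw: "((4 powr u)^j) powr v = (4 powr (u * v))^j" for u v :: real and j :: nat
 proof -
  have "((4 powr u)^j) powr v = (4 powr (u * real j)) powr v" by (simp only: powr_mult_nat zero_less_numeral)
  also have "... = 4 powr ((u * v) * real j)" by (simp only: powr_powr) (simp only: mult_ac)
  finally show ?thesis by (simp only: powr_mult_nat zero_less_numeral)
 qed
 have le4: "(4 powr u)^j <= (4 powr v)^j" if "u <= v" for u v :: real and j :: nat
  using that by (intro power_mono powr_mono) auto
 have bA: "T0 * a0 j + a1 j * (CY * (4 powr (de - 2 * s))^j) <= CA * (4 powr (s - 3*de))^j" for j
 proof -
  have bb: "be * (1 - s) = 2 * s - e0" by (simp add: e0_def)
  have "a0 j = (4 powr ((1 - s)/4 * (2*be)))^j" unfolding a0_def y_def pw ..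
  also have "... <= (4 powr (s - 3*de))^j"
  proof (rule le4)
   have k: "(1 - s)/4 * (2*be) = (be * (1 - s))/2" by (simp add: field_simps)
   show "(1 - s)/4 * (2*be) <= s - 3*de" unfolding k bb using de by (simp add: field_simps)
  qed
  finally have 1: "a0 j <= (4 powr (s - 3*de))^j" .
  have "4^j * y j powr (2*be - 4) * (4 powr (de - 2 * s))^j = (4 powr (1 + (1 - s)/4 * (2*be - 4) + (de - 2 * s)))^j"
   unfolding y_def pw by (simp add: powr_add power_mult_distrib)
  also have "... <= (4 powr (s - 3*de))^j"
  proof (rule le4)
   have k: "(1 - s)/4 * (2*be - 4) = (be * (1 - s))/2 - (1 - s)" by (simp add: field_simps)
   show "1 + (1 - s)/4 * (2*be - 4) + (de - 2 * s) <= s - 3*de" unfolding k bb using de s e0 by argo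
  qed
  finally have 2: "4^j * y j powr (2*be - 4) * (4 powr (de - 2 * s))^j <= (4 powr (s - 3*de))^j" .
  have "4^j * D j powr (2*be - 4) * (4 powr (de - 2 * s))^j = 3 powr (2*be - 4) * (4 powr (1 + (1 - s)/2 * (2*be - 4) + (de - 2 * s)))^j"
  proof -
   have "D j powr (2*be - 4) = 3 powr (2*be - 4) * (4 powr ((1 - s)/2 * (2*be - 4)))^j"
    unfolding D_def by (subst powr_mult; simp only: pw zero_le_power powr_ge_zero zero_le_numeral)
   thus ?thesis by (simp add: powr_add power_mult_distrib)
  qed
  also have "... <= 3 powr (2*be - 4) * (4 powr (s - 3*de))^j"
  proof (intro mult_left_mono le4)
   have k: "(1 - s)/2 * (2*be - 4) = be * (1 - s) - 2 * (1 - s)" by (simp add: field_simps)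
   show "1 + (1 - s)/2 * (2*be - 4) + (de - 2 * s) <= s - 3*de" unfolding k bb using de s e0 by argo
  qed simp
  finally have 3: "4^j * D j powr (2*be - 4) * (4 powr (de - 2 * s))^j <= 3 powr (2*be - 4) * (4 powr (s - 3*de))^j" .
  have "T0 * a0 j + a1 j * (CY * (4 powr (de - 2 * s))^j) = T0 * a0 j + 25 * CY * (4^j * y j powr (2*be - 4) * (4 powr (de - 2 * s))^j + 4^j * D j powr (2*be - 4) * (4 powr (de - 2 * s))^j)"
   by (simp add: a1_def algebra_simps)
  also have "... <= T0 * (4 powr (s - 3*de))^j + 25 * CY * ((4 powr (s - 3*de))^j + 3 powr (2*be - 4) * (4 powr (s - 3*de))^j)"
   using T0_pos CY(1) by (intro add_mono mult_left_mono 1 2 3) auto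
  also have "... = CA * (4 powr (s - 3*de))^j" by (simp add: CA_def algebra_simps)
  finally show ?thesis .
 qed
 define C where "C = (K * CX) / (1 - 4 powr (-de/2)) + CA / (1 - 4 powr (-de))"
 have Q: "0 < 4 powr (-de/2)" "4 powr (-de/2) < 1" "0 < 4 powr (-de)" "4 powr (-de) < 1"
  using de by (auto simp: powr_less_one)
 have C0: "0 <= C" using Q K0 CX(1) CA0 by (simp add: C_def)
 have "\<exists>ro \<in> bmeas. (\<forall>t. Zsq s p f m t <= (ro t)^2) & (IT t. ro t) <= ennreal C"
  if f: "rep 1 s 1 f" and m: "rep 1 s 1 m" for f m
 proof -
  have s0: "0 <= s" using s by simp
  have [measurable]: "(%t. f t k) : bmeas" "(%t. m t k) : bmeas" for k
   using rep_measurable[OF f s0] rep_measurable[OF m s0] by auto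
  define A where "A j t = ennreal (a0 j) + ennreal (a1 j) * Ysq m j t" for j t
  have Pp: "ennreal (cmod (Pj (m t) j x) powr p) <= A j t * sqn (Pj (m t) j x)" for j t x
  proof -
   define w where "w = cmod (Pj (m t) j x)"
   have w: "0 <= w" "w <= D j" using Pj_sup[OF s0, of "m t" 1 j x] rep_En[OF m s0, of t] by (auto simp: w_def D_def)
   have "w powr (2*be) <= a0 j + w^4 * (y j powr (2*be - 4) + D j powr (2*be - 4))"
    unfolding a0_def using w by (intro powr_interpolate be) (auto simp: y_def)
   hence "ennreal (w powr (2*be)) <= ennreal (a0 j + w^4 * (y j powr (2*be - 4) + D j powr (2*be - 4)))" by (rule ennreal_leI)
   also have "... = ennreal (a0 j) + ennreal (w^4 * (y j powr (2*be - 4) + D j powr (2*be - 4)))" by (rule ennreal_plus) (auto simp: a0_def)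
   also have "... = ennreal (a0 j) + ennreal (w^4) * ennreal (y j powr (2*be - 4) + D j powr (2*be - 4))" by (subst ennreal_mult) auto
   also have "... <= ennreal (a0 j) + (ennreal (25 * 4^j) * Ysq m j t) * ennreal (y j powr (2*be - 4) + D j powr (2*be - 4))"
    unfolding w_def by (intro add_left_mono mult_right_mono Ysq_sup) simp
   also have "... = A j t" by (simp add: A_def a1_def ennreal_mult mult_ac)
   finally have "ennreal (w powr (2*be)) <= A j t" .
   moreover have "w powr p = w powr (2*be) * w^2" using powr_minus_two_mult[OF w(1), of p] p by simp
   ultimately show ?thesis by (simp add: w_def ennreal_mult mult_right_mono)
  qed
  define X where "X = Xsq s f m"
  have Xm [measurable]: "X j : bmeas" for j unfolding X_def by (rule Xsq_measurable) measurable
  have Am [measurable]: "A j : bmeas" for j using Ysq_measurable[of m j] unfolding A_def by measurable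
  define Te where "Te = 4 powr te"
  \<comment> \<open>Weights that balance the two sequences: with \<open>mm\<close> and
    \<open>lam\<close> the terms decay like powers of \<open>4 powr (-de/2)\<close> and
    \<open>4 powr (-de)\<close>, while the product of the weights is the factor
    \<open>K * Te^j\<close> from adding the blocks.\<close>
  define lam where "lam j = (4 powr (2*de - s))^j" for j :: nat
  define mm where "mm j = K * (4 powr (te + s - 2*de))^j" for j :: nat
  have lm: "K * Te^j = mm j * lam j" for j
   by (simp add: mm_def lam_def Te_def mult.assoc flip: power_mult_distrib powr_add)
  have Zb: "Zsq s p f m t <= (\<Sum>j. (ennreal (mm j) * X j t) * (ennreal (lam j) * A j t))" for t
  proof -
   have syn: "ennreal (cmod (syn (m t) x) powr p) <= (\<Sum>j. ennreal (K * Te^j) * (A j t * sqn (Pj (m t) j x)))" for x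
   proof -
    have "ennreal (cmod (syn (m t) x) powr p) <= ennreal K * (\<Sum>j. ennreal (Te^j * cmod (Pj (m t) j x) powr p))"
     unfolding K_def Te_def by (rule syn_powr_le_blocks[OF p(1)]) (use de in \<open>simp add: te_def\<close>)
    also have "... = (\<Sum>j. ennreal K * ennreal (Te^j * cmod (Pj (m t) j x) powr p))" by simp
    also have "... <= (\<Sum>j. ennreal (K * Te^j) * (A j t * sqn (Pj (m t) j x)))"
    proof (intro suminf_le)
     fix j
     have "ennreal K * ennreal (Te^j * cmod (Pj (m t) j x) powr p) = ennreal (K * Te^j) * ennreal (cmod (Pj (m t) j x) powr p)"
      using K0 by (simp add: Te_def ennreal_mult mult.assoc)
     also have "... <= ennreal (K * Te^j) * (A j t * sqn (Pj (m t) j x))" by (intro mult_left_mono Pp) simp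
     finally show "ennreal K * ennreal (Te^j * cmod (Pj (m t) j x) powr p) <= ennreal (K * Te^j) * (A j t * sqn (Pj (m t) j x))" .
    qed auto
    finally show ?thesis .
   qed
   define W where "W n x = ennreal ((4 powr s)^fst n) * sqn (Dn n (f t) x)" for n x
   have Wm [measurable]: "W n : bmeas" for n unfolding W_def by measurable
   define R where "R j n x = sqn (Pj (m t) j x) + sqn (Pj (m t) j (x + hv n))" for j n x
   have Rm [measurable]: "R j n : bmeas" for j n unfolding R_def by measurable
   have "Zsq s p f m t <= (SU n. (IQ x. (\<Sum>j. ennreal (K * Te^j) * A j t * (W n x * R j n x))))"
    unfolding Zsq_def W_def[symmetric]
   proof (intro nn_integral_mono)
    fix n x
    have "ennreal (cmod (syn (m t) x) powr p) + ennreal (cmod (syn (m t) (x + hv n)) powr p)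
     <= (\<Sum>j. ennreal (K * Te^j) * (A j t * sqn (Pj (m t) j x))) + (\<Sum>j. ennreal (K * Te^j) * (A j t * sqn (Pj (m t) j (x + hv n))))"
     by (intro add_mono syn)
    also have "... = (\<Sum>j. ennreal (K * Te^j) * A j t * R j n x)"
     by (subst suminf_add) (auto simp: R_def distrib_left mult.assoc)
    finally have "W n x * (ennreal (cmod (syn (m t) x) powr p) + ennreal (cmod (syn (m t) (x + hv n)) powr p)) <= W n x * (\<Sum>j. ennreal (K * Te^j) * A j t * R j n x)"
     by (rule mult_left_mono) simp
    also have "... = (\<Sum>j. W n x * (ennreal (K * Te^j) * A j t * R j n x))" by simp
    also have "... = (\<Sum>j. ennreal (K * Te^j) * A j t * (W n x * R j n x))" by (simp only: mult_ac)
    finally show "W n x * (ennreal (cmod (syn (m t) x) powr p) + ennreal (cmod (syn (m t) (x + hv n)) powr p)) <= (\<Sum>j. ennreal (K * Te^j) * A j t * (W n x * R j n x))" .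
   qed
   also have "... = (\<Sum>j. ennreal (K * Te^j) * A j t * (SU n. (IQ x. W n x * R j n x)))"
    by (simp add: nn_integral_suminf nn_integral_cmult)
   also have "... = (\<Sum>j. ennreal (K * Te^j) * A j t * X j t)" by (simp add: X_def Xsq_def W_def R_def)
   also have "... = (\<Sum>j. (ennreal (mm j) * X j t) * (ennreal (lam j) * A j t))"
   proof -
    have "ennreal (K * Te^j) = ennreal (mm j) * ennreal (lam j)" for j unfolding lm using K0 by (intro ennreal_mult) (auto simp: mm_def lam_def)
    thus ?thesis by (simp only: mult_ac)
   qed
   finally show ?thesis .
  qed
  define ro where "ro t = (\<Sum>j. ennreal (mm j) * X j t + ennreal (lam j) * A j t)" for t
  have rom: "ro : bmeas" unfolding ro_def by measurable
  have "Zsq s p f m t <= (ro t)^2" for t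
   unfolding ro_def by (rule order_trans[OF Zb ennreal_prod_sum_le_square])
  moreover have "(IT t. ro t) <= ennreal C"
  proof -
   have "(IT t. ro t) = (\<Sum>j. (IT t. ennreal (mm j) * X j t + ennreal (lam j) * A j t))"
    unfolding ro_def by (rule nn_integral_suminf) measurable
   also have "... <= (\<Sum>j. ennreal ((K * CX) * (4 powr (-de/2))^j) + ennreal (CA * (4 powr (-de))^j))"
   proof (intro suminf_le)
    fix j
    have "(IT t. ennreal (mm j) * X j t + ennreal (lam j) * A j t) = ennreal (mm j) * (IT t. X j t) + ennreal (lam j) * (IT t. A j t)"
     by (simp add: nn_integral_add nn_integral_cmult)
    also have "... <= ennreal (mm j) * ennreal (CX * (4 powr (de - s))^j) + ennreal (lam j) * ennreal (CA * (4 powr (s - 3*de))^j)"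
    proof (intro add_mono mult_left_mono)
     show "(IT t. X j t) <= ennreal (CX * (4 powr (de - s))^j)" unfolding X_def by (rule CX(2)[OF f m])
     have "(IT t. A j t) = ennreal (a0 j) * ennreal T0 + ennreal (a1 j) * (IT t. Ysq m j t)"
      using T0_pos Ysq_measurable[of m j] unfolding A_def by (simp add: nn_integral_add nn_integral_cmult emeasure_ivl)
     also have "... <= ennreal (a0 j) * ennreal T0 + ennreal (a1 j) * ennreal (CY * (4 powr (de - 2 * s))^j)"
      by (intro add_left_mono mult_left_mono CY(2)[OF m]) simp
     also have "... = ennreal (T0 * a0 j + a1 j * (CY * (4 powr (de - 2 * s))^j))"
      using CY(1) T0_pos by (subst ennreal_plus) (auto simp: a0_def a1_def ennreal_mult mult_ac intro!: mult_nonneg_nonneg add_nonneg_nonneg)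
     also have "... <= ennreal (CA * (4 powr (s - 3*de))^j)" by (rule ennreal_leI[OF bA])
     finally show "(IT t. A j t) <= ennreal (CA * (4 powr (s - 3*de))^j)" .
    qed auto
    also have "ennreal (mm j) * ennreal (CX * (4 powr (de - s))^j) = ennreal ((K * CX) * (4 powr (-de/2))^j)"
    proof -
     have "(4 powr (te + s - 2*de))^j * (4 powr (de - s))^j = (4 powr (-de/2))^j"
      unfolding power_mult_distrib[symmetric] powr_add[symmetric] by (rule arg_cong[where f="%x. (4 powr x)^j"]) (simp add: te_def)
     hence "mm j * (CX * (4 powr (de - s))^j) = (K * CX) * (4 powr (-de/2))^j" by (simp add: mm_def mult_ac)
     thus ?thesis using K0 CX(1) by (subst ennreal_mult[symmetric]) (auto simp: mm_def)
    qed
    also have "ennreal (lam j) * ennreal (CA * (4 powr (s - 3*de))^j) = ennreal (CA * (4 powr (-de))^j)"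
    proof -
     have "(4 powr (2*de - s))^j * (4 powr (s - 3*de))^j = (4 powr (-de))^j"
      unfolding power_mult_distrib[symmetric] powr_add[symmetric] by (rule arg_cong[where f="%x. (4 powr x)^j"]) simp
     hence "lam j * (CA * (4 powr (s - 3*de))^j) = CA * (4 powr (-de))^j" by (simp add: lam_def mult_ac)
     thus ?thesis using CA0 by (subst ennreal_mult[symmetric]) (auto simp: lam_def)
    qed
    finally show "(IT t. ennreal (mm j) * X j t + ennreal (lam j) * A j t) <= ennreal ((K * CX) * (4 powr (-de/2))^j) + ennreal (CA * (4 powr (-de))^j)" .
   qed auto
   also have "... = (\<Sum>j. ennreal ((K * CX) * (4 powr (-de/2))^j)) + (\<Sum>j. ennreal (CA * (4 powr (-de))^j))" by (rule suminf_add[symmetric]) auto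
   also have "... = ennreal ((K * CX) / (1 - 4 powr (-de/2))) + ennreal (CA / (1 - 4 powr (-de)))"
    using Q K0 CX(1) CA0 by (subst (1 2) suminf_ennreal_geometric) auto
   also have "... = ennreal C" unfolding C_def using Q K0 CX(1) CA0 by (intro ennreal_plus[symmetric]) auto
   finally show ?thesis .
  qed
  ultimately show ?thesis using rom by blast
 qed
 thus ?thesis using that[of C] C0 unfolding p_def by blast
qed

section \<open>Energy through differences and the Lipschitz bound for the power\<close>

lemma syn_periodic: "v = (1,0) \<or> v = (0,1) ==> syn a (x + v) = syn a x"
proof -
 assume "v = (1,0) \<or> v = (0,1)"
 hence "ek k v = 1" for k by (auto simp: ek_def)
 thus ?thesis by (simp add: syn_shift)
qed

text \<open>By periodicity the integral over the square is invariant under the shift, so a shift of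
  the function becomes a character factor on its coefficients.\<close>

lemma fcoef_difference:
 assumes g: "integrable sqM g" and gm [measurable]: "g : bmeas"
  and per: "!!v x. v = (1,0) \<or> v = (0,1) ==> g (x + v) = g x"
 shows "fcoef (%x. g (x + hv n) - of_real (th n) * g x) k = mu n k * fcoef g k"
proof -
 define v where "v = (if snd n then (1,0) else (0,1) :: real \<times> real)"
 have v: "v = (1,0) \<or> v = (0,1)" by (simp add: v_def)
 define a where "a = (if fst n = 0 then 0 else (1/2::real)^fst n)"
 have a: "0 <= a" "a <= 1" by (auto simp: a_def power_le_one)
 have h: "hv n = a *\<^sub>R v" by (auto simp: hv_def a_def v_def zero_prod_def)
 have ev: "ek m v = 1" for m using v by (auto simp: ek_def)
 define G where "G x = g x * ek (- k) x" for x
 have Gm [measurable]: "G : bmeas" unfolding G_def by measurable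
 have Gp: "G (x + v) = G x" for x by (simp add: G_def per[OF v] ek_shift ev)
 have iG: "integrable sqM G" unfolding G_def
  by (rule bintegrable_bound[OF g]) (auto simp: norm_mult)
 have nG: "(IQ x. ennreal (cmod (G x))) < \<infinity>" using iG by (simp add: integrable_iff_bounded)
 have "(IQ x. ennreal (cmod (G (x + a *\<^sub>R v)))) = (IQ x. ennreal (cmod (G x)))"
  by (rule sq_shift(1)[OF v a, where f="%x. ennreal (cmod (G x))"]) (auto simp: Gp)
 hence iGs: "integrable sqM (%x. G (x + a *\<^sub>R v))" using nG by (intro integrableI_bounded) auto
 have IG: "(LINT x|sqM. G (x + a *\<^sub>R v)) = fcoef g k"
  using sq_shift(2)[OF v a, of G] Gp by (simp add: fcoef_sqM[OF gm] G_def)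
 have eq: "(g (x + hv n) - of_real (th n) * g x) * ek (- k) x = ek k (hv n) * G (x + a *\<^sub>R v) - of_real (th n) * G x" for x
 proof -
  have "ek k (hv n) * ek (- k) (x + hv n) = ek (- k) x" by (simp add: ek_shift mult.left_commute flip: ek_add)
  thus ?thesis by (simp add: G_def h[symmetric] left_diff_distrib mult.assoc mult.left_commute)
 qed
 have "fcoef (%x. g (x + hv n) - of_real (th n) * g x) k = (LINT x|sqM. ek k (hv n) * G (x + a *\<^sub>R v) - of_real (th n) * G x)"
  by (subst fcoef_sqM) (measurable, simp only: eq)
 also have "... = ek k (hv n) * fcoef g k - of_real (th n) * fcoef g k"
  using iG iGs by (subst bintegral_diff) (auto simp: IG fcoef_sqM[OF gm] G_def[symmetric])
 finally show ?thesis by (simp add: mu_def left_diff_distrib)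
qed

text \<open>The lower bound for the multipliers \<open>mu\<close> combined with Bessel's inequality
  for every difference; this brings pointwise information on \<open>g\<close> into the Sobolev
  norm.\<close>

lemma En_le_differences:
 assumes s: "0 <= s" and g: "integrable sqM g" and gm [measurable]: "g : bmeas"
  and per: "!!v x. v = (1,0) \<or> v = (0,1) ==> g (x + v) = g x"
 shows "En s (fcoef g) <= ennreal ((1 + 8 * pi^2) powr s) * (SU n. (IQ x. ennreal ((4 powr s)^fst n) * sqn (g (x + hv n) - of_real (th n) * g x)))"
proof -
 define C where "C = ennreal ((1 + 8 * pi^2) powr s)"
 have "En s (fcoef g) <= (SZ k. C * (SU n. ennreal ((4 powr s) ^ fst n * (cmod (mu n k))^2)) * sqn (fcoef g k))"
  unfolding En_def C_def using wt_le_mu_sum[OF s] by (intro nn_integral_mono) (simp add: ennreal_mult mult_right_mono)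
 also have "... = C * (SZ k. (SU n. ennreal ((4 powr s) ^ fst n) * sqn (mu n k * fcoef g k)))"
  by (simp add: norm_mult power_mult_distrib ennreal_mult nn_integral_cmult nn_integral_multc mult.assoc flip: nn_integral_multc)
 also have "... = C * (SU n. (SZ k. ennreal ((4 powr s) ^ fst n) * sqn (mu n k * fcoef g k)))"
  by (subst nn_integral_count_swap) auto
 also have "... <= C * (SU n. (IQ x. ennreal ((4 powr s)^fst n) * sqn (g (x + hv n) - of_real (th n) * g x)))"
 proof (intro mult_left_mono nn_integral_mono)
  fix n
  have "(SZ k. sqn (mu n k * fcoef g k)) <= (IQ x. sqn (g (x + hv n) - of_real (th n) * g x))"
   using bessel_sq[of "%x. g (x + hv n) - of_real (th n) * g x"] by (simp add: fcoef_difference[OF g gm per])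
  thus "(SZ k. ennreal ((4 powr s) ^ fst n) * sqn (mu n k * fcoef g k)) <= (IQ x. ennreal ((4 powr s)^fst n) * sqn (g (x + hv n) - of_real (th n) * g x))"
   by (simp add: nn_integral_cmult mult_left_mono)
 qed simp
 finally show ?thesis by (simp add: C_def)
qed

definition nlc :: "real => (lat => complex) => lat => complex" where
 "nlc af a = fcoef (%x. complex_of_real (cmod (syn a x) powr af))"

lemma integrable_syn_powr:
 assumes s: "0 < s" and af: "2 <= af" "(af - 2) * (1 - s) < 2 * s" and E: "En s a < \<infinity>"
 shows "integrable sqM (%x. complex_of_real (cmod (syn a x) powr af))"
proof -
 obtain C where C: "!!a q. 0 <= q ==> En s a <= ennreal (q^2) ==> (IQ x. ennreal (cmod (syn a x) powr af)) <= ennreal (C * q powr af)"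
  using embedding[OF s af] by metis
 obtain e where e: "En s a = ennreal e" "0 <= e" using E by (cases "En s a") auto
 have "(IQ x. ennreal (cmod (syn a x) powr af)) <= ennreal (C * sqrt e powr af)" by (rule C) (use e in auto)
 also have "... < \<infinity>" by simp
 finally show ?thesis by (intro integrableI_bounded) auto
qed

text \<open>Linearity of \<open>syn\<close> holds almost everywhere, and the pointwise inequality
  requires it at the shifted point as well.\<close>

lemma AE_sq_shift:
 assumes [measurable]: "Measurable.pred borel P" and per: "!!v x. v = (1,0) \<or> v = (0,1) ==> P (x + v) = P x"
  and P: "AE x in sqM. P x"
 shows "AE x in sqM. P (x + hv n)"
proof -
 define v where "v = (if snd n then (1,0) else (0,1) :: real \<times> real)"
 have v: "v = (1,0) \<or> v = (0,1)" by (simp add: v_def)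
 define a where "a = (if fst n = 0 then 0 else (1/2::real)^fst n)"
 have a: "0 <= a" "a <= 1" by (auto simp: a_def power_le_one)
 have h: "hv n = a *\<^sub>R v" by (auto simp: hv_def a_def v_def zero_prod_def)
 define f where "f x = (if P x then 0 else 1 :: ennreal)" for x
 have [measurable]: "f : bmeas" unfolding f_def by measurable
 have "(IQ x. f (x + hv n)) = (IQ x. f x)"
  unfolding h by (rule sq_shift(1)[OF v a]) (auto simp: f_def per[OF v])
 also have "... = (IQ x. 0)" by (rule nn_integral_cong_AE) (use P in \<open>auto simp: f_def elim: eventually_mono\<close>)
 finally have "(IQ x. f (x + hv n)) = 0" by simp
 hence "AE x in sqM. f (x + hv n) = 0" by (simp add: nn_integral_0_iff_AE)
 thus ?thesis by (auto simp: f_def elim!: eventually_mono split: if_splits)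
qed

lemma syn_linear:
 assumes "0 < s" "En s a < \<infinity>" "En s b < \<infinity>"
 shows "AE x in sqM. syn (%k. a k + z * b k) x = syn a x + z * syn b x"
 using syn_AE_L2(1)[OF assms(1,2)] syn_AE_L2(1)[OF assms(1,3)]
proof eventually_elim
 case (elim x)
 have sa: "summable (%j. Pj a j x)" and sb: "summable (%j. Pj b j x)" by (rule summable_norm_cancel[OF elim(1)], rule summable_norm_cancel[OF elim(2)])
 have "Pj (%k. a k + z * b k) j x = Pj a j x + z * Pj b j x" for j
  by (simp only: Pj_def distrib_right sum.distrib sum_distrib_left mult.assoc)
 thus ?case unfolding syn_def using sa sb by (simp add: suminf_add[symmetric] suminf_mult summable_mult)
qed

text \<open>The profiles \<open>c\<close>, \<open>c'\<close>, \<open>e\<close> are listed as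
  \<open>cc 0\<close>, \<open>cc 1\<close>, \<open>cc 2\<close>. In the squared difference of the
  two powers each term pairs a spatial difference of one profile with a power of one profile, hence
  nine quantities \<open>Zsq\<close> and the constant 9.\<close>

lemma nonlinear_core:
 assumes s: "0 < s" "s < 1" and af: "2 <= af" "(af - 2) * (1 - s) < 2 * s"
 obtains C where "0 <= C" "!!q c c' e. 0 <= q ==> rep 1 s 1 c ==> rep 1 s 1 c' ==> rep 1 s 1 e ==> (!!t k. c' t k = c t k + of_real q * e t k) ==>
  \<exists>ro \<in> bmeas. (\<forall>t. En s (%k. nlc af (c' t) k - nlc af (c t) k) <= ennreal (q^2) * (ro t)^2) & (IT t. ro t) <= ennreal C"
proof -
 define p where "p = 2*af - 2"
 obtain CZ' where CZ: "0 <= CZ'" "!!f m. rep 1 s 1 f ==> rep 1 s 1 m ==>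
  \<exists>ro \<in> bmeas. (\<forall>t. Zsq s p f m t <= (ro t)^2) & (IT t. ro t) <= ennreal CZ'"
  using Zsq_estimate[OF s af] unfolding p_def by blast
 define K4 where "K4 = 3 * af^4 * 6 powr p"
 have K40: "0 <= K4" by (simp add: K4_def)
 define K where "K = (1 + 8 * pi^2) powr s * K4"
 have K0: "0 <= K" using K40 by (simp add: K_def)
 have "\<exists>ro \<in> bmeas. (\<forall>t. En s (%k. nlc af (c' t) k - nlc af (c t) k) <= ennreal (q^2) * (ro t)^2) & (IT t. ro t) <= ennreal (sqrt K * (9 * CZ'))"
  if q: "0 <= q" and c: "rep 1 s 1 c" and c': "rep 1 s 1 c'" and e: "rep 1 s 1 e" and ceq: "!!t k. c' t k = c t k + of_real q * e t k" for q c c' e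
 proof -
  have s0: "0 <= s" using s by simp
  define cc where "cc i = (if i = 0 then c else if i = 1 then c' else e)" for i :: nat
  have rcc: "rep 1 s 1 (cc i)" for i using c c' e by (simp add: cc_def)
  have "\<forall>i j. \<exists>ro \<in> bmeas. (\<forall>t. Zsq s p (cc i) (cc j) t <= (ro t)^2) & (IT t. ro t) <= ennreal CZ'"
   using CZ(2)[OF rcc rcc] by blast
  then obtain ro where ro: "!!i j. ro i j : bmeas" "!!i j t. Zsq s p (cc i) (cc j) t <= (ro i j t)^2" "!!i j. (IT t. ro i j t) <= ennreal CZ'"
   by metis
  note [measurable] = ro(1)
  have E: "En s (cc i t) < \<infinity>" for i t using rep_En[OF rcc s0, of i t] by (simp add: le_less_trans)
  have key: "En s (%k. nlc af (c' t) k - nlc af (c t) k) <= ennreal (q^2) * (ennreal K * (\<Sum>i<3. \<Sum>j<3. Zsq s p (cc i) (cc j) t))" for t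
  proof -
   define u where "u i x = syn (cc i t) x" for i x
   have um [measurable]: "u i : bmeas" for i unfolding u_def by measurable
   define g where "g x = complex_of_real (cmod (u 1 x) powr af - cmod (u 0 x) powr af)" for x
   have gm [measurable]: "g : bmeas" unfolding g_def by measurable
   have iu: "integrable sqM (%x. complex_of_real (cmod (u i x) powr af))" for i unfolding u_def by (rule integrable_syn_powr[OF s(1) af E])
   have ig: "integrable sqM g" using bintegrable_diff[OF iu[of 1] iu[of 0]] by (simp add: g_def[abs_def])
   have fg: "fcoef g = (%k. nlc af (c' t) k - nlc af (c t) k)"
   proof
    fix k
    have "fcoef g k = fcoef (%x. complex_of_real (cmod (u 1 x) powr af) - complex_of_real (cmod (u 0 x) powr af)) k" by (simp add: g_def[abs_def])
    also have "... = fcoef (%x. complex_of_real (cmod (u 1 x) powr af)) k - fcoef (%x. complex_of_real (cmod (u 0 x) powr af)) k"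
     by (rule fcoef_diff[OF iu iu])
    finally show "fcoef g k = nlc af (c' t) k - nlc af (c t) k" by (simp add: nlc_def u_def cc_def)
   qed
   have per: "g (x + v) = g x" if "v = (1,0) \<or> v = (0,1)" for v x using that by (simp add: g_def u_def syn_periodic)
   have lin: "AE x in sqM. u 1 x = u 0 x + of_real q * u 2 x"
    using syn_linear[OF s(1) E[of 0 t] E[of 2 t], of "of_real q"] by (simp add: u_def cc_def ceq[abs_def])
   have lin': "AE x in sqM. u 1 (x + hv n) = u 0 (x + hv n) + of_real q * u 2 (x + hv n)" for n
    by (rule AE_sq_shift[OF _ _ lin]) (measurable, simp add: u_def syn_periodic)
   have "(IQ x. ennreal ((4 powr s)^fst n) * sqn (g (x + hv n) - of_real (th n) * g x))
    <= (IQ x. ennreal (K4 * q^2) * (\<Sum>i<3. \<Sum>j<3. ennreal ((4 powr s)^fst n) * sqn (Dn n (cc i t) x) * (ennreal (cmod (u j x) powr p) + ennreal (cmod (u j (x + hv n)) powr p))))" for n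
   proof (rule nn_integral_mono_AE)
    show "AE x in sqM. ennreal ((4 powr s)^fst n) * sqn (g (x + hv n) - of_real (th n) * g x)
     <= ennreal (K4 * q^2) * (\<Sum>i<3. \<Sum>j<3. ennreal ((4 powr s)^fst n) * sqn (Dn n (cc i t) x) * (ennreal (cmod (u j x) powr p) + ennreal (cmod (u j (x + hv n)) powr p)))"
     using lin lin'[of n]
    proof eventually_elim
     case (elim x)
     define d where "d i = (cmod (Dn n (cc i t) x))^2" for i
     define w where "w j = cmod (u j x) powr p + cmod (u j (x + hv n)) powr p" for j
     have "th n : {0, 1}" by (simp add: th_def)
     from four_point_square[OF af(1) q elim this]
     have "(cmod (g (x + hv n) - of_real (th n) * g x))^2 <= K4 * q^2 * (d 0 + d 1 + d 2) * (w 0 + w 1 + w 2)"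
      by (simp add: g_def K4_def d_def w_def p_def Dn_def u_def algebra_simps)
     also have "... = K4 * q^2 * (\<Sum>i<3. \<Sum>j<3. d i * w j)" 
     proof -
      have s3: "(\<Sum>i<3. f i) = f 0 + f 1 + f 2" for f :: "nat => real" by (simp add: eval_nat_numeral)
      show ?thesis by (simp only: s3) (simp add: algebra_simps)
     qed
     finally have "ennreal ((4 powr s)^fst n) * sqn (g (x + hv n) - of_real (th n) * g x) <= ennreal ((4 powr s)^fst n * (K4 * q^2 * (\<Sum>i<3. \<Sum>j<3. d i * w j)))"
      by (simp add: ennreal_mult[symmetric] ennreal_leI mult_left_mono)
     also have "... = ennreal (K4 * q^2 * (\<Sum>i<3. \<Sum>j<3. (4 powr s)^fst n * d i * w j))" by (simp add: sum_distrib_left mult_ac)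
     also have "... = ennreal (K4 * q^2) * (\<Sum>i<3. \<Sum>j<3. ennreal ((4 powr s)^fst n) * ennreal (d i) * (ennreal (cmod (u j x) powr p) + ennreal (cmod (u j (x + hv n)) powr p)))"
     proof -
      have "ennreal (\<Sum>i<3. \<Sum>j<3. (4 powr s)^fst n * d i * w j) = (\<Sum>i<3. \<Sum>j<3. ennreal ((4 powr s)^fst n * d i * w j))"
       by (simp add: sum_ennreal sum_nonneg d_def w_def)
      also have "... = (\<Sum>i<3. \<Sum>j<3. ennreal ((4 powr s)^fst n) * ennreal (d i) * (ennreal (cmod (u j x) powr p) + ennreal (cmod (u j (x + hv n)) powr p)))"
       by (simp add: d_def w_def ennreal_mult)
      finally show ?thesis using K40 by (subst ennreal_mult) (auto intro!: sum_nonneg simp: d_def w_def)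
     qed
     finally show ?case by (simp add: d_def)
    qed
   qed
   note pt = this
   have "En s (fcoef g) <= ennreal ((1 + 8 * pi^2) powr s) * (SU n. (IQ x. ennreal ((4 powr s)^fst n) * sqn (g (x + hv n) - of_real (th n) * g x)))"
    by (rule En_le_differences[OF s0 ig gm per])
   also have "... <= ennreal ((1 + 8 * pi^2) powr s) * (SU n. (IQ x. ennreal (K4 * q^2) * (\<Sum>i<3. \<Sum>j<3. ennreal ((4 powr s)^fst n) * sqn (Dn n (cc i t) x) * (ennreal (cmod (u j x) powr p) + ennreal (cmod (u j (x + hv n)) powr p)))))"
    by (intro mult_left_mono nn_integral_mono pt) simp
   also have "... = ennreal ((1 + 8 * pi^2) powr s) * (ennreal (K4 * q^2) * (\<Sum>i<3. \<Sum>j<3. Zsq s p (cc i) (cc j) t))"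
    unfolding Zsq_def u_def by (simp add: nn_integral_cmult nn_integral_sum)
   also have "... = ennreal (q^2) * (ennreal K * (\<Sum>i<3. \<Sum>j<3. Zsq s p (cc i) (cc j) t))"
    using K40 by (simp add: K_def ennreal_mult mult_ac)
   finally show ?thesis unfolding fg .
  qed
  define R where "R t = ennreal (sqrt K) * (\<Sum>i<3. \<Sum>j<3. ro i j t)" for t
  have Rm: "R : bmeas" unfolding R_def by measurable
  have "En s (%k. nlc af (c' t) k - nlc af (c t) k) <= ennreal (q^2) * (R t)^2" for t
  proof -
   have sq: "(\<Sum>i\<in>I. (x i)^2) <= (\<Sum>i\<in>I. x i)^2" if "finite I" for I :: "(nat \<times> nat) set" and x :: "nat \<times> nat => ennreal"
   proof -
    have "(\<Sum>i\<in>I. (x i)^2) <= (\<Sum>i\<in>I. x i * (\<Sum>i\<in>I. x i))"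
     unfolding power2_eq_square using that by (intro sum_mono mult_left_mono member_le_sum) auto
    thus ?thesis by (simp add: power2_eq_square sum_distrib_right)
   qed
   have "(\<Sum>i<3. \<Sum>j<3. Zsq s p (cc i) (cc j) t) <= (\<Sum>i<3. \<Sum>j<3. (ro i j t)^2)" by (intro sum_mono ro)
   also have "... = (\<Sum>z\<in>{..<3}\<times>{..<3}. (ro (fst z) (snd z) t)^2)" by (simp add: sum.cartesian_product case_prod_beta)
   also have "... <= (\<Sum>z\<in>{..<3}\<times>{..<3}. ro (fst z) (snd z) t)^2" by (rule sq) simp
   also have "(\<Sum>z\<in>{..<3}\<times>{..<3}. ro (fst z) (snd z) t) = (\<Sum>i<3. \<Sum>j<3. ro i j t)" by (simp add: sum.cartesian_product case_prod_beta)
   finally have "ennreal K * (\<Sum>i<3. \<Sum>j<3. Zsq s p (cc i) (cc j) t) <= ennreal K * (\<Sum>i<3. \<Sum>j<3. ro i j t)^2" by (rule mult_left_mono) simp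
   also have "... = (R t)^2" using K0 by (simp add: R_def power_mult_distrib ennreal_power)
   finally have "ennreal K * (\<Sum>i<3. \<Sum>j<3. Zsq s p (cc i) (cc j) t) <= (R t)^2" .
   thus ?thesis using key[of t] by (meson mult_left_mono order_trans zero_le)
  qed
  moreover have "(IT t. R t) <= ennreal (sqrt K * (9 * CZ'))"
  proof -
   have "(IT t. R t) = ennreal (sqrt K) * (\<Sum>i<3. \<Sum>j<3. (IT t. ro i j t))"
    unfolding R_def by (simp add: nn_integral_cmult nn_integral_sum)
   also have "... <= ennreal (sqrt K) * (\<Sum>i<(3::nat). \<Sum>j<(3::nat). ennreal CZ')" by (intro mult_left_mono sum_mono ro) simp
   also have "... = ennreal (sqrt K * (9 * CZ'))"
   proof -
    have "ennreal 3 * (ennreal 3 * ennreal CZ') = ennreal (3 * (3 * CZ'))" using CZ(1) by (simp only: ennreal_mult zero_le_numeral mult_nonneg_nonneg)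
    thus ?thesis using CZ(1) K0 by (simp add: ennreal_mult)
   qed
   finally show ?thesis .
  qed
  ultimately show ?thesis using Rm by blast
 qed
 thus ?thesis using that[of "sqrt K * (9 * CZ')"] CZ(1) K0 by simp
qed

lemma En_bounded_norm: "rep et s r c ==> 0 <= s ==> 0 <= r ==> En s (c t) < \<infinity>"
 using rep_En le_less_trans ennreal_less_top by (metis infinity_ennreal_def)

text \<open>Homogeneity is exact for functions, while scaling commutes with \<open>syn\<close>
  almost everywhere; passing to coefficients removes the exceptional set.\<close>

lemma nlc_scale:
 assumes s: "0 < s" and r: "0 < r" and E: "En s a < \<infinity>"
 shows "nlc af a k = of_real (r powr af) * nlc af (%k. of_real (1/r) * a k) k"
proof -
 have "AE x in sqM. syn (%k. 0 + of_real (1/r) * a k) x = syn (%k. 0) x + of_real (1/r) * syn a x"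
  by (rule syn_linear[OF s _ E]) (simp add: En_def)
 hence ae: "AE x in sqM. complex_of_real (cmod (syn a x) powr af) = of_real (r powr af) * complex_of_real (cmod (syn (%k. of_real (1/r) * a k) x) powr af)"
 proof eventually_elim
  case (elim x)
  have "syn (%k. 0) x = 0" by (simp add: syn_def Pj_def)
  hence "syn (%k. of_real (1/r) * a k) x = of_real (1/r) * syn a x" using elim by simp
  hence "cmod (syn a x) = r * cmod (syn (%k. of_real (1/r) * a k) x)" using r by (simp add: norm_mult norm_divide)
  thus ?case using r by (simp add: powr_mult)
 qed
 have "nlc af a k = fcoef (%x. of_real (r powr af) * complex_of_real (cmod (syn (%k. of_real (1/r) * a k) x) powr af)) k"
  unfolding nlc_def by (rule fcoef_cong_AE[OF ae]) measurable
 also have "... = of_real (r powr af) * nlc af (%k. of_real (1/r) * a k) k"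
  unfolding nlc_def by (subst (1 2) fcoef_sqM) (measurable, simp add: mult.assoc)
 finally show ?thesis .
qed

text \<open>An \<open>L^1 H^s\<close> bound stated through a measurable majorant \<open>ro\<close>
  of the norm, which avoids roots of extended reals. It is linear in the distance \<open>q\<close>
  and carries the power \<open>af - 1\<close> of the size \<open>r\<close>.\<close>

abbreviation lip_bound :: "real => real => real => real => real => (real => lat => complex) => (real => lat => complex) => bool" where
 "lip_bound s af C r q c c' == \<exists>ro\<in>bmeas. (\<forall>t. En s (%k. nlc af (c' t) k - nlc af (c t) k) <= (ro t)^2)
  & (IT t. ro t) <= ennreal (C * r powr (af - 1) * q)"

text \<open>The masses are normalised by homogeneity of the nonlinearity.\<close>

lemma nonlinear_estimate_low:
 assumes s: "0 < s" "s < 1" and af: "2 <= af" "(af - 2) * (1 - s) < 2 * s"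
 obtains C where "0 <= C" "!!r q c c'. 0 < r ==> 0 < q ==> rep 1 s r c ==> rep 1 s r c' ==> rep 1 s q (%t k. c' t k - c t k) ==>
  lip_bound s af C r q c c'"
proof -
 obtain C where C: "0 <= C" "!!q c c' e. 0 <= q ==> rep 1 s 1 c ==> rep 1 s 1 c' ==> rep 1 s 1 e ==> (!!t k. c' t k = c t k + of_real q * e t k) ==>
  \<exists>ro \<in> bmeas. (\<forall>t. En s (%k. nlc af (c' t) k - nlc af (c t) k) <= ennreal (q^2) * (ro t)^2) & (IT t. ro t) <= ennreal C"
  using nonlinear_core[OF s af] by blast
 have "lip_bound s af C r q c c'"
  if r: "0 < r" and q: "0 < q" and c: "rep 1 s r c" and c': "rep 1 s r c'" and e: "rep 1 s q (%t k. c' t k - c t k)" for r q c c'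
 proof -
  have n: "cmod (of_real (1/r)) * r = 1" "cmod (of_real (1/q)) * q = 1" using r q by (auto simp: norm_divide)
  have "\<exists>ro \<in> bmeas. (\<forall>t. En s (%k. nlc af (%k. of_real (1/r) * c' t k) k - nlc af (%k. of_real (1/r) * c t k) k) <= ennreal ((q/r)^2) * (ro t)^2) & (IT t. ro t) <= ennreal C"
  proof (rule C(2))
   show "rep 1 s 1 (%t k. of_real (1/r) * c t k)" using rep_cmult[OF c, of "of_real (1/r)"] r n by simp
   show "rep 1 s 1 (%t k. of_real (1/r) * c' t k)" using rep_cmult[OF c', of "of_real (1/r)"] r n by simp
   show "rep 1 s 1 (%t k. of_real (1/q) * (c' t k - c t k))" using rep_cmult[OF e, of "of_real (1/q)"] q n by simp
   show "of_real (1/r) * c' t k = of_real (1/r) * c t k + of_real (q/r) * (of_real (1/q) * (c' t k - c t k))" for t k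
    using r q by (simp add: field_simps)
  qed (use r q in simp)
  then obtain ro where ro: "ro : bmeas" "!!t. En s (%k. nlc af (%k. of_real (1/r) * c' t k) k - nlc af (%k. of_real (1/r) * c t k) k) <= ennreal ((q/r)^2) * (ro t)^2" "(IT t. ro t) <= ennreal C" by blast
  define z where "z = r powr (af - 1) * q"
  have z0: "0 <= z" using q by (simp add: z_def)
  have zr: "r powr af * (q/r) = z" using r by (simp add: z_def powr_diff)
  have "En s (%k. nlc af (c' t) k - nlc af (c t) k) <= (ennreal z * ro t)^2" for t
  proof -
   have Ec: "En s (c t) < \<infinity>" "En s (c' t) < \<infinity>" using En_bounded_norm[OF c] En_bounded_norm[OF c'] s r by auto
   have "(%k. nlc af (c' t) k - nlc af (c t) k) = (%k. of_real (r powr af) * (nlc af (%k. of_real (1/r) * c' t k) k - nlc af (%k. of_real (1/r) * c t k) k))"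
    using nlc_scale[OF s(1) r Ec(1)] nlc_scale[OF s(1) r Ec(2)] by (simp add: right_diff_distrib)
   hence "En s (%k. nlc af (c' t) k - nlc af (c t) k) = sqn (of_real (r powr af)) * En s (%k. nlc af (%k. of_real (1/r) * c' t k) k - nlc af (%k. of_real (1/r) * c t k) k)"
    by (simp only: En_cmult)
   also have "... <= ennreal ((r powr af)^2) * (ennreal ((q/r)^2) * (ro t)^2)" using ro(2)[of t] by (intro mult_mono) auto
   also have "... = ennreal (z^2) * (ro t)^2" 
   proof -
    have "ennreal (z^2) = ennreal ((r powr af)^2) * ennreal ((q/r)^2)" unfolding zr[symmetric] power_mult_distrib by (rule ennreal_mult) auto
    thus ?thesis by (simp only: mult.assoc)
   qed
   also have "... = (ennreal z * ro t)^2" using z0 by (simp add: power_mult_distrib ennreal_power)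
   finally show ?thesis .
  qed
  moreover have "(IT t. ennreal z * ro t) <= ennreal (C * r powr (af - 1) * q)"
  proof -
   have "(IT t. ennreal z * ro t) = ennreal z * (IT t. ro t)" using ro(1) by (simp add: nn_integral_cmult)
   also have "... <= ennreal z * ennreal C" by (intro mult_left_mono ro) simp
   also have "... = ennreal (C * r powr (af - 1) * q)" using z0 C(1) by (simp add: ennreal_mult[symmetric] z_def mult_ac)
   finally show ?thesis .
  qed
  ultimately show ?thesis using ro(1) by (intro bexI[of _ "%t. ennreal z * ro t"]) auto
 qed
 thus ?thesis using that C(1) by blast
qed

text \<open>For \<open>af = 2\<close> the nonlinearity is an exact convolution. This gives access to
  \<open>s >= 1\<close>, where first differences no longer yield an equivalent norm.\<close>

lemma nlc_two:
 assumes s: "0 < s" and E: "En s a < \<infinity>"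
 shows "nlc 2 a k = conv a (%k. cnj (a (- k))) k"
proof -
 have L: "L2 (syn a)" by (rule L2_syn[OF s E])
 have [measurable]: "syn a : bmeas" by measurable
 have Lc: "L2 (%x. cnj (syn a x))" using L by (simp add: L2_def)
 have "fcoef (%x. cnj (syn a x)) l = cnj (a (- l))" for l
 proof -
  have "fcoef (%x. cnj (syn a x)) l = cnj (fcoef (syn a) (- l))"
   by (subst (1 2) fcoef_sqM) (measurable, simp add: cnj_ek[symmetric] flip: complex_cnj_mult)
  thus ?thesis by (simp add: fcoef_syn[OF s E])
 qed
 hence f: "fcoef (%x. cnj (syn a x)) = (%l. cnj (a (- l)))" by blast
 have "complex_of_real (cmod (syn a x) powr 2) = cnj (syn a x) * syn a x" for x
  using complex_norm_square[of "syn a x"] by (simp add: mult.commute)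
 hence "nlc 2 a k = fcoef (%x. cnj (syn a x) * syn a x) k" by (simp add: nlc_def)
 also have "... = conv a (%k. cnj (a (- k))) k" unfolding fcoef_mult_syn(2)[OF s Lc E] f ..
 finally show ?thesis .
qed

lemma En_sum_le:
 assumes "!!k. cmod (a k) <= cmod (b k) + cmod (d k)"
 shows "En s a <= 2 * En s b + 2 * En s d"
proof -
 have "En s a <= (SZ k. 2 * ennreal (wt s k * (cmod (b k))^2) + 2 * ennreal (wt s k * (cmod (d k))^2))"
  unfolding En_def
 proof (rule nn_integral_mono)
  fix k
  have "(cmod (a k))^2 <= (cmod (b k) + cmod (d k))^2" by (intro power_mono assms) simp
  also have "... <= 2 * (cmod (b k))^2 + 2 * (cmod (d k))^2"
   using zero_le_power2[of "cmod (b k) - cmod (d k)"] unfolding power2_sum power2_diff by linarith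
  finally have "wt s k * (cmod (a k))^2 <= wt s k * (2 * (cmod (b k))^2 + 2 * (cmod (d k))^2)" by (rule mult_left_mono) simp
  also have "... = 2 * (wt s k * (cmod (b k))^2) + 2 * (wt s k * (cmod (d k))^2)" by (simp add: algebra_simps)
  finally have "ennreal (wt s k * (cmod (a k))^2) <= ennreal (2 * (wt s k * (cmod (b k))^2) + 2 * (wt s k * (cmod (d k))^2))" by (rule ennreal_leI)
  also have "... = 2 * ennreal (wt s k * (cmod (b k))^2) + 2 * ennreal (wt s k * (cmod (d k))^2)" by (simp add: ennreal_mult)
  finally show "ennreal (wt s k * (cmod (a k))^2) <= 2 * ennreal (wt s k * (cmod (b k))^2) + 2 * ennreal (wt s k * (cmod (d k))^2)" .
 qed
 also have "... = 2 * En s b + 2 * En s d" by (simp add: nn_integral_add nn_integral_cmult En_def)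
 finally show ?thesis .
qed

section \<open>Duhamel integrals\<close>

text \<open>Cauchy-Schwarz in time as an explicit majorant: the root of \<open>F\<close> is at most
  \<open>l/2 * F + 1/(2*l)\<close> by the inequality of the means, and \<open>l = sqrt T / B\<close>
  balances the two terms. This is the source of the factor \<open>sqrt T\<close>.\<close>

lemma nn_integral_L1_of_L2:
 assumes [measurable]: "F : bmeas" and B: "0 < B" and T: "0 < T" and F: "(NN (ivl 0 T) (%t. F t)) <= ennreal (B^2)"
 obtains ro where "ro : bmeas" "!!t. F t <= (ro t)^2" "(NN (ivl 0 T) (%t. ro t)) <= ennreal (sqrt T * B)"
proof -
 define l where "l = sqrt T / B"
 have l: "0 < l" using B T by (simp add: l_def)
 define ro where "ro t = ennreal (l/2) * F t + ennreal (1/(2*l))" for t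
 have [measurable]: "ro : bmeas" unfolding ro_def by measurable
 have "F t <= (ro t)^2" for t
 proof (cases "F t")
  case (real x)
  have "x <= (l/2 * x + 1/(2*l))^2"
  proof -
   have "0 <= (l/2 * x - 1/(2*l))^2" by simp
   also have "... = (l/2 * x + 1/(2*l))^2 - x" using l by (simp add: power2_eq_square field_simps)
   finally show ?thesis by simp
  qed
  moreover have "ro t = ennreal (l/2 * x + 1/(2*l))" using real l unfolding ro_def by (simp add: ennreal_mult[symmetric] ennreal_plus[symmetric] del: ennreal_plus)
  moreover have "0 <= l/2 * x + 1/(2*l)" using real l by simp
  ultimately show ?thesis using real by (simp only: ennreal_power ennreal_leI)
 next
  case top thus ?thesis using l by (simp add: ro_def ennreal_mult_top)
 qed
 moreover have "(NN (ivl 0 T) (%t. ro t)) <= ennreal (sqrt T * B)"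
 proof -
  have "(NN (ivl 0 T) (%t. ro t)) = ennreal (l/2) * (NN (ivl 0 T) (%t. F t)) + ennreal (1/(2*l)) * ennreal T"
   unfolding ro_def using T by (simp add: nn_integral_add nn_integral_cmult emeasure_ivl)
  also have "... <= ennreal (l/2) * ennreal (B^2) + ennreal (1/(2*l)) * ennreal T" by (intro add_right_mono mult_left_mono F) simp
  also have "... = ennreal (l/2 * B^2 + 1/(2*l) * T)" using l T by (simp add: ennreal_mult[symmetric] ennreal_plus[symmetric] del: ennreal_plus)
  also have "l/2 * B^2 + 1/(2*l) * T = sqrt T * B"
  proof -
   have "T = sqrt T * sqrt T" using T by simp
   hence "1/(2*l) * T = sqrt T * B / 2" using B T by (simp add: l_def field_simps)
   moreover have "l/2 * B^2 = sqrt T * B / 2" using B by (simp add: l_def power2_eq_square)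
   ultimately show ?thesis by simp
  qed
  finally show ?thesis .
 qed
 ultimately show ?thesis using that[of ro] by simp
qed

definition adm :: "real => real => bool" where
 "adm s af \<longleftrightarrow> 0 < s & 2 <= af & (af - 2) * (1 - s) < 2 * s & (s < 1 \<or> af = 2)"

lemma conv_diff:
 assumes "En 0 a < \<infinity>" "En 0 a' < \<infinity>" "En 0 b < \<infinity>" "En 0 b' < \<infinity>"
 shows "conv a' b' k - conv a b k = conv (%k. a' k - a k) b' k + conv a (%k. b' k - b k) k"
proof -
 have i: "integrable CZ (%l. x l * y (k - l))" if "En 0 x < \<infinity>" "En 0 y < \<infinity>" for x y
  using conv_integrable that by (simp add: En_0)
 have "conv a' b' k - conv a b' k = conv (%k. a' k - a k) b' k" "conv a b' k - conv a b k = conv a (%k. b' k - b k) k"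
  unfolding conv_def using assms by (simp_all add: left_diff_distrib right_diff_distrib bintegral_diff i)
 thus ?thesis by (simp add: algebra_simps)
qed

lemma En_0_finite: "0 <= s ==> En s a < \<infinity> ==> En 0 a < \<infinity>"
 using En_mono[of 0 s a] by (rule le_less_trans)

text \<open>For \<open>s < 1\<close> the method of differences applies. Otherwise
  \<open>af = 2\<close>, the difference of the two nonlinearities is a sum of two bilinear terms,
  and Cauchy-Schwarz over one period passes from \<open>L^2\<close> to \<open>L^1\<close> in
  time.\<close>

lemma nonlinear_estimate:
 assumes adm: "adm s af"
 obtains C where "0 < C" "!!r q c c'. 0 < r ==> 0 < q ==> rep 1 s r c ==> rep 1 s r c' ==> rep 1 s q (%t k. c' t k - c t k) ==>
  lip_bound s af C r q c c'"
proof (cases "s < 1")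
 case True
 obtain C where C: "0 <= C" "!!r q c c'. 0 < r ==> 0 < q ==> rep 1 s r c ==> rep 1 s r c' ==> rep 1 s q (%t k. c' t k - c t k) ==>
  lip_bound s af C r q c c'"
  using nonlinear_estimate_low[of s af] adm True unfolding adm_def by blast
 have "lip_bound s af (C + 1) r q c c'"
  if H: "0 < r" "0 < q" "rep 1 s r c" "rep 1 s r c'" "rep 1 s q (%t k. c' t k - c t k)" for r q c c'
 proof -
  have "ennreal (C * r powr (af - 1) * q) <= ennreal ((C + 1) * r powr (af - 1) * q)" using H by (intro ennreal_leI mult_right_mono) auto
  thus ?thesis using C(2)[OF H] by (meson order_trans)
 qed
 thus ?thesis using that[of "C + 1"] C(1) by simp
next
 case False
 hence s: "1 <= s" "0 < s" "0 <= s" and af: "af = 2" using adm by (auto simp: adm_def)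
 obtain C where C: "0 <= C" "!!r q c d. 0 <= r ==> 0 <= q ==> rep 1 s r c ==> rep (-1) s q d ==> (IT t. En s (conv (c t) (d t))) <= ennreal (C * (r * q)^2)"
  using product_estimate_cnj[OF s(1)] by blast
 define B where "B = sqrt (4 * C + 1)"
 have B: "0 < B" using C by (simp add: B_def)
 have "lip_bound s af (sqrt T0 * B) r q c c'"
  if r: "0 < r" and q: "0 < q" and c: "rep 1 s r c" and c': "rep 1 s r c'" and e: "rep 1 s q (%t k. c' t k - c t k)" for r q c c'
 proof -
  define m where "m d = (%t k. cnj (d t (- k) :: complex))" for d :: "real => lat => complex"
  define E where "E = (%t k. c' t k - c t k)"
  have [measurable]: "(%t. c t k) : bmeas" "(%t. c' t k) : bmeas" for k
   using rep_measurable[OF c s(3)] rep_measurable[OF c' s(3)] by auto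
  have rm: "rep (-1) s r (m c')" "rep (-1) s q (m E)" using rep_cnj[OF c'] rep_cnj[OF e] by (simp_all add: m_def E_def)
  have fin: "En 0 (x t) < \<infinity>" if "rep et s p x" "0 <= p" for et p x t
   using En_0_finite[OF s(3) En_bounded_norm[OF that(1) s(3) that(2)]] .
  define F where "F t = 2 * En s (conv (E t) (m c' t)) + 2 * En s (conv (c t) (m E t))" for t
  have [measurable]: "F : bmeas" unfolding F_def En_def conv_def E_def m_def by measurable
  have FE: "En s (%k. nlc af (c' t) k - nlc af (c t) k) <= F t" for t
  proof -
   have fs: "En s (c t) < \<infinity>" "En s (c' t) < \<infinity>" using En_bounded_norm[OF c] En_bounded_norm[OF c'] s r by auto
   have "nlc af (c' t) k - nlc af (c t) k = conv (E t) (m c' t) k + conv (c t) (m E t) k" for k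
   proof -
    have "nlc af (c' t) k - nlc af (c t) k = conv (c' t) (m c' t) k - conv (c t) (m c t) k"
     unfolding af using nlc_two[OF s(2) fs(1)] nlc_two[OF s(2) fs(2)] by (simp add: m_def)
    also have "... = conv (%k. c' t k - c t k) (m c' t) k + conv (c t) (%k. m c' t k - m c t k) k"
     by (rule conv_diff) (use fin[OF c] fin[OF c'] fin[OF rm(1)] fin[OF rep_cnj[OF c]] r in \<open>auto simp: m_def\<close>)
    finally show ?thesis by (simp add: E_def m_def)
   qed
   thus ?thesis unfolding F_def by (intro En_sum_le) (simp add: norm_triangle_ineq)
  qed
  have "(IT t. F t) = 2 * (IT t. En s (conv (E t) (m c' t))) + 2 * (IT t. En s (conv (c t) (m E t)))"
  proof -
   have [measurable]: "(%t. En s (conv (E t) (m c' t))) : bmeas" "(%t. En s (conv (c t) (m E t))) : bmeas"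
    unfolding En_def conv_def E_def m_def by measurable
   show ?thesis unfolding F_def by (simp add: nn_integral_add nn_integral_cmult)
  qed
  also have "... <= 2 * ennreal (C * (q * r)^2) + 2 * ennreal (C * (r * q)^2)"
   using r q rm c e by (intro add_mono mult_left_mono C(2)) (auto simp: E_def)
  also have "... = ennreal (4 * C * (r * q)^2)"
   using C(1) by (simp add: ennreal_mult[symmetric] ennreal_plus[symmetric] mult_ac flip: ennreal_numeral del: ennreal_plus)
  also have "... <= ennreal ((B * (r * q))^2)"
  proof -
   have "4 * C * (r * q)^2 <= (4 * C + 1) * (r * q)^2" by (intro mult_right_mono) auto
   also have "... = (B * (r * q))^2" using C(1) by (simp add: B_def power_mult_distrib)
   finally show ?thesis by (rule ennreal_leI)
  qed
  finally obtain ro where ro: "ro : bmeas" "!!t. F t <= (ro t)^2" "(IT t. ro t) <= ennreal (sqrt T0 * (B * (r * q)))"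
   using nn_integral_L1_of_L2[of F "B * (r * q)" T0] B r q T0_pos by auto
  have "r powr (af - 1) = r" using r by (simp add: af)
  thus ?thesis using ro FE by (intro bexI[of _ ro]) (auto simp: mult_ac intro: order_trans)
 qed
 thus ?thesis using that[of "sqrt T0 * B"] B T0_pos by simp
qed

lemma ennreal_le_of_power2_le:
 fixes x y :: ennreal
 assumes "x^2 <= y^2" shows "x <= y"
proof (cases y)
 case y: (real b)
 show ?thesis
 proof (cases x)
  case x: (real a)
  have "ennreal (a^2) <= ennreal (b^2)" using assms x y by (simp only: ennreal_power)
  hence "a^2 <= b^2" using y by simp
  hence "a <= b" using y(1) by (rule power2_le_imp_le)
  thus ?thesis using x y by (simp add: ennreal_leI)
 next
  case top
  hence "top * top <= ennreal b * ennreal b" using assms y by (simp only: power2_eq_square)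
  thus ?thesis using y by (simp add: ennreal_mult[symmetric] top_unique)
 qed
qed simp

text \<open>Minkowski's inequality written for squares, which makes sense for extended reals without
  roots.\<close>

lemma En_triangle:
 assumes a: "En s a <= p^2" and b: "En s b <= q^2" and c: "!!k. cmod (c k) <= cmod (a k) + cmod (b k)"
 shows "En s c <= (p + q)^2"
proof -
 define A where "A k = ennreal (sqrt (wt s k) * cmod (a k))" for k
 define B where "B k = ennreal (sqrt (wt s k) * cmod (b k))" for k
 have EA: "(SZ k. (A k)^2) = En s a" "(SZ k. (B k)^2) = En s b"
  by (simp_all add: A_def B_def En_def ennreal_power power_mult_distrib)
 have "(SZ k. A k * B k)^2 <= (SZ k. (A k)^2) * (SZ k. (B k)^2)" by (rule Cauchy_Schwarz_nn_integral) auto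
 also have "... <= p^2 * q^2" unfolding EA by (intro mult_mono a b) auto
 finally have AB: "(SZ k. A k * B k) <= p * q" using ennreal_le_of_power2_le[of "\<integral>\<^sup>+k. A k * B k \<partial>CZ" "p * q"] by (simp add: power_mult_distrib)
 have "En s c <= (SZ k. (A k + B k)^2)" unfolding En_def
 proof (rule nn_integral_mono)
  fix k
  have "wt s k * (cmod (c k))^2 <= wt s k * (cmod (a k) + cmod (b k))^2" by (intro mult_left_mono power_mono c) auto
  also have "... = (sqrt (wt s k) * cmod (a k) + sqrt (wt s k) * cmod (b k))^2" by (simp add: power_mult_distrib flip: distrib_left)
  finally have "ennreal (wt s k * (cmod (c k))^2) <= ennreal ((sqrt (wt s k) * cmod (a k) + sqrt (wt s k) * cmod (b k))^2)" by (rule ennreal_leI)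
  thus "ennreal (wt s k * (cmod (c k))^2) <= (A k + B k)^2" by (simp add: A_def B_def ennreal_power flip: ennreal_plus)
 qed
 also have "... = (SZ k. ((A k)^2 + 2 * (A k * B k)) + (B k)^2)" by (intro nn_integral_cong) (simp add: power2_eq_square distrib_left distrib_right mult_2 add_ac mult.commute)
 also have "... = En s a + 2 * (SZ k. A k * B k) + En s b" by (simp add: nn_integral_add nn_integral_cmult EA)
 also have "... <= p^2 + 2 * (p * q) + q^2" by (intro add_mono mult_left_mono a b AB) auto
 also have "... = (p + q)^2" by (simp only: power2_eq_square distrib_left distrib_right mult_2 add_ac mult.commute[of q p])
 finally show ?thesis .
qed

text \<open>The triangle inequality for finite sums together with Fatou's lemma. Finiteness of the
  sum of the norms makes every coefficient series converge, since a coefficient is at most the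
  norm.\<close>

lemma En_series:
 fixes g :: "nat => lat => complex"
 assumes s: "0 <= s" and g: "!!n. En s (g n) <= (ro n)^2"
 shows "En s (%k. (\<Sum>n. g n k) - (\<Sum>n<N. g n k)) <= (\<Sum>n. ro (n + N))^2"
proof (cases "(\<Sum>n. ro (n + N)) = \<infinity>")
 case True thus ?thesis by (simp add: power2_eq_square)
next
 case False
 define h where "h n = g (n + N)" for n
 have fin: "En s (%k. \<Sum>n<M. h n k) <= (\<Sum>n<M. ro (n + N))^2" for M
 proof (induction M)
  case 0 show ?case by (simp add: En_def)
 next
  case (Suc M)
  show ?case using En_triangle[OF Suc g[of "M + N"], of "%k. \<Sum>n<Suc M. h n k"] by (simp add: h_def norm_triangle_ineq)
 qed
 have rf: "ro (n + N) ~= \<infinity>" for n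
 proof
  assume "ro (n + N) = \<infinity>"
  moreover have "sum (%n. ro (n + N)) {n} <= (\<Sum>n. ro (n + N))" by (rule sum_le_suminf) auto
  ultimately show False using False by (simp add: top_unique)
 qed
 define R where "R n = enn2real (ro (n + N))" for n
 have R: "ro (n + N) = ennreal (R n)" "0 <= R n" for n using rf[of n] by (simp_all add: R_def less_top)
 have "(\<Sum>n. ennreal (R n)) ~= top" using False by (simp add: R(1))
 hence sR: "summable R" using R(2) summable_suminf_not_top[of R] by blast
 have sg: "summable (%n. g n k)" for k
 proof -
  have "cmod (h n k) <= R n" for n using En_le_cmod[OF s R(2)[of n], of "h n" k] g[of "n + N"] R[of n] by (simp add: h_def ennreal_power)
  hence "summable (%n. h n k)" by (intro summable_comparison_test'[OF sR, of 0]) auto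
  thus ?thesis unfolding h_def using summable_iff_shift[of "%n. g n k" N] by simp
 qed
 have lim: "(%M. \<Sum>n<M. h n k) \<longlonglongrightarrow> (\<Sum>n. g n k) - (\<Sum>n<N. g n k)" for k
 proof -
  have "summable (%n. h n k)" unfolding h_def using sg[of k] summable_iff_shift[of "%n. g n k" N] by simp
  from summable_LIMSEQ[OF this] show ?thesis using suminf_minus_initial_segment[OF sg[of k], of N] by (simp add: h_def)
 qed
 show ?thesis unfolding En_def
 proof (rule fatou_bound)
  show "AE k in CZ. (%M. ennreal (wt s k * (cmod (\<Sum>n<M. h n k))^2)) \<longlonglongrightarrow> ennreal (wt s k * (cmod ((\<Sum>n. g n k) - (\<Sum>n<N. g n k)))^2)"
   by (intro AE_I2 tendsto_ennrealI tendsto_intros lim)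
  fix M
  have "(SZ k. ennreal (wt s k * (cmod (\<Sum>n<M. h n k))^2)) <= (\<Sum>n<M. ro (n + N))^2" using fin[of M] by (simp add: En_def)
  also have "... <= (\<Sum>n. ro (n + N))^2" by (intro power_mono sum_le_suminf) auto
  finally show "(SZ k. ennreal (wt s k * (cmod (\<Sum>n<M. h n k))^2)) <= (\<Sum>n. ro (n + N))^2" .
 qed simp
qed

text \<open>One formula for both equations: \<open>et = 1\<close>, \<open>ka = 0\<close> for
  \<open>u\<close>, and \<open>et = 0\<close>, \<open>ka = 1/K\<close> for \<open>v\<close>. The
  forcing \<open>f\<close> is already pulled back by the flow, so the oscillation stands in front of
  the integral as in \<open>rep\<close>. The value 0 off the interval allows solutions to be
  compared as plain functions of time.\<close>

definition Dh :: "real => real => real => (lat => complex) => (real => lat => complex) => real => lat => complex" where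
 "Dh et ka T a f t k = (if t : {0..T} then cis (- et * freq2 k * t) * (of_real (exp (- ka * t)) * a k
  + (LINT ta|lborel. ind {0..t} ta *\<^sub>R (of_real (exp (- ka * (t - ta))) * f ta k))) else 0)"

lemma forcing_integrable:
 assumes s: "0 <= s" and [measurable]: "(%ta. f ta k) : bmeas" "ro : bmeas"
  and f: "!!ta. ta : {0..T} ==> En s (f ta) <= (ro ta)^2" and mass: "(NN (ivl 0 T) (%ta. ro ta)) < \<infinity>"
  and h: "h : bmeas" "!!ta. ta : {0..t} ==> cmod (h ta) <= 1" and t: "t <= T"
 shows "integrable lborel (%ta. ind {0..t} ta *\<^sub>R (h ta * f ta k))"
proof (rule integrableI_bounded)
 note [measurable] = h(1)
 have pt: "ennreal (cmod (f ta k)) <= ro ta" if "ta : {0..T}" for ta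
 proof -
  have "sqn (f ta k) <= En 0 (f ta)" using En_point[of 0 k "f ta"] by simp
  also have "... <= (ro ta)^2" using En_mono[OF s] f[OF that] by (rule order_trans)
  finally show ?thesis using ennreal_le_of_power2_le[of "ennreal (cmod (f ta k))" "ro ta"] by (simp add: ennreal_power)
 qed
 have "(IL ta. ennreal (norm (ind {0..t} ta *\<^sub>R (h ta * f ta k)))) <= (IL ta. ro ta * ind {0..T} ta)"
 proof (rule nn_integral_mono)
  fix ta show "ennreal (norm (ind {0..t} ta *\<^sub>R (h ta * f ta k))) <= ro ta * ind {0..T} ta"
  proof (cases "ta : {0..t}")
   case True
   have "cmod (h ta) * cmod (f ta k) <= cmod (f ta k)" using h(2)[OF True] by (simp add: mult_left_le_one_le)
   hence "ennreal (norm (ind {0..t} ta *\<^sub>R (h ta * f ta k))) <= ennreal (cmod (f ta k))" using True by (simp add: norm_mult ennreal_leI)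
   also have "... <= ro ta * ind {0..T} ta" using pt[of ta] True t by simp
   finally show ?thesis .
  qed simp
 qed
 also have "... < \<infinity>" using mass by (simp add: nn_integral_ivl)
 finally show "(IL ta. ennreal (norm (ind {0..t} ta *\<^sub>R (h ta * f ta k)))) < \<infinity>" .
 show "(%ta. ind {0..t} ta *\<^sub>R (h ta * f ta k)) : borel_measurable lborel" by measurable
qed

text \<open>Duhamel's formula is literally a superposition: the parameter is the time
  \<open>ta\<close> at which a free wave starts, the profile is the forcing at that time, and the
  modulation switches the wave on for \<open>ta <= t\<close>. The datum is spread over the
  parameters in \<open>{-1..<0}\<close>, an interval of length 1, and \<open>max 0 ta\<close> makes
  these start at time 0.\<close>

lemma Dh_rep:
 assumes s: "0 <= s" and ka: "0 <= ka" and T: "0 <= T" and A: "0 <= A" "En s a <= ennreal (A^2)" and B: "0 <= B"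
  and fm [measurable]: "!!k. (%ta. f ta k) : bmeas" and rom [measurable]: "ro : bmeas"
  and f: "!!ta. ta : {0..T} ==> En s (f ta) <= (ro ta)^2" and mass: "(NN (ivl 0 T) (%ta. ro ta)) <= ennreal B"
 shows "rep et s (A + B) (Dh et ka T a f)"
proof -
 have fin: "(NN (ivl 0 T) (%ta. ro ta)) < \<infinity>" using mass by (rule le_less_trans) simp
 define ro' where "ro' ta = (if ta : {-1..<0} then A else if ta : {0..T} then enn2real (ro ta) else 0)" for ta
 \<comment> \<open>The majorant \<open>ro\<close> may be infinite on a null set of times; there the
   profile is set to 0.\<close>
 define ph where "ph ta k = (if ta : {-1..<0} then a k else if ta : {0..T} & ro ta ~= \<infinity> then f ta k else 0)" for ta k
 define ze where "ze t ta = (if t : {0..T} & ta <= t then complex_of_real (exp (- ka * (t - max 0 ta))) else 0)" for t ta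
 have AEf: "AE ta in lborel. ta : {0..T} --> ro ta ~= \<infinity>"
  using nn_integral_PInf_AE[of ro "ivl 0 T"] fin by (auto simp: AE_ivl)
 show ?thesis
 proof (rule rep_intro[where N=lborel and ro=ro' and ph=ph and ze=ze])
  show "0 <= s" "sets lborel = sets borel" "!!ta. 0 <= ro' ta" using s A by (auto simp: ro'_def)
  show "ro' : bmeas" "!!k. (%ta. ph ta k) : bmeas" "(%p. ze (fst p) (snd p)) : bmeas2"
   unfolding ro'_def ph_def ze_def by measurable
  have "(IL ta. ennreal (ro' ta)) <= (IL ta. ennreal A * ind {-1..<0} ta + ro ta * ind {0..T} ta)"
   by (intro nn_integral_mono) (auto simp: ro'_def indicator_def ennreal_enn2real_if)
  also have "... = ennreal A + (NN (ivl 0 T) (%ta. ro ta))" by (subst nn_integral_add) (auto simp: nn_integral_cmult nn_integral_ivl)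
  also have "... <= ennreal (A + B)" using mass A B by (simp add: add_left_mono)
  finally show "(IL ta. ennreal (ro' ta)) <= ennreal (A + B)" .
  show "cmod (ze t ta) <= 1" for t ta using ka by (auto simp: ze_def max_def)
  show "En s (ph ta) <= ennreal ((ro' ta)^2)" for ta
  proof -
   have z: "En s (%k. 0) = 0" by (simp add: En_def)
   consider "ta : {-1..<0}" | "ta : {0..T}" "ro ta ~= \<infinity>" | "ta \<notin> {-1..<0}" "\<not> (ta : {0..T} & ro ta ~= \<infinity>)" by blast
   thus ?thesis
   proof cases
    case 1 thus ?thesis using A by (simp add: ph_def[abs_def] ro'_def)
   next
    case 2
    hence "En s (ph ta) = En s (f ta)" "ro' ta = enn2real (ro ta)" by (auto simp: ph_def[abs_def] ro'_def)
    thus ?thesis using f[OF 2(1)] 2(2) by (cases "ro ta") (auto simp: ennreal_power)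
   next
    case 3
    hence "ph ta = (%k. 0)" by (auto simp: ph_def[abs_def])
    thus ?thesis using z by simp
   qed
  qed
  fix t k
  show "Dh et ka T a f t k = cis (- et * freq2 k * t) * (LINT ta|lborel. ze t ta * ph ta k)"
  proof (cases "t : {0..T}")
   case False hence "ze t = (%ta. 0)" by (auto simp: ze_def)
   thus ?thesis using False by (auto simp: Dh_def)
  next
   case True
   have eq: "AE ta in lborel. ze t ta * ph ta k = ind {-1..<0} ta *\<^sub>R (of_real (exp (- ka * t)) * a k) + ind {0..t} ta *\<^sub>R (of_real (exp (- ka * (t - ta))) * f ta k)"
    using AEf by eventually_elim (use True in \<open>auto simp: ze_def ph_def indicator_def max_def\<close>)
   have i1: "integrable lborel (%ta::real. ind {-1..<0} ta *\<^sub>R (of_real (exp (- ka * t)) * a k))" by (intro integrable_real_indicator integrable_scaleR_left) auto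
   have i2: "integrable lborel (%ta. ind {0..t} ta *\<^sub>R (of_real (exp (- ka * (t - ta))) * f ta k))"
    by (rule forcing_integrable[OF s fm rom f fin]) (use True ka in auto)
   have "(LINT ta|lborel. ze t ta * ph ta k) = (LINT ta|lborel. ind {-1..<0} ta *\<^sub>R (of_real (exp (- ka * t)) * a k) + ind {0..t} ta *\<^sub>R (of_real (exp (- ka * (t - ta))) * f ta k))"
    by (rule integral_cong_AE) (use eq in \<open>auto simp: ze_def ph_def\<close>)
   also have "... = of_real (exp (- ka * t)) * a k + (LINT ta|lborel. ind {0..t} ta *\<^sub>R (of_real (exp (- ka * (t - ta))) * f ta k))"
    by (subst bintegral_add[OF i1 i2]) (simp add: scaleR_conv_of_real)
   finally show ?thesis using True by (simp add: Dh_def)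
  qed
 qed
qed

lemma Dh_diff:
 assumes s: "0 <= s" and ka: "0 <= ka"
  and fm [measurable]: "!!k. (%ta. f ta k) : bmeas" and rom [measurable]: "ro : bmeas"
  and f: "!!ta. ta : {0..T} ==> En s (f ta) <= (ro ta)^2" and mass: "(NN (ivl 0 T) (%ta. ro ta)) < \<infinity>"
  and fm' [measurable]: "!!k. (%ta. f' ta k) : bmeas" and rom' [measurable]: "ro' : bmeas"
  and f': "!!ta. ta : {0..T} ==> En s (f' ta) <= (ro' ta)^2" and mass': "(NN (ivl 0 T) (%ta. ro' ta)) < \<infinity>"
 shows "Dh et ka T a' f' t k - Dh et ka T a f t k = Dh et ka T (%k. a' k - a k) (%ta k. f' ta k - f ta k) t k"
proof (cases "t : {0..T}")
 case True
 have i: "integrable lborel (%ta. ind {0..t} ta *\<^sub>R (of_real (exp (- ka * (t - ta))) * f ta k))"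
  by (rule forcing_integrable[OF s fm rom f mass]) (use True ka in auto)
 have i': "integrable lborel (%ta. ind {0..t} ta *\<^sub>R (of_real (exp (- ka * (t - ta))) * f' ta k))"
  by (rule forcing_integrable[OF s fm' rom' f' mass']) (use True ka in auto)
 define e where "e ta = complex_of_real (exp (- ka * (t - ta)))" for ta
 have "(LINT ta|lborel. ind {0..t} ta *\<^sub>R (e ta * (f' ta k - f ta k))) =
  (LINT ta|lborel. ind {0..t} ta *\<^sub>R (e ta * f' ta k)) - (LINT ta|lborel. ind {0..t} ta *\<^sub>R (e ta * f ta k))"
  unfolding right_diff_distrib scaleR_diff_right by (rule bintegral_diff) (use i i' in \<open>simp_all add: e_def\<close>)
 thus ?thesis using True by (simp add: Dh_def e_def right_diff_distrib distrib_left)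
qed (auto simp: Dh_def)

section \<open>The integral equation for the Fourier coefficients\<close>

definition sqe :: "ennreal => ennreal" where "sqe x = (if x = \<infinity> then \<infinity> else ennreal (sqrt (enn2real x)))"

lemma sqe_power2: "(sqe x)^2 = x"
 by (cases x) (auto simp: sqe_def power2_eq_square ennreal_mult[symmetric])

lemma sqe_le: "x <= y^2 ==> sqe x <= y"
 by (rule ennreal_le_of_power2_le) (simp add: sqe_power2)

lemma sqe_measurable [measurable]: "sqe : bmeas"
 unfolding sqe_def[abs_def] by measurable

definition force :: "real => real => real => (real => lat => complex) => bool" where
 "force s T m f \<longleftrightarrow> (\<forall>k. (%ta. f ta k) : bmeas) & (NN (ivl 0 T) (%ta. sqe (En s (f ta)))) <= ennreal m"

lemma force_measurable: "force s T m f ==> (%ta. f ta k) : bmeas"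
 unfolding force_def by blast

lemma En_measurable [measurable (raw)]:
 assumes "!!k. (%ta. f ta k) : borel_measurable M" shows "(%ta. En s (f ta)) : borel_measurable M"
proof -
 note assms[measurable]
 show ?thesis unfolding En_def by measurable
qed

lemma forceI:
 assumes fm [measurable]: "!!k. (%ta. f ta k) : bmeas" and [measurable]: "ro : bmeas"
  and f: "!!ta. ta : {0..T} ==> En s (f ta) <= (ro ta)^2" and m: "(NN (ivl 0 T) (%ta. ro ta)) <= ennreal m"
 shows "force s T m f"
proof -
 have "(NN (ivl 0 T) (%ta. sqe (En s (f ta)))) <= (NN (ivl 0 T) (%ta. ro ta))"
  by (rule nn_integral_mono_AE) (auto simp: AE_ivl intro!: AE_I2 sqe_le f)
 thus ?thesis using m fm by (auto simp: force_def)
qed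

lemma force_mono: "force s T m f ==> m <= m' ==> force s T m' f"
 unfolding force_def using ennreal_leI order_trans by blast

lemma force_zero: "force s T 0 (%_ _. 0)"
 by (rule forceI[where ro="%_. 0"]) (auto simp: En_def)

lemma force_add:
 assumes f: "force s T m f" and g: "force s T m' g" and m: "0 <= m" "0 <= m'" and h: "!!ta k. h ta k = f ta k + g ta k"
 shows "force s T (m + m') h"
proof -
 note [measurable] = force_measurable[OF f] force_measurable[OF g]
 show ?thesis
 proof (rule forceI[where ro="%ta. sqe (En s (f ta)) + sqe (En s (g ta))"])
  show "En s (h ta) <= (sqe (En s (f ta)) + sqe (En s (g ta)))^2" for ta
   by (rule En_triangle[where a="f ta" and b="g ta"]) (auto simp: sqe_power2 h norm_triangle_ineq)
  have "(NN (ivl 0 T) (%ta. sqe (En s (f ta)) + sqe (En s (g ta)))) = (NN (ivl 0 T) (%ta. sqe (En s (f ta)))) + (NN (ivl 0 T) (%ta. sqe (En s (g ta))))"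
   by (rule nn_integral_add) auto
  also have "... <= ennreal m + ennreal m'" using f g by (intro add_mono) (auto simp: force_def)
  finally show "(NN (ivl 0 T) (%ta. sqe (En s (f ta)) + sqe (En s (g ta)))) <= ennreal (m + m')" using m by simp
 qed (auto simp: h)
qed

lemma force_mult:
 assumes f: "force s T m f" and z: "!!ta k. cmod (z ta k) <= 1" "!!k. (%ta. z ta k) : bmeas"
 shows "force s T m (%ta k. z ta k * f ta k)"
proof -
 note [measurable] = force_measurable[OF f] z(2)
 show ?thesis
 proof (rule forceI[where ro="%ta. sqe (En s (f ta))"])
  show "En s (%k. z ta k * f ta k) <= (sqe (En s (f ta)))^2" for ta
   unfolding sqe_power2 by (rule En_multiplier_le) (use z in \<open>auto simp: norm_mult intro: mult_left_le_one_le\<close>)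
 qed (use f in \<open>auto simp: force_def\<close>)
qed

lemma Dh_rep_force:
 assumes "0 <= s" "0 <= ka" "0 <= T" "0 <= A" "En s a <= ennreal (A^2)" "0 <= B" and f: "force s T B f"
 shows "rep et s (A + B) (Dh et ka T a f)"
proof -
 note [measurable] = force_measurable[OF f]
 show ?thesis using assms(1-6)
  by (rule Dh_rep[where ro="%ta. sqe (En s (f ta))"]) (use f in \<open>auto simp: sqe_power2 force_def\<close>)
qed

lemma Dh_diff_force:
 assumes s: "0 <= s" and ka: "0 <= ka" and f: "force s T m f" and f': "force s T m' f'"
 shows "Dh et ka T a' f' t k - Dh et ka T a f t k = Dh et ka T (%k. a' k - a k) (%ta k. f' ta k - f ta k) t k"
proof -
 note [measurable] = force_measurable[OF f] force_measurable[OF f']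
 have "(NN (ivl 0 T) (%ta. sqe (En s (f ta)))) < \<infinity>" "(NN (ivl 0 T) (%ta. sqe (En s (f' ta)))) < \<infinity>"
  using f f' by (auto simp: force_def intro: le_less_trans)
 thus ?thesis
  by (intro Dh_diff[where s=s and ro="%ta. sqe (En s (f ta))" and ro'="%ta. sqe (En s (f' ta))"] s ka) (auto simp: sqe_power2)
qed

lemma nlc_measurable [measurable (raw)]:
 assumes [measurable]: "!!k. (%ta. c ta k) : bmeas"
 shows "(%ta. nlc af (c ta) k) : bmeas"
proof -
 interpret finite_measure sqM by (rule finite_sqM)
 have "nlc af (c ta) k = (LINT x|sqM. complex_of_real (cmod (syn (c ta) x) powr af) * ek (- k) x)" for ta
  unfolding nlc_def by (rule fcoef_sqM) simp
 thus ?thesis by simp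
qed

lemma nlc_zero: assumes "0 < af" shows "nlc af (%_. 0) k = 0"
 using assms by (simp add: nlc_def syn_def Pj_def fcoef_def)

lemma rep_zero: "0 <= r ==> rep et s r (%_ _. 0)"
 unfolding rep_def
 by (intro exI[of _ "null_measure borel"] exI[of _ "%_ _. 0"]) (auto simp: En_def)

definition vf :: "real => real => real => (real => lat => complex) => real => lat => complex" where
 "vf af K ep c ta k = of_real (ep / K) * nlc af (c ta) k"

text \<open>\<open>cis (freq2 k * ta)\<close> pulls the product back by the Schroedinger flow, and
  \<open>- \<i>\<close> comes from solving the equation for the time derivative.\<close>

definition uf :: "(real => lat => complex) => (real => lat => complex) => real => lat => complex" where
 "uf c d ta k = - \<i> * cis (freq2 k * ta) * conv (c ta) (d ta) k"

text \<open>Everything at a fixed size \<open>R\<close> of the data. The constants of the estimates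
  are assumed, so that \<open>T\<close> can be chosen after them; \<open>small\<close> is calibrated
  so that the map from solution to forcing has size at most \<open>R/4\<close> and Lipschitz
  constant at most 1/4.\<close>

locale sde =
 fixes s af K ep R CP CN T :: real
 assumes s: "0 < s" and af: "2 <= af" and K: "0 < K" and ep: "ep : {1, -1}" and R: "0 < R" and CP: "0 < CP" and CN: "0 < CN"
  and product: "!!r q c d. 0 <= r ==> 0 <= q ==> rep 1 s r c ==> rep 0 s q d ==> (IT t. En s (conv (c t) (d t))) <= ennreal (CP * (r * q)^2)"
  and nonlin: "!!r q c c'. 0 < r ==> 0 < q ==> rep 1 s r c ==> rep 1 s r c' ==> rep 1 s q (%t k. c' t k - c t k) ==>
   lip_bound s af CN r q c c'"
  and T: "0 < T" "T <= T0" and small: "sqrt T * (sqrt CP * R * (4 + 4 * (CN / K * (2 * R) powr (af - 1)))) <= 1/4"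
begin

text \<open>Lipschitz constant of the forcing of \<open>v\<close> on superpositions of mass
  \<open>r\<close>. It contains no power of \<open>T\<close>: all smallness comes from the equation
  for \<open>u\<close>.\<close>

definition G :: "real => real" where "G r = CN / K * r powr (af - 1)"

lemma G_nonneg: "0 <= G r" using CN K by (simp add: G_def)

abbreviation V where "V b c \<equiv> Dh 0 (1/K) T b (vf af K ep c)"
abbreviation Fy where "Fy b c \<equiv> uf c (V b c)"

lemma ivl_mono: "f : bmeas ==> (NN (ivl 0 T) (%t. f t)) <= (IT t. f t)"
 using T by (auto simp: nn_integral_ivl intro!: nn_integral_mono simp: indicator_def)

lemma vf_diff:
 assumes r: "0 < r" and q: "0 < q" and c: "rep 1 s r c" "rep 1 s r c'" and e: "rep 1 s q (%t k. c' t k - c t k)"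
 shows "force s T (G r * q) (%ta k. vf af K ep c' ta k - vf af K ep c ta k)"
proof -
 have s0: "0 <= s" using s by simp
 note [measurable] = rep_measurable[OF c(1) s0] rep_measurable[OF c(2) s0]
 obtain ro where [measurable]: "ro : bmeas" and ro: "!!t. En s (%k. nlc af (c' t) k - nlc af (c t) k) <= (ro t)^2" and
  m: "(IT t. ro t) <= ennreal (CN * r powr (af - 1) * q)" using nonlin[OF r q c e] by blast
 show ?thesis
 proof (rule forceI[where ro="%t. ennreal (1/K) * ro t"])
  show "(%ta. vf af K ep c' ta k - vf af K ep c ta k) : bmeas" for k unfolding vf_def by measurable
  show "En s (%k. vf af K ep c' t k - vf af K ep c t k) <= (ennreal (1/K) * ro t)^2" for t
  proof -
   have "En s (%k. vf af K ep c' t k - vf af K ep c t k) = ennreal ((1/K)^2) * En s (%k. nlc af (c' t) k - nlc af (c t) k)"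
    using En_cmult[of s "of_real (ep/K)" "%k. nlc af (c' t) k - nlc af (c t) k"] ep
    by (auto simp: vf_def right_diff_distrib norm_divide power_divide)
   also have "... <= ennreal ((1/K)^2) * (ro t)^2" by (intro mult_left_mono ro) simp
   also have "... = (ennreal (1/K) * ro t)^2" using K by (simp add: power_mult_distrib ennreal_power)
   finally show ?thesis .
  qed
  have "(NN (ivl 0 T) (%t. ennreal (1/K) * ro t)) = ennreal (1/K) * (NN (ivl 0 T) (%t. ro t))" by (rule nn_integral_cmult) simp
  also have "... <= ennreal (1/K) * ennreal (CN * r powr (af - 1) * q)"
   by (rule mult_left_mono[OF order_trans[OF ivl_mono m]]) auto
  also have "... = ennreal (G r * q)" using K CN q by (subst ennreal_mult[symmetric]) (auto simp: G_def)
  finally show "(NN (ivl 0 T) (%t. ennreal (1/K) * ro t)) <= ennreal (G r * q)" .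
 qed simp
qed

lemma vf_force:
 assumes r: "0 < r" and c: "rep 1 s r c" shows "force s T (G r * r) (vf af K ep c)"
proof -
 have "force s T (G r * r) (%ta k. vf af K ep c ta k - vf af K ep (%_ _. 0) ta k)"
  by (rule vf_diff[OF r r rep_zero c]) (use r c in auto)
 moreover have "(%ta k. vf af K ep c ta k - vf af K ep (%_ _. 0) ta k) = vf af K ep c"
  using af by (intro ext) (simp add: vf_def nlc_zero)
 ultimately show ?thesis by simp
qed

lemma V_rep:
 assumes r: "0 < r" and c: "rep 1 s r c" and b: "0 <= B" "En s b <= ennreal (B^2)"
 shows "rep 0 s (B + G r * r) (V b c)"
 by (rule Dh_rep_force) (use s K T b r G_nonneg vf_force[OF r c] in auto)

lemma V_diff:
 assumes r: "0 < r" and q: "0 < q" and c: "rep 1 s r c" "rep 1 s r c'" and e: "rep 1 s q (%t k. c' t k - c t k)"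
  and b: "0 <= de" "En s (%k. b' k - b k) <= ennreal (de^2)"
 shows "rep 0 s (de + G r * q) (%t k. V b' c' t k - V b c t k)"
proof -
 have "rep 0 s (de + G r * q) (Dh 0 (1/K) T (%k. b' k - b k) (%ta k. vf af K ep c' ta k - vf af K ep c ta k))"
  by (rule Dh_rep_force) (use s K T b r q G_nonneg vf_diff[OF r q c e] in auto)
 moreover have "(%t k. V b' c' t k - V b c t k) = Dh 0 (1/K) T (%k. b' k - b k) (%ta k. vf af K ep c' ta k - vf af K ep c ta k)"
  by (intro ext Dh_diff_force[OF _ _ vf_force[OF r c(1)] vf_force[OF r c(2)]]) (use s K in auto)
 ultimately show ?thesis by simp
qed

text \<open>The product is controlled in \<open>L^2\<close> in time, and the passage to
  \<open>L^1\<close> supplies the factor \<open>sqrt T\<close> on which the contraction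
  rests.\<close>

lemma uf_force:
 assumes r: "0 < r" "0 < q" and c: "rep 1 s r c" and d: "rep 0 s q d"
 shows "force s T (sqrt T * sqrt CP * (r * q)) (uf c d)"
proof -
 have s0: "0 <= s" using s by simp
 note [measurable] = rep_measurable[OF c s0] rep_measurable[OF d s0]
 have [measurable]: "(%t. conv (c t) (d t) k) : bmeas" for k unfolding conv_def by measurable
 have [measurable]: "(%t. En s (conv (c t) (d t))) : bmeas" by measurable
 have "(NN (ivl 0 T) (%t. En s (conv (c t) (d t)))) <= ennreal ((sqrt CP * (r * q))^2)"
  using order_trans[OF ivl_mono product[of r q c d]] r c d CP by (simp add: power_mult_distrib)
 then obtain ro where ro: "ro : bmeas" "!!t. En s (conv (c t) (d t)) <= (ro t)^2" "(NN (ivl 0 T) (%t. ro t)) <= ennreal (sqrt T * (sqrt CP * (r * q)))"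
  using nn_integral_L1_of_L2[of "%t. En s (conv (c t) (d t))" "sqrt CP * (r * q)" T] r CP T by auto
 show ?thesis
 proof (rule forceI[OF _ ro(1)])
  show "(%ta. uf c d ta k) : bmeas" for k unfolding uf_def by measurable
  show "En s (uf c d ta) <= (ro ta)^2" for ta
   by (rule order_trans[OF En_multiplier_le ro(2)]) (simp add: uf_def norm_mult)
  show "(NN (ivl 0 T) (%t. ro t)) <= ennreal (sqrt T * sqrt CP * (r * q))" using ro(3) by (simp add: mult.assoc)
 qed
qed

lemma rep_fin0: "rep et s r c ==> 0 <= r ==> En 0 (c t) < \<infinity>"
 using s by (intro En_0_finite[of s] En_bounded_norm) auto

lemma Fy_force:
 assumes c: "rep 1 s (2 * R) c" and b: "En s b <= ennreal (R^2)"
 shows "force s T (R/4) (Fy b c)"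
proof (rule force_mono[OF uf_force[OF _ _ c V_rep[OF _ c _ b]]])
 have "sqrt T * sqrt CP * (2 * R * (R + G (2 * R) * (2 * R))) = R * (sqrt T * (sqrt CP * R * (2 + 4 * G (2 * R))))"
  by (simp add: algebra_simps)
 also have "... <= R * (sqrt T * (sqrt CP * R * (4 + 4 * G (2 * R))))" using R T CP by (intro mult_left_mono) auto
 also have "... <= R * (1/4)" using small R by (intro mult_left_mono) (auto simp: G_def)
 finally show "sqrt T * sqrt CP * (2 * R * (R + G (2 * R) * (2 * R))) <= R/4" by simp
qed (use R G_nonneg in \<open>auto intro: add_pos_nonneg\<close>)

lemma Fy_diff:
 assumes c: "rep 1 s (2 * R) c" "rep 1 s (2 * R) c'" and q: "0 < q" and e: "rep 1 s q (%t k. c' t k - c t k)"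
  and b: "En s b <= ennreal (R^2)" "En s b' <= ennreal (R^2)" and d: "0 <= de" "En s (%k. b' k - b k) <= ennreal (de^2)"
 shows "force s T ((q + de)/4) (%ta k. Fy b' c' ta k - Fy b c ta k)"
proof -
 define g where "g = G (2 * R)"
 have g: "0 <= g" using G_nonneg by (simp add: g_def)
 have R2: "0 < 2 * R" using R by simp
 have V': "rep 0 s (R + g * (2 * R)) (V b' c')" "rep 0 s (R + g * (2 * R)) (V b c)" unfolding g_def using V_rep[OF R2 c(2) _ b(2)] V_rep[OF R2 c(1) _ b(1)] R by auto
 have VD: "rep 0 s (de + g * q + et) (%t k. V b' c' t k - V b c t k)" if "0 <= et" for et unfolding g_def using rep_mono[OF V_diff[OF R2 q c e d]] that by simp
 define D where "D = (%t k. V b' c' t k - V b c t k)"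
 \<comment> \<open>\<open>uf_force\<close> asks for a positive mass, and \<open>de\<close> may be 0;
   the surplus \<open>q / 4\<close> ensures positivity.\<close>
 have D': "rep 0 s (de + g * q + q / 4) D" using VD[of "q/4"] q by (simp add: D_def)
 have f1: "force s T (sqrt T * sqrt CP * (q * (R + g * (2 * R)))) (uf (%t k. c' t k - c t k) (V b' c'))"
  by (rule uf_force[OF q _ e V'(1)]) (use R g in \<open>auto intro: add_pos_nonneg\<close>)
 have f2: "force s T (sqrt T * sqrt CP * (2 * R * (de + g * q + q / 4))) (uf c D)"
  by (rule uf_force[OF R2 _ c(1) D']) (use d g q in \<open>auto intro: add_nonneg_pos\<close>)
 have "force s T (sqrt T * sqrt CP * (q * (R + g * (2 * R))) + sqrt T * sqrt CP * (2 * R * (de + g * q + q / 4))) (%ta k. Fy b' c' ta k - Fy b c ta k)"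
 proof (rule force_add[OF f1 f2])
  fix ta k
  have "conv (c' ta) (V b' c' ta) k - conv (c ta) (V b c ta) k = conv (%k. c' ta k - c ta k) (V b' c' ta) k + conv (c ta) (D ta) k"
   unfolding D_def by (rule conv_diff) (use rep_fin0[OF c(1)] rep_fin0[OF c(2)] rep_fin0[OF V'(1)] rep_fin0[OF V'(2)] R g in auto)
  thus "Fy b' c' ta k - Fy b c ta k = uf (%t k. c' t k - c t k) (V b' c') ta k + uf c D ta k"
   unfolding uf_def by (simp only: right_diff_distrib[symmetric] distrib_left[symmetric])
 qed (use T CP q R g d in auto)
 thus ?thesis
 proof (rule force_mono)
  have "sqrt T * sqrt CP * (q * (R + g * (2 * R))) + sqrt T * sqrt CP * (2 * R * (de + g * q + q / 4)) = (sqrt T * sqrt CP * R) * (q * (3/2 + 4 * g) + 2 * de)"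
   by (simp add: algebra_simps)
  also have "... <= (sqrt T * sqrt CP * R) * ((4 + 4 * g) * (q + de))"
  proof (rule mult_left_mono)
   have "(4 + 4 * g) * (q + de) - (q * (3/2 + 4 * g) + 2 * de) = 5/2 * q + 2 * de + 4 * (g * de)" by (simp add: algebra_simps)
   moreover have "0 <= g * de" using g d by simp
   ultimately show "q * (3/2 + 4 * g) + 2 * de <= (4 + 4 * g) * (q + de)" using q d by linarith
  qed (use T CP R in auto)
  also have "... = (sqrt T * (sqrt CP * R * (4 + 4 * g))) * (q + de)" by (simp add: algebra_simps)
  also have "... <= 1/4 * (q + de)" using small q d by (intro mult_right_mono) (auto simp: g_def G_def)
  finally show "sqrt T * sqrt CP * (q * (R + g * (2 * R))) + sqrt T * sqrt CP * (2 * R * (de + g * q + q / 4)) <= (q + de)/4" by simp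
 qed
qed

lemma Dh_cong:
 assumes "!!ta. ta : {0..t} ==> f ta k = f' ta k" shows "Dh et ka S a f t k = Dh et ka S a f' t k"
proof -
 have "(LINT ta|lborel. ind {0..t} ta *\<^sub>R (of_real (exp (- ka * (t - ta))) * f ta k)) = (LINT ta|lborel. ind {0..t} ta *\<^sub>R (of_real (exp (- ka * (t - ta))) * f' ta k :: complex))"
  by (rule bintegral_cong) (use assms in \<open>auto simp: indicator_def\<close>)
 thus ?thesis by (simp add: Dh_def)
qed

text \<open>A given solution has some finite mass \<open>r\<close>, possibly large. As long as the
  accumulated norm \<open>integral {0..t} g\<close> of the forcing is at most \<open>R\<close>, the
  solution cut off at \<open>t\<close> has mass at most \<open>2 * R\<close>, and then this norm is
  in fact at most \<open>R/4\<close>. It is continuous and starts at 0, so it never reaches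
  \<open>R\<close>.\<close>

lemma apriori:
 assumes r: "0 < r" and c: "rep 1 s r c" and sol: "!!t k. c t k = Dh 1 0 T a (Fy b c) t k"
  and a: "En s a <= ennreal (R^2)" and b: "En s b <= ennreal (R^2)"
 shows "rep 1 s (2 * R) c"
proof -
 have s0: "0 <= s" using s by simp
 have pos: "0 < R + G r * r" using R r G_nonneg by (simp add: add_pos_nonneg)
 obtain M0 where f0: "force s T M0 (Fy b c)" using uf_force[OF r pos c V_rep[OF r c _ b]] R by auto
 note [measurable] = force_measurable[OF f0]
 define h where "h ta = sqe (En s (Fy b c ta))" for ta
 have [measurable]: "h : bmeas" unfolding h_def by measurable
 have fin: "(NN (ivl 0 T) (%ta. h ta)) < \<infinity>" using f0 by (auto simp: force_def h_def intro: le_less_trans)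
 have AEh: "AE ta in lborel. ta : {0..T} --> h ta ~= \<infinity>" using nn_integral_PInf_AE[of h "ivl 0 T"] fin by (auto simp: AE_ivl)
 define g where "g ta = enn2real (h ta)" for ta
 have [measurable]: "g : bmeas" unfolding g_def by measurable
 have Hg: "(NN (ivl 0 t) (%ta. h ta)) = (IL ta. ennreal (ind {0..t} ta *\<^sub>R g ta))" if "t <= T" for t
  unfolding nn_integral_ivl[OF \<open>h : bmeas\<close>]
 proof (rule nn_integral_cong_AE)
  show "AE ta in lborel. h ta * ind {0..t} ta = ennreal (ind {0..t} ta *\<^sub>R g ta)"
   using AEh by eventually_elim (use that in \<open>auto simp: indicator_def g_def less_top\<close>)
 qed
 have gi: "set_integrable lborel {0..T} g"
  unfolding set_integrable_def by (rule integrableI_nonneg) (use fin Hg[of T] in \<open>auto simp: g_def\<close>)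
 have HI: "(NN (ivl 0 t) (%ta. h ta)) = ennreal (integral {0..t} g)" if t: "t : {0..T}" for t
 proof -
  have gt: "set_integrable lborel {0..t} g" by (rule set_integrable_subset[OF gi]) (use t in auto)
  have "(NN (ivl 0 t) (%ta. h ta)) = ennreal (LINT ta:{0..t}|lborel. g ta)"
   unfolding set_lebesgue_integral_def using Hg[of t] t gt nn_integral_eq_integral[of lborel "%ta. ind {0..t} ta *\<^sub>R g ta"]
   by (auto simp: set_integrable_def g_def)
  thus ?thesis using set_borel_integral_eq_integral(2)[OF gt] by simp
 qed
 have cont: "continuous_on {0..T} (%t. integral {0..t} g)"
  by (rule indefinite_integral_continuous_1) (use set_borel_integral_eq_integral(1)[OF gi] in simp)
 have rept: "rep 1 s (2 * R) (Dh 1 0 t a (Fy b c))" if t: "t : {0..T}" and H: "integral {0..t} g <= R" for t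
 proof -
  have "force s t R (Fy b c)" using HI[OF t] H by (auto simp: force_def h_def[symmetric] intro: ennreal_leI force_measurable[OF f0])
  hence "rep 1 s (R + R) (Dh 1 0 t a (Fy b c))" using t R s a by (intro Dh_rep_force) auto
  thus ?thesis by simp
 qed
 have key: "integral {0..t} g <= R/4" if t: "t : {0..T}" and H: "integral {0..t} g <= R" for t
 proof -
  \<comment> \<open>Causality: the cut-off solution, its \<open>v\<close> and its forcing agree with
    the original ones up to time \<open>t\<close>.\<close>
  define ct where "ct = Dh 1 0 t a (Fy b c)"
  have ct: "rep 1 s (2 * R) ct" using rept[OF t H] by (simp add: ct_def)
  have eqc: "ct ta = c ta" if "ta : {0..t}" for ta
   using that t by (intro ext, subst sol) (auto simp: ct_def Dh_def)
  have eqV: "V b ct ta = V b c ta" if "ta : {0..t}" for ta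
   by (intro ext Dh_cong) (use that in \<open>auto simp: vf_def eqc\<close>)
  have eqP: "Fy b ct ta = Fy b c ta" if "ta : {0..t}" for ta
   by (intro ext) (simp add: uf_def eqc[OF that] eqV[OF that])
  have P: "force s T (R/4) (Fy b ct)" by (rule Fy_force[OF ct b])
  note [measurable] = force_measurable[OF P]
  have "(NN (ivl 0 t) (%ta. h ta)) <= (NN (ivl 0 T) (%ta. sqe (En s (Fy b ct ta))))"
   using t eqP by (auto simp: nn_integral_ivl h_def indicator_def intro!: nn_integral_mono)
  also have "... <= ennreal (R/4)" using P by (simp add: force_def)
  finally show ?thesis using HI[OF t] R by (simp add: ennreal_le_iff)
 qed
 have "integral {0..T} g <= R"
 proof (rule ccontr)
  assume "\<not> integral {0..T} g <= R"
  hence "\<exists>t\<ge>0. t <= T & integral {0..t} g = R" using R T cont by (intro IVT') auto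
  then obtain t where t: "t : {0..T}" "integral {0..t} g = R" by auto
  thus False using key[OF t(1)] R by simp
 qed
 moreover have "c = Dh 1 0 T a (Fy b c)" using sol by (intro ext) simp
 ultimately show ?thesis using rept[of T] T by auto
qed

text \<open>Let \<open>z\<close> be the exact \<open>L^1 H^s\<close> norm of the difference of the
  forcings, finite by the separate bounds. The difference of the solutions has mass
  \<open>de + z\<close>, and the Lipschitz bound returns \<open>z <= (de + z + de)/4\<close>, which
  gives \<open>z <= de\<close>.\<close>

lemma difference:
 assumes c: "rep 1 s (2 * R) c" "rep 1 s (2 * R) c'" and sol: "!!t k. c t k = Dh 1 0 T a (Fy b c) t k" "!!t k. c' t k = Dh 1 0 T a' (Fy b' c') t k"
  and b: "En s b <= ennreal (R^2)" "En s b' <= ennreal (R^2)"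
  and d: "0 < de" "En s (%k. a' k - a k) <= ennreal (de^2)" "En s (%k. b' k - b k) <= ennreal (de^2)"
 shows "rep 1 s (2 * de) (%t k. c' t k - c t k)" "rep 0 s (de + G (2 * R) * (2 * de)) (%t k. V b' c' t k - V b c t k)"
proof -
 have F: "force s T (R/4) (Fy b c)" "force s T (R/4) (Fy b' c')" using Fy_force[OF c(1) b(1)] Fy_force[OF c(2) b(2)] .
 define E where "E = (%ta k. Fy b' c' ta k - Fy b c ta k)"
 have FE: "force s T (R/4 + R/4) E"
  using force_add[OF F(2) force_mult[OF F(1), of "%_ _. -1"], of E] R by (simp add: E_def)
 define z where "z = enn2real (NN (ivl 0 T) (%ta. sqe (En s (E ta))))"
 have z0: "0 <= z" by (simp add: z_def)
 have fin: "(NN (ivl 0 T) (%ta. sqe (En s (E ta)))) < \<infinity>" using FE by (auto simp: force_def intro: le_less_trans)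
 have zeq: "(NN (ivl 0 T) (%ta. sqe (En s (E ta)))) = ennreal z" using fin by (simp add: z_def less_top)
 have Fz: "force s T z E" using FE zeq by (simp add: force_def)
 have eq: "(%t k. c' t k - c t k) = Dh 1 0 T (%k. a' k - a k) E"
 proof (intro ext)
  fix t k
  have "c' t k - c t k = Dh 1 0 T a' (Fy b' c') t k - Dh 1 0 T a (Fy b c) t k" by (rule arg_cong2[where f="(-)", OF sol(2) sol(1)])
  also have "... = Dh 1 0 T (%k. a' k - a k) E t k" unfolding E_def by (rule Dh_diff_force[OF _ _ F]) (use s in auto)
  finally show "c' t k - c t k = Dh 1 0 T (%k. a' k - a k) E t k" .
 qed
 have rz: "rep 1 s (de + z) (%t k. c' t k - c t k)"
  unfolding eq by (rule Dh_rep_force[OF _ _ _ _ d(2) z0 Fz]) (use s T d in auto)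
 have "force s T ((de + z + de)/4) E" unfolding E_def by (rule Fy_diff[OF c _ rz b _ d(3)]) (use d z0 in auto)
 hence "z <= (de + z + de)/4" using zeq d z0 by (simp add: force_def ennreal_le_iff)
 hence "z <= de" using d by simp
 thus r2: "rep 1 s (2 * de) (%t k. c' t k - c t k)" using rep_mono[OF rz] by simp
 show "rep 0 s (de + G (2 * R) * (2 * de)) (%t k. V b' c' t k - V b c t k)"
  by (rule V_diff[OF _ _ c r2 _ d(3)]) (use d R in auto)
qed

text \<open>The limit \<open>F\<close> of the forcings equals \<open>Fy b c\<close> for almost every
  time, coefficient by coefficient. The integrals in \<open>Dh\<close> do not see the exceptional
  times, so \<open>c\<close> solves its equation at every time.\<close>

lemma existence:
 assumes a: "En s a <= ennreal (R^2)" and b: "En s b <= ennreal (R^2)"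
 obtains c where "rep 1 s (2 * R) c" "!!t k. c t k = Dh 1 0 T a (Fy b c) t k"
proof -
 have s0: "0 <= s" using s by simp
 \<comment> \<open>Starting from zero forcing, the first increment has size at most
   \<open>R/4\<close> and each further one shrinks by 1/4; the sequence \<open>q\<close> records
   this.\<close>
 define f where "f = rec_nat (%_ _. 0) (%_ g. Fy b (Dh 1 0 T a g))"
 define C where "C n = Dh 1 0 T a (f n)" for n
 have f0: "f 0 = (%_ _. 0)" and fS: "f (Suc n) = Fy b (C n)" for n by (simp_all add: f_def C_def)
 have fC: "force s T (R/4) (f n) & rep 1 s (2 * R) (C n)" for n
 proof (induction n)
  case 0
  have F: "force s T (R/4) (f 0)" unfolding f0 by (rule force_mono[OF force_zero]) (use R in auto)
  have "rep 1 s (R + R/4) (C 0)" unfolding C_def by (rule Dh_rep_force[OF _ _ _ _ a _ F]) (use s T R in auto)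
  thus ?case using F rep_mono[of 1 s "R + R/4" "C 0" "2 * R"] R by simp
 next
  case (Suc n)
  hence F: "force s T (R/4) (f (Suc n))" unfolding fS using Fy_force b by blast
  have "rep 1 s (R + R/4) (C (Suc n))" unfolding C_def by (rule Dh_rep_force[OF _ _ _ _ a _ F]) (use s T R in auto)
  thus ?case using F rep_mono[of 1 s "R + R/4" "C (Suc n)" "2 * R"] R by simp
 qed
 define q where "q n = R * (1/4)^n" for n :: nat
 have q0: "0 < q n" for n using R by (simp add: q_def)
 have zA: "En s (%k. x k - x k) <= ennreal (0^2)" for x :: "lat => complex" by (simp add: En_def)
 define D where "D n = (%ta k. f (Suc n) ta k - f n ta k)" for n
 have FD: "force s T (q (Suc n)) (D n)" for n
 proof (induction n)
  case 0
  thus ?case using fC[of 1] by (simp add: D_def f0 q_def)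
 next
  case (Suc n)
  have "(%t k. C (Suc n) t k - C n t k) = Dh 1 0 T (%k. a k - a k) (D n)"
   unfolding C_def D_def by (intro ext Dh_diff_force[OF s0 _ conjunct1[OF fC] conjunct1[OF fC]]) simp
  moreover have "rep 1 s (0 + q (Suc n)) (Dh 1 0 T (%k. a k - a k) (D n))"
   by (rule Dh_rep_force[OF _ _ _ _ zA _ Suc]) (use s T q0[of "Suc n"] in auto)
  ultimately have "rep 1 s (q (Suc n)) (%t k. C (Suc n) t k - C n t k)" by simp
  hence "force s T ((q (Suc n) + 0)/4) (%ta k. Fy b (C (Suc n)) ta k - Fy b (C n) ta k)"
   using fC b by (intro Fy_diff[OF _ _ q0 _ b b _ zA]) auto
  thus ?case by (simp add: D_def fS q_def)
 qed
 note fm [measurable] = force_measurable[OF conjunct1[OF fC]] and Dm [measurable] = force_measurable[OF FD]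
 define F where "F ta k = (\<Sum>n. D n ta k)" for ta k
 have Fm [measurable]: "(%ta. F ta k) : bmeas" for k unfolding F_def by measurable
 have tele: "(\<Sum>n<N. D n ta k) = f N ta k" for N ta k
  by (induction N) (simp_all add: D_def f0)
 have tail: "force s T (q N) (%ta k. F ta k - f N ta k)" for N
 proof (rule forceI[where ro="%ta. \<Sum>n. sqe (En s (D (n + N) ta))"])
  show "En s (%k. F ta k - f N ta k) <= (\<Sum>n. sqe (En s (D (n + N) ta)))^2" for ta
   using En_series[OF s0, of "%n. D n ta" "%n. sqe (En s (D n ta))" N] by (simp add: sqe_power2 F_def tele)
  have "(NN (ivl 0 T) (%ta. (\<Sum>n. sqe (En s (D (n + N) ta))))) = (\<Sum>n. \<integral>\<^sup>+ta. sqe (En s (D (n + N) ta)) \<partial>ivl 0 T)"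
   by (rule nn_integral_suminf) measurable
  also have "... <= (\<Sum>n. ennreal (q N / 4 * (1/4)^n))"
  proof (rule suminf_le)
   fix n
   have "(NN (ivl 0 T) (%ta. sqe (En s (D (n + N) ta)))) <= ennreal (q (Suc (n + N)))" using FD[of "n + N"] by (simp add: force_def)
   also have "q (Suc (n + N)) = q N / 4 * (1/4)^n" by (simp add: q_def power_add)
   finally show "(NN (ivl 0 T) (%ta. sqe (En s (D (n + N) ta)))) <= ennreal (q N / 4 * (1/4)^n)" .
  qed auto
  also have "... = ennreal (\<Sum>n. q N / 4 * (1/4)^n)" using q0[of N] by (intro suminf_ennreal2 summable_mult summable_geometric) auto
  also have "(\<Sum>n. q N / 4 * (1/4)^n) = q N / 3" by (subst suminf_mult) (auto simp: suminf_geometric)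
  also have "ennreal (q N / 3) <= ennreal (q N)" using q0[of N] by (intro ennreal_leI) simp
  finally show "(NN (ivl 0 T) (%ta. (\<Sum>n. sqe (En s (D (n + N) ta))))) <= ennreal (q N)" .
 qed measurable
 have F1: "force s T R F" using tail[of 0] by (simp add: f0 q_def)
 define c where "c = Dh 1 0 T a F"
 have c: "rep 1 s (2 * R) c"
 proof -
  have "rep 1 s (R + R) c" unfolding c_def by (rule Dh_rep_force[OF _ _ _ _ a _ F1]) (use s T R in auto)
  thus ?thesis by simp
 qed
 have FP: "force s T (R/4) (Fy b c)" by (rule Fy_force[OF c b])
 \<comment> \<open>Both \<open>F\<close> and \<open>Fy b c\<close> are within a geometric error of
   the iterate \<open>f (Suc N)\<close>.\<close>
 have small': "force s T (q N) (%ta k. F ta k - Fy b c ta k)" for N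
 proof -
  have "(%t k. C N t k - c t k) = Dh 1 0 T (%k. a k - a k) (%ta k. f N ta k - F ta k)"
   unfolding C_def c_def by (intro ext Dh_diff_force[OF s0 _ F1 conjunct1[OF fC]]) simp
  moreover have "force s T (q N) (%ta k. f N ta k - F ta k)" using force_mult[OF tail[of N], of "%_ _. -1"] by simp
  hence "rep 1 s (0 + q N) (Dh 1 0 T (%k. a k - a k) (%ta k. f N ta k - F ta k))"
   by (intro Dh_rep_force[OF _ _ _ _ zA]) (use s T q0[of N] in auto)
  ultimately have "rep 1 s (q N) (%t k. C N t k - c t k)" by simp
  hence "force s T ((q N + 0)/4) (%ta k. Fy b (C N) ta k - Fy b c ta k)"
   using fC b by (intro Fy_diff[OF c _ q0 _ b b _ zA]) auto
  hence "force s T (q (Suc N) + q N / 4) (%ta k. F ta k - Fy b c ta k)"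
   using q0[of "Suc N"] q0[of N] by (intro force_add[OF tail[of "Suc N"]]) (auto simp: fS)
  thus ?thesis by (rule force_mono) (use q0[of N] in \<open>simp add: q_def\<close>)
 qed
 note Pm [measurable] = force_measurable[OF FP]
 have AEk: "AE ta in lborel. ta : {0..T} --> F ta k = Fy b c ta k" for k
 proof -
  have "(NN (ivl 0 T) (%ta. sqe (En s (%k. F ta k - Fy b c ta k)))) = 0"
  proof -
   have "(%N. ennreal (q N)) \<longlonglongrightarrow> ennreal 0" unfolding q_def by (intro tendsto_ennrealI tendsto_mult_right_zero LIMSEQ_power_zero) auto
   hence "(NN (ivl 0 T) (%ta. sqe (En s (%k. F ta k - Fy b c ta k)))) <= ennreal 0"
    by (rule LIMSEQ_le_const) (use small' in \<open>auto simp: force_def\<close>)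
   thus ?thesis by simp
  qed
  hence "AE ta in ivl 0 T. sqe (En s (%k. F ta k - Fy b c ta k)) = 0" by (subst (asm) nn_integral_0_iff_AE) auto
  thus ?thesis unfolding AE_ivl
  proof eventually_elim
   case (elim ta)
   show ?case
   proof
    assume "ta : {0..T}"
    hence "En s (%k. F ta k - Fy b c ta k) = 0" using elim sqe_power2[of "En s (%k. F ta k - Fy b c ta k)"] by simp
    hence "cmod (F ta k - Fy b c ta k) <= 0" by (intro En_le_cmod[OF s0, of 0 "%k. F ta k - Fy b c ta k" k]) auto
    thus "F ta k = Fy b c ta k" by simp
   qed
  qed
 qed
 have "c t k = Dh 1 0 T a (Fy b c) t k" for t k
 proof (cases "t : {0..T}")
  case True
  have "(LINT ta|lborel. ind {0..t} ta *\<^sub>R (of_real (exp (- 0 * (t - ta))) * F ta k)) = (LINT ta|lborel. ind {0..t} ta *\<^sub>R (of_real (exp (- 0 * (t - ta))) * Fy b c ta k))"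
   by (rule integral_cong_AE) (use AEk[of k] True in \<open>auto simp: indicator_def elim!: eventually_mono\<close>)
  thus ?thesis using True by (simp add: c_def Dh_def)
 qed (auto simp: c_def Dh_def)
 thus ?thesis using that c by blast
qed

end

section \<open>Bourgain spaces\<close>

abbreviation CI :: "int measure" where "CI \<equiv> count_space UNIV"

definition FT :: "(real => complex) => real => complex" where "FT H y = (LINT t|lborel. H t * cis (y * t))"

lemma FT_measurable [measurable]:
 assumes [measurable]: "H : bmeas" shows "FT H : bmeas"
 unfolding FT_def[abs_def] by measurable

text \<open>The line is cut into unit cells. For Fourier transforms this turns an integral over
  frequencies into sums over samples at \<open>n + x\<close>, integrated over the offset
  \<open>x\<close>.\<close>

lemma periodization:
 fixes F :: "real => ennreal"
 assumes [measurable]: "F : bmeas"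
 shows "(IL y. F y) = (IL x. (SU n. F (of_int n + x)) * ind {0..<1} x)"
proof -
 have one: "(SU n. F y * ind {of_int n..<of_int n + 1} y) = F y" for y :: real
 proof -
  have "(SU n. F y * ind {of_int n..<of_int n + 1} y) = (SU n. F y * ind {\<lfloor>y\<rfloor>} n)"
  proof (rule nn_integral_cong)
   fix n :: int
   have "y : {of_int n..<of_int n + 1} \<longleftrightarrow> n = \<lfloor>y\<rfloor>" using floor_eq_iff[of y n] by auto
   thus "F y * ind {of_int n..<of_int n + 1} y = F y * ind {\<lfloor>y\<rfloor>} n" by (simp add: indicator_def)
  qed
  also have "... = F y" by (simp add: nn_integral_cmult)
  finally show ?thesis .
 qed
 have "(IL y. F y) = (IL y. (SU n. F y * ind {of_int n..<of_int n + 1} y))" by (simp add: one)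
 also have "... = (SU n. (IL y. F y * ind {of_int n..<of_int n + 1} y))"
  by (rule nn_integral_count_swap[symmetric]) measurable
 also have "... = (SU n. (IL x. F (of_int n + x) * ind {0..<1} x))"
 proof (rule nn_integral_cong)
  fix n :: int
  have "(IL x. F (of_int n + x) * ind {of_int n..<of_int n + 1} (of_int n + x)) = (IL y. F y * ind {of_int n..<of_int n + 1} y)"
   by (rule nn_integral_lborel_shift) measurable
  thus "(IL y. F y * ind {of_int n..<of_int n + 1} y) = (IL x. F (of_int n + x) * ind {0..<1} x)"
   by (simp add: indicator_def)
 qed
 also have "... = (IL x. (SU n. F (of_int n + x) * ind {0..<1} x))"
  by (rule nn_integral_count_swap) measurable
 also have "... = (IL x. (SU n. F (of_int n + x)) * ind {0..<1} x)" by (simp add: nn_integral_multc)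
 finally show ?thesis .
qed

lemma cis_circle: "(\<integral>t. cis (of_int i * t) * cnj (cis (of_int j * t)) \<partial>ivl (-pi) pi) = (if i = j then of_real (2 * pi) else 0)"
proof -
 have "cis (1 * of_int m * (pi - - pi)) = 1" for m :: int using cis_multiple_2pi[of "of_int m"] by (simp add: mult_ac)
 thus ?thesis using cis_ivl_orthogonal[of "-pi" pi 1 i j] by simp
qed

lemma FT_ivl:
 assumes [measurable]: "H : bmeas" and H: "!!t. t \<notin> {-pi..pi} ==> H t = 0"
 shows "FT H y = (\<integral>t. H t * cis (y * t) \<partial>ivl (-pi) pi)"
proof -
 have "(\<integral>t. H t * cis (y * t) \<partial>ivl (-pi) pi) = (LINT t|lborel. ind {-pi..pi} t *\<^sub>R (H t * cis (y * t)))"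
  by (rule integral_ivl) measurable
 also have "... = FT H y" unfolding FT_def
  by (rule bintegral_cong) (use H in \<open>auto simp: indicator_def\<close>)
 finally show ?thesis by simp
qed

text \<open>One half of Plancherel's theorem: for each offset \<open>x\<close> Bessel's inequality
  bounds the samples at \<open>n + x\<close>, and periodization integrates over
  \<open>x\<close>.\<close>

lemma FT_L2_bound:
 assumes [measurable]: "H : bmeas" and supp: "!!t. t \<notin> {-pi..pi} ==> H t = 0"
 shows "(IL y. sqn (FT H y)) <= ennreal (2 * pi) * (IL t. sqn (H t))"
proof -
 define B where "B = ennreal (2 * pi) * (IL t. sqn (H t))"
 have b: "(SU n. sqn (FT H (of_int n + x))) <= B" for x
 proof -
  have "(SU n. sqn (FT H (of_int n + x))) = (SU n. sqn (\<integral>t. (H t * cis (x * t)) * cnj (cis (of_int (- n) * t)) \<partial>ivl (-pi) pi))"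
   by (intro nn_integral_cong arg_cong[where f="%z. sqn z"])
    (subst FT_ivl[OF _ supp], auto simp: cis_cnj cis_mult mult.assoc distrib_right add.commute)
  also have "... <= (SU n. sqn (\<integral>t. (H t * cis (x * t)) * cnj (cis (of_int n * t)) \<partial>ivl (-pi) pi))"
   using nn_integral_count_inj_le[of uminus UNIV "%n. sqn (\<integral>t. (H t * cis (x * t)) * cnj (cis (of_int n * t)) \<partial>ivl (-pi) pi)"] by simp
  also have "... <= ennreal (2 * pi) * (NN (ivl (-pi) pi) (%t. sqn (H t * cis (x * t))))"
   by (rule bessel) (use finite_ivl[of "-pi" pi] cis_circle in auto)
  also have "(NN (ivl (-pi) pi) (%t. sqn (H t * cis (x * t)))) = (IL t. sqn (H t))"
   by (subst nn_integral_ivl) (auto simp: norm_mult indicator_def intro!: nn_integral_cong supp)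
  finally show ?thesis by (simp add: B_def)
 qed
 have "(IL y. sqn (FT H y)) = (IL x. (SU n. sqn (FT H (of_int n + x))) * ind {0..<1} x)"
  by (rule periodization) measurable
 also have "... <= (IL x. B * ind {0..<1::real} x)" by (intro nn_integral_mono mult_right_mono b) auto
 also have "... = B" by (simp add: nn_integral_cmult)
 finally show ?thesis by (simp add: B_def)
qed

lemma circle_unique:
 assumes f: "set_integrable lborel {-pi..pi} f" and z: "!!m::int. (LINT t|lborel. ind {-pi..pi} t *\<^sub>R f t * cis (of_int m * t)) = 0"
 shows "AE t in lborel. t : {-pi<..<pi} --> f t = (0::complex)"
proof (rule fourier_unique[where e="%(n::int) t. cis (of_int n * t)" and E=cis and S="{-pi..pi}"])
 show "(%t. complex_of_real (cis t \<bullet> b)) : trig_poly (%(n::int) t. cis (of_int n * t))" if "b : Basis" for b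
 proof -
  have k: "(%x. a * cis (of_int k * x) + b * cis (of_int l * x)) : trig_poly (%(n::int) t. cis (of_int n * t))" for a b k l
   by (rule trig_poly.add; rule trig_poly.mono)
  have "complex_of_real (cos t) = (1/2) * cis (of_int 1 * t) + (1/2) * cis (of_int (-1) * t)"
   "complex_of_real (sin t) = (-\<i>/2) * cis (of_int 1 * t) + (\<i>/2) * cis (of_int (-1) * t)" for t by (auto simp: complex_eq_iff)
  moreover have "b = 1 \<or> b = \<i>" using that by (auto simp: Basis_complex_def)
  ultimately show ?thesis using k by (auto simp only: inner_complex_def cis.sel complex.sel one_complex.sel imaginary_unit.sel) (simp_all only: mult_1_right mult_zero_right add_0_right add_0_left)
 qed
 show "x = y" if "x : {-pi<..<pi}" "y : {-pi..pi}" "cis x = cis y" for x y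
 proof -
  have "cos x = cos y" "sin x = sin y" using that(3) by (auto simp: complex_eq_iff)
  hence "cos (x - y) = 1" using sin_cos_squared_add3[of y] by (simp add: cos_diff)
  then obtain n :: int where n: "x - y = of_int n * 2 * pi" using cos_one_2pi_int by blast
  have "\<bar>x - y\<bar> < 2 * pi" using that(1,2) by auto
  hence "\<bar>real_of_int n\<bar> < 1" unfolding n using pi_gt_zero by (simp add: abs_mult)
  hence "n = 0" by linarith
  thus ?thesis using n by simp
 qed
 have "pi : {-pi..pi} - {-pi<..<pi}" by auto
 thus "{-pi..pi} - {-pi<..<pi} ~= {}" by blast
 show "continuous_on {-pi..pi} cis" by (intro continuous_intros)
qed (use assms in \<open>auto simp: set_integrable_def distrib_right cis_mult\<close>)

lemma sum_inverse_shift: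
 assumes "x : {0..<1}" shows "(SU n. ennreal (1 / (1 + (of_int n + x)^2))) < \<infinity>"
proof -
 define g where "g n = 5 * inverse (real (Suc n) ^ 2)" for n
 have bd: "1 / (1 + (of_int n + x)^2) <= g (nat \<bar>n\<bar>)" for n :: int
 proof -
  define m where "m = real (nat \<bar>n\<bar>)"
  have "(m + 1)^2 <= 5 * (1 + (of_int n + x)^2)"
  proof (cases "0 <= n")
   case True
   hence "m = of_int n" by (simp add: m_def)
   hence "m^2 <= (of_int n + x)^2" using assms True by (intro power_mono) auto
   moreover have "0 <= (2 * m - 1/2)^2" by simp
   ultimately show ?thesis by (simp add: power2_eq_square algebra_simps)
  next
   case False
   hence m: "of_int n = - m" "1 <= m" by (auto simp: m_def)
   hence "(m - 1)^2 <= (m - x)^2" using assms by (intro power_mono) auto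
   moreover have "(m - x)^2 = (of_int n + x)^2" unfolding m(1) by (simp add: power2_eq_square algebra_simps)
   moreover have "0 <= (2 * m - 3)^2" by simp
   moreover have "5 * (1 + (m - 1)^2) = (m + 1)^2 + (2 * m - 3)^2" by (simp add: power2_eq_square algebra_simps)
   ultimately show ?thesis by (smt (verit))
  qed
  moreover have "0 < (m + 1)^2" "0 < 1 + (of_int n + x)^2" by (auto simp: m_def add_pos_nonneg)
  ultimately have "1 / (1 + (of_int n + x)^2) <= 5 / (m + 1)^2" by (simp add: divide_le_eq pos_le_divide_eq mult.commute)
  thus ?thesis by (simp add: g_def m_def add.commute divide_inverse)
 qed
 have sg: "summable g" unfolding g_def by (intro summable_mult) (use inverse_power_summable[of 2, where 'a=real] summable_Suc_iff[of "%n. inverse (real n ^ 2)"] in auto)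
 have g0: "0 <= g n" for n by (simp add: g_def)
 have half: "(SU n. ennreal (g (nat \<bar>n\<bar>)) * ind A n) <= ennreal (\<Sum>n. g n)" if "inj_on (%n. nat \<bar>n\<bar>) A" for A :: "int set"
  using nn_integral_count_inj_le[OF that, of "%n. ennreal (g n)"] sg g0 by (simp add: nn_integral_count_space_nat suminf_ennreal2)
 have "(SU n. ennreal (1 / (1 + (of_int n + x)^2))) <= (SU n. ennreal (g (nat \<bar>n\<bar>)) * ind {0..} n + ennreal (g (nat \<bar>n\<bar>)) * ind {..0} n)"
 proof (rule nn_integral_mono)
  fix n :: int
  have "ennreal (1 / (1 + (of_int n + x)^2)) <= ennreal (g (nat \<bar>n\<bar>))" by (rule ennreal_leI[OF bd])
  also have "... <= ennreal (g (nat \<bar>n\<bar>)) * ind {0..} n + ennreal (g (nat \<bar>n\<bar>)) * ind {..0} n"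
   by (cases "0 <= n") (auto simp: indicator_def)
  finally show "ennreal (1 / (1 + (of_int n + x)^2)) <= ennreal (g (nat \<bar>n\<bar>)) * ind {0..} n + ennreal (g (nat \<bar>n\<bar>)) * ind {..0} n" .
 qed
 also have "... <= ennreal (\<Sum>n. g n) + ennreal (\<Sum>n. g n)"
  by (subst nn_integral_add) (auto intro!: add_mono half simp: inj_on_def)
 also have "... < \<infinity>" by simp
 finally show ?thesis .
qed

text \<open>Modulation by \<open>cis (x * t)\<close> moves the samples at \<open>n + x\<close> to
  the integers. Then \<open>H\<close> and the absolutely convergent series have the same Fourier
  coefficients on a circle of length \<open>2 * pi\<close> and coincide by completeness.\<close>

lemma circle_series:
 fixes A :: "int => complex"
 assumes A: "(SU n. ennreal (cmod (A n))) < \<infinity>" and H [measurable]: "H : bmeas" "integrable lborel H" and supp: "!!t. t \<notin> {-pi..pi} ==> H t = 0"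
  and AH: "!!n. FT H (of_int n + x) = of_real (2 * pi) * A n"
 shows "AE t in lborel. t : {-pi<..<pi} --> H t = (LINT n|CI. A n * cis (- (of_int n + x) * t))"
proof -
 interpret C: sigma_finite_measure CI by (rule sigma_finite_measure_count_space_countable) simp
 interpret I: finite_measure "ivl (-pi) pi" by (rule finite_ivl) simp
 interpret P: pair_sigma_finite CI "ivl (-pi) pi" ..
 define S where "S t = (LINT n|CI. A n * cis (of_int (- n) * t))" for t
 have [measurable]: "S : bmeas" unfolding S_def by measurable
 have iA: "integrable CI A" using A by (intro integrableI_bounded) auto
 have Sb: "cmod (S t) <= (LINT n|CI. cmod (A n))" for t
  unfolding S_def using integral_norm_bound[of CI "%n. A n * cis (of_int (- n) * t)"] by (simp add: norm_mult)
 define f where "f t = H t * cis (x * t) - S t" for t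
 have iH: "integrable lborel (%t. ind {-pi..pi} t *\<^sub>R (H t * cis (y * t)))" for y
  by (rule bintegrable_bound[OF H(2)]) (auto simp: norm_mult indicator_def)
 have iS: "integrable (ivl (-pi) pi) S" by (rule I.integrable_const_bound[of _ "\<integral>n. cmod (A n) \<partial>CI"]) (use Sb in auto)
 have iS': "integrable lborel (%t. ind {-pi..pi} t *\<^sub>R S t)" using iS by (simp add: integrable_ivl set_integrable_def)
 have "AE t in lborel. t : {-pi<..<pi} --> f t = 0"
 proof (rule circle_unique)
  show "set_integrable lborel {-pi..pi} f" unfolding set_integrable_def f_def scaleR_diff_right by (intro bintegrable_diff iH iS')
  fix m :: int
  have iSm: "integrable lborel (%t. ind {-pi..pi} t *\<^sub>R (S t * cis (of_int m * t)))"
   by (rule bintegrable_bound[OF iS']) (auto simp: norm_mult)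
  have "(\<integral>t. S t * cis (of_int m * t) \<partial>ivl (-pi) pi) = (\<integral>t. (LINT n|CI. A n * cis (of_int (- n) * t) * cis (of_int m * t)) \<partial>ivl (-pi) pi)"
   unfolding S_def by (simp only: integral_mult_left_zero)
  also have "... = (LINT n|CI. (\<integral>t. A n * cis (of_int (- n) * t) * cis (of_int m * t) \<partial>ivl (-pi) pi))"
  proof (rule P.Fubini_integral)
   define h where "h p = A (fst p) * cis (of_int (- fst p) * snd p) * cis (of_int m * snd p)" for p
   have mm [measurable]: "h : borel_measurable (CI \<Otimes>\<^sub>M ivl (-pi) pi)" unfolding h_def
    by (rule measurable_pair_measure_countable1) auto
   have "(\<integral>\<^sup>+p. ennreal (norm (h p)) \<partial>(CI \<Otimes>\<^sub>M ivl (-pi) pi)) = (SU n. (NN (ivl (-pi) pi) (%t. ennreal (norm (h (n, t))))))"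
    by (rule I.nn_integral_fst[symmetric]) measurable
   also have "... = (SU n. ennreal (cmod (A n)) * ennreal (2 * pi))"
    by (simp add: h_def norm_mult emeasure_ivl)
   also have "... < \<infinity>" using A by (simp add: nn_integral_multc ennreal_mult_less_top)
   finally have "integrable (CI \<Otimes>\<^sub>M ivl (-pi) pi) h" by (intro integrableI_bounded mm)
   thus "integrable (CI \<Otimes>\<^sub>M ivl (-pi) pi) (%(n, t). A n * cis (of_int (- n) * t) * cis (of_int m * t))"
    by (simp only: h_def[abs_def] case_prod_beta')
  qed
  also have "... = (LINT n|CI. A n * (\<integral>t. cis (of_int m * t) * cnj (cis (of_int n * t)) \<partial>ivl (-pi) pi))"
   by (simp add: cis_cnj mult_ac)
  also have "... = (LINT n|CI. of_real (2 * pi) * A m * ind {m} n)"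
   by (intro bintegral_cong) (auto simp: cis_circle)
  also have "... = of_real (2 * pi) * A m"
   by (subst integral_mult_right_zero) (simp add: lebesgue_integral_count_space_finite_support indicator_def)
  finally have S1: "(LINT t|lborel. ind {-pi..pi} t *\<^sub>R (S t * cis (of_int m * t))) = of_real (2 * pi) * A m" by (simp add: integral_ivl)
  have H1: "(LINT t|lborel. ind {-pi..pi} t *\<^sub>R (H t * cis ((of_int m + x) * t))) = of_real (2 * pi) * A m"
  proof -
   have "(LINT t|lborel. ind {-pi..pi} t *\<^sub>R (H t * cis ((of_int m + x) * t))) = (\<integral>t. H t * cis ((of_int m + x) * t) \<partial>ivl (-pi) pi)"
    by (rule integral_ivl[symmetric]) measurable
   thus ?thesis using AH[of m] FT_ivl[OF H(1) supp, of "of_int m + x"] by simp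
  qed
  have "(LINT t|lborel. ind {-pi..pi} t *\<^sub>R f t * cis (of_int m * t)) = (LINT t|lborel. ind {-pi..pi} t *\<^sub>R (H t * cis ((of_int m + x) * t)) - ind {-pi..pi} t *\<^sub>R (S t * cis (of_int m * t)))"
   by (intro bintegral_cong) (auto simp: f_def indicator_def left_diff_distrib cis_mult mult.assoc distrib_right add.commute)
  also have "... = 0" by (subst bintegral_diff[OF iH iSm]) (simp add: H1 S1)
  finally show "(LINT t|lborel. ind {-pi..pi} t *\<^sub>R f t * cis (of_int m * t)) = 0" .
 qed
 thus ?thesis
 proof eventually_elim
  case (elim t)
  show ?case
  proof
   assume "t : {-pi<..<pi}"
   hence "H t * cis (x * t) = S t" using elim by (simp add: f_def)
   hence "H t * cis (x * t) * cis (- x * t) = (LINT n|CI. A n * cis (of_int (- n) * t) * cis (- x * t))" unfolding S_def by (simp only: integral_mult_left_zero)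
   thus "H t = (LINT n|CI. A n * cis (- (of_int n + x) * t))" by (simp add: mult.assoc cis_mult algebra_simps)
  qed
 qed
qed

lemma fcoef_time_measurable:
 assumes w: "(%(t, x). w t x) : borel_measurable (lborel :: (real \<times> real \<times> real) measure)"
 shows "w t : bmeas" "(%t. fcoef (w t) k) : bmeas"
proof -
 interpret finite_measure sqM by (rule finite_sqM)
 have wm: "(%p. w (fst p) (snd p)) : bmeas2" using w by (simp add: borel_prod case_prod_beta')
 show m: "w t : bmeas" for t using measurable_compose[OF _ wm, of "%x. (t, x)" borel] by simp
 have [measurable]: "(%p. w (fst p) (snd p)) : borel_measurable (borel \<Otimes>\<^sub>M sqM)" using wm by (simp cong: measurable_cong_sets)
 have "(%t. \<integral>x. w t x * ek (- k) x \<partial>sqM) : bmeas" by (rule borel_measurable_lebesgue_integral) (simp add: case_prod_beta')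
 thus "(%t. fcoef (w t) k) : bmeas" by (simp add: fcoef_sqM[OF m])
qed

lemma FT_stfour: "FT (%t. fcoef (w t) k * cis (freq2 k * t)) y = stfour w k (freq2 k + y)"
 by (simp add: FT_def stfour_def mult.assoc cis_mult distrib_right)

text \<open>Undoing the flow centres the modulation weight at frequency 0, where for
  \<open>b = 1\<close> it is \<open>1 + y^2\<close> for every \<open>k\<close>.\<close>

lemma Xsb_energy_FT:
 assumes w: "!!k. (%t. fcoef (w t) k) : bmeas"
 shows "Xsb_energy s 1 w = (IL y. (SZ k. ennreal (wt s k * (1 + y^2) * (cmod (FT (%t. fcoef (w t) k * cis (freq2 k * t)) y))^2)))"
proof -
 note [measurable] = w
 have [measurable]: "stfour w k : bmeas" for k unfolding stfour_def[abs_def] by measurable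
 have "Xsb_energy s 1 w = (SZ k. (IL y. ennreal (wt s k * (1 + y^2) * (cmod (stfour w k (freq2 k + y)))^2)))"
  unfolding Xsb_energy_def
 proof (rule nn_integral_cong)
  fix k
  define h where "h l = ennreal (wt s k * (1 + (l - freq2 k)^2) * (cmod (stfour w k l))^2)" for l
  have [measurable]: "h : bmeas" unfolding h_def by measurable
  have "(IL l. h l) = (IL y. h (freq2 k + y))" by (rule nn_integral_lborel_shift[symmetric]) simp
  moreover have "(1 + z^2) powr 1 = 1 + z^2" for z :: real by (simp add: add_pos_nonneg)
  ultimately show "(IL l. ennreal ((1 + freq2 k) powr s * (1 + (l - freq2 k)^2) powr 1 * (cmod (stfour w k l))^2))
   = (IL y. ennreal (wt s k * (1 + y^2) * (cmod (stfour w k (freq2 k + y)))^2))"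
   by (simp add: h_def wt_def)
 qed
 also have "... = (IL y. (SZ k. ennreal (wt s k * (1 + y^2) * (cmod (stfour w k (freq2 k + y)))^2)))"
  by (rule nn_integral_count_swap) measurable
 finally show ?thesis by (simp add: FT_stfour)
qed

text \<open>The extension is supported inside \<open>[-pi, pi]\<close>, so it is determined by
  samples of its Fourier transform. By periodization some offset \<open>x\<close> has finite sampled
  energy. The weight \<open>1 + (n + x)^2\<close> then makes the \<open>H^s\<close> norms of the
  sampled profiles summable, which is the finite mass of a superposition over the integers. Equality
  with the solution holds for almost every time.\<close>

lemma Xsb_rep:
 assumes s: "0 <= s" and T: "0 < T" "T + 1 < pi" and u: "in_Xsb_T s 1 T u"
 obtains r c where "0 < r" "rep 1 s r c" "AE t in lborel. t : {0..T} --> (\<forall>k. c t k = fcoef (u t) k)"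
proof -
 obtain w where w: "(%(t, x). w t x) : borel_measurable lborel" "set_integrable lborel (UNIV \<times> unit_sq) (%(t, x). (cmod (w t x))^2)"
  "!!t. t \<notin> {-1..T+1} ==> w t = (%x. 0)" "!!t. t : {0..T} ==> w t = u t" "Xsb_energy s 1 w < \<infinity>"
  using u unfolding in_Xsb_T_def by blast
 note wm = fcoef_time_measurable[OF w(1)]
 note [measurable] = wm(2)
 define H where "H k t = fcoef (w t) k * cis (freq2 k * t)" for k t
 have Hm [measurable]: "H k : bmeas" for k unfolding H_def by measurable
 have supp: "H k t = 0" if "t \<notin> {-pi..pi}" for k t
 proof -
  have "t \<notin> {-1..T+1}" using that T pi_gt3 by auto
  thus ?thesis using w(3) by (simp add: H_def fcoef_def)
 qed
 have HL2: "(IL t. sqn (H k t)) < \<infinity>" for k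
 proof -
  have mm: "(%p. sqn (w (fst p) (snd p)) * ind unit_sq (snd p)) : borel_measurable (lborel \<Otimes>\<^sub>M lborel)"
  proof -
   have [measurable]: "(%p. w (fst p) (snd p)) : borel_measurable (lborel \<Otimes>\<^sub>M lborel)" using w(1) by (simp add: lborel_prod case_prod_beta')
   show ?thesis by measurable
  qed
  have "(IL t. sqn (H k t)) <= (IL t. (IL x. sqn (w t x) * ind unit_sq x))"
  proof (rule nn_integral_mono)
   fix t
   show "sqn (H k t) <= (IL x. sqn (w t x) * ind unit_sq x)"
    using fcoef_bound[OF wm(1), of t k] wm(1)[of t] by (simp add: H_def norm_mult nn_integral_sqM)
  qed
  also have "... = (\<integral>\<^sup>+p. sqn (w (fst p) (snd p)) * ind unit_sq (snd p) \<partial>(lborel \<Otimes>\<^sub>M lborel))"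
   using lborel.nn_integral_fst[OF mm] by simp
  also have "... = (IL p. ennreal (norm (ind (UNIV \<times> unit_sq) p *\<^sub>R (cmod (w (fst p) (snd p)))^2)))"
   unfolding lborel_prod by (intro nn_integral_cong) (auto simp: indicator_def)
  also have "... < \<infinity>" using w(2) unfolding set_integrable_def integrable_iff_bounded by (simp add: case_prod_beta')
  finally show ?thesis .
 qed
 have Hi: "integrable lborel (H k)" for k
 proof -
  have "(NN (ivl (-pi) pi) (%t. sqn (H k t))) <= (IL t. sqn (H k t))"
   by (subst nn_integral_ivl) (auto simp: indicator_def intro!: nn_integral_mono)
  hence "integrable (ivl (-pi) pi) (H k)" using HL2[of k] by (intro integrable_of_L2(1) finite_ivl) (auto intro: le_less_trans)
  hence "integrable lborel (%t. ind {-pi..pi} t *\<^sub>R H k t)" by (simp add: integrable_ivl set_integrable_def)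
  moreover have "(%t. ind {-pi..pi} t *\<^sub>R H k t) = H k"
  proof
   fix t show "ind {-pi..pi} t *\<^sub>R H k t = H k t" by (cases "t : {-pi..pi}") (simp_all add: supp)
  qed
  ultimately show ?thesis by simp
 qed
 define E where "E y = (SZ k. ennreal (wt s k * (1 + y^2) * (cmod (FT (H k) y))^2))" for y
 have [measurable]: "E : bmeas" unfolding E_def by measurable
 have "(IL y. E y) < \<infinity>" using w(5) unfolding E_def H_def[abs_def] by (subst (asm) Xsb_energy_FT) auto
 hence per: "(IL x. (SU n. E (of_int n + x)) * ind {0..<1} x) < \<infinity>" using periodization[of E] by simp
 have "\<exists>x\<in>{0..<1}. (SU n. E (of_int n + x)) < \<infinity>"
 proof (rule ccontr)
  assume "\<not> (\<exists>x\<in>{0..<1}. (SU n. E (of_int n + x)) < \<infinity>)"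
  hence "(IL x. (SU n. E (of_int n + x)) * ind {0..<1} x) = (IL x. \<infinity> * ind {0..<1::real} x)"
   by (intro nn_integral_cong) (auto simp: indicator_def not_less top_unique)
  also have "... = \<infinity>" by (subst nn_integral_cmult) (auto simp: ennreal_top_mult)
  finally show False using per by simp
 qed
 then obtain x where x: "x : {0..<1}" and xE: "(SU n. E (of_int n + x)) < \<infinity>" by blast
 define A where "A n k = FT (H k) (of_int n + x) / of_real (2 * pi)" for n :: int and k
 define W where "W n = 1 + (of_int n + x)^2" for n :: int
 have W: "1 <= W n" for n by (simp add: W_def)
 have WE: "ennreal (W n) * En s (A n) <= E (of_int n + x)" for n
 proof -
  have "ennreal (W n) * En s (A n) = (SZ k. ennreal (W n) * ennreal (wt s k * (cmod (A n k))^2))"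
   unfolding En_def by (rule nn_integral_cmult[symmetric]) simp
  also have "... <= E (of_int n + x)" unfolding E_def
  proof (rule nn_integral_mono)
   fix k
   have "1 <= 2 * pi" using pi_gt3 by simp
   hence "cmod (FT (H k) (of_int n + x)) / (2 * pi) <= cmod (FT (H k) (of_int n + x)) / 1" by (intro divide_left_mono) auto
   hence "cmod (A n k) <= cmod (FT (H k) (of_int n + x))" by (simp add: A_def norm_divide)
   hence "W n * (wt s k * (cmod (A n k))^2) <= W n * (wt s k * (cmod (FT (H k) (of_int n + x)))^2)"
    using W[of n] by (intro mult_left_mono power_mono) (auto simp: wt_def)
   hence "ennreal (W n * (wt s k * (cmod (A n k))^2)) <= ennreal (wt s k * (1 + (of_int n + x)^2) * (cmod (FT (H k) (of_int n + x)))^2)"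
    by (intro ennreal_leI) (simp add: W_def mult_ac)
   thus "ennreal (W n) * ennreal (wt s k * (cmod (A n k))^2) <= ennreal (wt s k * (1 + (of_int n + x)^2) * (cmod (FT (H k) (of_int n + x)))^2)"
    using W[of n] by (subst ennreal_mult[symmetric]) (auto simp: wt_def)
  qed
  finally show ?thesis .
 qed
 have sumWE: "(SU n. ennreal (W n) * En s (A n)) < \<infinity>"
  by (rule le_less_trans[OF nn_integral_mono xE]) (rule WE)
 have eF: "En s (A n) < \<infinity>" for n
 proof -
  have "ennreal (W n) * En s (A n) <= (SU n. ennreal (W n) * En s (A n))" by (rule nn_integral_ge_point) simp
  hence "ennreal (W n) * En s (A n) < \<infinity>" using sumWE by (rule le_less_trans)
  moreover have "1 * En s (A n) <= ennreal (W n) * En s (A n)" using W[of n] by (intro mult_right_mono) (auto simp: one_ennreal.rep_eq ennreal_1[symmetric] simp del: ennreal_1 intro: ennreal_leI)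
  ultimately show ?thesis by (simp add: le_less_trans)
 qed
 define e where "e n = enn2real (En s (A n))" for n
 have e: "En s (A n) = ennreal (e n)" "0 <= e n" for n using eF[of n] by (simp_all add: e_def less_top)
 have sum: "(SU n. ennreal (sqrt (e n))) < \<infinity>"
 proof -
  have "(SU n. ennreal (sqrt (e n))) <= (SU n. ennreal (W n) * En s (A n) + ennreal (1 / W n))"
  proof (rule nn_integral_mono)
   fix n
   \<comment> \<open>The inequality of the means trades the root against the weighted energy and the
     summable \<open>1 / W n\<close>.\<close>
   have "0 <= (sqrt (W n) * sqrt (e n) - 1 / sqrt (W n))^2" by simp
   also have "... = W n * e n + 1 / W n - 2 * sqrt (e n)" using W[of n] e(2)[of n] by (simp add: power2_diff power_mult_distrib power_divide)
   finally have "sqrt (e n) <= W n * e n + 1 / W n" using e(2)[of n] real_sqrt_ge_zero[of "e n"] by linarith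
   hence "ennreal (sqrt (e n)) <= ennreal (W n * e n + 1 / W n)" by (rule ennreal_leI)
   also have "... = ennreal (W n) * En s (A n) + ennreal (1 / W n)" using W[of n] e[of n] by (simp add: ennreal_mult)
   finally show "ennreal (sqrt (e n)) <= ennreal (W n) * En s (A n) + ennreal (1 / W n)" .
  qed
  also have "... = (SU n. ennreal (W n) * En s (A n)) + (SU n. ennreal (1 / W n))" by (rule nn_integral_add) auto
  also have "... < \<infinity>" using sumWE sum_inverse_shift[OF x] by (simp add: W_def)
  finally show ?thesis .
 qed
 define r where "r = enn2real (SU n. ennreal (sqrt (e n))) + 1"
 define c where "c t k = cis (- 1 * freq2 k * t) * (LINT n|CI. A n k * cis (- (of_int n + x) * t))" for t k
 have rep: "rep 1 s r c"
 \<comment> \<open>Superpositions are indexed by reals; the integers enter as the image of counting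
   measure, and the floor recovers the index.\<close>
 proof (rule rep_intro[where N="distr CI borel of_int" and ro="%ta. sqrt (e \<lfloor>ta\<rfloor>)" and ph="%ta k. A \<lfloor>ta\<rfloor> k" and ze="%t ta. cis (- (ta + x) * t)"])
  have fl [measurable]: "(%ta::real. sqrt (e \<lfloor>ta\<rfloor>)) : bmeas"
   by (rule measurable_compose[OF measurable_real_floor, of "%n. sqrt (e n)"]) simp
  have flA [measurable]: "(%ta::real. A \<lfloor>ta\<rfloor> k) : bmeas" for k
   by (rule measurable_compose[OF measurable_real_floor, of "%n. A n k"]) simp
  show "(%ta::real. sqrt (e \<lfloor>ta\<rfloor>)) : bmeas" "(%ta::real. A \<lfloor>ta\<rfloor> k) : bmeas" for k using fl flA by blast+
  show "(\<integral>\<^sup>+ta. ennreal (sqrt (e \<lfloor>ta\<rfloor>)) \<partial>distr CI borel real_of_int) <= ennreal r"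
  proof -
   have "(\<integral>\<^sup>+ta. ennreal (sqrt (e \<lfloor>ta\<rfloor>)) \<partial>distr CI borel real_of_int) = (SU n. ennreal (sqrt (e n)))"
    using measurable_compose[OF fl measurable_ennreal] by (subst nn_integral_distr) simp_all
   also have "... <= ennreal r" using sum by (cases "\<integral>\<^sup>+n. ennreal (sqrt (e n)) \<partial>CI") (auto simp: r_def ennreal_leI)
   finally show ?thesis .
  qed
  show "c t k = cis (- 1 * freq2 k * t) * (\<integral>ta. cis (- (ta + x) * t) * A \<lfloor>ta\<rfloor> k \<partial>distr CI borel of_int)" for t k
  proof -
   have "(\<integral>ta. cis (- (ta + x) * t) * A \<lfloor>ta\<rfloor> k \<partial>distr CI borel of_int) = (LINT n|CI. cis (- (of_int n + x) * t) * A n k)" by (subst integral_distr) auto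
   thus ?thesis by (simp add: c_def mult.commute)
  qed
  show "En s (%k. A \<lfloor>ta\<rfloor> k) <= ennreal ((sqrt (e \<lfloor>ta\<rfloor>))^2)" for ta using e[of "\<lfloor>ta\<rfloor>"] by simp
  show "(%p. cis (- (snd p + x) * fst p)) : bmeas2" by measurable
 qed (use s e in auto)
 have AEk: "AE t in lborel. t : {-pi<..<pi} --> H k t = (LINT n|CI. A n k * cis (- (of_int n + x) * t))" for k
 proof (rule circle_series[OF _ Hm Hi supp])
  have "cmod (A n k) <= sqrt (e n)" for n by (rule En_le_cmod[OF s]) (use e in auto)
  hence "(SU n. ennreal (cmod (A n k))) <= (SU n. ennreal (sqrt (e n)))" by (intro nn_integral_mono ennreal_leI) simp
  thus "(SU n. ennreal (cmod (A n k))) < \<infinity>" using sum by (rule le_less_trans)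
  show "FT (H k) (of_int n + x) = of_real (2 * pi) * A n k" for n by (simp add: A_def)
 qed
 have "AE t in lborel. \<forall>k. t : {-pi<..<pi} --> H k t = (LINT n|CI. A n k * cis (- (of_int n + x) * t))"
  by (subst AE_all_countable) (use AEk in blast)
 hence "AE t in lborel. t : {0..T} --> (\<forall>k. c t k = fcoef (u t) k)"
 proof eventually_elim
  case (elim t)
  show ?case
  proof (intro impI allI)
   fix k assume t: "t : {0..T}"
   hence "t : {-pi<..<pi}" using T by auto
   hence "c t k = cis (- 1 * freq2 k * t) * H k t" using elim[THEN spec, of k] by (simp only: c_def)
   also have "... = fcoef (w t) k" by (simp add: H_def cis_mult mult.left_commute[of "cis _" "fcoef _ _"])
   finally show "c t k = fcoef (u t) k" using w(4)[OF t] by simp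
  qed
 qed
 moreover have "0 < r" by (simp add: r_def add_nonneg_pos)
 ultimately show ?thesis using that rep by blast
qed

text \<open>A compactly supported profile of zero mean has a compactly supported antiderivative. As
  \<open>py\<close> is merely integrable, Fubini's theorem takes the place of integration by
  parts.\<close>

lemma FT_antiderivative:
 fixes py :: "real => complex"
 assumes p: "p <= q" and py: "integrable lborel py" and supp: "!!t. t \<notin> {p..q} ==> py t = 0" and zero: "(LINT t|lborel. py t) = 0"
 defines "G \<equiv> %t. \<integral>ta. (if ta <= t then py ta else 0) \<partial>lborel"
 shows "t \<notin> {p..q} ==> G t = 0" "of_real y * FT G y = \<i> * FT py y"
proof -
 have [measurable]: "py : bmeas" using py by auto
 have [measurable]: "G : bmeas" unfolding G_def by measurable
 show G0: "G t = 0" if "t \<notin> {p..q}" for t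
 proof (cases "t < p")
  case True
  hence "(%ta. if ta <= t then py ta else 0) = (%ta. 0)" using supp by (auto simp: fun_eq_iff)
  thus ?thesis by (simp add: G_def)
 next
  case False
  hence "(%ta. if ta <= t then py ta else 0) = py" using supp that by (auto simp: fun_eq_iff)
  thus ?thesis using zero by (simp add: G_def)
 qed
 show "of_real y * FT G y = \<i> * FT py y"
 proof (cases "y = 0")
  case True thus ?thesis using zero by (simp add: FT_def)
 next
  case y: False
  define h where "h ta t = (if ta <= t & t : {p..q} then py ta * cis (y * t) else 0)" for ta t
  have hm [measurable]: "(%z. h (fst z) (snd z)) : borel_measurable (lborel \<Otimes>\<^sub>M lborel)" unfolding h_def by measurable
  have "(\<integral>\<^sup>+z. ennreal (norm (h (fst z) (snd z))) \<partial>(lborel \<Otimes>\<^sub>M lborel)) = (IL ta. (IL t. ennreal (norm (h ta t))))"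
   by (subst lborel.nn_integral_fst[symmetric]) auto
  also have "... <= (IL ta. (IL t. ennreal (norm (py ta)) * ind {p..q} t))"
   by (intro nn_integral_mono) (auto simp: h_def norm_mult)
  also have "... = (IL ta. ennreal (norm (py ta))) * ennreal (q - p)" using p by (simp add: nn_integral_cmult nn_integral_multc)
  also have "... < \<infinity>" using py by (simp add: integrable_iff_bounded ennreal_mult_less_top)
  finally have hi: "integrable (lborel \<Otimes>\<^sub>M lborel) (%(ta, t). h ta t)" by (intro integrableI_bounded) (auto simp: case_prod_beta')
  have "FT G y = (LINT t|lborel. (LINT ta|lborel. h ta t))" unfolding FT_def
  proof (rule bintegral_cong[OF refl])
   fix t
   show "G t * cis (y * t) = (LINT ta|lborel. h ta t)"
   proof (cases "t : {p..q}")
    case True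
    hence "(LINT ta|lborel. h ta t) = (LINT ta|lborel. (if ta <= t then py ta else 0) * cis (y * t))" by (intro bintegral_cong) (auto simp: h_def)
    thus ?thesis by (simp add: G_def)
   next
    case False hence "h ta t = 0" for ta by (auto simp: h_def)
    thus ?thesis using G0[OF False] by simp
   qed
  qed
  also have "... = (LINT ta|lborel. (LINT t|lborel. h ta t))" by (rule lborel_pair.Fubini_integral[OF hi])
  also have "... = (LINT ta|lborel. py ta * (cis (y * q) / (\<i> * of_real y)) - py ta * cis (y * ta) / (\<i> * of_real y))"
  proof (rule bintegral_cong[OF refl])
   fix ta
   show "(LINT t|lborel. h ta t) = py ta * (cis (y * q) / (\<i> * of_real y)) - py ta * cis (y * ta) / (\<i> * of_real y)"
   proof (cases "ta : {p..q}")
    case True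
    hence "(LINT t|lborel. h ta t) = (LINT t|lborel. py ta * (ind {ta..q} t *\<^sub>R cis (y * t)))"
     by (intro bintegral_cong) (auto simp: h_def indicator_def)
    also have "... = py ta * ((cis (y * q) - cis (y * ta)) / (\<i> * of_real y))"
     using integral_cis_linear[of ta q y] True y by (simp only: integral_mult_right_zero) simp
    finally show ?thesis by (simp add: diff_divide_distrib right_diff_distrib)
   next
    case False
    hence "h ta t = 0" for t using supp[OF False] by (simp add: h_def)
    thus ?thesis using supp[OF False] by simp
   qed
  qed
  also have "... = (LINT ta|lborel. py ta * (cis (y * q) / (\<i> * of_real y))) - (LINT ta|lborel. py ta * cis (y * ta) / (\<i> * of_real y))"
  proof (rule bintegral_diff)
   show "integrable lborel (%ta. py ta * (cis (y * q) / (\<i> * of_real y)))" using py by simp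
   have "integrable lborel (%ta. py ta * cis (y * ta))" by (rule bintegrable_bound[OF py]) (auto simp: norm_mult)
   thus "integrable lborel (%ta. py ta * cis (y * ta) / (\<i> * of_real y))" by simp
  qed
  also have "... = - FT py y / (\<i> * of_real y)" by (simp only: integral_mult_left_zero zero integral_divide_zero) (simp add: FT_def)
  finally have "FT G y = - FT py y / (\<i> * of_real y)" .
  hence "of_real y * FT G y = - FT py y / \<i>" using y by simp
  thus ?thesis by (simp add: divide_i)
 qed
qed

text \<open>An explicit extension: with the flow undone, the solution is continued by linear ramps,
  from 0 up to the datum before time 0 and from its value at \<open>T\<close> down to 0 after
  \<open>T\<close>, each of length 1. Its time derivative \<open>py\<close> has zero mean and lies
  in \<open>L^2 H^s\<close>, which makes the energy with \<open>b = 1\<close> finite.\<close>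

lemma Dh_in_Xsb:
 assumes s: "0 < s" and T: "0 < T" "T + 1 < pi" and c: "!!t k. c t k = Dh 1 0 T a f t k" and cT: "En s (c T) < \<infinity>" and a: "En s a < \<infinity>"
  and fm [measurable]: "!!k. (%ta. f ta k) : bmeas" and fL2: "(NN (ivl 0 T) (%ta. En s (f ta))) < \<infinity>"
 shows "in_Xsb_T s 1 T (%t. syn (c t))"
proof -
 define b where "b k = cis (freq2 k * T) * c T k" for k
 define py where "py k ta = ind {-1..<0} ta *\<^sub>R a k + ind {0..T} ta *\<^sub>R f ta k - ind {T<..T+1} ta *\<^sub>R b k" for k and ta :: real
 have pym [measurable]: "py k : bmeas" for k unfolding py_def by measurable
 have supp: "py k t = 0" if "t \<notin> {-1..T+1}" for k t using that T by (auto simp: py_def indicator_def)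
 have fi: "integrable lborel (%ta. ind {0..T} ta *\<^sub>R f ta k)" for k
 proof -
  have "(NN (ivl 0 T) (%ta. sqn (f ta k))) <= (NN (ivl 0 T) (%ta. En s (f ta)))"
   by (intro nn_integral_mono order_trans[OF _ En_mono[of 0 s]]) (use En_point[of 0 k] s in auto)
  hence "integrable (ivl 0 T) (%ta. f ta k)" using fL2 T by (intro integrable_of_L2(1) finite_ivl) (auto intro: le_less_trans)
  thus ?thesis by (simp add: integrable_ivl set_integrable_def)
 qed
 have ii: "integrable lborel (%ta. ind {-1..<0::real} ta *\<^sub>R a k)" "integrable lborel (%ta. ind {T<..T+1} ta *\<^sub>R b k)" for k
  by (intro integrable_real_indicator integrable_scaleR_left; simp)+
 have pyi: "integrable lborel (py k)" for k unfolding py_def by (intro bintegrable_diff bintegrable_add ii fi)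
 define g where "g k t = a k + (LINT ta|lborel. ind {0..t} ta *\<^sub>R f ta k)" for k t
 have cg: "c t k = cis (- freq2 k * t) * g k t" if "t : {0..T}" for t k using that by (simp add: c Dh_def g_def)
 have bg: "b k = g k T" for k using cg[of T k] T by (simp add: b_def mult.assoc[symmetric] cis_mult)
 have py0: "(LINT ta|lborel. py k ta) = 0" for k
  unfolding py_def using ii fi by (simp add: bintegral_diff bintegral_add bg g_def)
 define G where "G k t = (LINT ta|lborel. (if ta <= t then py k ta else 0))" for k t
 have Gm [measurable]: "G k : bmeas" for k unfolding G_def by measurable
 have p: "-1 <= T + 1" using T by simp
 have G': "G k = (%t. \<integral>ta. (if ta <= t then py k ta else 0) \<partial>lborel)" for k by (simp add: G_def fun_eq_iff)
 have FTG1: "G k t = 0" if "t \<notin> {-1..T+1}" for t k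
  unfolding G' by (rule FT_antiderivative(1)[OF p pyi]; fact supp py0 that)
 have FTG2: "of_real y * FT (G k) y = \<i> * FT (py k) y" for k y
  unfolding G' by (rule FT_antiderivative(2)[OF p pyi]; fact supp py0)
 have Gg: "G k t = g k t" if t: "t : {0..T}" for k t
 proof -
  have "integrable lborel (%ta. ind {0..t} ta *\<^sub>R f ta k)"
   by (rule bintegrable_bound[OF fi[of k]]) (use t in \<open>auto simp: indicator_def\<close>)
  moreover have "G k t = (LINT ta|lborel. ind {-1..<0} ta *\<^sub>R a k + ind {0..t} ta *\<^sub>R f ta k)"
   unfolding G_def by (intro bintegral_cong) (use t in \<open>auto simp: py_def indicator_def\<close>)
  ultimately show ?thesis using ii(1)[of k] by (simp add: g_def bintegral_add)
 qed
 define J where "J = (IL ta. En s (%k. py k ta))"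
 have Jf: "J < \<infinity>"
 proof -
  have "J <= (IL ta. (En s a * ind {-1..<0} ta + En s (f ta) * ind {0..T} ta) + En s b * ind {T<..T+1} ta)"
   unfolding J_def
  proof (rule nn_integral_mono)
   fix ta
   have "En s (%k. 0) = 0" "En s (%k. - b k) = En s b" by (simp_all add: En_def)
   moreover have "ta : {-1..<0} \<or> ta : {0..T} \<or> ta : {T<..T+1} \<or> ta \<notin> {-1..T+1}" by auto
   ultimately show "En s (%k. py k ta) <= (En s a * ind {-1..<0} ta + En s (f ta) * ind {0..T} ta) + En s b * ind {T<..T+1} ta"
    using T by (auto simp: py_def indicator_def)
  qed
  also have "... = En s a + (NN (ivl 0 T) (%ta. En s (f ta))) + En s b"
   by (subst nn_integral_add, simp, simp, subst nn_integral_add) (auto simp: nn_integral_cmult nn_integral_ivl)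
  also have "En s b = En s (c T)" by (simp add: En_def b_def norm_mult)
  finally show ?thesis using a fL2 cT by (simp add: le_less_trans)
 qed
 have GJ: "En s (%k. G k t) <= ennreal (T + 2) * J" for t
 proof -
  have "sqn (G k t) <= ennreal (T + 2) * (IL ta. sqn (py k ta))" for k
  proof -
   have "ennreal (cmod (G k t)) <= (IL ta. ennreal (norm (if ta <= t then py k ta else 0)))" unfolding G_def by (rule nn_norm_integral_le)
   also have "... <= (NN (ivl (-1) (T+1)) (%ta. ennreal (cmod (py k ta))))"
    by (subst nn_integral_ivl) (auto simp: indicator_def supp intro!: nn_integral_mono)
   finally have "(ennreal (cmod (G k t)))^2 <= (NN (ivl (-1) (T+1)) (%ta. ennreal (cmod (py k ta))))^2" by (intro power_mono) auto
   also have "... <= ennreal (T + 2) * (NN (ivl (-1) (T+1)) (%ta. (ennreal (cmod (py k ta)))^2))"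
    using nn_jensen[of "%ta. ennreal (cmod (py k ta))" "ivl (-1) (T+1)"] T by (simp add: emeasure_ivl add.commute)
   also have "(NN (ivl (-1) (T+1)) (%ta. (ennreal (cmod (py k ta)))^2)) <= (IL ta. sqn (py k ta))"
    by (subst nn_integral_ivl) (auto simp: indicator_def ennreal_power intro!: nn_integral_mono)
   finally show ?thesis by (simp add: ennreal_power mult_left_mono)
  qed
  hence "En s (%k. G k t) <= (SZ k. ennreal (wt s k) * (ennreal (T + 2) * (IL ta. sqn (py k ta))))"
   unfolding En_def by (intro nn_integral_mono) (simp add: ennreal_mult mult_left_mono wt_def)
  also have "... = ennreal (T + 2) * (SZ k. (IL ta. ennreal (wt s k * (cmod (py k ta))^2)))"
   by (subst nn_integral_cmult[symmetric], simp, intro nn_integral_cong) (simp add: ennreal_mult nn_integral_cmult wt_def mult.left_commute)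
  also have "(SZ k. (IL ta. ennreal (wt s k * (cmod (py k ta))^2))) = J"
   unfolding J_def En_def by (rule nn_integral_count_swap) measurable
  finally show ?thesis .
 qed
 have TJ: "ennreal (T + 2) * J < \<infinity>" using Jf by (simp add: ennreal_mult_less_top)
 define d where "d t k = cis (- freq2 k * t) * G k t" for t k
 have dm [measurable]: "(%t. d t k) : bmeas" for k unfolding d_def by measurable
 have dE: "En s (d t) <= ennreal (T + 2) * J" for t using GJ[of t] by (simp add: En_def d_def norm_mult)
 have dF: "En s (d t) < \<infinity>" for t using dE TJ by (rule le_less_trans)
 define w where "w t = syn (d t)" for t
 have d0: "d t = (%k. 0)" if "t \<notin> {-1..T+1}" for t using FTG1[OF that] by (auto simp: d_def)
 have w0: "w t = (%x. 0)" if "t \<notin> {-1..T+1}" for t unfolding w_def d0[OF that] by (simp add: syn_def Pj_def fun_eq_iff)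
 have fw: "fcoef (w t) k = d t k" for t k unfolding w_def by (rule fcoef_syn[OF s dF])
 show ?thesis unfolding in_Xsb_T_def
 proof (intro exI[of _ w] conjI allI ballI impI)
  have wm [measurable]: "(%p. w (fst p) (snd p)) : borel_measurable (lborel \<Otimes>\<^sub>M lborel)" unfolding w_def by measurable
  thus "(%(t, x). w t x) : borel_measurable lborel" by (simp add: lborel_prod case_prod_beta')
  show "set_integrable lborel (UNIV \<times> unit_sq) (%(t, x). (cmod (w t x))^2)"
  proof -
   define C where "C = (1 / (1 - 4 powr (-s/2)))^2"
   have "(IL p. ennreal (norm (ind (UNIV \<times> unit_sq) p *\<^sub>R (cmod (w (fst p) (snd p)))^2))) = (\<integral>\<^sup>+p. sqn (w (fst p) (snd p)) * ind unit_sq (snd p) \<partial>(lborel \<Otimes>\<^sub>M lborel))"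
    unfolding lborel_prod by (intro nn_integral_cong) (auto simp: indicator_def)
   also have "... = (IL t. (IL x. sqn (w t x) * ind unit_sq x))"
    by (subst lborel.nn_integral_fst[symmetric]) auto
   also have "... <= (IL t. (ennreal C * (ennreal (T + 2) * J)) * ind {-1..T+1} t)"
   proof (rule nn_integral_mono)
    fix t
    have "(IL x. sqn (w t x) * ind unit_sq x) = (IQ x. sqn (syn (d t) x))"
     by (simp add: nn_integral_sqM w_def)
    also have "... <= ennreal C * En s (d t)" using syn_AE_L2(2)[OF s dF, of t 0] by (simp add: C_def)
    also have "... <= ennreal C * (ennreal (T + 2) * J)" by (intro mult_left_mono dE) simp
    finally have "(IL x. sqn (w t x) * ind unit_sq x) <= ennreal C * (ennreal (T + 2) * J)" .
    thus "(IL x. sqn (w t x) * ind unit_sq x) <= (ennreal C * (ennreal (T + 2) * J)) * ind {-1..T+1} t"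
     using w0[of t] by (cases "t : {-1..T+1}") auto
   qed
   also have "... < \<infinity>" using TJ T by (simp add: nn_integral_cmult ennreal_mult_less_top)
   finally have fin: "(IL p. ennreal (norm (ind (UNIV \<times> unit_sq) p *\<^sub>R (cmod (w (fst p) (snd p)))^2))) < \<infinity>" .
   have "(%p. ind (UNIV \<times> unit_sq) p *\<^sub>R (cmod (w (fst p) (snd p)))^2) : borel_measurable (lborel \<Otimes>\<^sub>M lborel)" by measurable
   thus ?thesis unfolding set_integrable_def using fin by (intro integrableI_bounded) (auto simp: lborel_prod case_prod_beta')
  qed
  show "w t = (%x. 0)" if "t \<notin> {-1..T+1}" for t by (rule w0[OF that])
  show "w t = syn (c t)" if "t : {0..T}" for t
  proof -
   have "d t = c t" using cg[OF that] Gg[OF that] by (auto simp: d_def)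
   thus ?thesis by (simp add: w_def)
  qed
  have H: "(%t. fcoef (w t) k * cis (freq2 k * t)) = G k" for k by (auto simp: fw d_def cis_mult fun_eq_iff mult.left_commute[of "cis _" "G _ _"] mult.assoc mult.commute[of "G _ _"])
  have pi': "py k t = 0" "G k t = 0" if "t \<notin> {-pi..pi}" for k t
  proof -
   have "t \<notin> {-1..T+1}" using that T pi_gt3 by auto
   thus "py k t = 0" "G k t = 0" using supp FTG1 by auto
  qed
  have "Xsb_energy s 1 w = (IL y. (SZ k. ennreal (wt s k * (1 + y^2) * (cmod (FT (G k) y))^2)))"
   using Xsb_energy_FT[of w s] by (simp only: H) (simp add: fw)
  \<comment> \<open>The factor \<open>y^2\<close> turns the transform of \<open>G\<close> into that
    of its derivative \<open>py\<close>.\<close>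
  also have "... = (IL y. (SZ k. ennreal (wt s k) * (sqn (FT (G k) y) + sqn (FT (py k) y))))"
  proof (intro nn_integral_cong)
   fix y k
   have "y^2 * (cmod (FT (G k) y))^2 = (cmod (of_real y * FT (G k) y))^2" by (simp add: norm_mult power_mult_distrib)
   also have "... = (cmod (FT (py k) y))^2" by (simp add: FTG2 norm_mult)
   finally have "wt s k * (1 + y^2) * (cmod (FT (G k) y))^2 = wt s k * ((cmod (FT (G k) y))^2 + (cmod (FT (py k) y))^2)" by (simp add: distrib_right mult.assoc)
   thus "ennreal (wt s k * (1 + y^2) * (cmod (FT (G k) y))^2) = ennreal (wt s k) * (sqn (FT (G k) y) + sqn (FT (py k) y))"
    by (simp only:) (subst ennreal_mult; simp add: wt_def)
  qed
  also have "... = (SZ k. (IL y. ennreal (wt s k) * (sqn (FT (G k) y) + sqn (FT (py k) y))))"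
   by (rule nn_integral_count_swap[symmetric]) measurable
  also have "... = (SZ k. ennreal (wt s k) * ((IL y. sqn (FT (G k) y)) + (IL y. sqn (FT (py k) y))))"
   by (simp add: nn_integral_cmult nn_integral_add)
  also have "... <= (SZ k. ennreal (wt s k) * (ennreal (2 * pi) * (IL t. sqn (G k t)) + ennreal (2 * pi) * (IL t. sqn (py k t))))"
   by (intro nn_integral_mono mult_left_mono add_mono FT_L2_bound Gm pym pi') auto
  also have "... = (SZ k. ennreal (2 * pi) * ((IL t. ennreal (wt s k * (cmod (G k t))^2)) + (IL t. ennreal (wt s k * (cmod (py k t))^2))))"
   by (intro nn_integral_cong) (simp add: ennreal_mult nn_integral_cmult wt_def distrib_left mult.left_commute)
  also have "... = ennreal (2 * pi) * ((SZ k. (IL t. ennreal (wt s k * (cmod (G k t))^2))) + (SZ k. (IL t. ennreal (wt s k * (cmod (py k t))^2))))"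
   by (simp add: nn_integral_cmult nn_integral_add)
  also have "... = ennreal (2 * pi) * ((IL t. En s (%k. G k t)) + J)"
   unfolding J_def En_def by (subst (1 2) nn_integral_count_swap) auto
  also have "... < \<infinity>"
  proof -
   have "(IL t. En s (%k. G k t)) <= (IL t. (ennreal (T + 2) * J) * ind {-1..T+1} t)"
   proof (rule nn_integral_mono)
    fix t
    show "En s (%k. G k t) <= (ennreal (T + 2) * J) * ind {-1..T+1} t"
     using GJ[of t] FTG1[of t] by (cases "t : {-1..T+1}") (simp_all add: En_def)
   qed
   also have "... < \<infinity>" using TJ T by (simp add: nn_integral_cmult ennreal_mult_less_top)
   finally show ?thesis using Jf by (simp add: ennreal_mult_less_top)
  qed
  finally show "Xsb_energy s 1 w < \<infinity>" .
 qed
qed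

section \<open>Local well-posedness\<close>

lemma fcoef_cnj:
 assumes [measurable]: "f : bmeas" shows "fcoef (%x. cnj (f x)) k = cnj (fcoef f (- k))"
proof -
 have "fcoef (%x. cnj (f x)) k = (LINT x|sqM. cnj (f x * ek k x))" by (simp add: fcoef_sqM cnj_ek)
 also have "... = cnj (fcoef f (- k))" unfolding fcoef_sqM[OF assms] by (simp only: Bochner_Integration.integral_cnj minus_minus)
 finally show ?thesis .
qed

text \<open>\<open>v\<close> has to be real-valued, while the fixed point provides coefficients.
  Hermitian symmetry gives the real part the same coefficients, whether or not \<open>f\<close> is
  real at every point.\<close>

lemma fcoef_Re:
 assumes "L2 f" "!!k. fcoef f (- k) = cnj (fcoef f k)"
 shows "L2 (cplx (%x. Re (f x)))" "fcoef (cplx (%x. Re (f x))) k = fcoef f k"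
proof -
 have fm [measurable]: "f : bmeas" using assms(1) by (simp add: L2_def)
 have "(IQ x. sqn (cplx (%x. Re (f x)) x)) <= (IQ x. sqn (f x))"
  by (intro nn_integral_mono ennreal_leI) (simp add: cplx_def abs_le_square_iff[symmetric] abs_Re_le_cmod)
 thus "L2 (cplx (%x. Re (f x)))" using assms(1) unfolding L2_def by (auto simp: cplx_def intro: le_less_trans)
 have i: "integrable sqM (%x. f x * ek (- k) x)" "integrable sqM (%x. cnj (f x) * ek (- k) x)"
  by (rule bintegrable_bound[OF L2_integrable(1)[OF assms(1)]]; auto simp: norm_mult)+
 have m: "cplx (%x. Re (f x)) : bmeas" unfolding cplx_def by measurable
 have re: "complex_of_real (Re z) * w = (1/2) * (z * w + cnj z * w)" for z w by (simp add: distrib_right[symmetric] complex_add_cnj)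
 have "fcoef (cplx (%x. Re (f x))) k = (LINT x|sqM. (1/2) * (f x * ek (- k) x + cnj (f x) * ek (- k) x))"
  unfolding fcoef_sqM[OF m] by (simp only: cplx_def re)
 also have "... = (1/2) * (fcoef f k + fcoef (%x. cnj (f x)) k)"
  using i by (simp only: integral_mult_right_zero bintegral_add) (simp add: fcoef_sqM)
 finally show "fcoef (cplx (%x. Re (f x))) k = fcoef f k" using assms(2) by (simp add: fcoef_cnj)
qed

lemma En_Hs_norm: "in_Hs s f ==> En s (fcoef f) = ennreal ((Hs_norm s f)^2)"
 by (simp add: Hs_norm_def Hs_energy_En in_Hs_iff less_top)

lemma Hs_norm_le:
 assumes "0 <= m" "En s (fcoef f) <= ennreal (m^2)" shows "Hs_norm s f <= m"
proof -
 have "enn2real (En s (fcoef f)) <= m^2" using assms(2) by (simp add: enn2real_leI)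
 thus ?thesis unfolding Hs_norm_def Hs_energy_En using assms(1) by (simp add: real_le_lsqrt)
qed

lemma Hs_norm_nonneg: "0 <= Hs_norm s f" by (simp add: Hs_norm_def)

lemma data_ball_En: "data_ball s R u0 v0 ==> En s (fcoef u0) <= ennreal (R^2) & En s (fcoef (cplx v0)) <= ennreal (R^2)"
 unfolding data_ball_def using Hs_norm_nonneg[of s u0] Hs_norm_nonneg[of s "cplx v0"] by (auto simp: En_Hs_norm intro!: ennreal_leI power_mono)

lemma fcoef_Hs_diff: "in_Hs s f ==> in_Hs s g ==> fcoef (%x. f x - g x) k = fcoef f k - fcoef g k"
 by (intro fcoef_diff L2_integrable(1)) (auto simp: in_Hs_iff)

lemma force_integrable:
 assumes s: "0 <= s" and f: "force s T m f" and h: "h : bmeas" "!!ta. ta : {0..t} ==> cmod (h ta) <= 1" and t: "t <= T"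
 shows "integrable lborel (%ta. ind {0..t} ta *\<^sub>R (h ta * f ta k))"
proof -
 note [measurable] = force_measurable[OF f]
 show ?thesis by (rule forcing_integrable[where ro="%ta. sqe (En s (f ta))" and T=T, OF s _ _ _ _ h t])
  (use f in \<open>auto simp: sqe_power2 force_def intro: le_less_trans\<close>)
qed

lemma Dh_continuous:
 assumes s: "0 <= s" and f: "force s T m f" and ka: "0 <= ka" and c: "!!t. c t k = Dh et ka T a f t k"
 shows "continuous_on {0..T} (%t. c t k)"
proof -
 define F where "F ta = of_real (exp (ka * ta)) * f ta k" for ta
 note [measurable] = force_measurable[OF f]
 have 1: "integrable lborel (%ta. ind {0..T} ta *\<^sub>R (of_real (exp (ka * (ta - T))) * f ta k))"
  by (rule force_integrable[OF s f]) (use ka in \<open>auto simp: mult_nonneg_nonpos\<close>)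
 have Fi: "set_integrable lborel {0..T} F"
  unfolding set_integrable_def F_def
  using integrable_mult_right[OF 1, of "of_real (exp (ka * T))"]
  by (simp add: mult.left_commute[of _ "ind _ _ *\<^sub>R _"] scaleR_conv_of_real mult.assoc[symmetric] flip: exp_add of_real_mult) (simp add: algebra_simps exp_diff flip: of_real_mult exp_add)
 have eq: "c t k = cis (- et * freq2 k * t) * (of_real (exp (- ka * t)) * (a k + integral {0..t} F))" if t: "t : {0..T}" for t
 proof -
  have Ft: "set_integrable lborel {0..t} F" by (rule set_integrable_subset[OF Fi]) (use t in auto)
  have "(LINT ta|lborel. ind {0..t} ta *\<^sub>R (of_real (exp (- ka * (t - ta))) * f ta k)) = (LINT ta|lborel. of_real (exp (- ka * t)) * (ind {0..t} ta *\<^sub>R F ta))"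
  proof (rule bintegral_cong[OF refl])
   fix ta
   have "exp (- ka * (t - ta)) = exp (- ka * t) * exp (ka * ta)" by (simp add: exp_add[symmetric] algebra_simps)
   thus "ind {0..t} ta *\<^sub>R (of_real (exp (- ka * (t - ta))) * f ta k) = of_real (exp (- ka * t)) * (ind {0..t} ta *\<^sub>R F ta)" by (simp add: F_def)
  qed
  also have "... = of_real (exp (- ka * t)) * integral {0..t} F"
   using set_borel_integral_eq_integral(2)[OF Ft] by (simp only: integral_mult_right_zero) (simp add: set_lebesgue_integral_def)
  finally show ?thesis using t by (simp add: c Dh_def distrib_left)
 qed
 have "continuous_on {0..T} (%t. integral {0..t} F)"
  by (rule indefinite_integral_continuous_1) (use set_borel_integral_eq_integral(1)[OF Fi] in simp)
 hence "continuous_on {0..T} (%t. cis (- et * freq2 k * t) * (of_real (exp (- ka * t)) * (a k + integral {0..t} F)))"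
  by (intro continuous_intros)
 thus ?thesis by (rule continuous_on_eq) (use eq in auto)
qed

text \<open>Each coefficient is continuous, and the time-independent majorant \<open>D\<close> of a
  superposition permits dominated convergence in the sum over \<open>k\<close>; this upgrades to
  continuity in norm.\<close>

lemma rep_continuous_Hs:
 assumes s: "0 < s" and r: "0 <= r" and c: "rep et s r c" and cont: "!!k. continuous_on {0..T} (%t. c t k)"
  and u: "!!t. t : {0..T} ==> L2 (u t)" "!!t k. t : {0..T} ==> fcoef (u t) k = c t k"
 shows "cont_Hs s T u"
proof -
 have H: "in_Hs s (u t)" if "t : {0..T}" for t
 proof -
  have "fcoef (u t) = c t" using u(2)[OF that] by auto
  thus ?thesis using u(1)[OF that] En_bounded_norm[OF c] s r by (simp add: in_Hs_iff)
 qed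
 obtain D where D: "!!t k. cmod (c t k) <= D k" "!!k. 0 <= D k" "(SZ k. ennreal (wt s k * (D k)^2)) <= ennreal (r^2)"
  using rep_dominated[OF c less_imp_le[OF s] r] by blast
 have "((%t. Hs_norm s (%x. u t x - u t0 x)) \<longlongrightarrow> 0) (at t0 within {0..T})" if t0: "t0 : {0..T}" for t0
  unfolding tendsto_at_iff_sequentially comp_def
 proof (intro allI impI)
  fix X :: "nat => real" assume X: "\<forall>i. X i : {0..T} - {t0}" "X \<longlonglongrightarrow> t0"
  have E: "En s (fcoef (%x. u (X i) x - u t0 x)) = (SZ k. ennreal (wt s k * (cmod (c (X i) k - c t0 k))^2))" for i
   unfolding En_def using X(1) t0 by (intro nn_integral_cong) (subst fcoef_Hs_diff[of s], auto intro!: H simp: u(2))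
  have "(%i. \<integral>\<^sup>+k. ennreal (wt s k * (cmod (c (X i) k - c t0 k))^2) \<partial>CZ) \<longlonglongrightarrow> (SZ k. 0)"
  proof (rule nn_integral_dominated_convergence[where w="%k. ennreal (4 * (wt s k * (D k)^2))"])
   show "AE k in CZ. ennreal (wt s k * (cmod (c (X j) k - c t0 k))^2) <= ennreal (4 * (wt s k * (D k)^2))" for j
   proof (intro AE_I2 ennreal_leI)
    fix k
    have "cmod (c (X j) k - c t0 k) <= 2 * D k" using norm_triangle_ineq4[of "c (X j) k" "c t0 k"] D(1)[of "X j" k] D(1)[of t0 k] by simp
    hence "(cmod (c (X j) k - c t0 k))^2 <= (2 * D k)^2" by (intro power_mono) auto
    hence "wt s k * (cmod (c (X j) k - c t0 k))^2 <= wt s k * (2 * D k)^2" by (intro mult_left_mono) (auto simp: wt_def)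
    thus "wt s k * (cmod (c (X j) k - c t0 k))^2 <= 4 * (wt s k * (D k)^2)" by (simp add: power_mult_distrib)
   qed
   have "(SZ k. ennreal (4 * (wt s k * (D k)^2))) = ennreal 4 * (SZ k. ennreal (wt s k * (D k)^2))"
    by (subst nn_integral_cmult[symmetric]) (auto simp: ennreal_mult wt_def)
   also have "... < \<infinity>" using D(3) by (auto simp: ennreal_mult_less_top intro: le_less_trans)
   finally show "(SZ k. ennreal (4 * (wt s k * (D k)^2))) < \<infinity>" .
   show "AE k in CZ. (%i. ennreal (wt s k * (cmod (c (X i) k - c t0 k))^2)) \<longlonglongrightarrow> 0"
   proof (rule AE_I2)
    fix k
    have "(%i. c (X i) k) \<longlonglongrightarrow> c t0 k" using cont[of k] X t0 by (auto simp: continuous_on_sequentially comp_def)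
    hence "(%i. c (X i) k - c t0 k) \<longlonglongrightarrow> 0" by (rule LIM_zero)
    hence "(%i. wt s k * (cmod (c (X i) k - c t0 k))^2) \<longlonglongrightarrow> wt s k * (cmod 0)^2" by (intro tendsto_intros)
    hence "(%i. ennreal (wt s k * (cmod (c (X i) k - c t0 k))^2)) \<longlonglongrightarrow> ennreal (wt s k * (cmod 0)^2)" by (rule tendsto_ennrealI)
    thus "(%i. ennreal (wt s k * (cmod (c (X i) k - c t0 k))^2)) \<longlonglongrightarrow> 0" by simp
   qed
  qed auto
  hence "(%i. En s (fcoef (%x. u (X i) x - u t0 x))) \<longlonglongrightarrow> ennreal 0" by (simp add: E)
  hence "(%i. enn2real (En s (fcoef (%x. u (X i) x - u t0 x)))) \<longlonglongrightarrow> 0" by (rule tendsto_enn2real) simp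
  hence "(%i. sqrt (enn2real (En s (fcoef (%x. u (X i) x - u t0 x))))) \<longlonglongrightarrow> sqrt 0" by (rule tendsto_real_sqrt)
  thus "(%i. Hs_norm s (%x. u (X i) x - u t0 x)) \<longlonglongrightarrow> 0" by (simp add: Hs_norm_def Hs_energy_En)
 qed
 thus ?thesis using H by (simp add: cont_Hs_def)
qed

text \<open>Keeps the extended interval from -1 to \<open>T + 1\<close> inside
  \<open>[-pi, pi]\<close>.\<close>

lemma T0_less: "T0 + 1 < pi"
proof -
 have "T0 <= 1" using pi_gt3 by (simp add: T0_def divide_le_eq)
 thus ?thesis using pi_gt3 by simp
qed

context sde begin

lemma s0: "0 <= s" using s by simp

lemma V_formula:
 assumes "t : {0..T}"
 shows "V b c t k = of_real (exp (- t / K)) * b k + of_real (ep / K) * (LINT ta:{0..t}|lborel. of_real (exp (- (t - ta) / K)) * nlc af (c ta) k)"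
proof -
 have "(LINT ta|lborel. ind {0..t} ta *\<^sub>R (of_real (exp (- (1/K) * (t - ta))) * vf af K ep c ta k))
  = (LINT ta|lborel. of_real (ep / K) * (ind {0..t} ta *\<^sub>R (of_real (exp (- (t - ta) / K)) * nlc af (c ta) k)))"
 proof (rule bintegral_cong[OF refl])
  fix ta
  have "- (1/K) * (t - ta) = - (t - ta) / K" using K by (simp add: field_simps)
  thus "ind {0..t} ta *\<^sub>R (of_real (exp (- (1/K) * (t - ta))) * vf af K ep c ta k) = of_real (ep / K) * (ind {0..t} ta *\<^sub>R (of_real (exp (- (t - ta) / K)) * nlc af (c ta) k))"
   unfolding vf_def by (simp only: mult_scaleR_right mult_ac)
 qed
 also have "... = of_real (ep / K) * (LINT ta:{0..t}|lborel. of_real (exp (- (t - ta) / K)) * nlc af (c ta) k)"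
  unfolding set_lebesgue_integral_def by (rule integral_mult_right_zero)
 finally show ?thesis using assms by (simp add: Dh_def)
qed

lemma U_formula:
 assumes "t : {0..T}"
 shows "Dh 1 0 T a (uf c d) t k = cis (- freq2 k * t) * a k - \<i> * (LINT ta:{0..t}|lborel. cis (- freq2 k * (t - ta)) * conv (c ta) (d ta) k)"
proof -
 have "(LINT ta:{0..t}|lborel. cis (- freq2 k * (t - ta)) * conv (c ta) (d ta) k) = (LINT ta|lborel. \<i> * cis (- freq2 k * t) * (ind {0..t} ta *\<^sub>R uf c d ta k))"
  unfolding set_lebesgue_integral_def
 proof (rule bintegral_cong[OF refl])
  fix ta
  have "cis (- freq2 k * (t - ta)) = cis (- freq2 k * t) * cis (freq2 k * ta)" by (simp add: cis_mult right_diff_distrib)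
  thus "ind {0..t} ta *\<^sub>R (cis (- freq2 k * (t - ta)) * conv (c ta) (d ta) k) = \<i> * cis (- freq2 k * t) * (ind {0..t} ta *\<^sub>R uf c d ta k)"
   by (simp only: uf_def mult_scaleR_right) (simp add: mult_ac)
 qed
 also have "... = \<i> * cis (- freq2 k * t) * (LINT ta|lborel. ind {0..t} ta *\<^sub>R uf c d ta k)" by (rule integral_mult_right_zero)
 finally have "\<i> * (LINT ta:{0..t}|lborel. cis (- freq2 k * (t - ta)) * conv (c ta) (d ta) k) = - (cis (- freq2 k * t) * (LINT ta|lborel. ind {0..t} ta *\<^sub>R uf c d ta k))"
  by (simp add: mult.assoc[symmetric])
 thus ?thesis using assms by (simp add: Dh_def distrib_left)
qed

text \<open>Brings an arbitrary solution to the coefficient equation with mass \<open>2 * R\<close>,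
  whatever its norm in the restriction space. The superposition \<open>e\<close> from that space
  agrees with the coefficients \<open>c\<close> only for almost every time. But the integrals for
  \<open>v\<close> and \<open>u\<close> may be computed with \<open>e\<close>, and then the equation
  itself exhibits \<open>c\<close> as a superposition.\<close>

lemma sol_coefficients:
 assumes ball: "data_ball s R u0 v0" and sol: "SDE_sol s 1 af K ep T u0 v0 u v"
 obtains c where "rep 1 s (2 * R) c" "!!t k. c t k = Dh 1 0 T (fcoef u0) (Fy (fcoef (cplx v0)) c) t k"
  "!!t k. t : {0..T} ==> fcoef (u t) k = c t k" "!!t k. t : {0..T} ==> fcoef (cplx (v t)) k = V (fcoef (cplx v0)) c t k"
proof -
 define a where "a = fcoef u0"
 define b where "b = fcoef (cplx v0)"
 have ab: "En s a <= ennreal (R^2)" "En s b <= ennreal (R^2)" using data_ball_En[OF ball] by (auto simp: a_def b_def)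
 define c where "c t k = (if t : {0..T} then fcoef (u t) k else 0)" for t k
 define d where "d t k = (if t : {0..T} then fcoef (cplx (v t)) k else 0)" for t k
 have X: "in_Xsb_T s 1 T u" and Du: "SDE_duhamel af K ep T u0 v0 u v" and uH: "!!t. t : {0..T} ==> in_Hs s (u t)" and vH: "!!t. t : {0..T} ==> in_Hs s (cplx (v t))"
  using sol by (auto simp: SDE_sol_def cont_Hs_def)
 have nl: "fcoef (%x. complex_of_real (cmod (u t x) powr af)) k = nlc af (c t) k"
  and cv: "fcoef (%x. u t x * complex_of_real (v t x)) k = conv (c t) (d t) k" if t: "t : {0..T}" for t k
 proof -
  have ct: "c t = fcoef (u t)" "d t = fcoef (cplx (v t))" using t by (auto simp: c_def d_def)
  have u: "L2 (u t)" "En s (c t) < \<infinity>" and v: "L2 (cplx (v t))" using uH[OF t] vH[OF t] by (auto simp: in_Hs_iff ct)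
  have [measurable]: "u t : bmeas" "cplx (v t) : bmeas" using u v by (auto simp: L2_def)
  have AEu: "AE x in sqM. u t x = syn (c t) x" using syn_fcoef[OF s u(1)] u(2) by (simp add: ct)
  show "fcoef (%x. complex_of_real (cmod (u t x) powr af)) k = nlc af (c t) k" unfolding nlc_def
   by (rule fcoef_cong_AE) (use AEu in \<open>auto elim: eventually_mono\<close>)
  have "fcoef (%x. u t x * complex_of_real (v t x)) k = fcoef (%x. cplx (v t) x * syn (c t) x) k"
  proof (rule fcoef_cong_AE)
   show "AE x in sqM. u t x * complex_of_real (v t x) = cplx (v t) x * syn (c t) x" using AEu by eventually_elim (simp add: cplx_def)
   have "(%x. u t x * cplx (v t) x) : bmeas" by measurable
   thus "(%x. u t x * complex_of_real (v t x)) : bmeas" by (simp add: cplx_def)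
  qed measurable
  thus "fcoef (%x. u t x * complex_of_real (v t x)) k = conv (c t) (d t) k" using fcoef_mult_syn(2)[OF s v u(2)] by (simp add: ct)
 qed
 have cut: "(LINT ta:{0..t}|lborel. g ta) = (LINT ta:{0..t}|lborel. g' ta)" "set_integrable lborel {0..t} g = set_integrable lborel {0..t} g'"
  if "!!ta. ta : {0..t} ==> g ta = g' ta" for t and g g' :: "real => complex"
  by (rule set_lebesgue_integral_cong, simp, use that in blast, rule set_integrable_cong, simp, use that in auto)
 have iu: "set_integrable lborel {0..t} (%ta. cis (- freq2 k * (t - ta)) * conv (c ta) (d ta) k)"
  and iv: "set_integrable lborel {0..t} (%ta. complex_of_real (exp (- (t - ta) / K)) * nlc af (c ta) k)"
  and ceq: "c t k = Dh 1 0 T a (uf c d) t k" and deq: "d t k = V b c t k" if t: "t : {0..T}" for t k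
 proof -
  have sub: "ta : {0..T}" if "ta : {0..t}" for ta using that t by auto
  note D1 = Du[unfolded SDE_duhamel_def, THEN conjunct2, rule_format, OF t, of k]
  have e1: "cis (- freq2 k * (t - ta)) * fcoef (%x. u ta x * complex_of_real (v ta x)) k = cis (- freq2 k * (t - ta)) * conv (c ta) (d ta) k" if "ta : {0..t}" for ta
   using cv[OF sub[OF that]] by simp
  have e2: "complex_of_real (exp (- (t - ta) / K)) * fcoef (%x. complex_of_real (cmod (u ta x) powr af)) k = complex_of_real (exp (- (t - ta) / K)) * nlc af (c ta) k" if "ta : {0..t}" for ta
   using nl[OF sub[OF that]] by simp
  show "set_integrable lborel {0..t} (%ta. cis (- freq2 k * (t - ta)) * conv (c ta) (d ta) k)"
   using D1[THEN conjunct1] cut(2)[of t, OF e1] by simp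
  show "set_integrable lborel {0..t} (%ta. complex_of_real (exp (- (t - ta) / K)) * nlc af (c ta) k)"
   using D1[THEN conjunct2, THEN conjunct1] cut(2)[of t, OF e2] by simp
  show "c t k = Dh 1 0 T a (uf c d) t k"
   unfolding U_formula[OF t] using D1[THEN conjunct2, THEN conjunct2, THEN conjunct1] cut(1)[OF e1] t by (simp add: c_def a_def)
  show "d t k = V b c t k"
   unfolding V_formula[OF t] using D1[THEN conjunct2, THEN conjunct2, THEN conjunct2] cut(1)[OF e2] t by (simp add: d_def b_def)
 qed
 have deq': "d = V b c" by (intro ext) (use deq in \<open>auto simp: d_def Dh_def\<close>)
 have ceq': "c t k = Dh 1 0 T a (Fy b c) t k" for t k using ceq[of t k] by (cases "t : {0..T}") (simp add: deq', auto simp: c_def Dh_def)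
 obtain r e where r: "0 < r" and e: "rep 1 s r e" and AEe: "AE t in lborel. t : {0..T} --> (\<forall>k. e t k = fcoef (u t) k)"
  using Xsb_rep[OF s0 T(1) _ X] T0_less T(2) by auto
 have AEc: "AE t in lborel. t : {0..T} --> e t = c t" using AEe by eventually_elim (auto simp: c_def fun_eq_iff)
 note [measurable] = rep_measurable[OF e s0]
 have Ve: "V b e t k = V b c t k" for t k
 proof (cases "t : {0..T}")
  case True
  have "(LINT ta:{0..t}|lborel. of_real (exp (- (t - ta) / K)) * nlc af (e ta) k) = (LINT ta:{0..t}|lborel. of_real (exp (- (t - ta) / K)) * nlc af (c ta) k)"
   unfolding set_lebesgue_integral_def
  proof (rule integral_cong_AE)
   show "(%ta. ind {0..t} ta *\<^sub>R (of_real (exp (- (t - ta) / K)) * nlc af (c ta) k)) : borel_measurable lborel"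
    using iv[OF True, of k] by (simp add: set_integrable_def borel_measurable_integrable)
   show "AE ta in lborel. ind {0..t} ta *\<^sub>R (of_real (exp (- (t - ta) / K)) * nlc af (e ta) k) = ind {0..t} ta *\<^sub>R (of_real (exp (- (t - ta) / K)) * nlc af (c ta) k)"
    using AEc by eventually_elim (use True in \<open>auto simp: indicator_def\<close>)
  qed measurable
  thus ?thesis unfolding V_formula[OF True] by simp
 qed (auto simp: Dh_def)
 hence Ve': "V b e = d" by (simp add: deq' fun_eq_iff)
 have posG: "0 < R + G r * r" using R r G_nonneg by (simp add: add_pos_nonneg)
 define m where "m = sqrt T * sqrt CP * (r * (R + G r * r))"
 have m: "0 <= m" using T CP r posG by (simp add: m_def)
 have fe: "force s T m (uf e d)" unfolding m_def Ve'[symmetric] by (rule uf_force[OF r posG e V_rep[OF r e _ ab(2)]]) (use R in simp)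
 note [measurable] = force_measurable[OF fe]
 have "Dh 1 0 T a (uf e d) t k = c t k" for t k
 proof (cases "t : {0..T}")
  case True
  define h where "h = (%ta. ind {0..t} ta *\<^sub>R (cis (- freq2 k * (t - ta)) * conv (c ta) (d ta) k))"
  define h' where "h' = (%ta. ind {0..t} ta *\<^sub>R (cis (- freq2 k * (t - ta)) * conv (e ta) (d ta) k))"
  have "h' = (%ta. \<i> * cis (- freq2 k * t) * (ind {0..t} ta *\<^sub>R uf e d ta k))"
  proof
   fix ta
   have "cis (- freq2 k * (t - ta)) = cis (- freq2 k * t) * cis (freq2 k * ta)" by (simp add: cis_mult right_diff_distrib)
   thus "h' ta = \<i> * cis (- freq2 k * t) * (ind {0..t} ta *\<^sub>R uf e d ta k)"
    unfolding h'_def by (simp only: uf_def mult_scaleR_right) (simp add: mult_ac)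
  qed
  hence "h' : borel_measurable lborel" by simp
  moreover have "h : borel_measurable lborel" using iu[OF True, of k] by (simp add: h_def set_integrable_def borel_measurable_integrable)
  moreover have "AE ta in lborel. h' ta = h ta" using AEc by eventually_elim (use True in \<open>auto simp: h_def h'_def indicator_def\<close>)
  ultimately have "integral\<^sup>L lborel h' = integral\<^sup>L lborel h" by (intro integral_cong_AE)
  thus ?thesis unfolding ceq[OF True] U_formula[OF True] by (simp add: h_def h'_def set_lebesgue_integral_def)
 qed (auto simp: Dh_def c_def)
 hence "c = Dh 1 0 T a (uf e d)" by (simp add: fun_eq_iff)
 moreover have "rep 1 s (R + m) (Dh 1 0 T a (uf e d))" by (rule Dh_rep_force[OF _ _ _ _ ab(1) m fe]) (use s T R in auto)
 ultimately have "rep 1 s (R + m) c" by simp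
 \<comment> \<open>The mass \<open>R + m\<close> still depends on the solution through
   \<open>r\<close>; the a priori bound removes this dependence.\<close>
 hence "rep 1 s (2 * R) c" by (rule apriori[rotated, OF _ ceq' ab]) (use R m in simp)
 thus ?thesis using that[of c] ceq' deq by (auto simp: a_def b_def c_def d_def)
qed

lemma nlc_hermitian: "nlc be a (- k) = cnj (nlc be a k)"
 using fcoef_cnj[of "%x. complex_of_real (cmod (syn a x) powr be)" "- k"] by (simp add: nlc_def)

text \<open>Real data and the real function in the forcing keep the coefficients of \<open>v\<close>
  Hermitian, which later makes \<open>v\<close> real.\<close>

lemma V_hermitian:
 assumes b: "!!k. b (- k) = cnj (b k)" shows "V b c t (- k) = cnj (V b c t k)"
proof (cases "t : {0..T}")
 case True
 define g where "g ta = ind {0..t} ta *\<^sub>R (of_real (exp (- (t - ta) / K)) * nlc af (c ta) k)" for ta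
 have "(LINT ta:{0..t}|lborel. of_real (exp (- (t - ta) / K)) * nlc af (c ta) (- k)) = (LINT ta|lborel. cnj (g ta))"
  unfolding set_lebesgue_integral_def g_def by (intro bintegral_cong) (auto simp: nlc_hermitian)
 also have "... = cnj (LINT ta:{0..t}|lborel. of_real (exp (- (t - ta) / K)) * nlc af (c ta) k)"
  by (subst Bochner_Integration.integral_cnj) (simp add: g_def[abs_def] set_lebesgue_integral_def)
 finally show ?thesis unfolding V_formula[OF True] by (simp add: b)
qed (auto simp: Dh_def)

lemma solution_exists:
 assumes adm: "(af - 2) * (1 - s) < 2 * s" and ball: "data_ball s R u0 v0"
 shows "\<exists>u v. SDE_sol s 1 af K ep T u0 v0 u v"
proof -
 define a where "a = fcoef u0"
 define b where "b = fcoef (cplx v0)"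
 have ab: "En s a <= ennreal (R^2)" "En s b <= ennreal (R^2)" using data_ball_En[OF ball] by (auto simp: a_def b_def)
 obtain c where c: "rep 1 s (2 * R) c" and sol: "!!t k. c t k = Dh 1 0 T a (Fy b c) t k" using existence[OF ab] by blast
 define d where "d = V b c"
 define q where "q = R + G (2 * R) * (2 * R)"
 have R2: "0 < 2 * R" "0 <= R" using R by auto
 have q: "0 < q" using R G_nonneg by (simp add: q_def add_pos_nonneg)
 have d: "rep 0 s q d" unfolding d_def q_def by (rule V_rep[OF R2(1) c R2(2) ab(2)])
 have Ec: "En s (c t) < \<infinity>" and Ed: "En s (d t) < \<infinity>" for t using En_bounded_norm[OF c s0] En_bounded_norm[OF d s0] R q by auto
 have Fu: "force s T (R/4) (uf c d)" unfolding d_def by (rule Fy_force[OF c ab(2)])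
 have Fv: "force s T (G (2 * R) * (2 * R)) (vf af K ep c)" by (rule vf_force[OF R2(1) c])
 have b_herm: "b (- k) = cnj (b k)" for k
 proof -
  have "cplx v0 : bmeas" using ball by (auto simp: data_ball_def in_Hs_def)
  from fcoef_cnj[OF this, of "- k"] show ?thesis by (simp add: b_def cplx_def)
 qed
 have Ld: "L2 (syn (d t))" and fd: "fcoef (syn (d t)) k = d t k" for t k using L2_syn[OF s Ed] fcoef_syn[OF s Ed] by auto
 have herm: "fcoef (syn (d t)) (- k) = cnj (fcoef (syn (d t)) k)" for t k unfolding fd unfolding d_def by (rule V_hermitian) (rule b_herm)
 define u where "u t = syn (c t)" for t
 define v where "v t x = Re (syn (d t) x)" for t x
 have v: "L2 (cplx (v t))" "fcoef (cplx (v t)) k = d t k" for t k using fcoef_Re[OF Ld herm, of t] fd by (auto simp: v_def[abs_def])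
 have u: "L2 (u t)" "fcoef (u t) k = c t k" for t k using L2_syn[OF s Ec] fcoef_syn[OF s Ec] by (auto simp: u_def)
 have uv: "integrable sqM (%x. u t x * complex_of_real (v t x))" "fcoef (%x. u t x * complex_of_real (v t x)) k = conv (c t) (d t) k" for t k
 proof -
  have e: "(%x. u t x * complex_of_real (v t x)) = (%x. cplx (v t) x * syn (c t) x)" by (auto simp: u_def cplx_def)
  have dt: "fcoef (cplx (v t)) = d t" using v(2) by auto
  show "integrable sqM (%x. u t x * complex_of_real (v t x))" "fcoef (%x. u t x * complex_of_real (v t x)) k = conv (c t) (d t) k"
   unfolding e using fcoef_mult_syn[OF s v(1)[of t] Ec[of t]] by (simp_all add: dt)
 qed
 have nl: "fcoef (%x. complex_of_real (cmod (u t x) powr af)) = nlc af (c t)" for t by (simp add: u_def nlc_def)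
 have X: "in_Xsb_T s 1 T u"
  unfolding u_def
 proof (rule Dh_in_Xsb[OF s T(1) _ sol Ec])
  show "T + 1 < pi" using T T0_less by simp
  show "En s a < \<infinity>" using ab(1) by (rule le_less_trans) simp
  show "(%ta. Fy b c ta k) : bmeas" for k using force_measurable[OF Fu] by (simp add: d_def)
  note [measurable] = rep_measurable[OF c s0] rep_measurable[OF d s0]
  have [measurable]: "(%t. conv (c t) (d t) k) : bmeas" for k unfolding conv_def by measurable
  \<comment> \<open>Membership in the restriction space asks for the forcing in
    \<open>L^2 H^s\<close>, beyond the \<open>L^1\<close> bound of the iteration; the product
    estimate provides it.\<close>
  have "(NN (ivl 0 T) (%ta. En s (Fy b c ta))) <= (NN (ivl 0 T) (%ta. En s (conv (c ta) (d ta))))"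
   by (intro nn_integral_mono En_multiplier_le) (simp add: uf_def d_def norm_mult)
  also have "... <= (IT ta. En s (conv (c ta) (d ta)))" by (rule ivl_mono) measurable
  also have "... <= ennreal (CP * (2 * R * q)^2)" by (rule product[OF _ _ c d]) (use R q in auto)
  finally show "(NN (ivl 0 T) (%ta. En s (Fy b c ta))) < \<infinity>" by (rule le_less_trans) simp
 qed
 have Cu: "cont_Hs s T u"
 proof (rule rep_continuous_Hs[OF s _ c])
  show "continuous_on {0..T} (%t. c t k)" for k by (rule Dh_continuous[OF s0 Fu[unfolded d_def] order_refl sol])
 qed (use R u in auto)
 have Cv: "cont_Hs s T (%t. cplx (v t))"
 proof (rule rep_continuous_Hs[OF s _ d])
  show "continuous_on {0..T} (%t. d t k)" for k by (rule Dh_continuous[OF s0 Fv, where ka="1/K"]) (use K in \<open>auto simp: d_def\<close>)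
 qed (use q v in auto)
 have "SDE_duhamel af K ep T u0 v0 u v"
  unfolding SDE_duhamel_def
 proof (intro conjI ballI allI)
  fix t assume t: "t : {0..T}"
  have [measurable]: "u t : bmeas" "v t : bmeas" using u(1)[of t] Ld[of t] by (auto simp: L2_def v_def[abs_def])
  show "set_integrable lborel unit_sq (%x. u t x * complex_of_real (v t x))"
   using uv(1)[of t] by (simp add: integrable_sqM)
  have "integrable sqM (%x. complex_of_real (cmod (u t x) powr af))" unfolding u_def by (rule integrable_syn_powr[OF s af adm Ec])
  hence "integrable sqM (%x. cmod (u t x) powr af)" by (simp only: complex_of_real_integrable_eq)
  thus "set_integrable lborel unit_sq (%x. cmod (u t x) powr af)" by (simp add: integrable_sqM)
  fix k
  show "set_integrable lborel {0..t} (%ta. cis (- freq2 k * (t - ta)) * fcoef (%x. u ta x * complex_of_real (v ta x)) k)"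
  proof -
   have "integrable lborel (%ta. ind {0..t} ta *\<^sub>R ((\<i> * cis (- freq2 k * t)) * uf c d ta k))"
    by (rule force_integrable[OF s0 Fu]) (use t in \<open>auto simp: norm_mult\<close>)
   moreover have "(\<i> * cis (- freq2 k * t)) * uf c d ta k = cis (- freq2 k * (t - ta)) * conv (c ta) (d ta) k" for ta
   proof -
    have "cis (- freq2 k * (t - ta)) = cis (- freq2 k * t) * cis (freq2 k * ta)" by (simp add: cis_mult right_diff_distrib)
    thus ?thesis by (simp add: uf_def mult_ac)
   qed
   ultimately show ?thesis by (simp only: uv(2) set_integrable_def)
  qed
  show "set_integrable lborel {0..t} (%ta. complex_of_real (exp (- (t - ta) / K)) * fcoef (%x. complex_of_real (cmod (u ta x) powr af)) k)"
  proof -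
   have "integrable lborel (%ta. ind {0..t} ta *\<^sub>R (complex_of_real (exp (- (t - ta) / K)) * vf af K ep c ta k))"
    by (rule force_integrable[OF s0 Fv]) (use t K in \<open>auto simp: divide_nonpos_pos\<close>)
   hence "integrable lborel (%ta. of_real (K / ep) * (ind {0..t} ta *\<^sub>R (complex_of_real (exp (- (t - ta) / K)) * vf af K ep c ta k)))"
    by (rule integrable_mult_right)
   moreover have "of_real (K / ep) * (ind {0..t} ta *\<^sub>R (complex_of_real (exp (- (t - ta) / K)) * vf af K ep c ta k)) = ind {0..t} ta *\<^sub>R (complex_of_real (exp (- (t - ta) / K)) * nlc af (c ta) k)" for ta
   proof -
    have "of_real (K / ep) * vf af K ep c ta k = nlc af (c ta) k" using K ep by (auto simp: vf_def)
    thus ?thesis by (simp only: mult_scaleR_right mult.left_commute[of "of_real (K / ep)"])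
   qed
   ultimately show ?thesis by (simp only: nl set_integrable_def)
  qed
  show "fcoef (u t) k = cis (- freq2 k * t) * fcoef u0 k - \<i> * (LINT ta:{0..t}|lborel. cis (- freq2 k * (t - ta)) * fcoef (%x. u ta x * complex_of_real (v ta x)) k)"
   unfolding u(2) uv(2) a_def[symmetric] U_formula[OF t, symmetric] unfolding d_def by (rule sol)
  show "fcoef (cplx (v t)) k = complex_of_real (exp (- t / K)) * fcoef (cplx v0) k
     + complex_of_real (ep / K) * (LINT ta:{0..t}|lborel. complex_of_real (exp (- (t - ta) / K)) * fcoef (%x. complex_of_real (cmod (u ta x) powr af)) k)"
   unfolding v(2) nl b_def[symmetric] V_formula[OF t, symmetric] by (simp add: d_def)
 qed
 thus ?thesis using X Cu Cv unfolding SDE_sol_def by blast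
qed

text \<open>Stated with a positive \<open>de\<close> above the distance of the data instead of the
  distance itself, which includes coinciding data: uniqueness is the limit of small
  \<open>de\<close>.\<close>

lemma solution_difference:
 assumes ball: "data_ball s R u0 v0" "data_ball s R u0' v0'"
  and sol: "SDE_sol s 1 af K ep T u0 v0 u v" "SDE_sol s 1 af K ep T u0' v0' u' v'"
  and de: "0 < de" "Hs_norm s (%x. u0 x - u0' x) <= de" "Hs_norm s (%x. cplx v0 x - cplx v0' x) <= de" and t: "t : {0..T}"
 shows "Hs_norm s (%x. u t x - u' t x) <= 2 * de" "Hs_norm s (%x. cplx (v t) x - cplx (v' t) x) <= de + G (2 * R) * (2 * de)"
proof -
 obtain c where c: "rep 1 s (2 * R) c" "!!t k. c t k = Dh 1 0 T (fcoef u0) (Fy (fcoef (cplx v0)) c) t k"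
  "!!t k. t : {0..T} ==> fcoef (u t) k = c t k" "!!t k. t : {0..T} ==> fcoef (cplx (v t)) k = V (fcoef (cplx v0)) c t k"
  using sol_coefficients[OF ball(1) sol(1)] by blast
 obtain c' where c': "rep 1 s (2 * R) c'" "!!t k. c' t k = Dh 1 0 T (fcoef u0') (Fy (fcoef (cplx v0')) c') t k"
  "!!t k. t : {0..T} ==> fcoef (u' t) k = c' t k" "!!t k. t : {0..T} ==> fcoef (cplx (v' t)) k = V (fcoef (cplx v0')) c' t k"
  using sol_coefficients[OF ball(2) sol(2)] by blast
 have H: "in_Hs s u0" "in_Hs s u0'" "in_Hs s (cplx v0)" "in_Hs s (cplx v0')" using ball by (auto simp: data_ball_def)
 have Ht: "in_Hs s (u t)" "in_Hs s (u' t)" "in_Hs s (cplx (v t))" "in_Hs s (cplx (v' t))" using sol t by (auto simp: SDE_sol_def cont_Hs_def)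
 have dE: "En s (%k. fcoef f k - fcoef g k) = En s (fcoef (%x. f x - g x))" if "in_Hs s f" "in_Hs s g" for f g
  by (rule arg_cong[where f="En s"]) (simp add: fun_eq_iff fcoef_Hs_diff[OF that])
 have dfin: "En s (%k. fcoef f k - fcoef g k) <= ennreal (de^2)" if fg: "in_Hs s f" "in_Hs s g" and n: "Hs_norm s (%x. f x - g x) <= de" for f g
 proof -
  have "L2 (%x. f x - g x)" using fg by (auto simp: in_Hs_iff intro: L2_diff)
  moreover have "En s (%k. fcoef f k - fcoef g k) < \<infinity>"
  proof -
   have "En s (%k. fcoef f k - fcoef g k) <= 2 * En s (fcoef f) + 2 * En s (fcoef g)" by (rule En_sum_le) (rule norm_triangle_ineq4)
   also have "... < \<infinity>" using fg by (simp add: in_Hs_iff ennreal_mult_less_top)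
   finally show ?thesis .
  qed
  ultimately have "in_Hs s (%x. f x - g x)" by (simp add: in_Hs_iff dE[OF fg, symmetric])
  from En_Hs_norm[OF this] have "En s (%k. fcoef f k - fcoef g k) = ennreal ((Hs_norm s (%x. f x - g x))^2)" by (simp add: dE[OF fg])
  also have "... <= ennreal (de^2)" by (intro ennreal_leI power_mono n Hs_norm_nonneg)
  finally show ?thesis .
 qed
 have bb: "En s (fcoef (cplx v0)) <= ennreal (R^2)" "En s (fcoef (cplx v0')) <= ennreal (R^2)" using data_ball_En ball by auto
 note D = difference[OF c'(1) c(1) c'(2) c(2) bb(2) bb(1) de(1) dfin[OF H(1) H(2) de(2)] dfin[OF H(3) H(4) de(3)]]
 have "En s (%k. c t k - c' t k) <= ennreal ((2 * de)^2)" by (rule rep_En[OF D(1) s0]) (use de in simp)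
 thus "Hs_norm s (%x. u t x - u' t x) <= 2 * de"
  using de by (intro Hs_norm_le) (simp_all add: dE[OF Ht(1) Ht(2), symmetric] c(3)[OF t] c'(3)[OF t])
 have g: "0 <= de + G (2 * R) * (2 * de)" using de G_nonneg by simp
 have "En s (%k. V (fcoef (cplx v0)) c t k - V (fcoef (cplx v0')) c' t k) <= ennreal ((de + G (2 * R) * (2 * de))^2)" by (rule rep_En[OF D(2) s0 g])
 thus "Hs_norm s (%x. cplx (v t) x - cplx (v' t) x) <= de + G (2 * R) * (2 * de)"
  using g by (intro Hs_norm_le) (simp_all add: dE[OF Ht(3) Ht(4), symmetric] c(4)[OF t] c'(4)[OF t])
qed

end

lemma SDE_LWP_adm:
 assumes adm: "adm s af" and K: "0 < K" and ep: "ep : {1, -1}"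
 shows "SDE_LWP s af K ep"
proof -
 have s: "0 < s" and af: "2 <= af" and ad: "(af - 2) * (1 - s) < 2 * s" using adm by (auto simp: adm_def)
 obtain C where C: "0 <= C" "!!r q c d. 0 <= r ==> 0 <= q ==> rep 1 s r c ==> rep 0 s q d ==> (IT t. En s (conv (c t) (d t))) <= ennreal (C * (r * q)^2)"
  using product_estimate[OF s] by blast
 have C1: "(IT t. En s (conv (c t) (d t))) <= ennreal ((C + 1) * (r * q)^2)" if "0 <= r" "0 <= q" "rep 1 s r c" "rep 0 s q d" for r q c d
  by (rule order_trans[OF C(2)[OF that]]) (auto intro!: ennreal_leI mult_right_mono)
 obtain CN where CN: "0 < CN" "!!r q c c'. 0 < r ==> 0 < q ==> rep 1 s r c ==> rep 1 s r c' ==> rep 1 s q (%t k. c' t k - c t k) ==>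
   lip_bound s af CN r q c c'"
  using nonlinear_estimate[OF adm] by blast
 show ?thesis unfolding SDE_LWP_def
 proof (rule exI[of _ 1], intro conjI allI impI)
  fix R :: real assume R: "0 < R"
  \<comment> \<open>\<open>M\<close> is the bracket in the smallness condition of the locale, and
    \<open>T\<close> is solved from \<open>sqrt T * M <= 1/4\<close>, capped by the period
    \<open>T0\<close>. It depends on the size \<open>R\<close> and not on the individual
    data.\<close>
  define M where "M = sqrt (C + 1) * R * (4 + 4 * (CN / K * (2 * R) powr (af - 1)))"
  have M: "0 < M" unfolding M_def using C R CN K by (intro mult_pos_pos add_pos_nonneg) auto
  define T where "T = min T0 ((1 / (4 * M))^2)"
  have T: "0 < T" "T <= T0" using T0_pos M by (auto simp: T_def)
  have "sqrt T <= sqrt ((1 / (4 * M))^2)" by (intro real_sqrt_le_mono) (simp add: T_def)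
  also have "... = 1 / (4 * M)" using M by simp
  finally have small: "sqrt T * M <= 1/4" using M by (simp add: field_simps)
  interpret sde s af K ep R "C + 1" CN T
   by unfold_locales (use s af K ep R C CN C1 T small in \<open>auto simp: M_def\<close>)
  \<comment> \<open>The sum of the two Lipschitz constants, 2 for \<open>u\<close> and
    \<open>1 + 2 * G (2 * R)\<close> for \<open>v\<close>.\<close>
  define L where "L = 3 + G (2 * R) * 2"
  have L: "0 < L" using G_nonneg[of "2 * R"] by (simp add: L_def)
  have unique: "Hs_norm s (%x. u t x - u' t x) = 0 & Hs_norm s (%x. cplx (v t) x - cplx (v' t) x) = 0"
   if uq: "data_ball s R u0 v0" "SDE_sol s 1 af K ep T u0 v0 u v" "SDE_sol s 1 af K ep T u0 v0 u' v'" "t : {0..T}" for u0 v0 u v u' v' t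
  proof -
   have z: "Hs_norm s (%x. 0) = 0" by (simp add: Hs_norm_def Hs_energy_def fcoef_def)
   have b: "Hs_norm s (%x. u t x - u' t x) <= 0 + e" "Hs_norm s (%x. cplx (v t) x - cplx (v' t) x) <= 0 + e" if e: "0 < e" for e
   proof -
    define de where "de = e / L"
    have de: "0 < de" using e L by (simp add: de_def)
    have Le: "L * de = e" using L by (simp add: de_def)
    have g: "0 <= G (2 * R) * (2 * de)" using de G_nonneg by simp
    have L': "L * de = 3 * de + G (2 * R) * (2 * de)" by (simp add: L_def algebra_simps)
    have "Hs_norm s (%x. u0 x - u0 x) <= de" "Hs_norm s (%x. cplx v0 x - cplx v0 x) <= de" using z de by simp_all
    from solution_difference[OF uq(1) uq(1) uq(2) uq(3) de this uq(4)]
    show "Hs_norm s (%x. u t x - u' t x) <= 0 + e" "Hs_norm s (%x. cplx (v t) x - cplx (v' t) x) <= 0 + e"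
     using g Le L' de by linarith+
   qed
   have "Hs_norm s (%x. u t x - u' t x) <= 0" "Hs_norm s (%x. cplx (v t) x - cplx (v' t) x) <= 0"
    by (rule field_le_epsilon, rule b, assumption)+
   thus ?thesis using Hs_norm_nonneg by (metis order_antisym)
  qed
  have dependence: "Hs_norm s (%x. u t x - u' t x) + Hs_norm s (%x. cplx (v t) x - cplx (v' t) x) < e"
   if H: "data_ball s R u0 v0" "SDE_sol s 1 af K ep T u0 v0 u v" "0 < e" "data_ball s R u0' v0'" "SDE_sol s 1 af K ep T u0' v0' u' v'"
    "Hs_norm s (%x. u0 x - u0' x) + Hs_norm s (%x. cplx v0 x - cplx v0' x) < e / (L + 1)" and t: "t : {0..T}" for u0 v0 u v e u0' v0' u' v' t
  proof -
   define de where "de = e / (L + 1)"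
   have de: "0 < de" using H(3) L by (simp add: de_def)
   have "Hs_norm s (%x. u0 x - u0' x) <= de" "Hs_norm s (%x. cplx v0 x - cplx v0' x) <= de"
    using H(6) Hs_norm_nonneg[of s "%x. u0 x - u0' x"] Hs_norm_nonneg[of s "%x. cplx v0 x - cplx v0' x"] unfolding de_def by linarith+
   from solution_difference[OF H(1) H(4) H(2) H(5) de this t]
   have "Hs_norm s (%x. u t x - u' t x) + Hs_norm s (%x. cplx (v t) x - cplx (v' t) x) <= L * de" by (simp add: L_def algebra_simps)
   also have "... < (L + 1) * de" using de by (simp add: distrib_right)
   also have "... = e" using L by (simp add: de_def)
   finally show ?thesis .
  qed
  have dpos: "0 < e / (L + 1)" if "0 < e" for e using that L by simp
  have 1: "\<forall>u0 v0. data_ball s R u0 v0 --> (\<exists>u v. SDE_sol s 1 af K ep T u0 v0 u v)" using solution_exists[OF ad] by blast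
  have 2: "\<forall>u0 v0 u v u' v'. data_ball s R u0 v0 & SDE_sol s 1 af K ep T u0 v0 u v & SDE_sol s 1 af K ep T u0 v0 u' v' -->
    (\<forall>t\<in>{0..T}. Hs_norm s (%x. u t x - u' t x) = 0 & Hs_norm s (%x. cplx (v t) x - cplx (v' t) x) = 0)" using unique by blast
  have 3: "\<forall>u0 v0 u v. data_ball s R u0 v0 & SDE_sol s 1 af K ep T u0 v0 u v -->
    (\<forall>e>0. \<exists>d>0. \<forall>u0' v0' u' v'. data_ball s R u0' v0' & SDE_sol s 1 af K ep T u0' v0' u' v'
     & Hs_norm s (%x. u0 x - u0' x) + Hs_norm s (%x. cplx v0 x - cplx v0' x) < d -->
      (\<forall>t\<in>{0..T}. Hs_norm s (%x. u t x - u' t x) + Hs_norm s (%x. cplx (v t) x - cplx (v' t) x) < e))"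
   using dependence dpos by blast
  show "\<exists>T>0. (\<forall>u0 v0. data_ball s R u0 v0 --> (\<exists>u v. SDE_sol s 1 af K ep T u0 v0 u v))
 & (\<forall>u0 v0 u v u' v'. data_ball s R u0 v0 & SDE_sol s 1 af K ep T u0 v0 u v
    & SDE_sol s 1 af K ep T u0 v0 u' v' -->
    (\<forall>t\<in>{0..T}. Hs_norm s (%x. u t x - u' t x) = 0
         & Hs_norm s (%x. cplx (v t) x - cplx (v' t) x) = 0))
 & (\<forall>u0 v0 u v. data_ball s R u0 v0 & SDE_sol s 1 af K ep T u0 v0 u v -->
    (\<forall>e>0. \<exists>d>0. \<forall>u0' v0' u' v'.
      data_ball s R u0' v0' & SDE_sol s 1 af K ep T u0' v0' u' v'
     & Hs_norm s (%x. u0 x - u0' x) + Hs_norm s (%x. cplx v0 x - cplx v0' x) < d -->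
      (\<forall>t\<in>{0..T}. Hs_norm s (%x. u t x - u' t x)
            + Hs_norm s (%x. cplx (v t) x - cplx (v' t) x) < e)))"
   by (rule exI[of _ T]) (rule conjI[OF T(1) conjI[OF 1 conjI[OF 2 3]]])
 qed simp
qed

theorem theoremB:
  fixes s \<alpha> K \<epsilon> :: real
  assumes "K > 0" and "\<epsilon> \<in> {1, -1}"
  shows "(s > 0 \<longrightarrow> SDE_LWP s 2 K \<epsilon>)
       \<and> (2 \<le> \<alpha> \<and> \<alpha> < 2 / (1 - s) \<longrightarrow> SDE_LWP s \<alpha> K \<epsilon>)"
proof (intro conjI impI)
  assume "s > 0"
  then show "SDE_LWP s 2 K \<epsilon>" by (intro SDE_LWP_adm assms) (simp add: adm_def)
next
  assume A: "2 \<le> \<alpha> \<and> \<alpha> < 2 / (1 - s)"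
  \<comment> \<open>For \<open>s >= 1\<close> the quotient \<open>2 / (1 - s)\<close> is negative,
    or 0 by the convention for division by zero, so the hypothesis excludes this range.\<close>
  have s1: "s < 1"
  proof (rule ccontr)
    assume "\<not> s < 1"
    then have "2 / (1 - s) \<le> 0" by (simp add: divide_nonneg_nonpos)
    then show False using A by linarith
  qed
  then have "\<alpha> * (1 - s) < 2" using A by (simp add: field_simps)
  moreover have "2 * (1 - s) \<le> \<alpha> * (1 - s)" using A s1 by (intro mult_right_mono) auto
  \<comment> \<open>The chain \<open>2 * (1 - s) <= \<alpha> * (1 - s) < 2\<close> forces
    \<open>s > 0\<close>, and its second inequality rearranges into the condition in
    \<open>adm\<close>.\<close>
  ultimately have "0 < s" "(\<alpha> - 2) * (1 - s) < 2 * s" by (auto simp: algebra_simps)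
  then show "SDE_LWP s \<alpha> K \<epsilon>" using A s1 by (intro SDE_LWP_adm assms) (simp add: adm_def)
qed

end
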